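(* The period map $\Theta=(\Theta_2,\Theta_3)$ is a (real-analytic) diffeomorphism of $\mathcal D$ onto the domain $$\mathcal M=\{(x,y)\in\mathbb R^2: x^2+xy+y^2<1/4,\ x-y>0,\ x+y>1/2\}.$$ Consequently, the cr-equivalence classes of closed strings are in one-to-one correspondence with the rational points $\mathcal M\cap\mathbb Q^2$, a closed string with characters $(m,\ell)$ corresponding to $\Theta(m,\ell)$.
   Context: $\mathcal D=\{(m,\ell)\in(0,1)\times(0,\infty):\ell>\mathfrak l(m)\}$ with $\mathfrak l(m)=\Big(\frac{27}{(m-2)(1+m)(2m-1)+2(1-m+m^2)^{3/2}}\Big)^{1/6}$. On $\mathcal D$ put $\sigma=\sqrt{1-m+m^2}$, $\widetilde{\mathtt p}=\frac{(m-2)(1+m)(2m-1)\ell^6-27}{2\sigma^3\ell^6}\in(-1,1)$, $\alpha=\frac13\arcsin\widetilde{\mathtt p}$, $\lambda_2=-\frac43\sigma\ell^2\sin\alpha$, $\lambda_3=\frac23\sigma\ell^2\sin\alpha+\frac2{\sqrt3}\sigma\ell^2\cos\alpha$, and for $j=2,3$, $\Theta_j(m,\ell)=\frac{6\Pi(\frac{6m\ell^2}{2(1+m)\ell^2+3\lambda_j},m)}{\pi\ell(2(1+m)\ell^2+3\lambda_j)}$, where $\Pi(n,m)=\int_0^{\pi/2}\frac{d\theta}{(1-n\sin^2\theta)\sqrt{1-m\sin^2\theta}}$. Background for the second sentence: $\mathcal S=\{[z]\in\mathbb{CP}^2:\langle z,z\rangle=0\}$ with $\langle z,w\rangle=i(\bar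 z^1w^3-\bar z^3w^1)+\bar z^2w^2$, contact distribution $\ker(\langle z,dz\rangle|_{T\mathcal S})$; for a Legendrian curve with normalized lift $\Gamma$ ($\det(\Gamma,\Gamma',\Gamma'')=i$), $a=\mathrm{Im}\langle\Gamma''',\Gamma''\rangle$, $b=\frac12\langle\Gamma'',\Gamma''\rangle$; a string is a parameterization $\gamma:\mathbb R\to\mathcal S$ with $a\equiv1$ whose cr-curvature $\kappa=b$ is non-constant, periodic and satisfies $\kappa'''+8\kappa\kappa'=0$; then $\kappa(u)=\frac32\ell^2(\frac{m+1}3-m\,\mathrm{sn}^2(\ell(u+u_0),m))$ for unique characters $(m,\ell)\in(0,1)\times(0,\infty)$. Closed means periodic; cr-equivalence is $\widetilde\gamma=A\cdot(\gamma\circ h)$ with $A\in SU(2,1)$ (the unimodular group preserving $\langle\cdot,\cdot\rangle$) and $h$ a change of parameter. *)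

theory Defs
  imports "HOL-Analysis.Analysis"
begin

definition ellF :: "real \<Rightarrow> real \<Rightarrow> real" where
  "ellF \<phi> m = (if 0 \<le> \<phi> then integral {0..\<phi>} (\<lambda>\<theta>. 1 / sqrt (1 - m * (sin \<theta>)^2))
               else - integral {\<phi>..0} (\<lambda>\<theta>. 1 / sqrt (1 - m * (sin \<theta>)^2)))"

definition jacobi_am :: "real \<Rightarrow> real \<Rightarrow> real" where
  "jacobi_am u m = (THE \<phi>. ellF \<phi> m = u)"

definition jacobi_sn :: "real \<Rightarrow> real \<Rightarrow> real" where
  "jacobi_sn u m = sin (jacobi_am u m)"

definition ellPi :: "real \<Rightarrow> real \<Rightarrow> real" where
  "ellPi n m = integral {0..pi/2}
     (\<lambda>\<theta>. 1 / ((1 - n * (sin \<theta>)^2) * sqrt (1 - m * (sin \<theta>)^2)))"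

definition frak_l :: "real \<Rightarrow> real" where
  "frak_l m = (27 / ((m - 2) * (1 + m) * (2*m - 1) + 2 * (1 - m + m^2) powr (3/2))) powr (1/6)"

definition domD :: "(real \<times> real) set" where
  "domD = {(m, l). 0 < m \<and> m < 1 \<and> 0 < l \<and> l > frak_l m}"

definition sigma_c :: "real \<Rightarrow> real" where
  "sigma_c m = sqrt (1 - m + m^2)"

definition p_tilde :: "real \<Rightarrow> real \<Rightarrow> real" where
  "p_tilde m l = ((m - 2) * (1 + m) * (2*m - 1) * l^6 - 27) / (2 * (sigma_c m)^3 * l^6)"

definition alpha_c :: "real \<Rightarrow> real \<Rightarrow> real" where
  "alpha_c m l = arcsin (p_tilde m l) / 3"

definition lambda2 :: "real \<Rightarrow> real \<Rightarrow> real" where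
  "lambda2 m l = - 4/3 * sigma_c m * l^2 * sin (alpha_c m l)"

definition lambda3 :: "real \<Rightarrow> real \<Rightarrow> real" where
  "lambda3 m l = 2/3 * sigma_c m * l^2 * sin (alpha_c m l)
                 + 2 / sqrt 3 * sigma_c m * l^2 * cos (alpha_c m l)"

definition Theta_j :: "(real \<Rightarrow> real \<Rightarrow> real) \<Rightarrow> real \<Rightarrow> real \<Rightarrow> real" where
  "Theta_j lam m l =
     6 * ellPi (6 * m * l^2 / (2 * (1 + m) * l^2 + 3 * lam m l)) m
     / (pi * l * (2 * (1 + m) * l^2 + 3 * lam m l))"

definition Theta :: "real \<times> real \<Rightarrow> real \<times> real" where
  "Theta p = (Theta_j lambda2 (fst p) (snd p), Theta_j lambda3 (fst p) (snd p))"

definition domM :: "(real \<times> real) set" where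
  "domM = {(x, y). x^2 + x*y + y^2 < 1/4 \<and> x - y > 0 \<and> x + y > 1/2}"

definition real_analytic_at2 :: "(real \<times> real \<Rightarrow> real) \<Rightarrow> real \<times> real \<Rightarrow> bool" where
  "real_analytic_at2 f p \<longleftrightarrow> (\<exists>r>0. \<exists>c :: nat \<Rightarrow> nat \<Rightarrow> real.
     \<forall>q \<in> ball p r. ((\<lambda>(i, j). c i j * (fst q - fst p)^i * (snd q - snd p)^j) has_sum f q) UNIV)"

definition real_analytic_on2 :: "(real \<times> real \<Rightarrow> real \<times> real) \<Rightarrow> (real \<times> real) set \<Rightarrow> bool" where
  "real_analytic_on2 F S \<longleftrightarrow>
     (\<forall>p\<in>S. real_analytic_at2 (\<lambda>q. fst (F q)) p \<and> real_analytic_at2 (\<lambda>q. snd (F q)) p)"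

definition herm :: "complex^3 \<Rightarrow> complex^3 \<Rightarrow> complex" where
  "herm z w = \<i> * (cnj (z $ 1) * w $ 3 - cnj (z $ 3) * w $ 1) + cnj (z $ 2) * w $ 2"

fun vd :: "(real \<Rightarrow> 'a::real_normed_vector) \<Rightarrow> nat \<Rightarrow> real \<Rightarrow> 'a" where
  "vd f 0 = f"
| "vd f (Suc k) = (\<lambda>u. vector_derivative (vd f k) (at u))"

definition smooth_fun :: "(real \<Rightarrow> 'a::real_normed_vector) \<Rightarrow> bool" where
  "smooth_fun f \<longleftrightarrow> (\<forall>k u. (vd f k has_vector_derivative vd f (Suc k) u) (at u))"

definition det3 :: "complex^3 \<Rightarrow> complex^3 \<Rightarrow> complex^3 \<Rightarrow> complex" where
  "det3 x y z = det (\<chi> i. if i = 1 then x else if i = 2 then y else z :: complex^3^3)"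

definition normalized_legendrian_lift :: "(real \<Rightarrow> complex^3) \<Rightarrow> bool" where
  "normalized_legendrian_lift G \<longleftrightarrow> smooth_fun G \<and>
     (\<forall>u. G u \<noteq> 0 \<and> herm (G u) (G u) = 0 \<and> herm (G u) (vd G 1 u) = 0 \<and>
          det3 (G u) (vd G 1 u) (vd G 2 u) = \<i>)"

definition inv_a :: "(real \<Rightarrow> complex^3) \<Rightarrow> real \<Rightarrow> real" where
  "inv_a G u = Im (herm (vd G 3 u) (vd G 2 u))"

definition cr_curv :: "(real \<Rightarrow> complex^3) \<Rightarrow> real \<Rightarrow> real" where
  "cr_curv G u = Re (herm (vd G 2 u) (vd G 2 u)) / 2"

definition is_string :: "(real \<Rightarrow> complex^3) \<Rightarrow> bool" where
  "is_string G \<longleftrightarrow> normalized_legendrian_lift G \<and> (\<forall>u. inv_a G u = 1) \<and>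
     (\<exists>u v. cr_curv G u \<noteq> cr_curv G v) \<and>
     (\<exists>T>0. \<forall>u. cr_curv G (u + T) = cr_curv G u) \<and>
     (\<forall>u. vd (cr_curv G) 3 u + 8 * cr_curv G u * vd (cr_curv G) 1 u = 0)"

text \<open>Closed: the projective curve [G] is periodic.\<close>
definition closed_string :: "(real \<Rightarrow> complex^3) \<Rightarrow> bool" where
  "closed_string G \<longleftrightarrow> is_string G \<and>
     (\<exists>T>0. \<forall>u. \<exists>c. c \<noteq> 0 \<and> G (u + T) = c *s G u)"

definition characters :: "(real \<Rightarrow> complex^3) \<Rightarrow> real \<times> real" where
  "characters G = (THE (m, l). 0 < m \<and> m < 1 \<and> 0 < l \<and>
     (\<exists>u0. \<forall>u. cr_curv G u = 3/2 * l^2 * ((m + 1)/3 - m * (jacobi_sn (l * (u + u0)) m)^2)))"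

definition SU21 :: "(complex^3^3) set" where
  "SU21 = {A. det A = 1 \<and> (\<forall>z w. herm (A *v z) (A *v w) = herm z w)}"

definition change_of_param :: "(real \<Rightarrow> real) \<Rightarrow> bool" where
  "change_of_param h \<longleftrightarrow> bij h \<and> smooth_fun h \<and> (\<forall>u. vd h 1 u \<noteq> 0)"

definition cr_equiv :: "(real \<Rightarrow> complex^3) \<Rightarrow> (real \<Rightarrow> complex^3) \<Rightarrow> bool" where
  "cr_equiv G1 G2 \<longleftrightarrow> (\<exists>A\<in>SU21. \<exists>h. change_of_param h \<and>
     (\<forall>u. \<exists>c. c \<noteq> 0 \<and> G2 u = c *s (A *v G1 (h u))))"

end

theory Submission
  imports Defs "HOL-Complex_Analysis.Complex_Analysis"
begin

text \<open>
  In the coordinates \<open>d = m l\<^sup>2\<close>, \<open>k = l\<^sup>2\<close> put \<open>Q(V) = V (V - d) (V - k)\<close>. Then \<open>\<D>\<close> is the set where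
  \<open>Q(V) = -1\<close> has two distinct roots \<open>c\<^sub>2 < c\<^sub>3\<close> in \<open>(d, k)\<close>, and \<open>\<pi> \<Theta>\<^sub>j\<close> is the integral of
  \<open>1/(c\<^sub>j - d sin\<^sup>2 \<theta>)\<close> against \<open>d\<theta> / sqrt (k - d sin\<^sup>2 \<theta>)\<close> over \<open>[0, \<pi>/2]\<close>.

  Let \<open>A\<close> and \<open>B\<close> be minus the minimum and the maximum of \<open>Q\<close> at its critical points. In the coordinates
  \<open>(A, B)\<close> the derivatives of \<open>\<Theta>\<^sub>2, \<Theta>\<^sub>3\<close> have definite signs, which gives a nonvanishing Jacobian and, along
  curves of constant \<open>A\<close> and constant \<open>B\<close>, injectivity. The third root of \<open>Q = -1\<close> is negative and its period is
  \<open>-(\<Theta>\<^sub>2 + \<Theta>\<^sub>3)\<close>; this yields \<open>\<Theta>\<^sub>2 + \<Theta>\<^sub>3 > 1/2\<close> and properness at infinity. The image is open, and it is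
  closed in \<open>\<M>\<close> because \<open>d = 0\<close> goes to the elliptic arc and \<open>c\<^sub>2 = c\<^sub>3\<close> to the diagonal.

  A string with curvature \<open>(d + k)/2 - 3/2 W\<close> solves a linear equation that splits over the roots of
  \<open>Q = -1\<close> into solutions \<open>sqrt (c - W) exp (\<i> \<integral> du / (c - W))\<close>. A nonreal or a double root makes some solution
  non-periodic, so closed strings lie over \<open>\<D>\<close>, and there periodicity means that the \<open>\<Theta>\<^sub>j\<close> are rational.
\<close>

text \<open>The level \<open>-1\<close> carries the proof. It fixes the residue of
  \<open>dV / ((c - V) sqrt Q)\<close> at \<open>V = c\<close>, so when \<open>d\<close> and
  \<open>k\<close> move and \<open>c\<close> follows with \<open>Q(c) = -1\<close>, the integral of
  the third kind cancels from the derivative of the period. What remains, interpolated at the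
  critical points f < g of \<open>Q\<close>, is X d(log A) + Y d(log B), where X has the sign of
  \<open>g - c\<close> and Y is negative. As g separates \<open>c\<^sub>2\<close> from
  \<open>c\<^sub>3\<close>, the signs are (+, -) for the first period and (-, -) for the second.
  This pattern yields the Jacobian, the injectivity and, along constant \<open>A\<close>, the
  inequality for the elliptic arc. Analyticity of the inverse is asked for as a convergent double
  power series, so all functions are continued to complex arguments and inverted there. A lift
  normalised by its determinant is determined only up to a cube root of unity. Hence a projectively
  closed curve of period T has a lift of period 3T, and the constructed curves are finally
  multiplied by a cube root.\<close>

section \<open>Analyticity in two variables by complexification\<close>

text \<open>Joint complex differentiability with continuous partial derivatives \<open>D1\<close>
  and \<open>D2\<close>. The continuity is what the inverse function theorem and differentiation
  under the integral require.\<close>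

definition cderiv2 :: "(complex \<times> complex \<Rightarrow> complex) \<Rightarrow> (complex \<times> complex) set
    \<Rightarrow> (complex \<times> complex \<Rightarrow> complex) \<Rightarrow> (complex \<times> complex \<Rightarrow> complex) \<Rightarrow> bool" where
  "cderiv2 F S D1 D2 \<longleftrightarrow> open S \<and> continuous_on S D1 \<and> continuous_on S D2 \<and>
     (\<forall>z\<in>S. (F has_derivative (\<lambda>h. D1 z * fst h + D2 z * snd h)) (at z))"

definition hol2_at :: "(complex \<times> complex \<Rightarrow> complex) \<Rightarrow> complex \<times> complex \<Rightarrow> bool" where
  "hol2_at F z \<longleftrightarrow> (\<exists>S D1 D2. z \<in> S \<and> cderiv2 F S D1 D2)"

lemma hol2_atI: "z \<in> S \<Longrightarrow> cderiv2 F S D1 D2 \<Longrightarrow> hol2_at F z"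
  unfolding hol2_at_def by blast

definition cpt :: "real \<times> real \<Rightarrow> complex \<times> complex" where
  "cpt p = (of_real (fst p), of_real (snd p))"

text \<open>A notion for germs: agreement is asked only near \<open>p\<close>. It is stable under
  composition, and functions with branches such as \<open>sqrt\<close> and \<open>arcsin\<close>
  qualify at interior points of their domains.\<close>

definition complexifiable :: "(real \<times> real \<Rightarrow> real) \<Rightarrow> real \<times> real \<Rightarrow> bool" where
  "complexifiable f p \<longleftrightarrow>
     (\<exists>F. hol2_at F (cpt p) \<and> (\<forall>\<^sub>F q in nhds p. F (cpt q) = of_real (f q)))"

lemma isCont_cpt: "isCont cpt p"
  unfolding cpt_def by (intro continuous_intros)

lemma cderiv2_subset: "cderiv2 F S D1 D2 \<Longrightarrow> open T \<Longrightarrow> T \<subseteq> S \<Longrightarrow> cderiv2 F T D1 D2"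
  unfolding cderiv2_def by (meson continuous_on_subset subsetD)

lemma cderiv2_continuous: "cderiv2 F S D1 D2 \<Longrightarrow> continuous_on S F"
  unfolding cderiv2_def
  by (meson continuous_at_imp_continuous_on has_derivative_continuous)

lemma cderiv2_compose:
  assumes H: "cderiv2 H T H1 H2" and F: "cderiv2 F S F1 F2" and G: "cderiv2 G S G1 G2"
    and sub: "\<And>z. z \<in> S \<Longrightarrow> (F z, G z) \<in> T"
  shows "cderiv2 (\<lambda>z. H (F z, G z)) S
           (\<lambda>z. H1 (F z, G z) * F1 z + H2 (F z, G z) * G1 z)
           (\<lambda>z. H1 (F z, G z) * F2 z + H2 (F z, G z) * G2 z)"
proof -
  have cont: "continuous_on S (\<lambda>z. (F z, G z))"
    by (intro continuous_on_Pair cderiv2_continuous[OF F] cderiv2_continuous[OF G])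
  have c1: "continuous_on S (\<lambda>z. H1 (F z, G z))" and c2: "continuous_on S (\<lambda>z. H2 (F z, G z))"
    using H sub unfolding cderiv2_def
    by (auto intro!: continuous_on_compose2[OF _ cont])
  show ?thesis
    unfolding cderiv2_def
  proof (intro conjI ballI)
    show "open S" using F by (simp add: cderiv2_def)
    show "continuous_on S (\<lambda>z. H1 (F z, G z) * F1 z + H2 (F z, G z) * G1 z)"
      "continuous_on S (\<lambda>z. H1 (F z, G z) * F2 z + H2 (F z, G z) * G2 z)"
      using F G unfolding cderiv2_def by (auto intro!: continuous_intros c1 c2)
    fix z assume z: "z \<in> S"
    have p: "((\<lambda>z. (F z, G z)) has_derivative
         (\<lambda>h. (F1 z * fst h + F2 z * snd h, G1 z * fst h + G2 z * snd h))) (at z)"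
      using F G z unfolding cderiv2_def by (auto intro!: has_derivative_Pair)
    have "(H has_derivative (\<lambda>h. H1 (F z, G z) * fst h + H2 (F z, G z) * snd h)) (at (F z, G z))"
      using H sub[OF z] unfolding cderiv2_def by auto
    from has_derivative_compose[OF p this]
    show "((\<lambda>z. H (F z, G z)) has_derivative
        (\<lambda>h. (H1 (F z, G z) * F1 z + H2 (F z, G z) * G1 z) * fst h +
             (H1 (F z, G z) * F2 z + H2 (F z, G z) * G2 z) * snd h)) (at z)"
      by (simp add: algebra_simps)
  qed
qed

lemma hol2_at_compose:
  assumes H: "hol2_at H (F z, G z)" and F: "hol2_at F z" and G: "hol2_at G z"
  shows "hol2_at (\<lambda>w. H (F w, G w)) z"
proof -
  obtain T H1 H2 where T: "(F z, G z) \<in> T" "cderiv2 H T H1 H2" using H by (auto simp: hol2_at_def)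
  obtain S F1 F2 where S: "z \<in> S" "cderiv2 F S F1 F2" using F by (auto simp: hol2_at_def)
  obtain S' G1 G2 where S': "z \<in> S'" "cderiv2 G S' G1 G2" using G by (auto simp: hol2_at_def)
  have o: "open S" "open S'" "open T" using S S' T by (auto simp: cderiv2_def)
  have cont: "continuous_on (S \<inter> S') (\<lambda>w. (F w, G w))"
    using cderiv2_continuous[OF S(2)] cderiv2_continuous[OF S'(2)]
    by (intro continuous_on_Pair) (auto elim: continuous_on_subset)
  define U where "U = (S \<inter> S') \<inter> (\<lambda>w. (F w, G w)) -` T"
  have "open U" unfolding U_def
    using continuous_open_preimage[OF cont] o by auto
  moreover have "z \<in> U" using T(1) S(1) S'(1) by (simp add: U_def)
  moreover have sub: "U \<subseteq> S" "U \<subseteq> S'" "\<And>w. w \<in> U \<Longrightarrow> (F w, G w) \<in> T" by (auto simp: U_def)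
  ultimately show ?thesis
    unfolding hol2_at_def
    by (intro exI conjI,
        rule_tac [2] cderiv2_compose[OF T(2) cderiv2_subset[OF S(2)] cderiv2_subset[OF S'(2)]]) auto
qed

lemma cderiv2_fst: "cderiv2 fst UNIV (\<lambda>_. 1) (\<lambda>_. 0)"
  and cderiv2_snd: "cderiv2 snd UNIV (\<lambda>_. 0) (\<lambda>_. 1)"
  and cderiv2_const: "cderiv2 (\<lambda>_. c) UNIV (\<lambda>_. 0) (\<lambda>_. 0)"
  and cderiv2_add: "cderiv2 (\<lambda>z. fst z + snd z) UNIV (\<lambda>_. 1) (\<lambda>_. 1)"
  and cderiv2_mult: "cderiv2 (\<lambda>z. fst z * snd z) UNIV snd fst"
  unfolding cderiv2_def
  by (auto intro!: continuous_intros derivative_eq_intros simp: algebra_simps)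

lemma hol2_at_holomorphic:
  assumes S: "open S" "fst z \<in> S" "\<phi> holomorphic_on S"
  shows "hol2_at (\<lambda>w. \<phi> (fst w)) z"
proof -
  have cont: "continuous_on S (deriv \<phi>)"
    by (rule holomorphic_on_imp_continuous_on[OF holomorphic_deriv[OF S(3,1)]])
  have "cderiv2 (\<lambda>w. \<phi> (fst w)) (S \<times> UNIV) (\<lambda>w. deriv \<phi> (fst w)) (\<lambda>_. 0)"
    unfolding cderiv2_def
  proof (intro conjI ballI)
    show "open (S \<times> (UNIV::complex set))" by (rule open_Times[OF S(1) open_UNIV])
    show "continuous_on (S \<times> (UNIV::complex set)) (\<lambda>w. deriv \<phi> (fst w))"
      by (rule continuous_on_compose2[OF cont continuous_on_fst[OF continuous_on_id]]) auto
    show "continuous_on (S \<times> (UNIV::complex set)) (\<lambda>w. 0::complex)"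
      by (rule continuous_on_const)
  next
    fix w assume "w \<in> S \<times> (UNIV::complex set)"
    then have "fst w \<in> S" by (simp add: mem_Times_iff)
    then have "(\<phi> has_derivative (\<lambda>h. deriv \<phi> (fst w) * h)) (at (fst w))"
      using holomorphic_derivI[OF S(3,1)] by (simp add: has_field_derivative_def)
    from has_derivative_compose[OF has_derivative_fst[OF has_derivative_ident] this]
    show "((\<lambda>w. \<phi> (fst w)) has_derivative (\<lambda>h. deriv \<phi> (fst w) * fst h + 0 * snd h)) (at w)"
      by simp
  qed
  moreover have "z \<in> S \<times> UNIV" using S(2) by (simp add: mem_Times_iff)
  ultimately show ?thesis unfolding hol2_at_def by (intro exI conjI)
qed

lemma hol2_at_continuous: "hol2_at F z \<Longrightarrow> isCont F z"
  unfolding hol2_at_def cderiv2_def using has_derivative_continuous by blast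

lemma complexifiable_isCont:
  assumes "complexifiable f p" shows "isCont f p"
proof -
  obtain F where F: "hol2_at F (cpt p)" "\<forall>\<^sub>F q in nhds p. F (cpt q) = of_real (f q)"
    using assms by (auto simp: complexifiable_def)
  have "isCont (\<lambda>q. Re (F (cpt q))) p"
    by (intro continuous_Re isCont_o2[OF isCont_cpt hol2_at_continuous[OF F(1)]])
  moreover have "\<forall>\<^sub>F q in nhds p. Re (F (cpt q)) = f q"
    using F(2) by eventually_elim simp
  ultimately show ?thesis by (rule isCont_cong[THEN iffD1, rotated])
qed

lemma complexifiable_compose:
  assumes h: "complexifiable h (f p, g p)" and f: "complexifiable f p" and g: "complexifiable g p"
  shows "complexifiable (\<lambda>q. h (f q, g q)) p"
proof -
  obtain F where F: "hol2_at F (cpt p)" "\<forall>\<^sub>F q in nhds p. F (cpt q) = of_real (f q)"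
    using f by (auto simp: complexifiable_def)
  obtain G where G: "hol2_at G (cpt p)" "\<forall>\<^sub>F q in nhds p. G (cpt q) = of_real (g q)"
    using g by (auto simp: complexifiable_def)
  obtain H where H: "hol2_at H (cpt (f p, g p))"
      "\<forall>\<^sub>F q in nhds (f p, g p). H (cpt q) = of_real (h q)"
    using h by (auto simp: complexifiable_def)
  have eq: "F (cpt p) = of_real (f p)" "G (cpt p) = of_real (g p)"
    by (rule eventually_nhds_x_imp_x[OF F(2)], rule eventually_nhds_x_imp_x[OF G(2)])
  have "hol2_at H (F (cpt p), G (cpt p))" using H(1) by (simp add: eq cpt_def[of "(f p, g p)"])
  from hol2_at_compose[OF this F(1) G(1)]
  have 1: "hol2_at (\<lambda>w. H (F w, G w)) (cpt p)" .
  have "filterlim (\<lambda>q. (f q, g q)) (nhds (f p, g p)) (nhds p)"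
    using complexifiable_isCont[OF f] complexifiable_isCont[OF g]
    unfolding isCont_def by (intro tendsto_Pair tendsto_at_iff_tendsto_nhds[THEN iffD1])
  from eventually_compose_filterlim[OF H(2) this]
  have "\<forall>\<^sub>F q in nhds p. H (F (cpt q), G (cpt q)) = of_real (h (f q, g q))"
    using F(2) G(2) by eventually_elim (simp add: cpt_def)
  with 1 show ?thesis unfolding complexifiable_def by (intro exI conjI)
qed

lemma complexifiableI:
  assumes "cderiv2 F UNIV D1 D2" "\<And>q. F (cpt q) = of_real (f q)"
  shows "complexifiable f p"
proof -
  have "hol2_at F (cpt p)" unfolding hol2_at_def
    by (intro exI[of _ UNIV] exI[of _ D1] exI[of _ D2] conjI UNIV_I assms(1))
  then show ?thesis unfolding complexifiable_def using assms(2)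
    by (intro exI[of _ F] conjI always_eventually allI)
qed

lemma complexifiable_fst: "complexifiable fst p"
  by (rule complexifiableI[OF cderiv2_fst]) (simp add: cpt_def)

lemma complexifiable_snd: "complexifiable snd p"
  by (rule complexifiableI[OF cderiv2_snd]) (simp add: cpt_def)

lemma complexifiable_const: "complexifiable (\<lambda>_. c) p"
  by (rule complexifiableI[OF cderiv2_const[of "of_real c"]]) simp

lemma complexifiable_add:
  assumes "complexifiable f p" "complexifiable g p"
  shows "complexifiable (\<lambda>q. f q + g q) p"
proof -
  have "complexifiable (\<lambda>z. fst z + snd z) (f p, g p)"
    by (rule complexifiableI[OF cderiv2_add]) (simp add: cpt_def)
  from complexifiable_compose[OF this assms] show ?thesis by simp
qed

lemma complexifiable_mult:
  assumes "complexifiable f p" "complexifiable g p"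
  shows "complexifiable (\<lambda>q. f q * g q) p"
proof -
  have "complexifiable (\<lambda>z. fst z * snd z) (f p, g p)"
    by (rule complexifiableI[OF cderiv2_mult]) (simp add: cpt_def)
  from complexifiable_compose[OF this assms] show ?thesis by simp
qed

text \<open>A function of one variable enters as a function of two that ignores the second, so that
  \<open>complexifiable_compose\<close> applies with \<open>f\<close> in both slots.\<close>

lemma complexifiable_compose1:
  assumes f: "complexifiable f p" and S: "open S" "of_real (f p) \<in> S" "\<Phi> holomorphic_on S"
    and T: "open T" "f p \<in> T" "\<And>x. x \<in> T \<Longrightarrow> \<Phi> (of_real x) = of_real (\<phi> x)"
  shows "complexifiable (\<lambda>q. \<phi> (f q)) p"
proof -
  have "complexifiable (\<lambda>z. \<phi> (fst z)) (f p, f p)"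
    unfolding complexifiable_def
  proof (intro exI conjI)
    show "hol2_at (\<lambda>w. \<Phi> (fst w)) (cpt (f p, f p))"
      by (rule hol2_at_holomorphic[OF S(1) _ S(3)]) (simp add: cpt_def S(2))
    have "\<forall>\<^sub>F q in nhds (f p, f p). q \<in> T \<times> UNIV"
      by (rule eventually_nhds_in_open[OF open_Times[OF T(1) open_UNIV]]) (simp add: T(2))
    then show "\<forall>\<^sub>F q in nhds (f p, f p). \<Phi> (fst (cpt q)) = of_real (\<phi> (fst q))"
      by eventually_elim (simp add: cpt_def T(3) mem_Times_iff)
  qed
  from complexifiable_compose[OF this f f] show ?thesis by simp
qed

lemma complexifiable_sin:
  assumes "complexifiable f p" shows "complexifiable (\<lambda>q. sin (f q)) p"
  by (rule complexifiable_compose1[OF assms open_UNIV UNIV_I _ open_UNIV UNIV_I, of sin])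
    (simp_all add: holomorphic_on_sin sin_of_real)

lemma complexifiable_cos:
  assumes "complexifiable f p" shows "complexifiable (\<lambda>q. cos (f q)) p"
  by (rule complexifiable_compose1[OF assms open_UNIV UNIV_I _ open_UNIV UNIV_I, of cos])
    (simp_all add: holomorphic_on_cos cos_of_real)

lemma complexifiable_inverse:
  assumes "complexifiable f p" "f p \<noteq> 0" shows "complexifiable (\<lambda>q. inverse (f q)) p"
proof (rule complexifiable_compose1[OF assms(1) _ _ _ open_UNIV UNIV_I, of "-{0}" inverse])
  show "(\<lambda>z::complex. inverse z) holomorphic_on -{0}"
    by (rule holomorphic_on_inverse[OF holomorphic_on_ident]) simp
  show "open (-{0::complex})" by (rule open_Compl[OF closed_singleton])
qed (simp_all add: assms(2))

lemma complexifiable_uminus: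
  assumes "complexifiable f p" shows "complexifiable (\<lambda>q. - f q) p"
  using complexifiable_mult[OF complexifiable_const[of "-1"] assms] by simp

lemma complexifiable_diff:
  assumes "complexifiable f p" "complexifiable g p" shows "complexifiable (\<lambda>q. f q - g q) p"
  using complexifiable_add[OF assms(1) complexifiable_uminus[OF assms(2)]] by simp

lemma complexifiable_divide:
  assumes "complexifiable f p" "complexifiable g p" "g p \<noteq> 0"
  shows "complexifiable (\<lambda>q. f q / g q) p"
  using complexifiable_mult[OF assms(1) complexifiable_inverse[OF assms(2,3)]]
  by (simp add: divide_inverse)

lemma complexifiable_power:
  assumes "complexifiable f p" shows "complexifiable (\<lambda>q. f q ^ n) p"
proof (induction n)
  case 0
  show ?case using complexifiable_const[of 1] by simp
next
  case (Suc n)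
  show ?case using complexifiable_mult[OF assms Suc] by simp
qed

lemma complexifiable_sqrt:
  assumes "complexifiable f p" "f p > 0"
  shows "complexifiable (\<lambda>q. sqrt (f q)) p"
proof (rule complexifiable_compose1[OF assms(1), of "{z. Re z > 0}" csqrt "{0<..}"])
  show "open {z. Re z > 0}" by (rule open_halfspace_Re_gt)
  show "csqrt holomorphic_on {z. Re z > 0}"
    by (rule holomorphic_on_subset[OF holomorphic_on_csqrt]) (auto simp: complex_nonpos_Reals_iff)
  show "csqrt (of_real x) = of_real (sqrt x)" if "x \<in> {0<..}" for x
    using that by (intro of_real_sqrt[symmetric]) simp
qed (use assms(2) in simp_all)

lemma complexifiable_arcsin:
  assumes "complexifiable f p" "\<bar>f p\<bar> < 1"
  shows "complexifiable (\<lambda>q. arcsin (f q)) p"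
proof (rule complexifiable_compose1[OF assms(1), of "{z. Re z > -1} \<inter> {z. Re z < 1}" Arcsin "{-1<..<1}"])
  show "open ({z. Re z > -1} \<inter> {z. Re z < 1})"
    by (rule open_Int[OF open_halfspace_Re_gt open_halfspace_Re_lt])
  show "Arcsin holomorphic_on ({z. Re z > -1} \<inter> {z. Re z < 1})"
    by (rule holomorphic_on_Arcsin) auto
  show "Arcsin (of_real x) = of_real (arcsin x)" if "x \<in> {-1<..<1}" for x
    using that by (intro of_real_arcsin[symmetric]) (simp add: abs_le_iff)
qed (use assms(2) in \<open>simp_all add: abs_less_iff\<close>)

text \<open>Expanded in \<open>z\<close> for fixed \<open>w\<close>, \<open>F\<close> has
  coefficients that are Cauchy integrals over a fixed circle, hence holomorphic in \<open>w\<close>.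
  Expanding these in turn gives the candidates, and the Cauchy estimates
  \<open>M / r^i / r^j\<close> give the absolute convergence that turns the iterated sum into a sum
  over all pairs.\<close>

lemma hol2_double_series:
  assumes cd: "cderiv2 F S D1 D2" and r: "0 < r"
    and sub: "cball a (2*r) \<times> cball b (2*r) \<subseteq> S"
  obtains c :: "nat \<Rightarrow> nat \<Rightarrow> complex" where
    "\<And>z w. z \<in> ball a r \<Longrightarrow> w \<in> ball b r \<Longrightarrow>
       ((\<lambda>(i, j). c i j * (z - a)^i * (w - b)^j) has_sum F (z, w)) UNIV"
proof -
  have contF: "continuous_on S F" by (rule cderiv2_continuous[OF cd])
  have contD2: "continuous_on S D2" using cd by (simp add: cderiv2_def)
  have der: "(F has_derivative (\<lambda>h. D1 z * fst h + D2 z * snd h)) (at z)" if "z \<in> S" for z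
    using cd that by (simp add: cderiv2_def)
  have inS: "(z, w) \<in> S" if "z \<in> cball a (2*r)" "w \<in> cball b (2*r)" for z w
    using sub that by blast
  have dz: "((\<lambda>z. F (z, w)) has_field_derivative D1 (z, w)) (at z)"
    if "(z, w) \<in> S" for z w
  proof -
    have "((\<lambda>z. (z, w)) has_derivative (\<lambda>h. (h, 0))) (at z)"
      by (rule has_derivative_Pair[OF has_derivative_ident has_derivative_const])
    from has_derivative_compose[OF this der[OF that]]
    show ?thesis by (simp add: has_field_derivative_def)
  qed
  have dw: "((\<lambda>w. F (z, w)) has_field_derivative D2 (z, w)) (at w)"
    if "(z, w) \<in> S" for z w
  proof -
    have "((\<lambda>w. (z, w)) has_derivative (\<lambda>h. (0, h))) (at w)"
      by (rule has_derivative_Pair[OF has_derivative_const has_derivative_ident])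
    from has_derivative_compose[OF this der[OF that]]
    show ?thesis by (simp add: has_field_derivative_def)
  qed
  have "compact (cball a (2*r) \<times> cball b (2*r))" by (intro compact_Times compact_cball)
  then have "compact (F ` (cball a (2*r) \<times> cball b (2*r)))"
    by (rule compact_continuous_image[OF continuous_on_subset[OF contF sub]])
  then have "bounded (F ` (cball a (2*r) \<times> cball b (2*r)))" by (rule compact_imp_bounded)
  then obtain M where M: "\<And>x. x \<in> F ` (cball a (2*r) \<times> cball b (2*r)) \<Longrightarrow> norm x \<le> M"
    unfolding bounded_iff by auto
  have M': "norm (F (z, w)) \<le> M" if "z \<in> cball a (2*r)" "w \<in> cball b (2*r)" for z w
    by (rule M) (use that in blast)
  have r2: "cball a r \<subseteq> cball a (2*r)" "cball b r \<subseteq> cball b (2*r)" "ball b (2*r) \<subseteq> cball b (2*r)"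
      "ball a r \<subseteq> cball a (2*r)" "ball b r \<subseteq> cball b (2*r)"
    using r by (auto simp: dist_norm)
  have holz: "(\<lambda>z. F (z, w)) holomorphic_on cball a (2*r)" if "w \<in> cball b (2*r)" for w
    unfolding holomorphic_on_def field_differentiable_def
  proof
    fix z assume "z \<in> cball a (2*r)"
    from has_field_derivative_at_within[OF dz[OF inS[OF this that]]]
    show "\<exists>f'. ((\<lambda>z. F (z, w)) has_field_derivative f') (at z within cball a (2*r))" by (rule exI)
  qed
  define C where "C i w = (deriv ^^ i) (\<lambda>z. F (z, w)) a / fact i" for i w
  define g where "g i t = 1 / (of_real r * cis t) ^ Suc i * of_real r * \<i> * cis t" for i :: nat and t
  \<comment> \<open>With the circle parametrized over \<open>[0, 2 pi]\<close>, \<open>w\<close>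
    enters only through the integrand, and the Leibniz rule applies.\<close>
  have Cint: "C i w = integral (cbox 0 (2*pi)) (\<lambda>t. F (a + of_real r * cis t, w) * g i t) / (2 * pi * \<i>)"
    if w: "w \<in> cball b (2*r)" for i w
  proof -
    have "((\<lambda>u. F (u, w) / (u - a) ^ Suc i) has_contour_integral
            2 * pi * \<i> / fact i * (deriv ^^ i) (\<lambda>z. F (z, w)) a) (circlepath a r)"
    proof (rule Cauchy_has_contour_integral_higher_derivative_circlepath)
      show "continuous_on (cball a r) (\<lambda>z. F (z, w))"
        using holomorphic_on_imp_continuous_on[OF holz[OF w]] r2(1) by (rule continuous_on_subset)
      show "(\<lambda>z. F (z, w)) holomorphic_on ball a r"
        using holz[OF w] r2(4) by (rule holomorphic_on_subset)
    qed (use r in auto)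
    then have "((\<lambda>t. F (a + of_real r * cis t, w) / (a + of_real r * cis t - a) ^ Suc i * r * \<i> * cis t)
        has_integral 2 * pi * \<i> / fact i * (deriv ^^ i) (\<lambda>z. F (z, w)) a) {0..2*pi}"
      unfolding circlepath_def by (subst (asm) has_contour_integral_part_circlepath_iff) auto
    then have "((\<lambda>t. F (a + of_real r * cis t, w) * g i t)
        has_integral 2 * pi * \<i> / fact i * (deriv ^^ i) (\<lambda>z. F (z, w)) a) {0..2*pi}"
      by (rule has_integral_eq[rotated]) (simp add: g_def)
    from integral_unique[OF this] show ?thesis by (simp add: C_def)
  qed
  have circ: "a + of_real r * cis t \<in> cball a (2*r)" for t
    using r by (simp add: dist_norm norm_mult)
  have contg: "continuous_on UNIV (g i)" for i
    unfolding g_def cis_conv_exp using r by (intro continuous_intros) auto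
  have holC: "C i holomorphic_on ball b (2*r)" for i
  proof -
    have "((\<lambda>w. integral (cbox 0 (2*pi)) (\<lambda>t. F (a + of_real r * cis t, w) * g i t)) has_field_derivative
        integral (cbox 0 (2*pi)) (\<lambda>t. D2 (a + of_real r * cis t, w) * g i t)) (at w within ball b (2*r))"
      if w: "w \<in> ball b (2*r)" for w
    proof (rule leibniz_rule_field_derivative[OF _ _ _ w convex_ball])
      fix x t assume x: "x \<in> ball b (2*r)"
      then have x': "x \<in> cball b (2*r)" using r2(3) by blast
      have "((\<lambda>x. F (a + of_real r * cis t, x)) has_field_derivative D2 (a + of_real r * cis t, x))
              (at x within ball b (2*r))"
        using dw[OF inS[OF circ x']] by (rule DERIV_subset) auto
      then show "((\<lambda>x. F (a + of_real r * cis t, x) * g i t) has_field_derivative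
              D2 (a + of_real r * cis t, x) * g i t) (at x within ball b (2*r))"
        by (rule DERIV_cmult_right)
    next
      fix x assume x: "x \<in> ball b (2*r)"
      then have x': "x \<in> cball b (2*r)" using r2(3) by blast
      have "continuous_on (cbox 0 (2*pi)) (\<lambda>t. F (a + of_real r * cis t, x))"
        by (rule continuous_on_compose2[OF contF])
          (use inS[OF circ x'] in \<open>auto intro!: continuous_intros\<close>)
      then show "(\<lambda>t. F (a + of_real r * cis t, x) * g i t) integrable_on cbox 0 (2 * pi)"
        by (intro integrable_continuous continuous_on_mult continuous_on_subset[OF contg]) auto
    next
      have "continuous_on (ball b (2*r) \<times> cbox 0 (2*pi)) (\<lambda>p. D2 (a + of_real r * cis (snd p), fst p))"
        by (rule continuous_on_compose2[OF contD2])
          (use inS[OF circ subsetD[OF r2(3)]] in \<open>auto intro!: continuous_intros\<close>)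
      moreover have "continuous_on (ball b (2*r) \<times> cbox 0 (2*pi)) (\<lambda>p. g i (snd p))"
        by (rule continuous_on_compose2[OF contg]) (auto intro!: continuous_intros)
      ultimately show "continuous_on (ball b (2*r) \<times> cbox 0 (2*pi))
          (\<lambda>(x, t). D2 (a + of_real r * cis t, x) * g i t)"
        unfolding case_prod_beta by (rule continuous_on_mult)
    qed
    then have "(\<lambda>w. integral (cbox 0 (2*pi)) (\<lambda>t. F (a + of_real r * cis t, w) * g i t))
        holomorphic_on ball b (2*r)"
      unfolding holomorphic_on_def field_differentiable_def by (intro ballI exI)
    then have "(\<lambda>w. integral (cbox 0 (2*pi)) (\<lambda>t. F (a + of_real r * cis t, w) * g i t) / (2 * pi * \<i>))
        holomorphic_on ball b (2*r)"
      by (intro holomorphic_intros) auto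
    then show ?thesis
      by (rule holomorphic_transform) (use Cint r2(3) in auto)
  qed
  have boundC: "norm (C i w) \<le> M / r ^ i" if w: "w \<in> cball b (2*r)" for i w
  proof -
    have "norm ((deriv ^^ i) (\<lambda>z. F (z, w)) a) \<le> fact i * M / r ^ i"
    proof (rule Cauchy_inequality)
      show "(\<lambda>z. F (z, w)) holomorphic_on ball a r"
        using holz[OF w] r2(4) by (rule holomorphic_on_subset)
      show "continuous_on (cball a r) (\<lambda>z. F (z, w))"
        using holomorphic_on_imp_continuous_on[OF holz[OF w]] r2(1) by (rule continuous_on_subset)
      show "norm (F (x, w)) \<le> M" if "norm (a - x) = r" for x
        by (rule M'[OF _ w]) (use that r in \<open>simp add: dist_norm\<close>)
    qed (rule r)
    then show ?thesis by (simp add: C_def norm_divide field_simps)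
  qed
  define c where "c i j = (deriv ^^ j) (C i) b / fact j" for i j
  have boundc: "norm (c i j) \<le> M / r ^ i / r ^ j" for i j
  proof -
    have "norm ((deriv ^^ j) (C i) b) \<le> fact j * (M / r ^ i) / r ^ j"
    proof (rule Cauchy_inequality)
      show "C i holomorphic_on ball b r"
        using holC by (rule holomorphic_on_subset) (use r in auto)
      show "continuous_on (cball b r) (C i)"
        using holomorphic_on_imp_continuous_on[OF holC] by (rule continuous_on_subset) (use r in auto)
      show "norm (C i x) \<le> M / r ^ i" if "norm (b - x) = r" for x
        by (rule boundC) (use that r in \<open>simp add: dist_norm\<close>)
    qed (rule r)
    then show ?thesis by (simp add: c_def norm_divide field_simps)
  qed
  have "((\<lambda>(i, j). c i j * (z - a)^i * (w - b)^j) has_sum F (z, w)) UNIV"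
    if z: "z \<in> ball a r" and w: "w \<in> ball b r" for z w
  proof -
    \<comment> \<open>Both ratios are below 1, so a product of two geometric series dominates the
      double series.\<close>
    define q1 where "q1 = norm (z - a) / r"
    define q2 where "q2 = norm (w - b) / r"
    have q: "0 \<le> q1" "q1 < 1" "0 \<le> q2" "q2 < 1"
      using z w r by (auto simp: q1_def q2_def dist_norm norm_minus_commute)
    have M0: "0 \<le> M" using order_trans[OF norm_ge_zero M'[of a b]] r by simp
    let ?f = "\<lambda>i j. c i j * (z - a)^i * (w - b)^j"
    have bd: "norm (?f i j) \<le> M * q1 ^ i * q2 ^ j" for i j
    proof -
      have "norm (?f i j) \<le> (M / r ^ i / r ^ j) * norm (z - a)^i * norm (w - b)^j"
        unfolding norm_mult norm_power by (intro mult_right_mono boundc) auto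
      also have "\<dots> = M * q1 ^ i * q2 ^ j" by (simp add: q1_def q2_def power_divide)
      finally show ?thesis .
    qed
    have g1: "summable (\<lambda>i. q1 ^ i)" "summable (\<lambda>j. q2 ^ j)" using q by (auto intro: summable_geometric)
    have s1: "(\<lambda>i. M * q1 ^ i) summable_on UNIV"
      using g1(1) q M0 by (intro norm_summable_imp_summable_on) (auto simp: abs_mult intro: summable_mult)
    have s2: "(\<lambda>j. q2 ^ j) summable_on UNIV"
      using g1(2) q by (intro norm_summable_imp_summable_on) auto
    have inner: "((\<lambda>j. M * q1 ^ i * q2 ^ j) has_sum M * q1 ^ i * infsum (\<lambda>j. q2 ^ j) UNIV) UNIV" for i
      by (intro has_sum_cmult_right has_sum_infsum s2)
    have "(\<lambda>(i, j). M * q1 ^ i * q2 ^ j) summable_on (SIGMA i:UNIV. UNIV)"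
    proof (rule summable_on_SigmaI)
      show "((\<lambda>j. case (i, j) of (i, j) \<Rightarrow> M * q1 ^ i * q2 ^ j) has_sum
          M * q1 ^ i * infsum (\<lambda>j. q2 ^ j) UNIV) UNIV" for i
        using inner by simp
      show "(\<lambda>i. M * q1 ^ i * infsum (\<lambda>j. q2 ^ j) UNIV) summable_on UNIV"
        by (intro summable_on_cmult_left s1)
    qed (use q M0 in auto)
    then have "(\<lambda>p. norm ((\<lambda>(i, j). ?f i j) p)) summable_on (UNIV \<times> UNIV)"
      by (rule summable_on_comparison_test) (auto simp: bd)
    then have summ: "(\<lambda>(i, j). ?f i j) summable_on (UNIV \<times> UNIV)"
      by (rule abs_summable_summable)
    have holC': "C i holomorphic_on ball b r" for i
      using holC by (rule holomorphic_on_subset) (use r in auto)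
    have in1: "((\<lambda>j. ?f i j) has_sum C i w * (z - a) ^ i) UNIV" for i
    proof (rule norm_summable_imp_has_sum)
      show "summable (\<lambda>j. norm (?f i j))"
        by (rule summable_comparison_test'[OF summable_mult[OF g1(2), of "M * q1 ^ i"], of 0]) (use bd in auto)
      have "(\<lambda>j. c i j * (w - b)^j) sums C i w"
        unfolding c_def by (rule holomorphic_power_series[OF holC' w])
      from sums_mult2[OF this, of "(z - a)^i"] show "(\<lambda>j. ?f i j) sums (C i w * (z - a)^i)"
        by (simp add: mult_ac)
    qed
    have w': "w \<in> cball b (2*r)" using w r2(5) by blast
    have out1: "((\<lambda>i. C i w * (z - a) ^ i) has_sum F (z, w)) UNIV"
    proof (rule norm_summable_imp_has_sum)
      have "norm (C i w * (z - a) ^ i) \<le> M * q1 ^ i" for i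
      proof -
        have "norm (C i w * (z - a) ^ i) \<le> (M / r ^ i) * norm (z - a)^i"
          unfolding norm_mult norm_power by (intro mult_right_mono boundC[OF w']) auto
        then show ?thesis by (simp add: q1_def power_divide)
      qed
      then show "summable (\<lambda>i. norm (C i w * (z - a) ^ i))"
        by (intro summable_comparison_test'[OF summable_mult[OF g1(1), of M], of 0]) auto
      show "(\<lambda>i. C i w * (z - a) ^ i) sums F (z, w)"
        unfolding C_def
        by (rule holomorphic_power_series[OF holomorphic_on_subset[OF holz[OF w'] r2(4)] z])
    qed
    have "infsum (\<lambda>(i, j). ?f i j) (UNIV \<times> UNIV) = infsum (\<lambda>i. infsum (?f i) UNIV) UNIV"
      by (rule infsum_Sigma'_banach[OF summ, symmetric])
    also have "\<dots> = F (z, w)"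
      using infsumI[OF in1] infsumI[OF out1] by simp
    finally show ?thesis using has_sum_infsum[OF summ] by simp
  qed
  then show ?thesis by (rule that)
qed

lemma Re_coeff:
  "Re (c * (of_real x - of_real x0)^i * (of_real y - of_real y0)^j) = Re c * (x - x0)^i * (y - y0)^j"
proof -
  have "c * (of_real x - of_real x0)^i * (of_real y - of_real y0)^j
      = c * (of_real ((x - x0)^i) * of_real ((y - y0)^j))"
    by (simp add: mult.assoc)
  also have "Re \<dots> = Re c * ((x - x0)^i * (y - y0)^j)"
    unfolding of_real_mult[symmetric] by (simp only: Re_complex_of_real Im_complex_of_real times_complex.sel mult_zero_right diff_zero)
  finally show ?thesis by (simp only: mult.assoc)
qed

lemma complexifiable_imp_real_analytic:
  assumes "complexifiable f p"
  shows "real_analytic_at2 f p"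
proof -
  obtain F where F: "hol2_at F (cpt p)" "\<forall>\<^sub>F q in nhds p. F (cpt q) = of_real (f q)"
    using assms by (auto simp: complexifiable_def)
  obtain S D1 D2 where S: "cpt p \<in> S" "cderiv2 F S D1 D2" using F(1) by (auto simp: hol2_at_def)
  have "open S" using S(2) by (simp add: cderiv2_def)
  then obtain A B where AB: "open A" "open B" "cpt p \<in> A \<times> B" "A \<times> B \<subseteq> S"
    using S(1) by (rule open_prod_elim)
  obtain r1 where r1: "0 < r1" "cball (of_real (fst p)) r1 \<subseteq> A"
    using AB(1,3) unfolding cpt_def open_contains_cball by auto
  obtain r2 where r2: "0 < r2" "cball (of_real (snd p)) r2 \<subseteq> B"
    using AB(2,3) unfolding cpt_def open_contains_cball by auto
  obtain r3 where r3: "0 < r3" "\<And>q. q \<in> ball p r3 \<Longrightarrow> F (cpt q) = of_real (f q)"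
    using F(2) unfolding eventually_nhds_metric by (auto simp: dist_commute)
  define r where "r = min r1 r2 / 2"
  have r: "0 < r" "2 * r \<le> r1" "2 * r \<le> r2" using r1 r2 by (auto simp: r_def)
  have "cball (complex_of_real (fst p)) (2*r) \<times> cball (of_real (snd p)) (2*r) \<subseteq> A \<times> B"
    by (intro Sigma_mono order_trans[OF subset_cball[OF r(2)] r1(2)] order_trans[OF subset_cball[OF r(3)] r2(2)])
  then have "cball (complex_of_real (fst p)) (2*r) \<times> cball (of_real (snd p)) (2*r) \<subseteq> S"
    using AB(4) by blast
  from hol2_double_series[OF S(2) r(1) this] obtain c where c:
    "\<And>z w. z \<in> ball (of_real (fst p)) r \<Longrightarrow> w \<in> ball (of_real (snd p)) r \<Longrightarrow>
       ((\<lambda>(i, j). c i j * (z - of_real (fst p))^i * (w - of_real (snd p))^j) has_sum F (z, w)) UNIV"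
    by blast
  have main: "((\<lambda>(i, j). Re (c i j) * (fst q - fst p)^i * (snd q - snd p)^j) has_sum f q) UNIV"
    if q: "q \<in> ball p (min r r3)" for q
  proof -
    have "dist (fst p) (fst q) < r" "dist (snd p) (snd q) < r"
      using q dist_fst_le[of p q] dist_snd_le[of p q] by auto
    then have "complex_of_real (fst q) \<in> ball (of_real (fst p)) r" "complex_of_real (snd q) \<in> ball (of_real (snd p)) r"
      by (simp_all add: dist_norm flip: of_real_diff)
    from has_sum_Re[OF c[OF this]]
    have *: "((\<lambda>x. Re (case x of (i, j) \<Rightarrow> c i j * (of_real (fst q) - of_real (fst p))^i *
        (of_real (snd q) - of_real (snd p))^j)) has_sum Re (F (cpt q))) UNIV"
      by (simp add: cpt_def)
    have "Re (F (cpt q)) = f q" using r3(2)[of q] q by simp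
    moreover have "(\<lambda>x. Re (case x of (i, j) \<Rightarrow> c i j * (of_real (fst q) - of_real (fst p))^i *
        (of_real (snd q) - of_real (snd p))^j)) =
      (\<lambda>(i, j). Re (c i j) * (fst q - fst p)^i * (snd q - snd p)^j)"
      by (simp add: fun_eq_iff Re_coeff)
    ultimately show ?thesis using * by simp
  qed
  show ?thesis unfolding real_analytic_at2_def
  proof (intro exI conjI ballI)
    show "0 < min r r3" using r(1) r3(1) by simp
  qed (rule main)
qed

text \<open>The imaginary part of \<open>F\<close> vanishes identically on the real points near
  \<open>p\<close>, so the partial derivatives of \<open>F\<close> at \<open>p\<close> are real and
  are those of \<open>f\<close>.\<close>

lemma complexifiable_has_derivative:
  assumes "complexifiable f p"
  obtains F D1 D2 S where "cpt p \<in> S" "cderiv2 F S D1 D2" "\<forall>\<^sub>F q in nhds p. F (cpt q) = of_real (f q)"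
    "(f has_derivative (\<lambda>h. Re (D1 (cpt p)) * fst h + Re (D2 (cpt p)) * snd h)) (at p)"
    "Im (D1 (cpt p)) = 0" "Im (D2 (cpt p)) = 0"
proof -
  obtain F where F: "hol2_at F (cpt p)" "\<forall>\<^sub>F q in nhds p. F (cpt q) = of_real (f q)"
    using assms by (auto simp: complexifiable_def)
  obtain S D1 D2 where S: "cpt p \<in> S" "cderiv2 F S D1 D2" using F(1) by (auto simp: hol2_at_def)
  have cp: "(cpt has_derivative cpt) (at p)"
    unfolding cpt_def
    by (rule has_derivative_Pair[OF has_derivative_of_real[OF has_derivative_fst[OF has_derivative_ident]]
          has_derivative_of_real[OF has_derivative_snd[OF has_derivative_ident]]])
  have "(F has_derivative (\<lambda>h. D1 (cpt p) * fst h + D2 (cpt p) * snd h)) (at (cpt p))"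
    using S by (simp add: cderiv2_def)
  from has_derivative_compose[OF cp this]
  have FR: "((\<lambda>q. F (cpt q)) has_derivative (\<lambda>h. D1 (cpt p) * of_real (fst h) + D2 (cpt p) * of_real (snd h))) (at p)"
    by (simp add: cpt_def)
  have ev: "\<forall>\<^sub>F q in at p. F (cpt q) = of_real (f q)" "F (cpt p) = of_real (f p)"
    by (rule eventually_nhds_conv_at[THEN iffD1, OF F(2), THEN conjunct1],
        rule eventually_nhds_x_imp_x[OF F(2)])
  have fC: "((\<lambda>q. complex_of_real (f q)) has_derivative (\<lambda>h. D1 (cpt p) * of_real (fst h) + D2 (cpt p) * of_real (snd h))) (at p)"
    by (rule has_derivative_transform_eventually[OF FR ev(1) ev(2)]) simp
  have r: "(f has_derivative (\<lambda>h. Re (D1 (cpt p)) * fst h + Re (D2 (cpt p)) * snd h)) (at p)"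
    using bounded_linear.has_derivative[OF bounded_linear_Re fC] by simp
  have i: "((\<lambda>q. 0::real) has_derivative (\<lambda>h. Im (D1 (cpt p)) * fst h + Im (D2 (cpt p)) * snd h)) (at p)"
    using bounded_linear.has_derivative[OF bounded_linear_Im fC] by simp
  have "(\<lambda>h. Im (D1 (cpt p)) * fst h + Im (D2 (cpt p)) * snd h) = (\<lambda>h. 0)"
    by (rule has_derivative_unique[OF i has_derivative_const])
  from fun_cong[OF this, of "(1,0)"] fun_cong[OF this, of "(0,1)"]
  have "Im (D1 (cpt p)) = 0" "Im (D2 (cpt p)) = 0" by simp_all
  with S F(2) r show ?thesis by (rule that)
qed

text \<open>Identifies the abstract \<open>inv\<close> in the derivative of a local inverse with
  Cramer's rule, from which the partial derivatives of the inverse and their continuity can be read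
  off.\<close>

lemma cramer2:
  fixes a b c d :: complex
  assumes "a * d - b * c \<noteq> 0"
  shows "inv (\<lambda>h. (a * fst h + b * snd h, c * fst h + d * snd h)) =
     (\<lambda>h. ((d * fst h - b * snd h) / (a * d - b * c), (a * snd h - c * fst h) / (a * d - b * c)))"
proof (rule inv_unique_comp)
  define e where "e = a * d - b * c"
  have e: "e \<noteq> 0" using assms by (simp add: e_def)
  have 1: "a * ((d * x - b * y) / e) + b * ((a * y - c * x) / e) = x" for x y
  proof -
    have "a * ((d * x - b * y) / e) + b * ((a * y - c * x) / e) =
        (a * (d * x - b * y) + b * (a * y - c * x)) / e"
      by (simp only: add_divide_distrib times_divide_eq_right)
    also have "a * (d * x - b * y) + b * (a * y - c * x) = e * x"
      by (simp add: e_def algebra_simps)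
    finally show ?thesis using e by simp
  qed
  have 2: "c * ((d * x - b * y) / e) + d * ((a * y - c * x) / e) = y" for x y
  proof -
    have "c * ((d * x - b * y) / e) + d * ((a * y - c * x) / e) =
        (c * (d * x - b * y) + d * (a * y - c * x)) / e"
      by (simp only: add_divide_distrib times_divide_eq_right)
    also have "c * (d * x - b * y) + d * (a * y - c * x) = e * y"
      by (simp add: e_def algebra_simps)
    finally show ?thesis using e by simp
  qed
  have 3: "(d * (a * x + b * y) - b * (c * x + d * y)) / e = x" for x y
  proof -
    have "d * (a * x + b * y) - b * (c * x + d * y) = e * x" by (simp add: e_def algebra_simps)
    then show ?thesis using e by simp
  qed
  have 4: "(a * (c * x + d * y) - c * (a * x + b * y)) / e = y" for x y
  proof -
    have "a * (c * x + d * y) - c * (a * x + b * y) = e * y" by (simp add: e_def algebra_simps)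
    then show ?thesis using e by simp
  qed
  show "(\<lambda>h. (a * fst h + b * snd h, c * fst h + d * snd h)) \<circ>
    (\<lambda>h. ((d * fst h - b * snd h) / (a * d - b * c), (a * snd h - c * fst h) / (a * d - b * c))) = id"
    unfolding e_def[symmetric] by (rule ext) (simp only: o_def fst_conv snd_conv 1 2 prod.collapse id_def)
  show "(\<lambda>h. ((d * fst h - b * snd h) / (a * d - b * c), (a * snd h - c * fst h) / (a * d - b * c))) \<circ>
    (\<lambda>h. (a * fst h + b * snd h, c * fst h + d * snd h)) = id"
    unfolding e_def[symmetric] by (rule ext) (simp only: o_def fst_conv snd_conv 3 4 prod.collapse id_def)
qed

definition mat_blin :: "complex \<Rightarrow> complex \<Rightarrow> complex \<Rightarrow> complex \<Rightarrow> (complex \<times> complex) \<Rightarrow>\<^sub>L (complex \<times> complex)" where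
  "mat_blin a b c d = Blinfun (\<lambda>h. (a * fst h + b * snd h, c * fst h + d * snd h))"

lemma mat_blin_apply: "blinfun_apply (mat_blin a b c d) = (\<lambda>h. (a * fst h + b * snd h, c * fst h + d * snd h))"
  unfolding mat_blin_def
  by (rule bounded_linear_Blinfun_apply)
     (intro bounded_linear_Pair bounded_linear_add bounded_linear_const_mult bounded_linear_fst bounded_linear_snd)

lemma continuous_on_mat_blin:
  fixes S :: "(complex \<times> complex) set"
  assumes "continuous_on S a" "continuous_on S b" "continuous_on S c" "continuous_on S d"
  shows "continuous_on S (\<lambda>z. mat_blin (a z) (b z) (c z) (d z))"
  by (rule continuous_on_blinfun_componentwise) (simp add: mat_blin_apply, intro continuous_intros assms)

text \<open>The inverse function theorem is applied to pairs of complex numbers as a real normed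
  space. The inverse of a complex linear map is complex linear, so the local inverse is again
  holomorphic.\<close>

lemma hol2_inverse:
  assumes F: "cderiv2 F S F1 F2" and G: "cderiv2 G S G1 G2" and z: "z \<in> S"
    and det: "F1 z * G2 z - F2 z * G1 z \<noteq> 0"
  obtains U V g where "open U" "z \<in> U" "open V" "(F z, G z) \<in> V"
    "\<forall>u\<in>U. (F u, G u) \<in> V \<and> g (F u, G u) = u"
    "hol2_at (\<lambda>w. fst (g w)) (F z, G z)" "hol2_at (\<lambda>w. snd (g w)) (F z, G z)"
proof -
  define \<Delta> where "\<Delta> = (\<lambda>z. F1 z * G2 z - F2 z * G1 z)"
  have c: "continuous_on S F1" "continuous_on S F2" "continuous_on S G1" "continuous_on S G2"
    using F G by (simp_all add: cderiv2_def)
  have c\<Delta>: "continuous_on S \<Delta>" unfolding \<Delta>_def by (intro continuous_intros c)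
  have oS: "open S" using F by (simp add: cderiv2_def)
  \<comment> \<open>On \<open>S'\<close> the determinant stays nonzero, so Cramer's rule is
    available on the whole neighbourhood \<open>U\<close> and not only at \<open>z\<close>.\<close>
  define S' where "S' = S \<inter> \<Delta> -` (-{0})"
  have oS': "open S'" unfolding S'_def
    by (rule continuous_open_preimage[OF c\<Delta> oS]) (rule open_Compl[OF closed_singleton])
  have zS': "z \<in> S'" using z det by (simp add: S'_def \<Delta>_def)
  have sub: "S' \<subseteq> S" by (simp add: S'_def)
  define P where "P = (\<lambda>z. (F z, G z))"
  define P' where "P' = (\<lambda>z. mat_blin (F1 z) (F2 z) (G1 z) (G2 z))"
  define iv where "iv = mat_blin (G2 z / \<Delta> z) (- F2 z / \<Delta> z) (- G1 z / \<Delta> z) (F1 z / \<Delta> z)"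
  have derP: "(P has_derivative blinfun_apply (P' x)) (at x)" if "x \<in> S'" for x
  proof -
    have "x \<in> S" using that sub by blast
    then show ?thesis
      unfolding P_def P'_def mat_blin_apply
      using F G unfolding cderiv2_def by (intro has_derivative_Pair) blast+
  qed
  have contP': "continuous_on S' P'" unfolding P'_def
    by (intro continuous_on_mat_blin continuous_on_subset[OF _ sub] c)
  have \<Delta>z: "\<Delta> z \<noteq> 0" "F1 z * G2 z - F2 z * G1 z \<noteq> 0" using det by (simp_all add: \<Delta>_def)
  have "iv o\<^sub>L P' z = id_blinfun"
  proof (rule blinfun_eqI)
    fix h :: "complex \<times> complex"
    have "blinfun_apply iv (blinfun_apply (P' z) h) =
       ((G2 z * (F1 z * fst h + F2 z * snd h) - F2 z * (G1 z * fst h + G2 z * snd h)) / \<Delta> z,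
        (F1 z * (G1 z * fst h + G2 z * snd h) - G1 z * (F1 z * fst h + F2 z * snd h)) / \<Delta> z)"
      unfolding iv_def P'_def mat_blin_apply by (simp add: diff_divide_distrib)
    also have "G2 z * (F1 z * fst h + F2 z * snd h) - F2 z * (G1 z * fst h + G2 z * snd h) = \<Delta> z * fst h"
      by (simp add: \<Delta>_def algebra_simps)
    also have "F1 z * (G1 z * fst h + G2 z * snd h) - G1 z * (F1 z * fst h + F2 z * snd h) = \<Delta> z * snd h"
      by (simp add: \<Delta>_def algebra_simps)
    finally show "blinfun_apply (iv o\<^sub>L P' z) h = blinfun_apply id_blinfun h"
      using \<Delta>z(1) by (simp add: prod_eq_iff)
  qed
  note inv_thm = inverse_function_theorem[OF oS' derP contP' zS' this]
  obtain U V g g' where UV: "open U" "U \<subseteq> S'" "z \<in> U" "open V" "P z \<in> V" "homeomorphism U V P g"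
    and dg: "\<And>y. y \<in> V \<Longrightarrow> (g has_derivative g' y) (at y)"
    and g': "\<And>y. y \<in> V \<Longrightarrow> g' y = inv (blinfun_apply (P' (g y)))"
    by (rule inv_thm, assumption, (rule that; assumption))
  have gV: "g y \<in> S'" if "y \<in> V" for y
    using UV(2,6) that unfolding homeomorphism_def by blast
  have contg: "continuous_on V g" using UV(6) by (simp add: homeomorphism_def)
  have cg: "continuous_on V (\<lambda>y. h (g y))" if "continuous_on S h" for h :: "complex \<times> complex \<Rightarrow> complex"
    by (rule continuous_on_compose2[OF continuous_on_subset[OF that sub] contg]) (use gV in blast)
  have \<Delta>g: "\<Delta> (g y) \<noteq> 0" if "y \<in> V" for y using gV[OF that] by (simp add: S'_def)
  have dg': "(g has_derivative (\<lambda>h. ((G2 (g y) * fst h - F2 (g y) * snd h) / \<Delta> (g y),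
      (F1 (g y) * snd h - G1 (g y) * fst h) / \<Delta> (g y)))) (at y)" if "y \<in> V" for y
    using dg[OF that] \<Delta>g[OF that] unfolding g'[OF that] P'_def mat_blin_apply \<Delta>_def
    by (subst (asm) cramer2) simp_all
  have h1: "cderiv2 (\<lambda>w. fst (g w)) V (\<lambda>y. G2 (g y) / \<Delta> (g y)) (\<lambda>y. - F2 (g y) / \<Delta> (g y))"
    unfolding cderiv2_def
  proof (intro conjI ballI)
    show "continuous_on V (\<lambda>y. G2 (g y) / \<Delta> (g y))" "continuous_on V (\<lambda>y. - F2 (g y) / \<Delta> (g y))"
      by (intro continuous_on_divide continuous_on_minus cg c c\<Delta> ballI \<Delta>g; assumption)+
    show "((\<lambda>w. fst (g w)) has_derivative (\<lambda>h. G2 (g y) / \<Delta> (g y) * fst h + - F2 (g y) / \<Delta> (g y) * snd h)) (at y)"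
      if "y \<in> V" for y
      using has_derivative_fst[OF dg'[OF that]] by (simp add: diff_divide_distrib)
  qed (rule UV(4))
  have h2: "cderiv2 (\<lambda>w. snd (g w)) V (\<lambda>y. - G1 (g y) / \<Delta> (g y)) (\<lambda>y. F1 (g y) / \<Delta> (g y))"
    unfolding cderiv2_def
  proof (intro conjI ballI)
    show "continuous_on V (\<lambda>y. - G1 (g y) / \<Delta> (g y))" "continuous_on V (\<lambda>y. F1 (g y) / \<Delta> (g y))"
      by (intro continuous_on_divide continuous_on_minus cg c c\<Delta> ballI \<Delta>g; assumption)+
    show "((\<lambda>w. snd (g w)) has_derivative (\<lambda>h. - G1 (g y) / \<Delta> (g y) * fst h + F1 (g y) / \<Delta> (g y) * snd h)) (at y)"
      if "y \<in> V" for y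
      using has_derivative_snd[OF dg'[OF that]] by (simp add: diff_divide_distrib)
  qed (rule UV(4))
  have PV: "(F z, G z) \<in> V" using UV(5) by (simp add: P_def)
  have h: "hol2_at (\<lambda>w. fst (g w)) (F z, G z)" "hol2_at (\<lambda>w. snd (g w)) (F z, G z)"
    by (rule hol2_atI[OF PV h1], rule hol2_atI[OF PV h2])
  have "\<forall>u\<in>U. (F u, G u) \<in> V \<and> g (F u, G u) = u"
    using UV(6) unfolding homeomorphism_def P_def by blast
  from that[OF UV(1,3,4) PV this h] show ?thesis .
qed

text \<open>\<open>g\<close> is a given real right inverse. Its continuity keeps
  \<open>cpt (g q)\<close> inside the neighbourhood where the complex local inverse undoes
  \<open>(F, G)\<close>, so that local inverse extends \<open>g\<close>.\<close>

lemma complexifiable_inverse_map: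
  fixes f1 f2 :: "real \<times> real \<Rightarrow> real" and g :: "real \<times> real \<Rightarrow> real \<times> real"
  assumes f: "complexifiable f1 p" "complexifiable f2 p"
    and d1: "(f1 has_derivative (\<lambda>h. a * fst h + b * snd h)) (at p)"
    and d2: "(f2 has_derivative (\<lambda>h. c * fst h + d * snd h)) (at p)"
    and det: "a * d - b * c \<noteq> 0"
    and g: "isCont g (f1 p, f2 p)" "g (f1 p, f2 p) = p"
    and inv: "\<forall>\<^sub>F q in nhds (f1 p, f2 p). (f1 (g q), f2 (g q)) = q"
  shows "complexifiable (\<lambda>q. fst (g q)) (f1 p, f2 p)" "complexifiable (\<lambda>q. snd (g q)) (f1 p, f2 p)"
proof -
  obtain F F1 F2 S where F: "cpt p \<in> S" "cderiv2 F S F1 F2" "\<forall>\<^sub>F q in nhds p. F (cpt q) = of_real (f1 q)"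
    "(f1 has_derivative (\<lambda>h. Re (F1 (cpt p)) * fst h + Re (F2 (cpt p)) * snd h)) (at p)"
    "Im (F1 (cpt p)) = 0" "Im (F2 (cpt p)) = 0"
    using complexifiable_has_derivative[OF f(1)] .
  obtain G G1 G2 T where G: "cpt p \<in> T" "cderiv2 G T G1 G2" "\<forall>\<^sub>F q in nhds p. G (cpt q) = of_real (f2 q)"
    "(f2 has_derivative (\<lambda>h. Re (G1 (cpt p)) * fst h + Re (G2 (cpt p)) * snd h)) (at p)"
    "Im (G1 (cpt p)) = 0" "Im (G2 (cpt p)) = 0"
    using complexifiable_has_derivative[OF f(2)] .
  have "(\<lambda>h. a * fst h + b * snd h) = (\<lambda>h. Re (F1 (cpt p)) * fst h + Re (F2 (cpt p)) * snd h)"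
    by (rule has_derivative_unique[OF d1 F(4)])
  from fun_cong[OF this, of "(1,0)"] fun_cong[OF this, of "(0,1)"] F(5,6)
  have FF: "F1 (cpt p) = of_real a" "F2 (cpt p) = of_real b" by (simp_all add: complex_eq_iff)
  have "(\<lambda>h. c * fst h + d * snd h) = (\<lambda>h. Re (G1 (cpt p)) * fst h + Re (G2 (cpt p)) * snd h)"
    by (rule has_derivative_unique[OF d2 G(4)])
  from fun_cong[OF this, of "(1,0)"] fun_cong[OF this, of "(0,1)"] G(5,6)
  have GG: "G1 (cpt p) = of_real c" "G2 (cpt p) = of_real d" by (simp_all add: complex_eq_iff)
  have o: "open (S \<inter> T)" using F(2) G(2) by (simp add: cderiv2_def open_Int)
  have "F1 (cpt p) * G2 (cpt p) - F2 (cpt p) * G1 (cpt p) = of_real (a * d - b * c)"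
    unfolding FF GG by simp
  then have det': "F1 (cpt p) * G2 (cpt p) - F2 (cpt p) * G1 (cpt p) \<noteq> 0"
    using det by (simp only: of_real_eq_0_iff not_False_eq_True)
  have in': "cpt p \<in> S \<inter> T" using F(1) G(1) by simp
  obtain U V gg where gg: "open U" "cpt p \<in> U" "open V" "(F (cpt p), G (cpt p)) \<in> V"
    "\<forall>u\<in>U. (F u, G u) \<in> V \<and> gg (F u, G u) = u"
    "hol2_at (\<lambda>w. fst (gg w)) (F (cpt p), G (cpt p))" "hol2_at (\<lambda>w. snd (gg w)) (F (cpt p), G (cpt p))"
    using hol2_inverse[OF cderiv2_subset[OF F(2) o Int_lower1] cderiv2_subset[OF G(2) o Int_lower2] in' det'] .
  have pp: "(F (cpt p), G (cpt p)) = cpt (f1 p, f2 p)"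
    using eventually_nhds_x_imp_x[OF F(3)] eventually_nhds_x_imp_x[OF G(3)] by (simp add: cpt_def)
  have limg: "filterlim g (nhds p) (nhds (f1 p, f2 p))"
    using tendsto_at_iff_tendsto_nhds[THEN iffD1, OF g(1)[unfolded isCont_def]] by (simp only: g(2))
  have "isCont cpt p" by (rule isCont_cpt)
  then have limc: "filterlim cpt (nhds (cpt p)) (nhds p)"
    unfolding isCont_def by (rule tendsto_at_iff_tendsto_nhds[THEN iffD1])
  have "\<forall>\<^sub>F q in nhds (f1 p, f2 p). cpt (g q) \<in> U"
    by (rule eventually_compose_filterlim[OF eventually_nhds_in_open[OF gg(1,2)] filterlim_compose[OF limc limg]])
  moreover have "\<forall>\<^sub>F q in nhds (f1 p, f2 p). F (cpt (g q)) = of_real (f1 (g q))"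
    by (rule eventually_compose_filterlim[OF F(3) limg])
  moreover have "\<forall>\<^sub>F q in nhds (f1 p, f2 p). G (cpt (g q)) = of_real (f2 (g q))"
    by (rule eventually_compose_filterlim[OF G(3) limg])
  ultimately have ev: "\<forall>\<^sub>F q in nhds (f1 p, f2 p). gg (cpt q) = cpt (g q)"
    using inv
  proof eventually_elim
    case (elim q)
    then have "cpt q = (F (cpt (g q)), G (cpt (g q)))" by (metis cpt_def fst_conv snd_conv)
    then show ?case using bspec[OF gg(5) elim(1)] by simp
  qed
  show "complexifiable (\<lambda>q. fst (g q)) (f1 p, f2 p)"
    unfolding complexifiable_def
  proof (intro exI conjI)
    show "hol2_at (\<lambda>w. fst (gg w)) (cpt (f1 p, f2 p))" using gg(6) by (simp only: pp)
    show "\<forall>\<^sub>F q in nhds (f1 p, f2 p). fst (gg (cpt q)) = of_real (fst (g q))"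
      using ev by eventually_elim (simp add: cpt_def)
  qed
  show "complexifiable (\<lambda>q. snd (g q)) (f1 p, f2 p)"
    unfolding complexifiable_def
  proof (intro exI conjI)
    show "hol2_at (\<lambda>w. snd (gg w)) (cpt (f1 p, f2 p))" using gg(7) by (simp only: pp)
    show "\<forall>\<^sub>F q in nhds (f1 p, f2 p). snd (gg (cpt q)) = of_real (snd (g q))"
      using ev by eventually_elim (simp add: cpt_def)
  qed
qed

section \<open>The complete elliptic integral of the third kind\<close>

lemma cderiv2_partials:
  assumes X: "open X" and Y: "open Y" "convex Y"
    and d1: "\<And>x y. x \<in> X \<Longrightarrow> y \<in> Y \<Longrightarrow> ((\<lambda>x. f (x, y)) has_field_derivative D1 (x, y)) (at x)"
    and d2: "\<And>x y. x \<in> X \<Longrightarrow> y \<in> Y \<Longrightarrow> ((\<lambda>y. f (x, y)) has_field_derivative D2 (x, y)) (at y)"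
    and c1: "continuous_on (X \<times> Y) D1" and c2: "continuous_on (X \<times> Y) D2"
  shows "cderiv2 f (X \<times> Y) D1 D2"
  unfolding cderiv2_def
proof (intro conjI ballI)
  show o: "open (X \<times> Y)" by (rule open_Times[OF X Y(1)])
  fix z assume z: "z \<in> X \<times> Y"
  obtain x y where xy: "z = (x, y)" "x \<in> X" "y \<in> Y" using z by blast
  have "((\<lambda>(x, y). f (x, y)) has_derivative
     (\<lambda>(tx, ty). D1 (x, y) * tx + blinfun_apply (blinfun_mult_right (D2 (x, y))) ty)) (at (x, y) within X \<times> Y)"
  proof (rule has_derivative_partialsI)
    show "((\<lambda>x. f (x, y)) has_derivative (*) (D1 (x, y))) (at x within X)"
      using has_field_derivative_at_within[OF d1[OF xy(2,3)]] by (simp add: has_field_derivative_def)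
    show "((\<lambda>b. f (a, b)) has_derivative blinfun_apply (blinfun_mult_right (D2 (a, b)))) (at b within Y)"
      if "a \<in> X" "b \<in> Y" for a b
      using has_field_derivative_at_within[OF d2[OF that]] by (simp add: has_field_derivative_def)
    have "continuous_on (X \<times> Y) (\<lambda>p. blinfun_mult_right (D2 p))"
      by (rule bounded_linear.continuous_on[OF bounded_linear_blinfun_mult_right c2])
    then show "continuous (at (x, y) within X \<times> Y) (\<lambda>(x, y). blinfun_mult_right (D2 (x, y)))"
      using xy unfolding continuous_on_eq_continuous_within case_prod_beta prod.collapse by blast
  qed (rule xy(3) Y(2))+
  then have "(f has_derivative (\<lambda>h. D1 (x, y) * fst h + D2 (x, y) * snd h)) (at (x, y) within X \<times> Y)"
    by (simp add: case_prod_unfold)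
  then show "(f has_derivative (\<lambda>h. D1 z * fst h + D2 z * snd h)) (at z)"
    using at_within_open[OF z o] xy(1) by simp
qed (rule c1 c2)+

definition ellPiC :: "complex \<times> complex \<Rightarrow> complex" where
  "ellPiC z = integral (cbox 0 (pi/2))
     (\<lambda>\<theta>. 1 / ((1 - fst z * of_real ((sin \<theta>)^2)) * csqrt (1 - snd z * of_real ((sin \<theta>)^2))))"

lemma Re_one_minus_pos:
  assumes "Re n < 1" shows "0 < Re (1 - n * of_real ((sin \<theta>)^2))"
proof -
  have s: "0 \<le> (sin \<theta>)^2" "(sin \<theta>)^2 \<le> 1" by (simp_all add: abs_square_le_1)
  have "Re n * (sin \<theta>)^2 < 1"
  proof (cases "Re n \<le> 0")
    case True
    then show ?thesis using s(1) by (smt (verit) mult_nonneg_nonneg mult_minus_left)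
  next
    case False
    then have "Re n * (sin \<theta>)^2 \<le> Re n * 1" using s(2) by (intro mult_left_mono) auto
    then show ?thesis using assms by simp
  qed
  then show ?thesis by simp
qed

lemma recip_algebra:
  fixes a w S :: complex
  shows "inverse w * (1 / a) = 1 / (a * w)"
    "- (inverse w * (inverse (2 * w) * (- S)) * inverse w) * (1 / a) = S / (2 * a * w^2 * w)"
    "- (inverse w * (- S) * inverse w) * (1 / a) = S / (w^2 * a)"
  by (simp_all add: divide_simps power2_eq_square)

text \<open>Real parts below 1 put \<open>1 - n sin^2\<close> and \<open>1 - m sin^2\<close> into
  the right half-plane, where the denominator has no zero and \<open>csqrt\<close> is
  holomorphic.\<close>

lemma cderiv2_ellPiC:
  "cderiv2 ellPiC ({n. Re n < 1} \<times> {m. Re m < 1})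
    (\<lambda>z. integral (cbox 0 (pi/2)) (\<lambda>\<theta>. of_real ((sin \<theta>)^2) /
        ((1 - fst z * of_real ((sin \<theta>)^2))^2 * csqrt (1 - snd z * of_real ((sin \<theta>)^2)))))
    (\<lambda>z. integral (cbox 0 (pi/2)) (\<lambda>\<theta>. of_real ((sin \<theta>)^2) /
        (2 * (1 - fst z * of_real ((sin \<theta>)^2)) * (1 - snd z * of_real ((sin \<theta>)^2)) *
          csqrt (1 - snd z * of_real ((sin \<theta>)^2)))))"
proof -
  let ?X = "{n. Re n < 1} :: complex set"
  let ?S = "\<lambda>\<theta>. complex_of_real ((sin \<theta>)^2)"
  have nz: "1 - n * ?S \<theta> \<noteq> 0" "csqrt (1 - n * ?S \<theta>) \<noteq> 0" "1 - n * ?S \<theta> \<notin> \<real>\<^sub>\<le>\<^sub>0"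
    if "n \<in> ?X" for n \<theta>
  proof -
    have R: "0 < Re (1 - n * ?S \<theta>)" using Re_one_minus_pos[of n \<theta>] that by simp
    then show 1: "1 - n * ?S \<theta> \<noteq> 0" by (metis less_irrefl zero_complex.sel(1))
    then show "csqrt (1 - n * ?S \<theta>) \<noteq> 0" by (simp only: csqrt_eq_0 not_False_eq_True)
    show "1 - n * ?S \<theta> \<notin> \<real>\<^sub>\<le>\<^sub>0" using R unfolding complex_nonpos_Reals_iff by linarith
  qed
  have oX: "open ?X" by (rule open_halfspace_Re_lt)
  have cX: "convex ?X" by (rule convex_halfspace_Re_lt)
  have cS: "continuous_on A (\<lambda>p. ?S (t p))" if "continuous_on A t" for A :: "'a::metric_space set" and t
    by (rule continuous_on_of_real[OF continuous_on_power[OF continuous_on_sin[OF that]]])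
  have cp: "continuous_on A (\<lambda>p. 1 - h p * ?S (t p))"
    if "continuous_on A h" "continuous_on A t" for A :: "'a::metric_space set" and h t
    by (rule continuous_on_diff[OF continuous_on_const continuous_on_mult[OF that(1) cS[OF that(2)]]])
  have cs: "continuous_on A (\<lambda>p. csqrt (1 - h p * ?S (t p)))"
    if "continuous_on A h" "continuous_on A t" "\<And>p. p \<in> A \<Longrightarrow> h p \<in> ?X"
    for A :: "'a::metric_space set" and h t
  proof (rule continuous_on_compose2[OF continuous_on_csqrt])
    show "continuous_on A (\<lambda>p. 1 - h p * ?S (t p))" by (rule cp[OF that(1,2)])
    show "(\<lambda>p. 1 - h p * ?S (t p)) ` A \<subseteq> - \<real>\<^sub>\<le>\<^sub>0" using nz(3) that(3) by blast
  qed
  have den0: "(1 - n * ?S t) * csqrt (1 - m * ?S t) \<noteq> 0"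
    and den1: "(1 - n * ?S t)^2 * csqrt (1 - m * ?S t) \<noteq> 0"
    and den2: "2 * (1 - n * ?S t) * (1 - m * ?S t) * csqrt (1 - m * ?S t) \<noteq> 0"
    if "n \<in> ?X" "m \<in> ?X" for n m t
    using nz(1)[OF that(1), of t] nz(1)[OF that(2), of t] nz(2)[OF that(2), of t]
    by (simp_all only: mult_eq_0_iff power_eq_0_iff) simp_all
  have int1: "continuous_on (cbox 0 (pi/2)) (\<lambda>\<theta>. 1 / ((1 - n * ?S \<theta>) * csqrt (1 - m * ?S \<theta>)))"
    if "n \<in> ?X" "m \<in> ?X" for n m
    by (intro continuous_on_divide continuous_on_mult continuous_on_const cs cp continuous_on_id ballI den0)
       (use that in simp_all)
  show ?thesis
  proof (rule cderiv2_partials[OF oX oX cX])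
    fix n m assume nm: "n \<in> ?X" "m \<in> ?X"
    have "((\<lambda>n. integral (cbox 0 (pi/2)) (\<lambda>\<theta>. 1 / ((1 - n * ?S \<theta>) * csqrt (1 - m * ?S \<theta>)))) has_field_derivative
       integral (cbox 0 (pi/2)) (\<lambda>\<theta>. ?S \<theta> / ((1 - n * ?S \<theta>)^2 * csqrt (1 - m * ?S \<theta>)))) (at n within ?X)"
    proof (rule leibniz_rule_field_derivative[OF _ _ _ nm(1) cX])
      fix x t assume x: "x \<in> ?X"
      have "((\<lambda>x. 1 - x * ?S t) has_field_derivative - ?S t) (at x within ?X)"
        by (auto intro!: derivative_eq_intros)
      from DERIV_inverse'[OF this nz(1)[OF x]]
      have "((\<lambda>x. inverse (1 - x * ?S t)) has_field_derivative
          - (inverse (1 - x * ?S t) * (- ?S t) * inverse (1 - x * ?S t))) (at x within ?X)" .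
      from DERIV_cmult_right[OF this, of "1 / csqrt (1 - m * ?S t)"]
      show "((\<lambda>x. 1 / ((1 - x * ?S t) * csqrt (1 - m * ?S t))) has_field_derivative
          ?S t / ((1 - x * ?S t)^2 * csqrt (1 - m * ?S t))) (at x within ?X)"
        unfolding recip_algebra(1,3) by (simp only: mult.commute[of "csqrt _"])
    next
      fix x assume x: "x \<in> ?X"
      show "(\<lambda>\<theta>. 1 / ((1 - x * ?S \<theta>) * csqrt (1 - m * ?S \<theta>))) integrable_on cbox 0 (pi/2)"
        by (rule integrable_continuous[OF int1[OF x nm(2)]])
    next
      show "continuous_on (?X \<times> cbox 0 (pi/2)) (\<lambda>(x, t). ?S t / ((1 - x * ?S t)^2 * csqrt (1 - m * ?S t)))"
        unfolding case_prod_beta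
        by (intro continuous_on_divide continuous_on_mult continuous_on_power continuous_on_const cs cp cS
            continuous_on_id continuous_on_fst continuous_on_snd ballI den1 den2)
          (use nm in \<open>simp_all add: mem_Times_iff\<close>)
    qed
    then show "((\<lambda>x. ellPiC (x, m)) has_field_derivative integral (cbox 0 (pi/2)) (\<lambda>\<theta>. ?S \<theta> /
        ((1 - fst (n, m) * ?S \<theta>)^2 * csqrt (1 - snd (n, m) * ?S \<theta>)))) (at n)"
      unfolding ellPiC_def using at_within_open[OF nm(1) oX] by simp
    have "((\<lambda>m. integral (cbox 0 (pi/2)) (\<lambda>\<theta>. 1 / ((1 - n * ?S \<theta>) * csqrt (1 - m * ?S \<theta>)))) has_field_derivative
       integral (cbox 0 (pi/2)) (\<lambda>\<theta>. ?S \<theta> / (2 * (1 - n * ?S \<theta>) * (1 - m * ?S \<theta>) * csqrt (1 - m * ?S \<theta>)))) (at m within ?X)"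
    proof (rule leibniz_rule_field_derivative[OF _ _ _ nm(2) cX])
      fix x t assume x: "x \<in> ?X"
      have "((\<lambda>x. 1 - x * ?S t) has_field_derivative - ?S t) (at x within ?X)"
        by (auto intro!: derivative_eq_intros)
      from DERIV_chain2[OF has_field_derivative_csqrt[OF nz(3)[OF x]] this]
      have "((\<lambda>x. csqrt (1 - x * ?S t)) has_field_derivative
          inverse (2 * csqrt (1 - x * ?S t)) * (- ?S t)) (at x within ?X)" .
      from DERIV_inverse'[OF this nz(2)[OF x]]
      have "((\<lambda>x. inverse (csqrt (1 - x * ?S t))) has_field_derivative
          - (inverse (csqrt (1 - x * ?S t)) * (inverse (2 * csqrt (1 - x * ?S t)) * (- ?S t)) *
            inverse (csqrt (1 - x * ?S t)))) (at x within ?X)" .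
      from DERIV_cmult_right[OF this, of "1 / (1 - n * ?S t)"]
      have "((\<lambda>x. 1 / ((1 - n * ?S t) * csqrt (1 - x * ?S t))) has_field_derivative
          ?S t / (2 * (1 - n * ?S t) * (csqrt (1 - x * ?S t))^2 * csqrt (1 - x * ?S t))) (at x within ?X)"
        unfolding recip_algebra(1,2) .
      then show "((\<lambda>x. 1 / ((1 - n * ?S t) * csqrt (1 - x * ?S t))) has_field_derivative
          ?S t / (2 * (1 - n * ?S t) * (1 - x * ?S t) * csqrt (1 - x * ?S t))) (at x within ?X)"
        by (simp only: power2_csqrt)
    next
      fix x assume x: "x \<in> ?X"
      show "(\<lambda>\<theta>. 1 / ((1 - n * ?S \<theta>) * csqrt (1 - x * ?S \<theta>))) integrable_on cbox 0 (pi/2)"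
        by (rule integrable_continuous[OF int1[OF nm(1) x]])
    next
      show "continuous_on (?X \<times> cbox 0 (pi/2))
          (\<lambda>(x, t). ?S t / (2 * (1 - n * ?S t) * (1 - x * ?S t) * csqrt (1 - x * ?S t)))"
        unfolding case_prod_beta
        by (intro continuous_on_divide continuous_on_mult continuous_on_const cs cp cS
            continuous_on_id continuous_on_fst continuous_on_snd ballI den1 den2)
          (use nm in \<open>simp_all add: mem_Times_iff\<close>)
    qed
    then show "((\<lambda>y. ellPiC (n, y)) has_field_derivative integral (cbox 0 (pi/2)) (\<lambda>\<theta>. ?S \<theta> /
        (2 * (1 - fst (n, m) * ?S \<theta>) * (1 - snd (n, m) * ?S \<theta>) * csqrt (1 - snd (n, m) * ?S \<theta>)))) (at m)"
      unfolding ellPiC_def using at_within_open[OF nm(2) oX] by simp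
  next
    show "continuous_on (?X \<times> ?X) (\<lambda>z. integral (cbox 0 (pi/2)) (\<lambda>\<theta>. ?S \<theta> /
        ((1 - fst z * ?S \<theta>)^2 * csqrt (1 - snd z * ?S \<theta>))))"
      by (rule integral_continuous_on_param, unfold case_prod_beta)
         (intro continuous_on_divide continuous_on_mult continuous_on_power continuous_on_const cs cp cS
            continuous_on_id continuous_on_fst continuous_on_snd ballI den1 den2, simp_all add: mem_Times_iff)
    show "continuous_on (?X \<times> ?X) (\<lambda>z. integral (cbox 0 (pi/2)) (\<lambda>\<theta>. ?S \<theta> /
        (2 * (1 - fst z * ?S \<theta>) * (1 - snd z * ?S \<theta>) * csqrt (1 - snd z * ?S \<theta>))))"
      by (rule integral_continuous_on_param, unfold case_prod_beta)
         (intro continuous_on_divide continuous_on_mult continuous_on_power continuous_on_const cs cp cS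
            continuous_on_id continuous_on_fst continuous_on_snd ballI den1 den2, simp_all add: mem_Times_iff)
  qed
qed

lemma one_minus_sin_pos: "n < 1 \<Longrightarrow> 0 < 1 - n * (sin \<theta>)^2" for n :: real
  using Re_one_minus_pos[of "of_real n" \<theta>] by (simp flip: of_real_power)

lemma integral_of_real_cbox:
  fixes f :: "real \<Rightarrow> real"
  assumes "continuous_on (cbox a b) f"
  shows "integral (cbox a b) (\<lambda>x. complex_of_real (f x)) = of_real (integral (cbox a b) f)"
  by (rule integral_unique[OF has_integral_of_real[OF integrable_integral[OF integrable_continuous[OF assms]]]])

lemma ellPiC_of_real:
  assumes "n < 1" "m < 1"
  shows "ellPiC (of_real n, of_real m) = of_real (ellPi n m)"
proof -
  have p: "0 < 1 - n * (sin \<theta>)^2" "0 < 1 - m * (sin \<theta>)^2" for \<theta>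
    by (rule one_minus_sin_pos[OF assms(1)], rule one_minus_sin_pos[OF assms(2)])
  have p': "1 - n * (sin \<theta>)^2 \<noteq> 0" "sqrt (1 - m * (sin \<theta>)^2) \<noteq> 0" for \<theta>
    using p[of \<theta>] by auto
  have e: "1 / ((1 - fst (complex_of_real n, complex_of_real m) * of_real ((sin \<theta>)^2)) *
        csqrt (1 - snd (complex_of_real n, complex_of_real m) * of_real ((sin \<theta>)^2)))
     = of_real (1 / ((1 - n * (sin \<theta>)^2) * sqrt (1 - m * (sin \<theta>)^2)))" for \<theta>
  proof -
    have "csqrt (1 - of_real m * of_real ((sin \<theta>)^2)) = of_real (sqrt (1 - m * (sin \<theta>)^2))"
      using of_real_sqrt[of "1 - m * (sin \<theta>)^2"] p(2)[of \<theta>] by simp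
    then show ?thesis by (simp only: fst_conv snd_conv of_real_divide of_real_mult of_real_diff of_real_1)
  qed
  have "continuous_on (cbox 0 (pi/2)) (\<lambda>\<theta>. 1 / ((1 - n * (sin \<theta>)^2) * sqrt (1 - m * (sin \<theta>)^2)))"
    by (intro continuous_intros) (use p' in auto)
  from integral_of_real_cbox[OF this] show ?thesis
    unfolding ellPiC_def e ellPi_def by simp
qed

lemma complexifiable_ellPi:
  assumes "n < 1" "m < 1"
  shows "complexifiable (\<lambda>p. ellPi (fst p) (snd p)) (n, m)"
  unfolding complexifiable_def
proof (intro exI conjI)
  show "hol2_at ellPiC (cpt (n, m))"
    by (rule hol2_atI[OF _ cderiv2_ellPiC]) (simp add: cpt_def assms)
  have "\<forall>\<^sub>F q in nhds (n, m). q \<in> {..<1} \<times> {..<1}"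
    by (rule eventually_nhds_in_open) (simp_all add: open_Times assms)
  then show "\<forall>\<^sub>F q in nhds (n, m). ellPiC (cpt q) = of_real (ellPi (fst q) (snd q))"
    by eventually_elim (simp add: cpt_def ellPiC_of_real mem_Times_iff)
qed

lemma ellPi_has_derivative:
  assumes nm: "n < 1" "m < 1"
  shows "((\<lambda>p. ellPi (fst p) (snd p)) has_derivative
    (\<lambda>h. integral {0..pi/2} (\<lambda>\<theta>. (sin \<theta>)^2 / ((1 - n * (sin \<theta>)^2)^2 * sqrt (1 - m * (sin \<theta>)^2))) * fst h
       + integral {0..pi/2} (\<lambda>\<theta>. (sin \<theta>)^2 / (2 * (1 - n * (sin \<theta>)^2) * (1 - m * (sin \<theta>)^2) *
            sqrt (1 - m * (sin \<theta>)^2))) * snd h)) (at (n, m))"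
proof -
  define D1 where "D1 = (\<lambda>z. integral (cbox 0 (pi/2)) (\<lambda>\<theta>. complex_of_real ((sin \<theta>)^2) /
        ((1 - fst z * of_real ((sin \<theta>)^2))^2 * csqrt (1 - snd z * of_real ((sin \<theta>)^2)))))"
  define D2 where "D2 = (\<lambda>z. integral (cbox 0 (pi/2)) (\<lambda>\<theta>. complex_of_real ((sin \<theta>)^2) /
        (2 * (1 - fst z * of_real ((sin \<theta>)^2)) * (1 - snd z * of_real ((sin \<theta>)^2)) *
          csqrt (1 - snd z * of_real ((sin \<theta>)^2)))))"
  have p: "0 < 1 - n * (sin \<theta>)^2" "0 < 1 - m * (sin \<theta>)^2" for \<theta>
    by (rule one_minus_sin_pos[OF assms(1)], rule one_minus_sin_pos[OF assms(2)])
  have p': "1 - n * (sin \<theta>)^2 \<noteq> 0" "1 - m * (sin \<theta>)^2 \<noteq> 0" "sqrt (1 - m * (sin \<theta>)^2) \<noteq> 0" for \<theta>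
    using p[of \<theta>] by auto
  have sq: "csqrt (1 - of_real m * of_real ((sin \<theta>)^2)) = of_real (sqrt (1 - m * (sin \<theta>)^2))" for \<theta>
    using of_real_sqrt[of "1 - m * (sin \<theta>)^2"] p(2)[of \<theta>] by simp
  have D1: "D1 (of_real n, of_real m) =
      of_real (integral {0..pi/2} (\<lambda>\<theta>. (sin \<theta>)^2 / ((1 - n * (sin \<theta>)^2)^2 * sqrt (1 - m * (sin \<theta>)^2))))"
  proof -
    have e: "complex_of_real ((sin \<theta>)^2) / ((1 - of_real n * of_real ((sin \<theta>)^2))^2 *
        csqrt (1 - of_real m * of_real ((sin \<theta>)^2)))
      = of_real ((sin \<theta>)^2 / ((1 - n * (sin \<theta>)^2)^2 * sqrt (1 - m * (sin \<theta>)^2)))" for \<theta>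
      unfolding sq by (simp only: of_real_divide of_real_mult of_real_diff of_real_1 of_real_power)
    have "continuous_on (cbox 0 (pi/2)) (\<lambda>\<theta>. (sin \<theta>)^2 / ((1 - n * (sin \<theta>)^2)^2 * sqrt (1 - m * (sin \<theta>)^2)))"
      by (intro continuous_intros) (use p' in auto)
    from integral_of_real_cbox[OF this] show ?thesis unfolding D1_def fst_conv snd_conv e by simp
  qed
  have D2: "D2 (of_real n, of_real m) =
      of_real (integral {0..pi/2} (\<lambda>\<theta>. (sin \<theta>)^2 / (2 * (1 - n * (sin \<theta>)^2) * (1 - m * (sin \<theta>)^2) *
            sqrt (1 - m * (sin \<theta>)^2))))"
  proof -
    have e: "complex_of_real ((sin \<theta>)^2) / (2 * (1 - of_real n * of_real ((sin \<theta>)^2)) *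
        (1 - of_real m * of_real ((sin \<theta>)^2)) * csqrt (1 - of_real m * of_real ((sin \<theta>)^2)))
      = of_real ((sin \<theta>)^2 / (2 * (1 - n * (sin \<theta>)^2) * (1 - m * (sin \<theta>)^2) * sqrt (1 - m * (sin \<theta>)^2)))" for \<theta>
      unfolding sq by (simp only: of_real_divide of_real_mult of_real_diff of_real_1 of_real_power of_real_numeral)
    have "continuous_on (cbox 0 (pi/2)) (\<lambda>\<theta>. (sin \<theta>)^2 / (2 * (1 - n * (sin \<theta>)^2) * (1 - m * (sin \<theta>)^2) *
            sqrt (1 - m * (sin \<theta>)^2)))"
      by (intro continuous_intros) (use p' in auto)
    from integral_of_real_cbox[OF this] show ?thesis unfolding D2_def fst_conv snd_conv e by simp
  qed
  have cp: "(cpt has_derivative cpt) (at (n, m))"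
    unfolding cpt_def
    by (rule has_derivative_Pair[OF has_derivative_of_real[OF has_derivative_fst[OF has_derivative_ident]]
          has_derivative_of_real[OF has_derivative_snd[OF has_derivative_ident]]])
  have "(ellPiC has_derivative (\<lambda>h. D1 (cpt (n, m)) * fst h + D2 (cpt (n, m)) * snd h)) (at (cpt (n, m)))"
    using cderiv2_ellPiC nm unfolding cderiv2_def D1_def D2_def by (simp add: cpt_def)
  from bounded_linear.has_derivative[OF bounded_linear_Re has_derivative_compose[OF cp this]]
  have R: "((\<lambda>q. Re (ellPiC (cpt q))) has_derivative
      (\<lambda>h. Re (D1 (of_real n, of_real m)) * fst h + Re (D2 (of_real n, of_real m)) * snd h)) (at (n, m))"
    by (simp add: cpt_def)
  have "\<forall>\<^sub>F q in nhds (n, m). q \<in> {..<1} \<times> {..<1}"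
    by (rule eventually_nhds_in_open) (simp_all add: open_Times assms)
  then have ev: "\<forall>\<^sub>F q in nhds (n, m). Re (ellPiC (cpt q)) = ellPi (fst q) (snd q)"
    by eventually_elim (simp add: cpt_def ellPiC_of_real mem_Times_iff)
  have "((\<lambda>p. ellPi (fst p) (snd p)) has_derivative
      (\<lambda>h. Re (D1 (of_real n, of_real m)) * fst h + Re (D2 (of_real n, of_real m)) * snd h)) (at (n, m))"
    by (rule has_derivative_transform_eventually[OF R eventually_nhds_conv_at[THEN iffD1, OF ev, THEN conjunct1]
         eventually_nhds_x_imp_x[OF ev] UNIV_I])
  then show ?thesis unfolding D1 D2 by simp
qed

section \<open>Integrals over a half period and exact differentials\<close>

text \<open>With \<open>V = d sin^2 \<theta>\<close> this is the integral of
  \<open>\<phi>(V) dV / (2 sqrt (Q V))\<close> over \<open>[0, d]\<close>. The angle removes the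
  singularities at the endpoints and keeps the case \<open>d = 0\<close> meaningful.\<close>

definition EI :: "real \<Rightarrow> real \<Rightarrow> (real \<Rightarrow> real) \<Rightarrow> real" where
  "EI d k \<phi> = integral {0..pi/2} (\<lambda>\<theta>. \<phi> (d * (sin \<theta>)^2) / sqrt (k - d * (sin \<theta>)^2))"

definition Qc :: "real \<Rightarrow> real \<Rightarrow> real \<Rightarrow> real" where
  "Qc d k V = V * (V - d) * (V - k)"

definition Qc' :: "real \<Rightarrow> real \<Rightarrow> real \<Rightarrow> real" where
  "Qc' d k V = 3 * V^2 - 2 * (d + k) * V + d * k"

lemma sin_sq_range: "0 \<le> d \<Longrightarrow> d * (sin \<theta>)^2 \<in> {0..d}" for d :: real
  using mult_left_mono[of "(sin \<theta>)^2" 1 d] by (simp add: abs_square_le_1)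

lemma EI_continuous:
  assumes "0 \<le> d" "d < k" "continuous_on {0..d} \<phi>"
  shows "continuous_on {0..pi/2} (\<lambda>\<theta>. \<phi> (d * (sin \<theta>)^2) / sqrt (k - d * (sin \<theta>)^2))"
proof (rule continuous_on_divide)
  show "continuous_on {0..pi/2} (\<lambda>\<theta>. \<phi> (d * (sin \<theta>)^2))"
    by (rule continuous_on_compose2[OF assms(3)]) (use sin_sq_range[OF assms(1)] in \<open>auto intro!: continuous_intros\<close>)
  show "continuous_on {0..pi/2} (\<lambda>\<theta>. sqrt (k - d * (sin \<theta>)^2))" by (intro continuous_intros)
  show "\<forall>\<theta>\<in>{0..pi/2}. sqrt (k - d * (sin \<theta>)^2) \<noteq> 0"
    using sin_sq_range[OF assms(1)] assms(2) by (metis atLeastAtMost_iff diff_gt_0_iff_gt less_irrefl order_le_less_trans real_sqrt_eq_0_iff)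
qed

lemma EI_has_integral:
  assumes "0 \<le> d" "d < k" "continuous_on {0..d} \<phi>"
  shows "((\<lambda>\<theta>. \<phi> (d * (sin \<theta>)^2) / sqrt (k - d * (sin \<theta>)^2)) has_integral EI d k \<phi>) {0..pi/2}"
  unfolding EI_def
  by (intro integrable_integral integrable_continuous_interval EI_continuous assms)

lemma EI_cong:
  assumes "0 \<le> d" "\<And>V. 0 \<le> V \<Longrightarrow> V \<le> d \<Longrightarrow> \<phi> V = \<psi> V"
  shows "EI d k \<phi> = EI d k \<psi>"
proof -
  have "\<phi> (d * (sin \<theta>)^2) = \<psi> (d * (sin \<theta>)^2)" for \<theta>
    using assms(2) sin_sq_range[OF assms(1), of \<theta>] by simp
  then show ?thesis unfolding EI_def by simp
qed

lemma EI_add: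
  assumes "0 \<le> d" "d < k" "continuous_on {0..d} \<phi>" "continuous_on {0..d} \<psi>"
  shows "EI d k (\<lambda>V. \<phi> V + \<psi> V) = EI d k \<phi> + EI d k \<psi>"
proof -
  have "((\<lambda>\<theta>. (\<phi> (d * (sin \<theta>)^2) + \<psi> (d * (sin \<theta>)^2)) / sqrt (k - d * (sin \<theta>)^2)) has_integral
     EI d k \<phi> + EI d k \<psi>) {0..pi/2}"
    unfolding add_divide_distrib by (intro has_integral_add EI_has_integral assms)
  then show ?thesis unfolding EI_def[of d k "\<lambda>V. \<phi> V + \<psi> V"] by (rule integral_unique)
qed

lemma EI_cmult: "EI d k (\<lambda>V. c * \<phi> V) = c * EI d k \<phi>"
  unfolding EI_def times_divide_eq_right[symmetric] by (rule integral_mult_right)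

lemma EI_linear:
  assumes "0 \<le> d" "d < k" "continuous_on {0..d} \<phi>" "continuous_on {0..d} \<psi>"
  shows "EI d k (\<lambda>V. a * \<phi> V + b * \<psi> V) = a * EI d k \<phi> + b * EI d k \<psi>"
  by (subst EI_add[OF assms(1,2)]) (intro continuous_intros assms, intro continuous_intros assms, simp only: EI_cmult)

lemma EI_affine:
  assumes "0 \<le> d" "d < k"
  shows "EI d k (\<lambda>V. x - V) = x * EI d k (\<lambda>_. 1) - EI d k (\<lambda>V. V)"
  using EI_linear[OF assms continuous_on_const continuous_on_id, of x 1 "-1"] by simp

lemma EI_pos:
  assumes "0 \<le> d" "d < k" "continuous_on {0..d} \<phi>"
    and nn: "\<And>V. 0 \<le> V \<Longrightarrow> V \<le> d \<Longrightarrow> 0 \<le> \<phi> V" and p: "\<phi> 0 \<noteq> 0"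
  shows "0 < EI d k \<phi>"
proof -
  have r: "0 \<le> d * (sin \<theta>)^2" "d * (sin \<theta>)^2 \<le> d" for \<theta> using sin_sq_range[OF assms(1), of \<theta>] by auto
  have nn': "0 \<le> \<phi> (d * (sin \<theta>)^2) / sqrt (k - d * (sin \<theta>)^2)" for \<theta>
    by (intro divide_nonneg_nonneg nn r) (use r(2)[of \<theta>] assms(2) in simp)
  have "0 \<le> EI d k \<phi>" unfolding EI_def by (rule integral_nonneg[OF integrable_continuous_interval[OF EI_continuous[OF assms(1-3)]] nn'])
  moreover have "EI d k \<phi> \<noteq> 0"
  proof
    assume "EI d k \<phi> = 0"
    then have "\<forall>\<theta>\<in>{0..pi/2}. \<phi> (d * (sin \<theta>)^2) / sqrt (k - d * (sin \<theta>)^2) = 0"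
      unfolding EI_def by (subst (asm) integral_eq_0_iff) (use EI_continuous[OF assms(1-3)] nn' in auto)
    then have "\<phi> (d * (sin 0)^2) / sqrt (k - d * (sin 0)^2) = 0" by (rule bspec) simp
    then show False using p assms(1,2) by simp
  qed
  ultimately show ?thesis by linarith
qed

text \<open>The square root of \<open>Q(V)\<close> along \<open>V = d sin^2 \<theta>\<close>, with
  the sign that makes it smooth through the zeros at \<open>V = 0\<close> and
  \<open>V = d\<close>.\<close>

definition Yc :: "real \<Rightarrow> real \<Rightarrow> real \<Rightarrow> real" where
  "Yc d k \<theta> = d * (sin \<theta> * cos \<theta>) * sqrt (k - d * (sin \<theta>)^2)"

lemma Yc_sq:
  assumes "0 \<le> d" "d < k" shows "(Yc d k \<theta>)^2 = Qc d k (d * (sin \<theta>)^2)"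
proof -
  define s c where "s = sin \<theta>" and "c = cos \<theta>"
  define D where "D = sqrt (k - d * s^2)"
  have "0 < k - d * s^2" using sin_sq_range[OF assms(1), of \<theta>] assms(2) by (simp add: s_def)
  then have D: "D * D = k - d * s^2" by (simp add: D_def)
  have sc: "c * c = 1 - s * s" using cos_squared_eq[of \<theta>] by (simp add: s_def c_def power2_eq_square)
  have "(Yc d k \<theta>)^2 = d * d * (s * s) * (c * c) * (D * D)"
    unfolding Yc_def s_def[symmetric] c_def[symmetric] D_def[symmetric] by (simp only: power2_eq_square mult_ac)
  also have "\<dots> = Qc d k (d * s^2)"
    unfolding sc D Qc_def by (simp add: power2_eq_square algebra_simps)
  finally show ?thesis by (simp only: s_def)
qed

lemma Yc_deriv:
  assumes "0 \<le> d" "d < k"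
  shows "(Yc d k has_real_derivative Qc' d k (d * (sin \<theta>)^2) / sqrt (k - d * (sin \<theta>)^2)) (at \<theta>)"
proof -
  define s c where "s = sin \<theta>" and "c = cos \<theta>"
  define D where "D = sqrt (k - d * s^2)"
  have pos: "0 < k - d * s^2" using sin_sq_range[OF assms(1), of \<theta>] assms(2) by (simp add: s_def)
  have D: "0 < D" "D * D = k - d * s^2" using pos by (simp_all add: D_def)
  have sc: "c * c = 1 - s * s" using cos_squared_eq[of \<theta>] by (simp add: s_def c_def power2_eq_square)
  have "(Yc d k has_real_derivative d * (c * c - s * s) * D + d * (s * c) * ((- (d * (2 * s * c))) * (inverse D / 2))) (at \<theta>)"
    unfolding Yc_def using pos unfolding s_def c_def D_def
    by (auto intro!: derivative_eq_intros simp: algebra_simps)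
  moreover have "d * (c * c - s * s) * D + d * (s * c) * ((- (d * (2 * s * c))) * (inverse D / 2))
      = Qc' d k (d * s^2) / D"
  proof -
    have "d * (c * c - s * s) * D + d * (s * c) * ((- (d * (2 * s * c))) * (inverse D / 2))
        = (d * (c * c - s * s) * (D * D) - d * d * (s * s) * (c * c)) / D"
      using D(1) by (simp add: field_simps)
    also have "d * (c * c - s * s) * (D * D) - d * d * (s * s) * (c * c) = Qc' d k (d * s^2)"
      unfolding D(2) sc Qc'_def by (simp add: power2_eq_square algebra_simps)
    finally show ?thesis .
  qed
  ultimately show ?thesis unfolding D_def s_def by simp
qed

lemma sin_sq_deriv: "((\<lambda>\<theta>. d * (sin \<theta>)^2) has_real_derivative 2 * (d * (sin \<theta> * cos \<theta>))) (at \<theta>)"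
  by (auto intro!: derivative_eq_intros)

lemma Yc_ends: "Yc d k 0 = 0" "Yc d k (pi/2) = 0"
  by (simp_all add: Yc_def)

text \<open>Integrating the exact differential of \<open>Y h(V)\<close>, where \<open>Y\<^sup>2 = Q(V)\<close> vanishes at both ends.\<close>

lemma EI_exact:
  assumes dk: "0 \<le> d" "d < k"
    and h: "\<And>V. 0 \<le> V \<Longrightarrow> V \<le> d \<Longrightarrow> (h has_real_derivative h' V) (at V)"
  shows "EI d k (\<lambda>V. Qc' d k V * h V + 2 * Qc d k V * h' V) = 0"
proof -
  have dY: "((\<lambda>\<theta>. Yc d k \<theta> * h (d * (sin \<theta>)^2)) has_real_derivative
      (Qc' d k (d * (sin \<theta>)^2) * h (d * (sin \<theta>)^2) + 2 * Qc d k (d * (sin \<theta>)^2) * h' (d * (sin \<theta>)^2))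
        / sqrt (k - d * (sin \<theta>)^2)) (at \<theta>)" for \<theta>
  proof -
    let ?V = "d * (sin \<theta>)^2" let ?D = "sqrt (k - ?V)"
    have V: "0 \<le> ?V" "?V \<le> d" using sin_sq_range[OF dk(1), of \<theta>] by auto
    have D: "0 < ?D" using V dk by simp
    have "((\<lambda>\<theta>. Yc d k \<theta> * h (d * (sin \<theta>)^2)) has_real_derivative
       Qc' d k ?V / ?D * h ?V + h' ?V * (2 * (d * (sin \<theta> * cos \<theta>))) * Yc d k \<theta>) (at \<theta>)"
      by (rule DERIV_mult[OF Yc_deriv[OF dk] DERIV_chain2[OF h[OF V] sin_sq_deriv]])
    moreover have "Qc' d k ?V / ?D * h ?V + h' ?V * (2 * (d * (sin \<theta> * cos \<theta>))) * Yc d k \<theta>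
        = (Qc' d k ?V * h ?V + 2 * Qc d k ?V * h' ?V) / ?D"
    proof -
      have y: "d * (sin \<theta> * cos \<theta>) = Yc d k \<theta> / ?D" using D by (simp add: Yc_def)
      have "h' ?V * (2 * (Yc d k \<theta> / ?D)) * Yc d k \<theta> = 2 * (Yc d k \<theta>)^2 * h' ?V / ?D"
        by (simp add: power2_eq_square)
      then show ?thesis unfolding y Yc_sq[OF dk] by (simp only: add_divide_distrib times_divide_eq_left)
    qed
    ultimately show ?thesis by (simp only:)
  qed
  have "((\<lambda>\<theta>. (Qc' d k (d * (sin \<theta>)^2) * h (d * (sin \<theta>)^2) + 2 * Qc d k (d * (sin \<theta>)^2) * h' (d * (sin \<theta>)^2))
        / sqrt (k - d * (sin \<theta>)^2)) has_integral
     (Yc d k (pi/2) * h (d * (sin (pi/2))^2) - Yc d k 0 * h (d * (sin 0)^2))) {0..pi/2}"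
    by (rule fundamental_theorem_of_calculus, simp)
       (rule has_vector_derivative_at_within[OF dY[unfolded has_real_derivative_iff_has_vector_derivative]])
  from integral_unique[OF this] show ?thesis unfolding EI_def Yc_ends by simp
qed

text \<open>The exact differential of \<open>Y / (x - V)\<close>. Expanding \<open>Q\<close> about
  \<open>x\<close> in powers of \<open>x - V\<close> reduces the double pole to the simple pole and
  a linear term.\<close>

lemma EI_exact_pole:
  assumes dk: "0 \<le> d" "d < k" and x: "x < 0 \<or> d < x"
  shows "2 * Qc d k x * EI d k (\<lambda>V. 1 / (x - V)^2) - Qc' d k x * EI d k (\<lambda>V. 1 / (x - V))
     + EI d k (\<lambda>V. x - V) = 0"
proof -
  have nz: "x - V \<noteq> 0" if "0 \<le> V" "V \<le> d" for V using that x by auto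
  have "EI d k (\<lambda>V. Qc' d k V * (1 / (x - V)) + 2 * Qc d k V * (1 / (x - V)^2)) = 0"
  proof (rule EI_exact[OF dk])
    fix V :: real assume "0 \<le> V" "V \<le> d"
    from nz[OF this] show "((\<lambda>V. 1 / (x - V)) has_real_derivative 1 / (x - V)^2) (at V)"
      by (auto intro!: derivative_eq_intros simp: power2_eq_square)
  qed
  also have "EI d k (\<lambda>V. Qc' d k V * (1 / (x - V)) + 2 * Qc d k V * (1 / (x - V)^2))
     = EI d k (\<lambda>V. 1 * (2 * Qc d k x * (1 / (x - V)^2) + - Qc' d k x * (1 / (x - V))) + 1 * (x - V))"
  proof (rule EI_cong[OF dk(1)])
    fix V assume "0 \<le> V" "V \<le> d"
    define w where "w = x - V"
    have w: "w \<noteq> 0" "V = x - w" using nz[OF \<open>0 \<le> V\<close> \<open>V \<le> d\<close>] by (auto simp: w_def)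
    have "Qc' d k V * w + 2 * Qc d k V = 2 * Qc d k x - Qc' d k x * w + w^3"
      unfolding w(2) Qc_def Qc'_def by (simp add: power2_eq_square power3_eq_cube algebra_simps)
    then have "(Qc' d k V * w + 2 * Qc d k V) / w^2 = (2 * Qc d k x - Qc' d k x * w + w^3) / w^2" by simp
    then show "Qc' d k V * (1 / (x - V)) + 2 * Qc d k V * (1 / (x - V)^2)
      = 1 * (2 * Qc d k x * (1 / (x - V)^2) + - Qc' d k x * (1 / (x - V))) + 1 * (x - V)"
      unfolding w_def[symmetric] using w(1)
      by (simp add: add_divide_distrib diff_divide_distrib power2_eq_square power3_eq_cube)
  qed
  also have "\<dots> = 1 * EI d k (\<lambda>V. 2 * Qc d k x * (1 / (x - V)^2) + - Qc' d k x * (1 / (x - V))) + 1 * EI d k (\<lambda>V. x - V)"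
    by (rule EI_linear[OF dk]) (intro continuous_intros ballI; use nz in auto)+
  also have "EI d k (\<lambda>V. 2 * Qc d k x * (1 / (x - V)^2) + - Qc' d k x * (1 / (x - V)))
    = 2 * Qc d k x * EI d k (\<lambda>V. 1 / (x - V)^2) + - Qc' d k x * EI d k (\<lambda>V. 1 / (x - V))"
    by (rule EI_linear[OF dk]) (intro continuous_intros ballI; use nz in auto)+
  finally show ?thesis by simp
qed

lemma Qc_at_k: "Qc d k k = 0" "Qc' d k k = k * (k - d)" and Qc'_at_d: "Qc' d k d = d * (d - k)"
  by (simp_all add: Qc_def Qc'_def power2_eq_square algebra_simps)

text \<open>\<open>critm\<close> and \<open>critp\<close> are the zeros of \<open>Qc'\<close>, see
  \<open>Qc'_factor\<close>. For \<open>0 < d < k\<close> the first lies in \<open>(0, d)\<close>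
  and the second in \<open>(d, k)\<close>.\<close>

definition critm :: "real \<Rightarrow> real \<Rightarrow> real" where
  "critm d k = ((d + k) - sqrt (d^2 - d * k + k^2)) / 3"

definition critp :: "real \<Rightarrow> real \<Rightarrow> real" where
  "critp d k = ((d + k) + sqrt (d^2 - d * k + k^2)) / 3"

lemma crit_disc_nonneg: "0 \<le> d^2 - d * k + k^2" for d k :: real
proof -
  have "d^2 - d * k + k^2 = (d - k/2)^2 + 3/4 * k^2" by (simp add: power2_eq_square field_simps)
  then show ?thesis by simp
qed

lemma Qc'_factor: "Qc' d k V = 3 * (V - critm d k) * (V - critp d k)"
proof -
  define s where "s = sqrt (d^2 - d * k + k^2)"
  have s: "s * s = d * d - d * k + k * k" using crit_disc_nonneg[of d k] by (simp add: s_def power2_eq_square)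
  have "3 * (V - critm d k) * (V - critp d k) = (1/3) * ((3 * V - (d + k)) * (3 * V - (d + k)) - s * s)"
    unfolding critm_def critp_def s_def[symmetric] by (simp add: field_simps)
  also have "\<dots> = Qc' d k V" unfolding s Qc'_def by (simp add: power2_eq_square algebra_simps)
  finally show ?thesis by simp
qed

lemma crit_order:
  assumes "0 < d" "d < k"
  shows "0 < critm d k" "critm d k < d" "d < critp d k" "critp d k < k"
proof -
  define s where "s = sqrt (d^2 - d * k + k^2)"
  have a: "d^2 - d * k + k^2 < (d + k)^2" using assms by (simp add: power2_eq_square algebra_simps)
  have b: "(k - 2 * d)^2 < d^2 - d * k + k^2"
    using assms mult_pos_pos[of d "k - d"] by (simp add: power2_eq_square algebra_simps)
  have c: "d^2 - d * k + k^2 < (2 * k - d)^2"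
    using assms mult_pos_pos[of k "k - d"] by (simp add: power2_eq_square algebra_simps)
  have 1: "s < d + k" unfolding s_def using a assms by (intro real_less_lsqrt) auto
  have 2: "\<bar>k - 2 * d\<bar> < s" unfolding s_def using b real_less_rsqrt[of "\<bar>k - 2 * d\<bar>"] by simp
  have 3: "s < 2 * k - d" unfolding s_def using c assms by (intro real_less_lsqrt) auto
  show "0 < critm d k" "critm d k < d" "d < critp d k" "critp d k < k"
    unfolding critm_def critp_def s_def[symmetric] using 1 2 3 by auto
qed

text \<open>\<open>V - critm\<close> changes sign on \<open>[0, d]\<close>, so the second inequality
  is not pointwise. The integral of \<open>Q'\<close> vanishes because it is exact, and
  \<open>Q' = 3 (V - f)^2 - 3 (g - f) (V - f)\<close> with f = \<open>critm\<close>, g =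
  \<open>critp\<close> then trades the linear term for a square.\<close>

lemma EI_crit_pos:
  assumes "0 < d" "d < k"
  shows "0 < EI d k (\<lambda>V. critp d k - V)" "0 < EI d k (\<lambda>V. V - critm d k)"
proof -
  note o = crit_order[OF assms]
  have dk: "0 \<le> d" "d < k" using assms by auto
  show "0 < EI d k (\<lambda>V. critp d k - V)"
    by (rule EI_pos[OF dk]) (use o assms in \<open>auto intro!: continuous_intros\<close>)
  let ?f = "critm d k" and ?g = "critp d k"
  have "EI d k (\<lambda>V. Qc' d k V * 1 + 2 * Qc d k V * 0) = 0"
    by (rule EI_exact[OF dk]) (rule DERIV_const)
  also have "EI d k (\<lambda>V. Qc' d k V * 1 + 2 * Qc d k V * 0)
     = EI d k (\<lambda>V. 3 * (V - ?f)^2 + - (3 * (?g - ?f)) * (V - ?f))"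
    by (rule EI_cong[OF dk(1)]) (simp add: Qc'_factor power2_eq_square algebra_simps)
  also have "\<dots> = 3 * EI d k (\<lambda>V. (V - ?f)^2) + - (3 * (?g - ?f)) * EI d k (\<lambda>V. V - ?f)"
    by (rule EI_linear[OF dk]) (intro continuous_intros)+
  finally have "(?g - ?f) * EI d k (\<lambda>V. V - ?f) = EI d k (\<lambda>V. (V - ?f)^2)" by (simp add: algebra_simps)
  moreover have "0 < EI d k (\<lambda>V. (V - ?f)^2)"
    by (rule EI_pos[OF dk]) (use o in \<open>auto intro!: continuous_intros\<close>)
  ultimately have "0 < (?g - ?f) * EI d k (\<lambda>V. V - ?f)" by simp
  then show "0 < EI d k (\<lambda>V. V - ?f)" using o by (simp add: zero_less_mult_iff)
qed

lemma pole_sign: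
  fixes c d k V :: real
  assumes "c < 0 \<or> d < c" "0 \<le> V" "V \<le> d"
  shows "c - V \<noteq> 0"
  using assms by auto

section \<open>Derivative of a period along a curve of parameters\<close>

lemma ellPi_integrand:
  fixes c d k s :: real
  assumes "0 \<le> d" "d < k" "c < 0 \<or> d < c"
  shows "1 - d / c * (sin \<theta>)^2 = (c - d * (sin \<theta>)^2) / c"
    "sqrt (1 - d / k * (sin \<theta>)^2) = sqrt (k - d * (sin \<theta>)^2) / sqrt k"
    "1 - d / k * (sin \<theta>)^2 = (k - d * (sin \<theta>)^2) / k"
proof -
  have nz: "c \<noteq> 0" "k \<noteq> 0" using assms by auto
  show "1 - d / c * (sin \<theta>)^2 = (c - d * (sin \<theta>)^2) / c" using nz by (simp add: diff_divide_distrib)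
  show *: "1 - d / k * (sin \<theta>)^2 = (k - d * (sin \<theta>)^2) / k" using nz by (simp add: diff_divide_distrib)
  show "sqrt (1 - d / k * (sin \<theta>)^2) = sqrt (k - d * (sin \<theta>)^2) / sqrt k"
    unfolding * by (rule real_sqrt_divide)
qed

lemma ellPi_EI:
  assumes "0 \<le> d" "d < k" "c < 0 \<or> d < c"
  shows "ellPi (d / c) (d / k) = c * sqrt k * EI d k (\<lambda>V. 1 / (c - V))"
proof -
  have "1 / ((1 - d / c * (sin \<theta>)^2) * sqrt (1 - d / k * (sin \<theta>)^2)) =
      c * sqrt k * (1 / (c - d * (sin \<theta>)^2)) / sqrt (k - d * (sin \<theta>)^2)" for \<theta>
    unfolding ellPi_integrand(1,2)[OF assms] by simp
  then show ?thesis
    unfolding ellPi_def EI_cmult[symmetric] by (simp add: EI_def)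
qed

lemma ellPi_dn_EI:
  assumes "0 < d" "d < k" "c < 0 \<or> d < c"
  shows "integral {0..pi/2} (\<lambda>\<theta>. (sin \<theta>)^2 / ((1 - d/c * (sin \<theta>)^2)^2 * sqrt (1 - d/k * (sin \<theta>)^2)))
     = c^2 * sqrt k / d * (c * EI d k (\<lambda>V. 1 / (c - V)^2) - EI d k (\<lambda>V. 1 / (c - V)))"
proof -
  have dk: "0 \<le> d" "d < k" using assms by auto
  have e: "(sin \<theta>)^2 / ((1 - d/c * (sin \<theta>)^2)^2 * sqrt (1 - d/k * (sin \<theta>)^2)) =
     (c^2 * sqrt k / d * (d * (sin \<theta>)^2 / (c - d * (sin \<theta>)^2)^2)) / sqrt (k - d * (sin \<theta>)^2)" for \<theta>
    unfolding ellPi_integrand(1,2)[OF dk assms(3)] using assms(1) by (simp add: power_divide)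
  have "integral {0..pi/2} (\<lambda>\<theta>. (sin \<theta>)^2 / ((1 - d/c * (sin \<theta>)^2)^2 * sqrt (1 - d/k * (sin \<theta>)^2)))
     = c^2 * sqrt k / d * EI d k (\<lambda>V. V / (c - V)^2)"
    unfolding e EI_cmult[symmetric] by (simp only: EI_def)
  also have "EI d k (\<lambda>V. V / (c - V)^2) = EI d k (\<lambda>V. c * (1 / (c - V)^2) + -1 * (1 / (c - V)))"
  proof (rule EI_cong[OF dk(1)])
    fix V assume V: "0 \<le> V" "V \<le> d"
    define w where "w = c - V"
    have w: "w \<noteq> 0" "V = c - w" using pole_sign[OF assms(3) V] by (auto simp: w_def)
    show "V / (c - V)^2 = c * (1 / (c - V)^2) + -1 * (1 / (c - V))"
      unfolding w_def[symmetric] using w by (simp add: power2_eq_square diff_divide_distrib)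
  qed
  also have "\<dots> = c * EI d k (\<lambda>V. 1 / (c - V)^2) + -1 * EI d k (\<lambda>V. 1 / (c - V))"
    by (rule EI_linear[OF dk]) (intro continuous_intros ballI; use pole_sign[OF assms(3)] in auto)+
  finally show ?thesis by simp
qed

lemma period_deriv_identity0:
  fixes x :: real
  shows "d \<noteq> 0 \<Longrightarrow> x / (2 * (a / c) * (b / k) * (D / K)) = (c * k * K / (2 * d) * (d * x / (a * b))) / D"
  by (simp add: mult_ac)

text \<open>The factor \<open>k - c\<close> turns the product of two poles into a difference of
  simple poles by partial fractions.\<close>

lemma ellPi_dm_EI:
  assumes "0 < d" "d < k" "c < 0 \<or> d < c" "c \<noteq> k"
  shows "(k - c) * integral {0..pi/2} (\<lambda>\<theta>. (sin \<theta>)^2 / (2 * (1 - d/c * (sin \<theta>)^2) * (1 - d/k * (sin \<theta>)^2) *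
            sqrt (1 - d/k * (sin \<theta>)^2)))
     = c * k * sqrt k / (2 * d) * (c * EI d k (\<lambda>V. 1 / (c - V)) - k * EI d k (\<lambda>V. 1 / (k - V)))"
proof -
  have dk: "0 \<le> d" "d < k" using assms by auto
  have e: "(sin \<theta>)^2 / (2 * (1 - d/c * (sin \<theta>)^2) * (1 - d/k * (sin \<theta>)^2) * sqrt (1 - d/k * (sin \<theta>)^2)) =
     (c * k * sqrt k / (2 * d) * (d * (sin \<theta>)^2 / ((c - d * (sin \<theta>)^2) * (k - d * (sin \<theta>)^2)))) /
       sqrt (k - d * (sin \<theta>)^2)" for \<theta>
    unfolding ellPi_integrand(2)[OF dk assms(3)]
    unfolding ellPi_integrand(1,3)[OF dk assms(3)] using assms(1) by (intro period_deriv_identity0) simp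
  have 1: "integral {0..pi/2} (\<lambda>\<theta>. (sin \<theta>)^2 / (2 * (1 - d/c * (sin \<theta>)^2) * (1 - d/k * (sin \<theta>)^2) *
            sqrt (1 - d/k * (sin \<theta>)^2)))
     = c * k * sqrt k / (2 * d) * EI d k (\<lambda>V. V / ((c - V) * (k - V)))"
    unfolding e EI_cmult[symmetric] by (simp only: EI_def)
  have "(k - c) * EI d k (\<lambda>V. V / ((c - V) * (k - V))) = EI d k (\<lambda>V. (k - c) * (V / ((c - V) * (k - V))))"
    by (rule EI_cmult[symmetric])
  also have "\<dots> = EI d k (\<lambda>V. c * (1 / (c - V)) + -k * (1 / (k - V)))"
  proof (rule EI_cong[OF dk(1)])
    fix V assume V: "0 \<le> V" "V \<le> d"
    have nz: "c - V \<noteq> 0" "k - V \<noteq> 0" using pole_sign[OF assms(3) V] V dk by auto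
    have "(k - c) * V = c * (k - V) - k * (c - V)" by (simp add: algebra_simps)
    then have "(k - c) * (V / ((c - V) * (k - V))) = (c * (k - V) - k * (c - V)) / ((c - V) * (k - V))" by simp
    also have "\<dots> = c * (1 / (c - V)) + -k * (1 / (k - V))" using nz by (simp add: diff_divide_distrib)
    finally show "(k - c) * (V / ((c - V) * (k - V))) = c * (1 / (c - V)) + -k * (1 / (k - V))" .
  qed
  also have "\<dots> = c * EI d k (\<lambda>V. 1 / (c - V)) + -k * EI d k (\<lambda>V. 1 / (k - V))"
    by (rule EI_linear[OF dk]) (intro continuous_intros ballI; use pole_sign[OF assms(3)] dk in auto)+
  finally have "(k - c) * EI d k (\<lambda>V. V / ((c - V) * (k - V))) =
      c * EI d k (\<lambda>V. 1 / (c - V)) - k * EI d k (\<lambda>V. 1 / (k - V))" by simp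
  then show ?thesis unfolding 1 by (simp only: mult.left_commute[of "k - c"])
qed

lemma period_deriv_identity5:
  fixes J :: real
  shows "d \<noteq> 0 \<Longrightarrow> (J * (d * u) + w / (2 * p)) / d = u * J + w / (2 * d * p)"
  by (simp add: add_divide_distrib)

lemma period_deriv_identity6:
  fixes J :: real
  assumes "I2 = - (q * J - n) / 2"
  shows "- I2 * c' + d' * (c * (k - c) / 2 * J + Z) + k' * (- (c * (c - d) / 2) * (J - K1))
    = (J / 2) * (q * c' - c * (c - k) * d' - c * (c - d) * k') - c' * n / 2 + d' * Z + k' * (c * (c - d) / 2 * K1)"
  unfolding assms by (simp add: algebra_simps add_divide_distrib diff_divide_distrib)

lemma period_deriv_identity7:
  fixes a :: real
  shows "a \<noteq> 0 \<Longrightarrow> b \<noteq> 0 \<Longrightarrow> (Pp * a + Pm * b) / G / (a * b) = (Pp / b + Pm / a) / G"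
  by (simp add: add_divide_distrib mult.commute[of G])

lemma period_deriv_identity9:
  fixes a :: real
  shows "a \<noteq> 0 \<Longrightarrow> b \<noteq> 0 \<Longrightarrow> (Pp * a + Pm * (- b)) / G / (a * b) = (Pp / b - Pm / a) / G"
  by (simp add: diff_divide_distrib mult.commute[of G])

lemma recip_diff:
  fixes a b :: real
  assumes "a \<noteq> 0" "b \<noteq> 0"
  shows "1 / a - 1 / b = - ((a - b) / (a * b))" "1 / a + 1 / b = (a + b) / (a * b)"
  using assms by (simp_all add: diff_divide_distrib add_divide_distrib)

lemma period_deriv_identity1:
  fixes u :: real
  shows "- ((- u * d' + w * k') / (3 * p * q)) * n1 / 2 + d' * (u * n2 / (6 * r * s)) + k' * (w * n3 / (6 * y * z))
   = d' * (u / 6 * (n1 / (p * q) + n2 / (r * s))) + k' * (w / 6 * (n3 / (y * z) - n1 / (p * q)))"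
  by (simp add: algebra_simps add_divide_distrib diff_divide_distrib)

lemma period_deriv_identity2:
  fixes u :: real
  shows "u / 6 * ((Pp / A + Pm / B) / G + (Pp / C - Pm / D) / G)
     = (Pp * (u * (1 / A + 1 / C)) + Pm * (u * (1 / B - 1 / D))) / (6 * G)"
  by (simp add: algebra_simps add_divide_distrib diff_divide_distrib)

lemma period_deriv_identity3:
  fixes u :: real
  shows "u / 6 * ((Pp / A + Pm / B) / G - (Pp / C + Pm / D) / G)
     = (Pp * (u * (1 / A - 1 / C)) + Pm * (u * (1 / B - 1 / D))) / (6 * G)"
  by (simp add: algebra_simps add_divide_distrib diff_divide_distrib)

lemma period_deriv_identity4:
  fixes d' :: real
  shows "d' * ((Pp / (a * b) - Pm / (e * h)) / (6 * G)) + k' * (- (Pp / (y * a) + Pm / (z * e)) / (6 * G))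
   = - (1 / (6 * G)) * (Pp * (k' / y - d' / b) / a + Pm * (d' / h + k' / z) / e)"
  by (simp add: algebra_simps add_divide_distrib diff_divide_distrib)

text \<open>The algebra behind the derivative of the periods. The integral \<open>J\<close> itself drops out
  because the point \<open>c\<close> moves with \<open>Q(c) = -1\<close> (the residue stays constant).\<close>

lemma period_derivative_algebra:
  fixes c d k c' d' k' J I2 K1 N M0 M1 f g :: real
  assumes pos: "0 < d" "d < c" "c < k"
    and fg: "0 < f" "f < d" "d < g" "g < k" "c \<noteq> g"
    and fac: "\<And>V. Qc' d k V = 3 * (V - f) * (V - g)"
    and con: "c * (k - c) * (c - d) = 1"
    and lin: "Qc' d k c * c' = c * (c - k) * d' + c * (c - d) * k'"
    and N: "(k - c) * N = c * J - k * K1"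
    and K1: "k * (k - d) * K1 = k * M0 - M1"
    and I2: "- 2 * I2 = Qc' d k c * J - (c * M0 - M1)"
  shows "(c * I2 - J) * (d'/d - c'/c) + (N / 2) * (d'/d - k'/k) - J * (c'/c + k'/(2*k)) =
     - (1 / (6 * (g - f))) * ((g * M0 - M1) * (k'/(k - g) - d'/(g - d)) / (c - g)
        + (M1 - f * M0) * (d'/(d - f) + k'/(k - f)) / (c - f))"
proof -
  define Pp Pm where "Pp = g * M0 - M1" and "Pm = M1 - f * M0"
  have gf: "g - f \<noteq> 0" using fg by simp
  \<comment> \<open>A linear function of \<open>x\<close> is interpolated at \<open>f\<close> and
    \<open>g\<close>. Its values there are \<open>- Pm\<close> and \<open>Pp\<close>, the two
    integrals whose sign \<open>EI_crit_pos\<close> provides.\<close>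
  have lineN: "x * M0 - M1 = (Pp * (x - f) + Pm * (x - g)) / (g - f)" for x
  proof -
    have "Pp * (x - f) + Pm * (x - g) = (g - f) * (x * M0 - M1)"
      by (simp add: Pp_def Pm_def algebra_simps)
    then show ?thesis using gf by simp
  qed
  have nz: "c \<noteq> 0" "d \<noteq> 0" "k \<noteq> 0" "k - c \<noteq> 0" "c - d \<noteq> 0" "k - d \<noteq> 0" "c - f \<noteq> 0" "c - g \<noteq> 0"
    "d - f \<noteq> 0" "g - d \<noteq> 0" "k - f \<noteq> 0" "k - g \<noteq> 0" using pos fg by auto
  have Ns: "N = c * (c - d) * (c * J - k * K1)"
  proof -
    have "c * (c - d) * (c * J - k * K1) = (c * (k - c) * (c - d)) * N" unfolding N[symmetric] by (simp add: algebra_simps)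
    then show ?thesis using con by simp
  qed
  have K1s: "K1 = (k * M0 - M1) / (k * (k - d))" using K1 nz by (simp add: field_simps)
  have I2s: "I2 = - (Qc' d k c * J - (c * M0 - M1)) / 2" using I2 by simp
  have eqk: "- (N + J) / (2 * k) = - (c * (c - d) / 2) * (J - K1)"
  proof -
    \<comment> \<open>\<open>J\<close> is multiplied by the constraint, which equals 1, to bring out
      the factor \<open>c (c - d)\<close>.\<close>
    have "N + J = N + (c * (k - c) * (c - d)) * J" using con by simp
    also have "\<dots> = c * (c - d) * k * (J - K1)" unfolding Ns by (simp add: algebra_simps)
    finally show ?thesis using nz by simp
  qed
  have eqd: "(c * I2 - J + N / 2) / d = c * (k - c) / 2 * J + c * (k - c) * (d * M0 - M1) / (2 * d * (k - d))"
  proof -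
    have a: "c * I2 - J + N / 2 = J * (- c / 2 * Qc' d k c - c * (k - c) * (c - d) + c * c * (c - d) / 2)
        + (c / 2 * (c * M0 - M1) - c * (c - d) * k * K1 / 2)"
      unfolding Ns I2s con by (simp add: algebra_simps add_divide_distrib diff_divide_distrib)
    have b: "- c / 2 * Qc' d k c - c * (k - c) * (c - d) + c * c * (c - d) / 2 = d * (c * (k - c) / 2)"
      unfolding Qc'_def by (simp add: power2_eq_square field_simps)
    have e: "k * K1 = (k * M0 - M1) / (k - d)" unfolding K1s using nz by simp
    have "c / 2 * (c * M0 - M1) - c * (c - d) * k * K1 / 2 =
       c / 2 * (((k - d) * (c * M0 - M1) - (c - d) * (k * M0 - M1)) / (k - d))"
      unfolding mult.assoc[of _ k K1] e using nz by (simp add: field_simps)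
    also have "(k - d) * (c * M0 - M1) - (c - d) * (k * M0 - M1) = (k - c) * (d * M0 - M1)"
      by (simp add: algebra_simps)
    finally have c2: "c / 2 * (c * M0 - M1) - c * (c - d) * k * K1 / 2 = c * (k - c) * (d * M0 - M1) / (2 * (k - d))"
      by simp
    show ?thesis unfolding a b c2 by (rule period_deriv_identity5[OF nz(2)])
  qed
  have "(c * I2 - J) * (d'/d - c'/c) + (N / 2) * (d'/d - k'/k) - J * (c'/c + k'/(2*k))
      = - I2 * c' + d' * ((c * I2 - J + N / 2) / d) + k' * (- (N + J) / (2 * k))"
    using nz(1) by (simp add: algebra_simps add_divide_distrib diff_divide_distrib)
  \<comment> \<open>The coefficient of \<open>J\<close> is exactly the differentiated constraint
    \<open>lin\<close>, so the integral of the third kind disappears.\<close>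
  also have "\<dots> = (J / 2) * (Qc' d k c * c' - c * (c - k) * d' - c * (c - d) * k') - c' * (c * M0 - M1) / 2
     + d' * (c * (k - c) * (d * M0 - M1) / (2 * d * (k - d))) + k' * (c * (c - d) / 2 * K1)"
    unfolding eqk eqd by (rule period_deriv_identity6[OF I2s])
  also have "\<dots> = - c' * (c * M0 - M1) / 2
     + d' * (c * (k - c) * (d * M0 - M1) / (2 * d * (k - d))) + k' * (c * (c - d) * (k * M0 - M1) / (2 * k * (k - d)))"
    unfolding lin K1s by simp
  finally have step: "(c * I2 - J) * (d'/d - c'/c) + (N / 2) * (d'/d - k'/k) - J * (c'/c + k'/(2*k)) =
     - c' * (c * M0 - M1) / 2
     + d' * (c * (k - c) * (d * M0 - M1) / (2 * d * (k - d))) + k' * (c * (c - d) * (k * M0 - M1) / (2 * k * (k - d)))" .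
  have cs: "c' = (- c * (k - c) * d' + c * (c - d) * k') / (3 * (c - f) * (c - g))"
  proof -
    have "3 * (c - f) * (c - g) * c' = - c * (k - c) * d' + c * (c - d) * k'"
      using lin unfolding fac by (simp add: algebra_simps)
    moreover have "3 * (c - f) * (c - g) \<noteq> 0" using nz by simp
    ultimately show ?thesis by (metis nonzero_mult_div_cancel_left)
  qed
  \<comment> \<open>\<open>Q'\<close> at \<open>d\<close> and at \<open>k\<close>, each evaluated
    once directly and once in factored form.\<close>
  have dd: "2 * d * (k - d) = 6 * (d - f) * (g - d)"
    using fac[of d] unfolding Qc'_at_d by (simp add: algebra_simps)
  have kk: "2 * k * (k - d) = 6 * (k - f) * (k - g)"
    using fac[of k] unfolding Qc_at_k by (simp add: algebra_simps)
  have "- c' * (c * M0 - M1) / 2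
     + d' * (c * (k - c) * (d * M0 - M1) / (2 * d * (k - d))) + k' * (c * (c - d) * (k * M0 - M1) / (2 * k * (k - d)))
    = d' * (c * (k - c) / 6 * ((c * M0 - M1) / ((c - f) * (c - g)) + (d * M0 - M1) / ((d - f) * (g - d))))
     + k' * (c * (c - d) / 6 * ((k * M0 - M1) / ((k - f) * (k - g)) - (c * M0 - M1) / ((c - f) * (c - g))))"
    unfolding cs dd kk using period_deriv_identity1[of "c * (k - c)" d' "c * (c - d)" k' "c - f" "c - g" "c * M0 - M1" "d * M0 - M1" "d - f" "g - d"
      "k * M0 - M1" "k - f" "k - g"] by (simp only: mult_minus_left)
  then have main: "(c * I2 - J) * (d'/d - c'/c) + (N / 2) * (d'/d - k'/k) - J * (c'/c + k'/(2*k)) =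
     d' * (c * (k - c) / 6 * ((c * M0 - M1) / ((c - f) * (c - g)) + (d * M0 - M1) / ((d - f) * (g - d))))
     + k' * (c * (c - d) / 6 * ((k * M0 - M1) / ((k - f) * (k - g)) - (c * M0 - M1) / ((c - f) * (c - g))))"
    unfolding step .
  have pf: "(x * M0 - M1) / ((x - f) * (x - g)) = (Pp / (x - g) + Pm / (x - f)) / (g - f)"
    if "x - f \<noteq> 0" "x - g \<noteq> 0" for x
    unfolding lineN by (rule period_deriv_identity7[OF that])
  have pfd: "(d * M0 - M1) / ((d - f) * (g - d)) = (Pp / (g - d) - Pm / (d - f)) / (g - f)"
  proof -
    have dg: "d - g = - (g - d)" by simp
    show ?thesis unfolding lineN dg by (rule period_deriv_identity9[OF nz(9,10)])
  qed
  \<comment> \<open>In each of \<open>p1\<close> to \<open>p4\<close> combining the two poles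
    produces the missing factor of the constraint \<open>con\<close>, and the numerator collapses to
    1 up to sign.\<close>
  have p1: "c * (k - c) * (1 / (c - g) + 1 / (g - d)) = 1 / ((c - g) * (g - d))"
  proof -
    have "1 / (c - g) + 1 / (g - d) = (c - d) / ((c - g) * (g - d))"
      using recip_diff(2)[OF nz(8,10)] by simp
    then show ?thesis using con by (simp add: mult.assoc[symmetric])
  qed
  have p2: "c * (k - c) * (1 / (c - f) - 1 / (d - f)) = - (1 / ((c - f) * (d - f)))"
  proof -
    have "1 / (c - f) - 1 / (d - f) = - ((c - d) / ((c - f) * (d - f)))"
      using recip_diff(1)[OF nz(7,9)] by simp
    then show ?thesis using con by (simp add: mult.assoc[symmetric])
  qed
  have con': "c * (c - d) * (k - c) = 1" using con by (simp add: mult_ac)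
  have p3: "c * (c - d) * (1 / (k - g) - 1 / (c - g)) = - (1 / ((k - g) * (c - g)))"
  proof -
    have "1 / (k - g) - 1 / (c - g) = - ((k - c) / ((k - g) * (c - g)))"
      using recip_diff(1)[OF nz(12,8)] by simp
    then show ?thesis using con' by (simp add: mult.assoc[symmetric])
  qed
  have p4: "c * (c - d) * (1 / (k - f) - 1 / (c - f)) = - (1 / ((k - f) * (c - f)))"
  proof -
    have "1 / (k - f) - 1 / (c - f) = - ((k - c) / ((k - f) * (c - f)))"
      using recip_diff(1)[OF nz(11,7)] by simp
    then show ?thesis using con' by (simp add: mult.assoc[symmetric])
  qed
  have "c * (k - c) / 6 * ((c * M0 - M1) / ((c - f) * (c - g)) + (d * M0 - M1) / ((d - f) * (g - d)))
     = (Pp * (c * (k - c) * (1 / (c - g) + 1 / (g - d))) + Pm * (c * (k - c) * (1 / (c - f) - 1 / (d - f)))) / (6 * (g - f))"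
    unfolding pf[OF nz(7,8)] pfd by (rule period_deriv_identity2)
  also have "\<dots> = (Pp / ((c - g) * (g - d)) - Pm / ((c - f) * (d - f))) / (6 * (g - f))"
    unfolding p1 p2 by simp
  finally have q1: "c * (k - c) / 6 * ((c * M0 - M1) / ((c - f) * (c - g)) + (d * M0 - M1) / ((d - f) * (g - d)))
     = (Pp / ((c - g) * (g - d)) - Pm / ((c - f) * (d - f))) / (6 * (g - f))" .
  have "c * (c - d) / 6 * ((k * M0 - M1) / ((k - f) * (k - g)) - (c * M0 - M1) / ((c - f) * (c - g)))
     = (Pp * (c * (c - d) * (1 / (k - g) - 1 / (c - g))) + Pm * (c * (c - d) * (1 / (k - f) - 1 / (c - f)))) / (6 * (g - f))"
    unfolding pf[OF nz(7,8)] pf[OF nz(11,12)] by (rule period_deriv_identity3)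
  also have "\<dots> = - (Pp / ((k - g) * (c - g)) + Pm / ((k - f) * (c - f))) / (6 * (g - f))"
    unfolding p3 p4 by simp
  finally have q2: "c * (c - d) / 6 * ((k * M0 - M1) / ((k - f) * (k - g)) - (c * M0 - M1) / ((c - f) * (c - g)))
     = - (Pp / ((k - g) * (c - g)) + Pm / ((k - f) * (c - f))) / (6 * (g - f))" .
  show ?thesis unfolding main q1 q2 Pp_def[symmetric] Pm_def[symmetric]
    by (rule period_deriv_identity4)
qed

lemma period_deriv_identity8:
  fixes c d w :: real
  assumes "c \<noteq> 0" "d \<noteq> 0" "w \<noteq> 0"
  shows "(((c^2 * w / d * X) * ((d' * c - d * c') / (c * c)) + (c * w^2 * w / (2 * d) * N) * ((d' * w^2 - d * k') / (w^2 * w^2))) * (c * w)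
     - c * w * J * (c' * w + c * (k' * (inverse w / 2)))) / ((c * w) * (c * w))
   = X * (d'/d - c'/c) + (N / 2) * (d'/d - k'/w^2) - J * (c'/c + k'/(2 * w^2))"
  using assms by (simp add: field_simps power2_eq_square)

lemma deriv_along_path:
  fixes f :: "real \<times> real \<Rightarrow> real"
  assumes f: "(f has_derivative (\<lambda>h. A * fst h + B * snd h)) (at (n t, m t))"
    and n: "(n has_real_derivative n') (at t)" and m: "(m has_real_derivative m') (at t)"
  shows "((\<lambda>s. f (n s, m s)) has_real_derivative A * n' + B * m') (at t)"
proof -
  have "((\<lambda>s. (n s, m s)) has_derivative (\<lambda>h. (n' * h, m' * h))) (at t)"
    using n m unfolding has_field_derivative_def by (rule has_derivative_Pair)
  from has_derivative_compose[OF this f]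
  have "((\<lambda>s. f (n s, m s)) has_derivative (\<lambda>h. A * (n' * h) + B * (m' * h))) (at t)" by simp
  moreover have "(\<lambda>h. A * (n' * h) + B * (m' * h)) = (\<lambda>h. (A * n' + B * m') * h)"
    by (simp add: fun_eq_iff algebra_simps)
  ultimately show ?thesis unfolding has_field_derivative_def by simp
qed

text \<open>Differentiability comes from \<open>ellPi\<close> as a function of
  \<open>n = d/c\<close> and \<open>m = d/k\<close>, the value of the derivative from
  \<open>period_derivative_algebra\<close>. The result involves \<open>d'\<close> and
  \<open>k'\<close> only through the logarithmic derivatives of the two critical values, see
  \<open>Acr_Bcr_deriv\<close>.\<close>

lemma period_deriv:
  fixes c d k :: "real \<Rightarrow> real"
  assumes D: "(c has_real_derivative c') (at t)" "(d has_real_derivative d') (at t)" "(k has_real_derivative k') (at t)"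
    and o: "0 < d t" "d t < c t" "c t < k t" "c t \<noteq> critp (d t) (k t)"
    and con: "\<forall>\<^sub>F s in nhds t. c s * (k s - c s) * (c s - d s) = 1"
  shows "((\<lambda>s. EI (d s) (k s) (\<lambda>V. 1 / (c s - V))) has_real_derivative
    - (1 / (6 * (critp (d t) (k t) - critm (d t) (k t)))) *
      (EI (d t) (k t) (\<lambda>V. critp (d t) (k t) - V) *
          (k'/(k t - critp (d t) (k t)) - d'/(critp (d t) (k t) - d t)) / (c t - critp (d t) (k t))
        + EI (d t) (k t) (\<lambda>V. V - critm (d t) (k t)) *
          (d'/(d t - critm (d t) (k t)) + k'/(k t - critm (d t) (k t))) / (c t - critm (d t) (k t)))) (at t)"
proof -
  define C E K where "C = c t" and "E = d t" and "K = k t"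
  have o': "0 < E" "E < C" "C < K" "C \<noteq> critp E K" "0 \<le> E" "E < K" "C < 0 \<or> E < C"
    using o by (auto simp: C_def E_def K_def)
  define w where "w = sqrt K"
  have w: "w \<noteq> 0" "w^2 = K" "0 < w" using o' by (auto simp: w_def)
  define J where "J = EI E K (\<lambda>V. 1 / (C - V))"
  define I2 where "I2 = EI E K (\<lambda>V. 1 / (C - V)^2)"
  define K1 where "K1 = EI E K (\<lambda>V. 1 / (K - V))"
  define M0 where "M0 = EI E K (\<lambda>_. 1)"
  define M1 where "M1 = EI E K (\<lambda>V. V)"
  define N where "N = (C * J - K * K1) / (K - C)"
  have con0: "C * (K - C) * (C - E) = 1"
    using eventually_nhds_x_imp_x[OF con] by (simp add: C_def E_def K_def)
  have lin: "Qc' E K C * c' = C * (C - K) * d' + C * (C - E) * k'"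
  proof -
    have "((\<lambda>s. c s * (k s - c s) * (c s - d s)) has_real_derivative
        (c' * (K - C) + (k' - c') * C) * (C - E) + (c' - d') * (C * (K - C))) (at t)"
      unfolding C_def E_def K_def
      by (rule DERIV_mult[OF DERIV_mult[OF D(1) DERIV_diff[OF D(3) D(1)]] DERIV_diff[OF D(1) D(2)]])
    moreover have "((\<lambda>s. c s * (k s - c s) * (c s - d s)) has_real_derivative 0) (at t)"
      using DERIV_cong_ev[OF refl con refl, of 0] by simp
    ultimately have "(c' * (K - C) + (k' - c') * C) * (C - E) + (c' - d') * (C * (K - C)) = 0"
      by (rule DERIV_unique)
    then show ?thesis unfolding Qc'_def by (simp add: power2_eq_square algebra_simps)
  qed
  have Nk: "(K - C) * N = C * J - K * K1" using o' by (simp add: N_def)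
  \<comment> \<open>At \<open>x = k\<close> the cubic vanishes, which removes the double pole from
    \<open>EI_exact_pole\<close>.\<close>
  have K1: "K * (K - E) * K1 = K * M0 - M1"
  proof -
    have "E < K" "K < 0 \<or> E < K" using o' by auto
    from EI_exact_pole[OF o'(5) this] show ?thesis
      unfolding Qc_at_k EI_affine[OF o'(5,6)] K1_def M0_def M1_def by simp
  qed
  have Qm: "Qc E K C = -1" unfolding Qc_def using con0 by (simp add: algebra_simps)
  have I2: "- 2 * I2 = Qc' E K C * J - (C * M0 - M1)"
    using EI_exact_pole[OF o'(5,6,7)]
    unfolding Qm EI_affine[OF o'(5,6)] I2_def J_def M0_def M1_def by simp
  have alg: "(C * I2 - J) * (d'/E - c'/C) + (N / 2) * (d'/E - k'/K) - J * (c'/C + k'/(2*K)) =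
     - (1 / (6 * (critp E K - critm E K))) * ((critp E K * M0 - M1) * (k'/(K - critp E K) - d'/(critp E K - E)) / (C - critp E K)
        + (M1 - critm E K * M0) * (d'/(E - critm E K) + k'/(K - critm E K)) / (C - critm E K))"
    by (rule period_derivative_algebra[OF o'(1,2,3) crit_order[OF o'(1,6)] o'(4) Qc'_factor con0 lin Nk K1 I2])
  let ?A = "integral {0..pi/2} (\<lambda>\<theta>. (sin \<theta>)^2 / ((1 - E/C * (sin \<theta>)^2)^2 * sqrt (1 - E/K * (sin \<theta>)^2)))"
  let ?B = "integral {0..pi/2} (\<lambda>\<theta>. (sin \<theta>)^2 / (2 * (1 - E/C * (sin \<theta>)^2) * (1 - E/K * (sin \<theta>)^2) *
            sqrt (1 - E/K * (sin \<theta>)^2)))"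
  have A: "?A = C^2 * w / E * (C * I2 - J)"
    unfolding ellPi_dn_EI[OF o'(1,6,7)] w_def I2_def J_def by simp
  have B: "?B = C * w^2 * w / (2 * E) * N"
  proof -
    have "(K - C) * ?B = C * K * w / (2 * E) * ((K - C) * N)"
      unfolding Nk w_def J_def K1_def by (rule ellPi_dm_EI[OF o'(1,6,7)]) (use o' in simp)
    then have "(K - C) * ?B = (K - C) * (C * K * w / (2 * E) * N)" by (simp only: mult.left_commute)
    then have "?B = C * K * w / (2 * E) * N" by (rule mult_left_cancel[THEN iffD1, rotated]) (use o' in simp)
    then show ?thesis unfolding w(2) .
  qed
  have dn: "((\<lambda>s. d s / c s) has_real_derivative (d' * C - E * c') / (C * C)) (at t)"
    using DERIV_divide[OF D(2) D(1)] o' by (simp add: C_def E_def)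
  have dm: "((\<lambda>s. d s / k s) has_real_derivative (d' * w^2 - E * k') / (w^2 * w^2)) (at t)"
    using DERIV_divide[OF D(2) D(3)] o' unfolding w(2) by (simp add: K_def E_def)
  have nm: "E / C < 1" "E / K < 1" using o' by auto
  have dP: "((\<lambda>s. ellPi (d s / c s) (d s / k s)) has_real_derivative
     ?A * ((d' * C - E * c') / (C * C)) + ?B * ((d' * w^2 - E * k') / (w^2 * w^2))) (at t)"
  proof -
    have "(d t / c t, d t / k t) = (E / C, E / K)" by (simp add: C_def E_def K_def)
    then have "((\<lambda>p. ellPi (fst p) (snd p)) has_derivative (\<lambda>h. ?A * fst h + ?B * snd h)) (at (d t / c t, d t / k t))"
      using ellPi_has_derivative[OF nm] by (simp only:)
    from deriv_along_path[OF this dn dm] show ?thesis by (simp only: fst_conv snd_conv)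
  qed
  have dsq: "((\<lambda>s. sqrt (k s)) has_real_derivative k' * (inverse w / 2)) (at t)"
    using DERIV_chain2[OF DERIV_real_sqrt D(3)] o' by (simp add: w_def K_def mult.commute)
  have nzCE: "C \<noteq> 0" "E \<noteq> 0" using o' by auto
  have Cw: "C * w \<noteq> 0" using nzCE w(1) by simp
  have cw: "c t * sqrt (k t) = C * w" by (simp add: C_def w_def K_def)
  have dcw: "((\<lambda>s. c s * sqrt (k s)) has_real_derivative c' * w + C * (k' * (inverse w / 2))) (at t)"
    by (rule DERIV_cong[OF DERIV_mult[OF D(1) dsq]]) (simp only: w_def K_def C_def mult.commute)
  have PP: "ellPi (d t / c t) (d t / k t) = C * w * J"
    unfolding C_def[symmetric] E_def[symmetric] K_def[symmetric] w_def J_def by (rule ellPi_EI[OF o'(5,6,7)])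
  have "((\<lambda>s. ellPi (d s / c s) (d s / k s) / (c s * sqrt (k s))) has_real_derivative
     ((?A * ((d' * C - E * c') / (C * C)) + ?B * ((d' * w^2 - E * k') / (w^2 * w^2))) * (C * w)
       - C * w * J * (c' * w + C * (k' * (inverse w / 2)))) / ((C * w) * (C * w))) (at t)"
    using DERIV_divide[OF dP dcw, unfolded PP cw, OF Cw] .
  then have fin: "((\<lambda>s. ellPi (d s / c s) (d s / k s) / (c s * sqrt (k s))) has_real_derivative
     (C * I2 - J) * (d'/E - c'/C) + (N / 2) * (d'/E - k'/w^2) - J * (c'/C + k'/(2 * w^2))) (at t)"
    unfolding A B period_deriv_identity8[OF nzCE w(1)] .
  have cts: "isCont c t" "isCont d t" "isCont k t" using D DERIV_isCont by blast+
  have e1: "\<forall>\<^sub>F s in nhds t. 0 < d s"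
    using order_tendstoD(1)[OF cts(2)[unfolded isCont_def, THEN tendsto_at_iff_tendsto_nhds[THEN iffD1]] o(1)] .
  have e2: "\<forall>\<^sub>F s in nhds t. 0 < c s - d s"
    by (rule order_tendstoD(1)[OF tendsto_at_iff_tendsto_nhds[THEN iffD1, OF isCont_diff[OF cts(1,2), unfolded isCont_def]]])
      (use o(2) in simp)
  have e3: "\<forall>\<^sub>F s in nhds t. 0 < k s - c s"
    by (rule order_tendstoD(1)[OF tendsto_at_iff_tendsto_nhds[THEN iffD1, OF isCont_diff[OF cts(3,1), unfolded isCont_def]]])
      (use o(3) in simp)
  have "\<forall>\<^sub>F s in nhds t. ellPi (d s / c s) (d s / k s) / (c s * sqrt (k s)) = EI (d s) (k s) (\<lambda>V. 1 / (c s - V))"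
    using e1 e2 e3
  proof eventually_elim
    case (elim s)
    then have "0 \<le> d s" "d s < k s" "c s < 0 \<or> d s < c s" "c s \<noteq> 0" "0 < k s" by auto
    then show ?case by (simp add: ellPi_EI)
  qed
  from DERIV_cong_ev[OF refl this refl] fin
  have "((\<lambda>s. EI (d s) (k s) (\<lambda>V. 1 / (c s - V))) has_real_derivative
     (C * I2 - J) * (d'/E - c'/C) + (N / 2) * (d'/E - k'/w^2) - J * (c'/C + k'/(2 * w^2))) (at t)" by blast
  moreover have "EI E K (\<lambda>V. critp E K - V) = critp E K * M0 - M1"
    unfolding M0_def M1_def by (rule EI_affine[OF o'(5,6)])
  moreover have "EI E K (\<lambda>V. V - critm E K) = M1 - critm E K * M0"
    using EI_linear[OF o'(5,6) continuous_on_const continuous_on_id, of "- critm E K" 1 1]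
    unfolding M0_def M1_def by simp
  ultimately show ?thesis
    unfolding w(2) alg C_def[symmetric] E_def[symmetric] K_def[symmetric] by simp
qed

section \<open>Critical values of the cubic\<close>

definition Acr :: "real \<Rightarrow> real \<Rightarrow> real" where "Acr d k = - Qc d k (critp d k)"
definition Bcr :: "real \<Rightarrow> real \<Rightarrow> real" where "Bcr d k = Qc d k (critm d k)"

text \<open>At a critical point the motion of the point itself drops out, so the critical value
  varies only through the explicit dependence of \<open>Q\<close> on \<open>d\<close> and
  \<open>k\<close>.\<close>

lemma Qc_crit_deriv:
  assumes D: "(g has_real_derivative g') (at t)" "(d has_real_derivative d') (at t)" "(k has_real_derivative k') (at t)"
    and crit: "Qc' (d t) (k t) (g t) = 0" and nz: "g t \<noteq> d t" "g t \<noteq> k t"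
  shows "((\<lambda>s. Qc (d s) (k s) (g s)) has_real_derivative
     Qc (d t) (k t) (g t) * (- d' / (g t - d t) - k' / (g t - k t))) (at t)"
proof -
  have "((\<lambda>s. Qc (d s) (k s) (g s)) has_real_derivative
     (g' * (g t - d t) + (g' - d') * g t) * (g t - k t) + (g' - k') * (g t * (g t - d t))) (at t)"
    unfolding Qc_def
    by (rule DERIV_mult[OF DERIV_mult[OF D(1) DERIV_diff[OF D(1) D(2)]] DERIV_diff[OF D(1) D(3)]])
  moreover have "(g' * (g t - d t) + (g' - d') * g t) * (g t - k t) + (g' - k') * (g t * (g t - d t))
     = g' * Qc' (d t) (k t) (g t) - d' * g t * (g t - k t) - k' * g t * (g t - d t)"
    unfolding Qc'_def by (simp add: power2_eq_square algebra_simps)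
  moreover have "Qc (d t) (k t) (g t) * (- d' / (g t - d t) - k' / (g t - k t))
     = - d' * g t * (g t - k t) - k' * g t * (g t - d t)"
  proof -
    define u v where "u = g t - d t" and "v = g t - k t"
    have "u \<noteq> 0" "v \<noteq> 0" using nz by (auto simp: u_def v_def)
    then show ?thesis unfolding Qc_def u_def[symmetric] v_def[symmetric] by (simp add: field_simps)
  qed
  ultimately show ?thesis using crit by simp
qed

lemma crit_differentiable:
  assumes D: "(d has_real_derivative d') (at t)" "(k has_real_derivative k') (at t)" and p: "0 < d t" "d t < k t"
  shows "\<exists>g'. ((\<lambda>s. critp (d s) (k s)) has_real_derivative g') (at t)"
    "\<exists>g'. ((\<lambda>s. critm (d s) (k s)) has_real_derivative g') (at t)"
proof -
  have pos: "0 < (d t)^2 - d t * k t + (k t)^2"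
  proof -
    have "(d t)^2 - d t * k t + (k t)^2 = (k t - d t) * (k t - d t) + d t * k t" by (simp add: power2_eq_square algebra_simps)
    moreover have "0 < (k t - d t) * (k t - d t) + d t * k t" using p by (intro add_nonneg_pos) auto
    ultimately show ?thesis by (simp only:)
  qed
  have "((\<lambda>s. (d s)^2 - d s * k s + (k s)^2) has_real_derivative
      (2 * d t * d' - (d' * k t + k' * d t) + 2 * k t * k')) (at t)"
    using D by (auto intro!: derivative_eq_intros)
  from DERIV_chain2[OF DERIV_real_sqrt[OF pos] this]
  obtain s' where s': "((\<lambda>s. sqrt ((d s)^2 - d s * k s + (k s)^2)) has_real_derivative s') (at t)" by blast
  show "\<exists>g'. ((\<lambda>s. critp (d s) (k s)) has_real_derivative g') (at t)"
    unfolding critp_def by (rule exI, rule DERIV_cdivide[OF DERIV_add[OF DERIV_add[OF D] s']])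
  show "\<exists>g'. ((\<lambda>s. critm (d s) (k s)) has_real_derivative g') (at t)"
    unfolding critm_def by (rule exI, rule DERIV_cdivide[OF DERIV_diff[OF DERIV_add[OF D] s']])
qed

lemma Acr_Bcr_deriv:
  assumes D: "(d has_real_derivative d') (at t)" "(k has_real_derivative k') (at t)" and p: "0 < d t" "d t < k t"
  shows "((\<lambda>s. Acr (d s) (k s)) has_real_derivative
      Acr (d t) (k t) * (k' / (k t - critp (d t) (k t)) - d' / (critp (d t) (k t) - d t))) (at t)"
    "((\<lambda>s. Bcr (d s) (k s)) has_real_derivative
      Bcr (d t) (k t) * (d' / (d t - critm (d t) (k t)) + k' / (k t - critm (d t) (k t)))) (at t)"
proof -
  obtain g' f' where gf: "((\<lambda>s. critp (d s) (k s)) has_real_derivative g') (at t)"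
    "((\<lambda>s. critm (d s) (k s)) has_real_derivative f') (at t)"
    using crit_differentiable[OF D p] by blast
  note o = crit_order[OF p]
  have flip: "x / (a - b) = - (x / (b - a))" for x a b :: real
    by (metis minus_diff_eq minus_divide_right)
  show "((\<lambda>s. Acr (d s) (k s)) has_real_derivative
      Acr (d t) (k t) * (k' / (k t - critp (d t) (k t)) - d' / (critp (d t) (k t) - d t))) (at t)"
    unfolding Acr_def
    using DERIV_minus[OF Qc_crit_deriv[OF gf(1) D]] o flip[of k' "k t" "critp (d t) (k t)"] by (simp add: Qc'_factor algebra_simps)
  show "((\<lambda>s. Bcr (d s) (k s)) has_real_derivative
      Bcr (d t) (k t) * (d' / (d t - critm (d t) (k t)) + k' / (k t - critm (d t) (k t)))) (at t)"
    unfolding Bcr_def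
    using Qc_crit_deriv[OF gf(2) D] o flip[of k' "k t" "critm (d t) (k t)"] flip[of d' "d t" "critm (d t) (k t)"]
    by (simp add: Qc'_factor algebra_simps)
qed

lemma Acr_Bcr_pos:
  assumes "0 < d" "d < k" shows "0 < Acr d k" "0 < Bcr d k"
proof -
  note o = crit_order[OF assms]
  have "Acr d k = critp d k * (critp d k - d) * (k - critp d k)" by (simp add: Acr_def Qc_def algebra_simps)
  then show "0 < Acr d k" using o assms by simp
  have "Bcr d k = critm d k * (d - critm d k) * (k - critm d k)" by (simp add: Bcr_def Qc_def algebra_simps)
  then show "0 < Bcr d k" using o assms by simp
qed

section \<open>The period map in the coordinates \<open>d = m l\<^sup>2\<close>, \<open>k = l\<^sup>2\<close>\<close>

text \<open>Trigonometric solution of the cubic. Centred at \<open>(d + k)/3\<close>,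
  \<open>Q(V) + 1\<close> becomes \<open>x^3 - 3 rr^2 x + qq + 1\<close>, and the substitution
  \<open>x = -2 rr sin\<close> reduces its vanishing to the triple-angle formula for the sine. Up to
  the factor \<open>l^2\<close> these are the \<open>\<sigma>\<close>, \<open>p_tilde\<close> and
  \<open>\<alpha>\<close> of the theorem.\<close>

definition rr :: "real \<Rightarrow> real \<Rightarrow> real" where "rr d k = sqrt (d^2 - d * k + k^2) / 3"
definition qq :: "real \<Rightarrow> real \<Rightarrow> real" where "qq d k = (2*k - d) * (2*d - k) * (d + k) / 27"
definition pp :: "real \<Rightarrow> real \<Rightarrow> real" where "pp d k = - (qq d k + 1) / (2 * rr d k ^ 3)"
definition al :: "real \<Rightarrow> real \<Rightarrow> real" where "al d k = arcsin (pp d k) / 3"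
definition c2 :: "real \<Rightarrow> real \<Rightarrow> real" where "c2 d k = (d + k)/3 - 2 * rr d k * sin (al d k)"
definition c3 :: "real \<Rightarrow> real \<Rightarrow> real" where
  "c3 d k = (d + k)/3 + rr d k * (sin (al d k) + sqrt 3 * cos (al d k))"

lemma critp_rr: "critp d k = (d + k)/3 + rr d k" and critm_rr: "critm d k = (d + k)/3 - rr d k"
  by (simp_all add: critp_def critm_def rr_def add_divide_distrib diff_divide_distrib)

lemma rr_sq: "9 * (rr d k * rr d k) = d * d - d * k + k * k"
  using crit_disc_nonneg[of d k] by (simp add: rr_def power2_eq_square)

lemma rr_pos:
  assumes "0 \<le> d" "d < k" shows "0 < rr d k"
proof -
  have "d^2 - d * k + k^2 = (k - d) * (k - d) + d * k" by (simp add: power2_eq_square algebra_simps)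
  moreover have "0 < (k - d) * (k - d) + d * k" using assms by (intro add_pos_nonneg) auto
  ultimately have "0 < d^2 - d * k + k^2" by (simp only:)
  then show ?thesis by (simp add: rr_def)
qed

lemma Qc_shift: "Qc d k ((d + k)/3 + x) = x^3 - 3 * (rr d k * rr d k) * x + qq d k"
proof -
  have r: "rr d k * rr d k = (d * d - d * k + k * k) / 9" using rr_sq[of d k] by simp
  show ?thesis unfolding r Qc_def qq_def by (simp add: power3_eq_cube field_simps)
qed

lemma Acr_rr: "Acr d k = 2 * rr d k ^ 3 - qq d k" and Bcr_rr: "Bcr d k = 2 * rr d k ^ 3 + qq d k"
  unfolding Acr_def Bcr_def critp_rr critm_rr diff_conv_add_uminus[of "(d + k)/3"] Qc_shift
  by (simp_all add: power3_eq_cube)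

text \<open>\<open>Dop\<close> with the edges \<open>d = 0\<close> and \<open>A = 1\<close> added.
  The roots and the periods are still continuous there, and the closedness of the image rests on
  this.\<close>

definition Ecl :: "(real \<times> real) set" where
  "Ecl = {(d, k). 0 \<le> d \<and> d < k \<and> 1 \<le> Acr d k}"

definition Dop :: "(real \<times> real) set" where
  "Dop = {(d, k). 0 < d \<and> d < k \<and> 1 < Acr d k}"

lemma critm_nonneg: assumes "0 \<le> d" "d < k" shows "0 \<le> critm d k"
  using crit_order(1)[of d k] assms by (cases "d = 0") (auto simp: critm_def)

lemma Bcr_nonneg: assumes "0 \<le> d" "d < k" shows "0 \<le> Bcr d k"
  using Acr_Bcr_pos(2)[of d k] assms by (cases "d = 0") (auto simp: Bcr_def Qc_def critm_def)

lemma pp_bounds: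
  assumes "0 \<le> d" "d < k" "1 \<le> Acr d k"
  shows "- 1 \<le> pp d k" "pp d k < 1" "1 < Acr d k \<Longrightarrow> - 1 < pp d k" "2 * rr d k ^ 3 * pp d k = - qq d k - 1"
    "Acr d k = 1 \<Longrightarrow> pp d k = - 1"
proof -
  have r: "0 < 2 * rr d k ^ 3" using rr_pos[OF assms(1,2)] by simp
  have a: "qq d k + 1 \<le> 2 * rr d k ^ 3" using assms(3) unfolding Acr_rr by simp
  have b: "- (qq d k + 1) < 2 * rr d k ^ 3" using Bcr_nonneg[OF assms(1,2)] unfolding Bcr_rr by simp
  show "- 1 \<le> pp d k" unfolding pp_def using r a by (simp add: le_divide_eq)
  show "pp d k < 1" unfolding pp_def using r b by (simp add: divide_less_eq)
  show "- 1 < pp d k" if "1 < Acr d k" unfolding pp_def using r that unfolding Acr_rr by (simp add: less_divide_eq)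
  show "2 * rr d k ^ 3 * pp d k = - qq d k - 1" unfolding pp_def using r by simp
  show "pp d k = - 1" if "Acr d k = 1"
  proof -
    have "qq d k + 1 = 2 * rr d k ^ 3" using that unfolding Acr_rr by simp
    then show ?thesis unfolding pp_def using r by simp
  qed
qed

lemma sin_triple: "sin (3 * x) = 3 * sin x - 4 * sin x ^ 3" for x :: real
proof -
  have "sin (3 * x) = sin (2 * x + x)" by simp
  also have "\<dots> = sin x * (2 * (cos x * cos x)) + (1 - 2 * (sin x * sin x)) * sin x"
    unfolding sin_add sin_double cos_double_sin by (simp add: power2_eq_square)
  also have "cos x * cos x = 1 - sin x * sin x" using cos_squared_eq[of x] by (simp add: power2_eq_square)
  finally show ?thesis by (simp add: power3_eq_cube algebra_simps)
qed

lemma al_props: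
  assumes "0 \<le> d" "d < k" "1 \<le> Acr d k"
  shows "sin (3 * al d k) = pp d k" "- (1/2) \<le> sin (al d k)" "sin (al d k) < 1/2"
    "1 < Acr d k \<Longrightarrow> - (1/2) < sin (al d k)" "sqrt 3 / 2 \<le> cos (al d k)"
proof -
  note p = pp_bounds[OF assms]
  have b: "- (pi/2) \<le> arcsin (pp d k)" "arcsin (pp d k) < pi/2"
    using arcsin_lbound[of "pp d k"] arcsin_less_arcsin[of "pp d k" 1] p(1,2) by auto
  have al: "- (pi/6) \<le> al d k" "al d k < pi/6" using b by (auto simp: al_def)
  show "sin (3 * al d k) = pp d k" using p(1,2) by (simp add: al_def)
  have s: "sin (-(pi/6)) = -(1/2)" by (simp add: sin_30)
  show "- (1/2) \<le> sin (al d k)" using sin_monotone_2pi_le[of "-(pi/6)" "al d k"] al s by auto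
  show "sin (al d k) < 1/2" using sin_monotone_2pi[of "al d k" "pi/6"] al sin_30 by auto
  show "- (1/2) < sin (al d k)" if "1 < Acr d k"
  proof -
    have "arcsin (-1) < arcsin (pp d k)" using p(2) p(3)[OF that] by (intro arcsin_less_arcsin) auto
    then have "- (pi/6) < al d k" by (simp add: al_def)
    then show ?thesis using sin_monotone_2pi[of "-(pi/6)" "al d k"] al s by auto
  qed
  have "\<bar>al d k\<bar> \<le> pi/6" using al by auto
  then have "cos (pi/6) \<le> cos \<bar>al d k\<bar>" by (intro cos_monotone_0_pi_le) auto
  then show "sqrt 3 / 2 \<le> cos (al d k)" by (simp add: cos_30)
qed

lemma root_between:
  fixes c d k :: real
  assumes "Qc d k c = -1" "0 < c" "d < k"
  shows "d < c" "c < k" "c * (k - c) * (c - d) = 1"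
proof -
  show 1: "d < c"
  proof (rule ccontr)
    assume "\<not> d < c"
    then have "0 \<le> c * ((d - c) * (k - c))" using assms by (intro mult_nonneg_nonneg) auto
    then show False using assms(1) by (simp add: Qc_def algebra_simps)
  qed
  show "c < k"
  proof (rule ccontr)
    assume "\<not> c < k"
    then have "0 \<le> c * ((c - d) * (c - k))" using assms 1 by (intro mult_nonneg_nonneg) auto
    then show False using assms(1) by (simp add: Qc_def algebra_simps)
  qed
  show "c * (k - c) * (c - d) = 1" using assms(1) by (simp add: Qc_def algebra_simps)
qed

text \<open>Both numbers have the form \<open>(d + k)/3 + x\<close>, with \<open>x\<close> equal to
  \<open>-2 r sin \<alpha>\<close> or to \<open>2 r sin (\<alpha> + pi/3)\<close>, and both choices
  give \<open>x^3 - 3 r^2 x = 2 r^3 sin (3 \<alpha>)\<close>. The range \<open>[-pi/6, pi/6)\<close>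
  of the angle places them on the two sides of \<open>critp\<close>.\<close>

lemma c_props:
  assumes "0 \<le> d" "d < k" "1 \<le> Acr d k"
  shows "Qc d k (c2 d k) = -1" "Qc d k (c3 d k) = -1"
    "d < c2 d k" "c2 d k \<le> critp d k" "critp d k \<le> c3 d k" "c3 d k < k"
    "1 < Acr d k \<Longrightarrow> c2 d k < critp d k" "1 < Acr d k \<Longrightarrow> critp d k < c3 d k"
    "Acr d k = 1 \<Longrightarrow> c2 d k = c3 d k"
proof -
  note a = al_props[OF assms] and p = pp_bounds[OF assms]
  define r s c where "r = rr d k" and "s = sin (al d k)" and "c = cos (al d k)"
  have r: "0 < r" using rr_pos[OF assms(1,2)] by (simp add: r_def)
  have sc: "c * c = 1 - s * s" using cos_squared_eq[of "al d k"] by (simp add: s_def c_def power2_eq_square)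
  have t: "2 * r ^ 3 * (3 * s - 4 * s ^ 3) = - qq d k - 1"
    using p(4) a(1) unfolding sin_triple r_def s_def by simp
  have c2: "c2 d k = (d + k)/3 + (- 2 * r * s)" by (simp add: c2_def r_def s_def)
  have c3: "c3 d k = (d + k)/3 + r * (s + sqrt 3 * c)" by (simp add: c3_def r_def s_def c_def)
  have "(- 2 * r * s)^3 - 3 * (r * r) * (- 2 * r * s) = 2 * r ^ 3 * (3 * s - 4 * s ^ 3)"
    by (simp add: power3_eq_cube algebra_simps)
  then show q2: "Qc d k (c2 d k) = -1" unfolding c2 Qc_shift r_def[symmetric] t by simp
  have "(s + sqrt 3 * c)^3 = s * s * s + 3 * sqrt 3 * s * s * c + 3 * (sqrt 3 * sqrt 3) * s * (c * c) + sqrt 3 * sqrt 3 * sqrt 3 * (c * c) * c"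
    by (simp add: power3_eq_cube algebra_simps)
  also have "\<dots> = 9 * s - 8 * s ^ 3 + 3 * (sqrt 3 * c)" unfolding sc by (simp add: power3_eq_cube algebra_simps)
  finally have cu: "(s + sqrt 3 * c)^3 = 9 * s - 8 * s ^ 3 + 3 * (sqrt 3 * c)" .
  have "(r * x)^3 - 3 * (r * r) * (r * x) = r^3 * (x^3 - 3 * x)" for x
    by (simp add: power3_eq_cube algebra_simps)
  then have "(r * (s + sqrt 3 * c))^3 - 3 * (r * r) * (r * (s + sqrt 3 * c)) = r^3 * ((s + sqrt 3 * c)^3 - 3 * (s + sqrt 3 * c))" .
  also have "\<dots> = 2 * r ^ 3 * (3 * s - 4 * s ^ 3)" unfolding cu by (simp add: algebra_simps)
  finally have "(r * (s + sqrt 3 * c))^3 - 3 * (r * r) * (r * (s + sqrt 3 * c)) = 2 * r ^ 3 * (3 * s - 4 * s ^ 3)" .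
  then show q3: "Qc d k (c3 d k) = -1" unfolding c3 Qc_shift r_def[symmetric] t by simp
  have cb: "sqrt 3 * (sqrt 3 / 2) \<le> sqrt 3 * c" using a(5) by (intro mult_left_mono) (auto simp: c_def)
  have cb': "3/2 \<le> sqrt 3 * c" using cb by simp
  have m2: "- 2 * r * s \<le> r" using mult_left_mono[OF a(2), of "2 * r"] r by (simp add: s_def)
  have m2': "- r < - 2 * r * s" using mult_strict_left_mono[OF a(3), of "2 * r"] r by (simp add: s_def)
  have m3: "r \<le> r * (s + sqrt 3 * c)" using mult_left_mono[of 1 "s + sqrt 3 * c" r] cb' a(2) r by (simp add: s_def)
  have pos2: "0 < c2 d k" unfolding c2 using m2' critm_nonneg[OF assms(1,2)] unfolding critm_rr r_def by simp
  show "c2 d k \<le> critp d k" unfolding c2 critp_rr r_def[symmetric] using m2 by simp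
  show 3: "critp d k \<le> c3 d k" unfolding c3 critp_rr r_def[symmetric] using m3 by simp
  have pos3: "0 < c3 d k" using 3 critm_nonneg[OF assms(1,2)] r unfolding critp_rr critm_rr r_def by linarith
  show "d < c2 d k" by (rule root_between(1)[OF q2 pos2 assms(2)])
  show "c3 d k < k" by (rule root_between(2)[OF q3 pos3 assms(2)])
  show "c2 d k < critp d k" if "1 < Acr d k"
    using mult_strict_left_mono[OF a(4)[OF that], of "2 * r"] r unfolding c2 critp_rr r_def[symmetric] by (simp add: s_def)
  show "critp d k < c3 d k" if "1 < Acr d k"
    using mult_strict_left_mono[of 1 "s + sqrt 3 * c" r] cb' a(4)[OF that] r unfolding c3 critp_rr r_def[symmetric] by (simp add: s_def)
  show "c2 d k = c3 d k" if "Acr d k = 1"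
  proof -
    have "al d k = - (pi/6)" unfolding al_def p(5)[OF that] by simp
    then have "s = -(1/2)" "c = sqrt 3 / 2" by (simp_all add: s_def c_def sin_30 cos_30)
    moreover have "sqrt 3 * c = 3 / 2" unfolding \<open>c = sqrt 3 / 2\<close> by simp
    ultimately show ?thesis unfolding c2 c3 by simp
  qed
qed

lemma c_con:
  assumes "0 \<le> d" "d < k" "1 \<le> Acr d k"
  shows "c2 d k * (k - c2 d k) * (c2 d k - d) = 1" "c3 d k * (k - c3 d k) * (c3 d k - d) = 1"
proof -
  note c = c_props[OF assms]
  show "c2 d k * (k - c2 d k) * (c2 d k - d) = 1"
    by (rule root_between(3)[OF c(1) _ assms(2)]) (use c(3) assms in simp)
  show "c3 d k * (k - c3 d k) * (c3 d k - d) = 1"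
    by (rule root_between(3)[OF c(2) _ assms(2)]) (use c(3,4,5) assms in simp)
qed

text \<open>Written with \<open>ellPi\<close> the period matches \<open>Theta_j\<close> and is
  visibly analytic. The estimates use the equivalent form \<open>Tf_EI\<close>.\<close>

definition Tf :: "(real \<Rightarrow> real \<Rightarrow> real) \<Rightarrow> real \<Rightarrow> real \<Rightarrow> real" where
  "Tf c d k = ellPi (d / c d k) (d / k) / (pi * (c d k * sqrt k))"

lemma Tf_EI:
  assumes "0 \<le> d" "d < k" "d < c d k"
  shows "Tf c d k = EI d k (\<lambda>V. 1 / (c d k - V)) / pi"
  unfolding Tf_def using ellPi_EI[of d k "c d k"] assms by simp

lemma rr_scale: assumes "0 \<le> t" shows "rr (t * d) (t * k) = t * rr d k"
proof -
  have "(t * d)^2 - t * d * (t * k) + (t * k)^2 = t^2 * (d^2 - d * k + k^2)" by (simp add: power2_eq_square algebra_simps)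
  then have "sqrt ((t * d)^2 - t * d * (t * k) + (t * k)^2) = t * sqrt (d^2 - d * k + k^2)"
    using assms by (simp add: real_sqrt_mult)
  then show ?thesis by (simp add: rr_def)
qed

lemma qq_scale: "qq (t * d) (t * k) = t^3 * qq d k"
  unfolding qq_def by (simp add: power3_eq_cube algebra_simps)

text \<open>\<open>Q\<close> is homogeneous of degree 3 in \<open>(d, k, V)\<close>, so along a ray
  \<open>d = \<mu> k\<close> the critical values are multiples of \<open>k^3\<close>. This is what
  lets level curves of \<open>A\<close> and \<open>B\<close> be parametrized by the ratio
  \<open>\<mu>\<close>.\<close>

lemma Acr_scale: "0 \<le> t \<Longrightarrow> Acr (t * d) (t * k) = t^3 * Acr d k"
  and Bcr_scale: "0 \<le> t \<Longrightarrow> Bcr (t * d) (t * k) = t^3 * Bcr d k"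
  unfolding Acr_rr Bcr_rr qq_scale by (simp_all add: rr_scale power_mult_distrib right_diff_distrib distrib_left)

lemma sigma_rr: assumes "0 \<le> l" shows "sigma_c m * l^2 = 3 * rr (m * l^2) (l^2)"
proof -
  have "rr (m * l^2) (l^2) = l^2 * rr m 1" using rr_scale[of "l^2" m 1] by (simp add: mult.commute)
  then show ?thesis by (simp add: rr_def sigma_c_def)
qed

lemma qq_ml: "27 * qq (m * l^2) (l^2) = - ((m - 2) * (1 + m) * (2*m - 1)) * l^6"
proof -
  have "qq (m * l^2) (l^2) = (l^2)^3 * qq m 1" using qq_scale[of "l^2" m 1] by (simp add: mult.commute)
  then have "27 * qq (m * l^2) (l^2) = (27 * qq m 1) * l^6" by (simp flip: power_mult)
  also have "27 * qq m 1 = - ((m - 2) * (1 + m) * (2*m - 1))" by (simp add: qq_def field_simps)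
  finally show ?thesis .
qed

lemma p_tilde_pp: assumes "0 < l" shows "p_tilde m l = pp (m * l^2) (l^2)"
proof -
  have "(sigma_c m)^3 * l^6 = (sigma_c m * l^2)^3" by (simp add: power_mult_distrib flip: power_mult)
  also have "\<dots> = 27 * rr (m * l^2) (l^2) ^ 3" unfolding sigma_rr[OF less_imp_le[OF assms]] by (simp add: power_mult_distrib)
  finally have a: "2 * (sigma_c m)^3 * l^6 = 27 * (2 * rr (m * l^2) (l^2) ^ 3)" by (simp add: mult.assoc)
  have b: "(m - 2) * (1 + m) * (2*m - 1) * l^6 - 27 = 27 * (- (qq (m * l^2) (l^2) + 1))"
    using qq_ml[of m l] by (simp add: algebra_simps)
  show ?thesis unfolding p_tilde_def pp_def a b by (rule mult_divide_mult_cancel_left) simp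
qed

lemma lambda_c:
  assumes "0 < l"
  shows "2 * (1 + m) * l^2 + 3 * lambda2 m l = 6 * c2 (m * l^2) (l^2)"
    "2 * (1 + m) * l^2 + 3 * lambda3 m l = 6 * c3 (m * l^2) (l^2)"
proof -
  have al: "alpha_c m l = al (m * l^2) (l^2)" unfolding alpha_c_def al_def p_tilde_pp[OF assms] ..
  have "lambda2 m l = - 4 / 3 * (sigma_c m * l^2) * sin (alpha_c m l)" by (simp add: lambda2_def)
  then show "2 * (1 + m) * l^2 + 3 * lambda2 m l = 6 * c2 (m * l^2) (l^2)"
    unfolding sigma_rr[OF less_imp_le[OF assms]] al c2_def by (simp add: algebra_simps)
  have e: "2 / sqrt 3 = 2 / 3 * sqrt 3" by (simp add: field_simps)
  have "lambda3 m l = 2/3 * (sigma_c m * l^2) * sin (alpha_c m l) + 2/3 * (sigma_c m * l^2) * (sqrt 3 * cos (alpha_c m l))"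
    unfolding lambda3_def e by (simp only: mult_ac)
  then show "2 * (1 + m) * l^2 + 3 * lambda3 m l = 6 * c3 (m * l^2) (l^2)"
    unfolding sigma_rr[OF less_imp_le[OF assms]] al c3_def by (simp add: algebra_simps)
qed

lemma Theta_Tf:
  assumes "0 < l"
  shows "Theta (m, l) = (Tf c2 (m * l^2) (l^2), Tf c3 (m * l^2) (l^2))"
proof -
  have "6 * m * l^2 / (6 * c) = m * l^2 / c" "6 * x / (pi * l * (6 * c)) = x / (pi * (c * sqrt (l^2)))"
    "m = m * l^2 / l^2" for c x
    using assms by simp_all
  then show ?thesis unfolding Theta_def Theta_j_def fst_conv snd_conv lambda_c[OF assms] Tf_def by simp
qed

text \<open>\<open>frak_l m\<close> is the value of \<open>l\<close> at which
  \<open>Acr (m l^2) (l^2) = 1\<close>: by homogeneity this quantity is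
  \<open>l^6 * Acr m 1\<close>, and \<open>27 * Acr m 1\<close> is the denominator in
  \<open>frak_l\<close>.\<close>

lemma domD_Dop: "(m, l) \<in> domD \<longleftrightarrow> 0 < l \<and> (m * l^2, l^2) \<in> Dop"
proof (cases "0 < l \<and> 0 < m \<and> m < 1")
  case True
  then have ml: "0 < l" "0 < m" "m < 1" by auto
  define A where "A = Acr m 1"
  have A: "0 < A" unfolding A_def by (rule Acr_Bcr_pos(1)) (use ml in auto)
  have s3: "(1 - m + m^2) powr (3/2) = sigma_c m ^ 3"
  proof -
    have "0 < 1 - m + m^2" using ml by (simp add: add_pos_pos)
    then have "sigma_c m ^ 3 = ((1 - m + m^2) powr (1/2)) powr 3"
      by (simp add: sigma_c_def powr_half_sqrt powr_numeral)
    then show ?thesis by (simp add: powr_powr)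
  qed
  have "27 * A = 2 * sigma_c m ^ 3 + (m - 2) * (1 + m) * (2*m - 1)"
    unfolding A_def Acr_rr using qq_ml[of m 1] sigma_rr[of 1 m] by (simp add: power_mult_distrib)
  then have "(m - 2) * (1 + m) * (2*m - 1) + 2 * sigma_c m ^ 3 = 27 * A" by simp
  then have fl: "frak_l m = (1 / A) powr (1/6)" unfolding frak_l_def s3 by simp
  have f6: "frak_l m ^ 6 = 1 / A" "0 \<le> frak_l m"
  proof -
    have "frak_l m ^ 6 = ((1 / A) powr (1/6)) powr 6" unfolding fl using A by (simp add: powr_numeral)
    also have "\<dots> = 1 / A" unfolding powr_powr using A by simp
    finally show "frak_l m ^ 6 = 1 / A" .
    show "0 \<le> frak_l m" unfolding fl by simp
  qed
  have "frak_l m < l \<longleftrightarrow> frak_l m ^ 6 < l ^ 6"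
    using power_less_imp_less_base[of "frak_l m" 6 l] power_strict_mono[of "frak_l m" l 6] f6(2) ml(1) by auto
  also have "\<dots> \<longleftrightarrow> 1 < l^6 * A" unfolding f6(1) using A by (simp add: divide_less_eq)
  also have "l^6 * A = Acr (m * l^2) (l^2)"
    using Acr_scale[of "l^2" m 1] by (simp add: A_def mult.commute flip: power_mult)
  finally show ?thesis using ml by (simp add: domD_def Dop_def)
next
  case False
  then show ?thesis by (auto simp: domD_def Dop_def zero_less_mult_iff)
qed

lemma complexifiable_differentiable:
  assumes "complexifiable f p"
  shows "\<exists>A B. (f has_derivative (\<lambda>h. A * fst h + B * snd h)) (at p)"
  by (rule complexifiable_has_derivative[OF assms]) (intro exI)

lemma complexifiable_c:
  assumes "(d, k) \<in> Dop"
  shows "complexifiable (\<lambda>p. c2 (fst p) (snd p)) (d, k)" "complexifiable (\<lambda>p. c3 (fst p) (snd p)) (d, k)"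
proof -
  have dk: "0 \<le> d" "d < k" "1 \<le> Acr d k" "1 < Acr d k" using assms by (auto simp: Dop_def)
  note F = complexifiable_fst[of "(d, k)"] and S = complexifiable_snd[of "(d, k)"]
  have pos: "0 < d^2 - d * k + k^2" using rr_pos[OF dk(1,2)] by (simp add: rr_def)
  have "complexifiable (\<lambda>p. (fst p)^2 - fst p * snd p + (snd p)^2) (d, k)"
    by (rule complexifiable_add[OF complexifiable_diff[OF complexifiable_power[OF F] complexifiable_mult[OF F S]] complexifiable_power[OF S]])
  from complexifiable_sqrt[OF this] pos
  have "complexifiable (\<lambda>p. sqrt ((fst p)^2 - fst p * snd p + (snd p)^2)) (d, k)" by simp
  from complexifiable_divide[OF this complexifiable_const[of 3]]
  have r: "complexifiable (\<lambda>p. rr (fst p) (snd p)) (d, k)" unfolding rr_def by simp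
  have q: "complexifiable (\<lambda>p. qq (fst p) (snd p)) (d, k)"
    unfolding qq_def
    by (rule complexifiable_divide[OF complexifiable_mult[OF complexifiable_mult[OF
          complexifiable_diff[OF complexifiable_mult[OF complexifiable_const S] F]
          complexifiable_diff[OF complexifiable_mult[OF complexifiable_const F] S]]
          complexifiable_add[OF F S]] complexifiable_const]) simp
  have "complexifiable (\<lambda>p. pp (fst p) (snd p)) (d, k)"
    unfolding pp_def
    by (rule complexifiable_divide[OF complexifiable_uminus[OF complexifiable_add[OF q complexifiable_const]]
          complexifiable_mult[OF complexifiable_const complexifiable_power[OF r]]])
       (use rr_pos[OF dk(1,2)] in simp)
  from complexifiable_arcsin[OF this]
  have "complexifiable (\<lambda>p. arcsin (pp (fst p) (snd p))) (d, k)"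
    using pp_bounds(2,3)[OF dk(1-3)] dk(4) by (simp add: abs_less_iff)
  from complexifiable_divide[OF this complexifiable_const[of 3]]
  have a: "complexifiable (\<lambda>p. al (fst p) (snd p)) (d, k)" unfolding al_def by simp
  have s: "complexifiable (\<lambda>p. (fst p + snd p) / 3) (d, k)"
    by (rule complexifiable_divide[OF complexifiable_add[OF F S] complexifiable_const]) simp
  show "complexifiable (\<lambda>p. c2 (fst p) (snd p)) (d, k)"
    unfolding c2_def
    by (rule complexifiable_diff[OF s complexifiable_mult[OF complexifiable_mult[OF complexifiable_const r] complexifiable_sin[OF a]]])
  show "complexifiable (\<lambda>p. c3 (fst p) (snd p)) (d, k)"
    unfolding c3_def
    by (rule complexifiable_add[OF s complexifiable_mult[OF r complexifiable_add[OF complexifiable_sin[OF a]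
         complexifiable_mult[OF complexifiable_const complexifiable_cos[OF a]]]]])
qed

lemma complexifiable_Tf:
  assumes c: "complexifiable (\<lambda>p. c (fst p) (snd p)) (d, k)" and o: "0 < d" "d < k" "d < c d k"
  shows "complexifiable (\<lambda>p. Tf c (fst p) (snd p)) (d, k)"
proof -
  note F = complexifiable_fst[of "(d, k)"] and S = complexifiable_snd[of "(d, k)"]
  have 1: "complexifiable (\<lambda>p. fst p / c (fst p) (snd p)) (d, k)"
    by (rule complexifiable_divide[OF F c]) (use o in simp)
  have 2: "complexifiable (\<lambda>p. fst p / snd p) (d, k)"
    by (rule complexifiable_divide[OF F S]) (use o in simp)
  have "complexifiable (\<lambda>p. ellPi (fst p) (snd p)) (d / c d k, d / k)"
    by (rule complexifiable_ellPi) (use o in simp_all)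
  then have "complexifiable (\<lambda>p. ellPi (fst p) (snd p)) (fst (d, k) / c (fst (d, k)) (snd (d, k)), fst (d, k) / snd (d, k))"
    by simp
  from complexifiable_compose[OF this 1 2]
  have 3: "complexifiable (\<lambda>p. ellPi (fst p / c (fst p) (snd p)) (fst p / snd p)) (d, k)" by simp
  have 4: "complexifiable (\<lambda>p. sqrt (snd p)) (d, k)" by (rule complexifiable_sqrt[OF S]) (use o in simp)
  show ?thesis unfolding Tf_def
    by (rule complexifiable_divide[OF 3 complexifiable_mult[OF complexifiable_const complexifiable_mult[OF c 4]]])
       (use o in simp)
qed

lemma Dop_props:
  assumes "(d, k) \<in> Dop"
  shows "0 < d" "d < k" "1 < Acr d k" "0 \<le> d" "1 \<le> Acr d k"
  using assms by (auto simp: Dop_def)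

lemma complexifiable_T23:
  assumes "(d, k) \<in> Dop"
  shows "complexifiable (\<lambda>p. Tf c2 (fst p) (snd p)) (d, k)" "complexifiable (\<lambda>p. Tf c3 (fst p) (snd p)) (d, k)"
proof -
  note o = Dop_props[OF assms] and c = c_props[OF Dop_props(4,2,5)[OF assms]]
  show "complexifiable (\<lambda>p. Tf c2 (fst p) (snd p)) (d, k)"
    by (rule complexifiable_Tf[OF complexifiable_c(1)[OF assms] o(1,2) c(3)])
  show "complexifiable (\<lambda>p. Tf c3 (fst p) (snd p)) (d, k)"
    by (rule complexifiable_Tf[OF complexifiable_c(2)[OF assms] o(1,2)]) (use c(3,4,5) in simp)
qed

lemma open_Dop: "open Dop"
proof -
  have "continuous_on UNIV (\<lambda>p. Acr (fst p) (snd p))"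
    unfolding Acr_def Qc_def critp_def by (intro continuous_intros) auto
  then have "open ({p. (0::real) < fst p} \<inter> {p. fst p < (snd p :: real)} \<inter> {p. 1 < Acr (fst p) (snd p)})"
    by (intro open_Int open_Collect_less continuous_intros)
  moreover have "Dop = {p. (0::real) < fst p} \<inter> {p. fst p < (snd p :: real)} \<inter> {p. 1 < Acr (fst p) (snd p)}"
    by (auto simp: Dop_def)
  ultimately show ?thesis by simp
qed

section \<open>Derivatives of the periods in the coordinates A and B\<close>

text \<open>\<open>Xw\<close> and \<open>Yw\<close> are the coefficients of d(log A) and d(log B) in
  the differential of \<open>Tf c\<close>, as a comparison of \<open>Tf_path_deriv\<close> with
  \<open>Acr_Bcr_deriv\<close> shows.\<close>

definition Xw :: "(real \<Rightarrow> real \<Rightarrow> real) \<Rightarrow> real \<Rightarrow> real \<Rightarrow> real" where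
  "Xw c d k = EI d k (\<lambda>V. critp d k - V) / (6 * pi * (critp d k - critm d k)) / (critp d k - c d k)"
definition Yw :: "(real \<Rightarrow> real \<Rightarrow> real) \<Rightarrow> real \<Rightarrow> real \<Rightarrow> real" where
  "Yw c d k = - EI d k (\<lambda>V. V - critm d k) / (6 * pi * (critp d k - critm d k)) / (c d k - critm d k)"

lemma Tf_path_deriv:
  fixes d k :: "real \<Rightarrow> real"
  assumes D: "(d has_real_derivative d') (at t)" "(k has_real_derivative k') (at t)"
    and dom: "(d t, k t) \<in> Dop"
    and cdef: "c = c2 \<or> c = c3"
  shows "((\<lambda>s. Tf c (d s) (k s)) has_real_derivative
     Xw c (d t) (k t) * (k'/(k t - critp (d t) (k t)) - d'/(critp (d t) (k t) - d t))
   + Yw c (d t) (k t) * (d'/(d t - critm (d t) (k t)) + k'/(k t - critm (d t) (k t)))) (at t)"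
proof -
  have pc: "isCont (\<lambda>s. (d s, k s)) t" using D DERIV_isCont by (intro continuous_Pair) blast+
  have "\<forall>\<^sub>F s in nhds t. (d s, k s) \<in> Dop"
    using eventually_compose_filterlim[OF eventually_nhds_in_open[OF open_Dop dom]
      tendsto_at_iff_tendsto_nhds[THEN iffD1, OF pc[unfolded isCont_def]]] .
  note ev = this
  have cpf: "complexifiable (\<lambda>p. c (fst p) (snd p)) (d t, k t)"
    using cdef complexifiable_c[OF dom] by auto
  obtain A B where FD: "((\<lambda>p. c (fst p) (snd p)) has_derivative (\<lambda>h. A * fst h + B * snd h)) (at (d t, k t))"
    using complexifiable_differentiable[OF cpf] by (elim exE)
  from deriv_along_path[OF FD D] obtain c' where c': "((\<lambda>s. c (d s) (k s)) has_real_derivative c') (at t)"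
    unfolding fst_conv snd_conv by (rule that)
  have cc: "d < c d k \<and> c d k < k \<and> c d k \<noteq> critp d k \<and> c d k * (k - c d k) * (c d k - d) = 1"
    if "(d, k) \<in> Dop" for d k
  proof -
    note o = Dop_props[OF that] and cp = c_props[OF Dop_props(4,2,5)[OF that]] and con = c_con[OF Dop_props(4,2,5)[OF that]]
    show ?thesis using cdef cp(3-8) con o(3) by auto
  qed
  have con: "\<forall>\<^sub>F s in nhds t. c (d s) (k s) * (k s - c (d s) (k s)) * (c (d s) (k s) - d s) = 1"
    using ev by eventually_elim (use cc in blast)
  have "((\<lambda>s. EI (d s) (k s) (\<lambda>V. 1 / (c (d s) (k s) - V))) has_real_derivative
    - (1 / (6 * (critp (d t) (k t) - critm (d t) (k t)))) *
      (EI (d t) (k t) (\<lambda>V. critp (d t) (k t) - V) *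
          (k'/(k t - critp (d t) (k t)) - d'/(critp (d t) (k t) - d t)) / (c (d t) (k t) - critp (d t) (k t))
        + EI (d t) (k t) (\<lambda>V. V - critm (d t) (k t)) *
          (d'/(d t - critm (d t) (k t)) + k'/(k t - critm (d t) (k t))) / (c (d t) (k t) - critm (d t) (k t)))) (at t)"
    by (rule period_deriv[OF c' D _ _ _ _ con]) (use cc[OF dom] Dop_props[OF dom] in auto)
  from DERIV_cdivide[OF this, of pi]
  have "((\<lambda>s. EI (d s) (k s) (\<lambda>V. 1 / (c (d s) (k s) - V)) / pi) has_real_derivative
     Xw c (d t) (k t) * (k'/(k t - critp (d t) (k t)) - d'/(critp (d t) (k t) - d t))
   + Yw c (d t) (k t) * (d'/(d t - critm (d t) (k t)) + k'/(k t - critm (d t) (k t)))) (at t)"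
  proof (rule DERIV_cong)
    have g: "- (1 / (6 * G)) * (P * u / (x - y) + M * v / z) / pi = P / (6 * pi * G) / (y - x) * u + - M / (6 * pi * G) / z * v"
      for G P u x y M v z :: real
    proof -
      have "P * u / (x - y) = - (P * u / (y - x))" by (metis minus_diff_eq minus_divide_right)
      then show ?thesis by (simp add: algebra_simps add_divide_distrib diff_divide_distrib)
    qed
    show "- (1 / (6 * (critp (d t) (k t) - critm (d t) (k t)))) *
      (EI (d t) (k t) (\<lambda>V. critp (d t) (k t) - V) *
          (k'/(k t - critp (d t) (k t)) - d'/(critp (d t) (k t) - d t)) / (c (d t) (k t) - critp (d t) (k t))
        + EI (d t) (k t) (\<lambda>V. V - critm (d t) (k t)) *
          (d'/(d t - critm (d t) (k t)) + k'/(k t - critm (d t) (k t))) / (c (d t) (k t) - critm (d t) (k t))) / pi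
     = Xw c (d t) (k t) * (k'/(k t - critp (d t) (k t)) - d'/(critp (d t) (k t) - d t))
      + Yw c (d t) (k t) * (d'/(d t - critm (d t) (k t)) + k'/(k t - critm (d t) (k t)))"
      unfolding Xw_def Yw_def by (rule g)
  qed
  moreover have "\<forall>\<^sub>F s in nhds t. Tf c (d s) (k s) = EI (d s) (k s) (\<lambda>V. 1 / (c (d s) (k s) - V)) / pi"
    using ev by eventually_elim (use cc Dop_props in \<open>auto intro!: Tf_EI\<close>)
  ultimately show ?thesis by (rule DERIV_cong_ev[OF refl _ refl, THEN iffD2, rotated])
qed

lemma XY_signs:
  assumes "(d, k) \<in> Dop"
  shows "0 < Xw c2 d k" "Yw c2 d k < 0" "Xw c3 d k < 0" "Yw c3 d k < 0"
proof -
  note o = Dop_props[OF assms] and c = c_props[OF Dop_props(4,2,5)[OF assms]]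
  note P = EI_crit_pos[OF o(1,2)] and cr = crit_order[OF o(1,2)]
  have G: "0 < 6 * pi * (critp d k - critm d k)" using cr by simp
  show "0 < Xw c2 d k" unfolding Xw_def using P(1) G c(7)[OF o(3)] by simp
  show "Xw c3 d k < 0" unfolding Xw_def using P(1) G c(8)[OF o(3)] by (intro divide_pos_neg divide_pos_pos) auto
  show "Yw c2 d k < 0" unfolding Yw_def using P(2) G c(3) cr by (intro divide_neg_pos) auto
  show "Yw c3 d k < 0" unfolding Yw_def using P(2) G c(3,4,5) cr by (intro divide_neg_pos) auto
qed

lemma deriv_Acr1:
  assumes "0 < \<mu>" "\<mu> < 1"
  shows "((\<lambda>\<mu>. Acr \<mu> 1) has_real_derivative Acr \<mu> 1 * (- 1 / (critp \<mu> 1 - \<mu>))) (at \<mu>)"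
    "((\<lambda>\<mu>. Bcr \<mu> 1) has_real_derivative Bcr \<mu> 1 * (1 / (\<mu> - critm \<mu> 1))) (at \<mu>)"
    "Acr \<mu> 1 * (- 1 / (critp \<mu> 1 - \<mu>)) < 0" "0 < Bcr \<mu> 1 * (1 / (\<mu> - critm \<mu> 1))"
proof -
  note cr = crit_order[OF assms] and p = Acr_Bcr_pos[OF assms]
  show "((\<lambda>\<mu>. Acr \<mu> 1) has_real_derivative Acr \<mu> 1 * (- 1 / (critp \<mu> 1 - \<mu>))) (at \<mu>)"
    using Acr_Bcr_deriv(1)[OF DERIV_ident DERIV_const assms] by simp
  show "((\<lambda>\<mu>. Bcr \<mu> 1) has_real_derivative Bcr \<mu> 1 * (1 / (\<mu> - critm \<mu> 1))) (at \<mu>)"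
    using Acr_Bcr_deriv(2)[OF DERIV_ident DERIV_const assms] by simp
  show "Acr \<mu> 1 * (- 1 / (critp \<mu> 1 - \<mu>)) < 0" using p(1) cr by (simp add: mult_pos_neg)
  show "0 < Bcr \<mu> 1 * (1 / (\<mu> - critm \<mu> 1))" using p(2) cr by simp
qed

lemma Acr1_strict_decreasing:
  assumes "0 < x" "x < y" "y < 1" shows "Acr y 1 < Acr x 1" "Bcr x 1 < Bcr y 1"
proof -
  show "Acr y 1 < Acr x 1"
  proof (rule DERIV_neg_imp_decreasing[OF assms(2)])
    fix t assume "x \<le> t" "t \<le> y"
    then have "0 < t" "t < 1" using assms by auto
    from deriv_Acr1(1,3)[OF this] show "\<exists>D. ((\<lambda>\<mu>. Acr \<mu> 1) has_real_derivative D) (at t) \<and> D < 0" by blast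
  qed
  show "Bcr x 1 < Bcr y 1"
  proof (rule DERIV_pos_imp_increasing[OF assms(2)])
    fix t assume "x \<le> t" "t \<le> y"
    then have "0 < t" "t < 1" using assms by auto
    from deriv_Acr1(2,4)[OF this] show "\<exists>D. ((\<lambda>\<mu>. Bcr \<mu> 1) has_real_derivative D) (at t) \<and> 0 < D" by blast
  qed
qed

lemma AB_ray:
  assumes "0 < d" "d < k"
  shows "Acr d k = k^3 * Acr (d/k) 1" "Bcr d k = k^3 * Bcr (d/k) 1"
  using Acr_scale[of k "d/k" 1] Bcr_scale[of k "d/k" 1] assms by auto

section \<open>Level curves of A and B, and injectivity\<close>

text \<open>The height \<open>k\<close> at which the level curve of value \<open>a\<close> meets the
  ray \<open>d = \<mu> k\<close>, that is, the solution of \<open>k^3 * h \<mu> = a\<close>.\<close>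

definition ray :: "(real \<Rightarrow> real) \<Rightarrow> real \<Rightarrow> real \<Rightarrow> real" where
  "ray h a \<mu> = (a / h \<mu>) powr (1/3)"

lemma cube_root_cube: "0 < x \<Longrightarrow> (x powr (1/3))^3 = x" for x :: real
proof -
  assume x: "0 < x"
  have "(x powr (1/3))^3 = (x powr (1/3)) powr 3" using x by (simp add: powr_numeral)
  also have "\<dots> = x" unfolding powr_powr using x by simp
  finally show ?thesis .
qed

lemma ray_cube: "0 < a \<Longrightarrow> 0 < h \<mu> \<Longrightarrow> ray h a \<mu> ^ 3 = a / h \<mu>"
  unfolding ray_def by (rule cube_root_cube) simp

lemma ray_pos: "0 < a \<Longrightarrow> 0 < h \<mu> \<Longrightarrow> 0 < ray h a \<mu>"
  unfolding ray_def by simp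

lemma ray_eq: "0 < k \<Longrightarrow> 0 < h \<mu> \<Longrightarrow> ray h (k^3 * h \<mu>) \<mu> = k"
proof -
  assume "0 < k" "0 < h \<mu>"
  then have "ray h (k^3 * h \<mu>) \<mu> = (k^3) powr (1/3)" unfolding ray_def by simp
  moreover have "(k^3) powr (1/3) = (k powr 3) powr (1/3)" using \<open>0 < k\<close> by (simp add: powr_numeral)
  moreover have "(k powr 3) powr (1/3) = k" unfolding powr_powr using \<open>0 < k\<close> by simp
  ultimately show ?thesis by (simp only:)
qed

lemma ray_deriv:
  assumes "(h has_real_derivative h') (at \<mu>)" "0 < a" "0 < h \<mu>"
  obtains k' where "(ray h a has_real_derivative k') (at \<mu>)" "h' < 0 \<Longrightarrow> 0 < k'" "0 < h' \<Longrightarrow> k' < 0"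
proof -
  have p: "0 < a / h \<mu>" using assms by simp
  have "((\<lambda>\<mu>. a / h \<mu>) has_real_derivative (0 * h \<mu> - a * h') / (h \<mu> * h \<mu>)) (at \<mu>)"
    by (rule DERIV_divide[OF DERIV_const assms(1)]) (use assms in simp)
  from DERIV_chain2[OF has_real_derivative_powr[OF p, of "1/3"] this]
  have "(ray h a has_real_derivative 1/3 * (a / h \<mu>) powr (1/3 - 1) * ((0 * h \<mu> - a * h') / (h \<mu> * h \<mu>))) (at \<mu>)"
    unfolding ray_def .
  moreover have q: "0 < 1/3 * (a / h \<mu>) powr (1/3 - 1)" "0 < h \<mu> * h \<mu>" using p assms(3) by auto
  have "0 < 1/3 * (a / h \<mu>) powr (1/3 - 1) * ((0 * h \<mu> - a * h') / (h \<mu> * h \<mu>))" if "h' < 0"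
    by (intro mult_pos_pos q divide_pos_pos) (use that assms(2) in \<open>auto simp: mult_pos_neg\<close>)
  moreover have "1/3 * (a / h \<mu>) powr (1/3 - 1) * ((0 * h \<mu> - a * h') / (h \<mu> * h \<mu>)) < 0" if "0 < h'"
    by (intro mult_pos_neg q divide_neg_pos) (use that assms(2) in auto)
  ultimately show ?thesis by (rule that)
qed

text \<open>Along constant \<open>A\<close> the term with \<open>Xw\<close> vanishes, and
  \<open>Yw\<close> is negative for both roots. The remaining factor, the derivative of log B, is
  positive because \<open>d\<close> and \<open>k\<close> both grow with
  \<open>\<mu>\<close>.\<close>

lemma constant_A_path:
  assumes a: "1 < a" and mu: "0 < \<mu>" "\<mu> < 1" and c: "c = c2 \<or> c = c3"
  defines "k \<equiv> ray (\<lambda>\<mu>. Acr \<mu> 1) a"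
  shows "(\<mu> * k \<mu>, k \<mu>) \<in> Dop" "Acr (\<mu> * k \<mu>) (k \<mu>) = a"
    "\<exists>D. ((\<lambda>\<mu>. Tf c (\<mu> * k \<mu>) (k \<mu>)) has_real_derivative D) (at \<mu>) \<and> D < 0"
proof -
  have A: "Acr (x * k x) (k x) = a" "0 < k x" if "0 < x" "x < 1" for x
  proof -
    have h: "0 < Acr x 1" using Acr_Bcr_pos(1)[OF that] .
    show kp: "0 < k x" unfolding k_def using a h by (intro ray_pos) auto
    have "Acr (x * k x) (k x) = k x ^ 3 * Acr x 1" using Acr_scale[of "k x" x 1] kp by (simp add: mult.commute)
    also have "\<dots> = a" unfolding k_def using ray_cube[of a "\<lambda>\<mu>. Acr \<mu> 1" x] a h by simp
    finally show "Acr (x * k x) (k x) = a" .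
  qed
  show dom: "(\<mu> * k \<mu>, k \<mu>) \<in> Dop" using A[OF mu] a mu by (simp add: Dop_def)
  show "Acr (\<mu> * k \<mu>) (k \<mu>) = a" by (rule A(1)[OF mu])
  obtain k' where k': "(k has_real_derivative k') (at \<mu>)" "0 < k'"
    unfolding k_def
    by (rule ray_deriv[OF deriv_Acr1(1)[OF mu], of a]) (use a Acr_Bcr_pos(1)[OF mu] deriv_Acr1(3)[OF mu] in auto)
  have d': "((\<lambda>\<mu>. \<mu> * k \<mu>) has_real_derivative 1 * k \<mu> + k' * \<mu>) (at \<mu>)"
    by (rule DERIV_mult[OF DERIV_ident k'(1)])
  define d'' where "d'' = 1 * k \<mu> + k' * \<mu>"
  have d''pos: "0 < d''" unfolding d''_def using A(2)[OF mu] k'(2) mu by (simp add: add_pos_pos)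
  have dk: "0 < \<mu> * k \<mu>" "\<mu> * k \<mu> < k \<mu>" using Dop_props[OF dom] by auto
  note cr = crit_order[OF dk]
  let ?g = "critp (\<mu> * k \<mu>) (k \<mu>)" and ?f = "critm (\<mu> * k \<mu>) (k \<mu>)"
  have ev: "\<forall>\<^sub>F x in nhds \<mu>. Acr (x * k x) (k x) = a"
  proof -
    have "\<forall>\<^sub>F x in nhds \<mu>. x \<in> {0<..<1}" by (rule eventually_nhds_in_open) (use mu in auto)
    then show ?thesis by eventually_elim (use A(1) in auto)
  qed
  have z: "k' / (k \<mu> - ?g) - d'' / (?g - \<mu> * k \<mu>) = 0"
  proof -
    have "((\<lambda>x. Acr (x * k x) (k x)) has_real_derivative 0) (at \<mu>)"
      using DERIV_cong_ev[OF refl ev refl, of 0] by simp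
    from DERIV_unique[OF Acr_Bcr_deriv(1)[OF d' k'(1) dk] this]
    show ?thesis using A(1)[OF mu] a unfolding d''_def by simp
  qed
  have pos: "0 < d'' / (\<mu> * k \<mu> - ?f) + k' / (k \<mu> - ?f)"
    using d''pos k'(2) cr by (intro add_pos_pos divide_pos_pos) auto
  have "((\<lambda>\<mu>. Tf c (\<mu> * k \<mu>) (k \<mu>)) has_real_derivative
      Yw c (\<mu> * k \<mu>) (k \<mu>) * (d'' / (\<mu> * k \<mu> - ?f) + k' / (k \<mu> - ?f))) (at \<mu>)"
    using Tf_path_deriv[OF d' k'(1) dom c] z unfolding d''_def by simp
  moreover have "Yw c (\<mu> * k \<mu>) (k \<mu>) < 0" using c XY_signs(2,4)[OF dom] by auto
  ultimately show "\<exists>D. ((\<lambda>\<mu>. Tf c (\<mu> * k \<mu>) (k \<mu>)) has_real_derivative D) (at \<mu>) \<and> D < 0"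
    using pos mult_neg_pos by blast
qed

text \<open>Along constant \<open>B\<close> only the term with \<open>Xw\<close> survives, and its
  sign differs for the two roots. A level curve of \<open>B\<close> need not stay in
  \<open>Dop\<close>, hence the hypothesis on \<open>A\<close>.\<close>

lemma constant_B_path:
  assumes b: "0 < b" and mu: "0 < \<mu>" "\<mu> < 1"
  defines "k \<equiv> ray (\<lambda>\<mu>. Bcr \<mu> 1) b"
  assumes A1: "1 < Acr (\<mu> * k \<mu>) (k \<mu>)"
  shows "\<exists>D. ((\<lambda>\<mu>. Tf c2 (\<mu> * k \<mu>) (k \<mu>)) has_real_derivative D) (at \<mu>) \<and> D < 0"
    "\<exists>D. ((\<lambda>\<mu>. Tf c3 (\<mu> * k \<mu>) (k \<mu>)) has_real_derivative D) (at \<mu>) \<and> 0 < D"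
proof -
  have A: "Bcr (x * k x) (k x) = b" "0 < k x" if "0 < x" "x < 1" for x
  proof -
    have h: "0 < Bcr x 1" using Acr_Bcr_pos(2)[OF that] .
    show kp: "0 < k x" unfolding k_def using b h by (intro ray_pos) auto
    have "Bcr (x * k x) (k x) = k x ^ 3 * Bcr x 1" using Bcr_scale[of "k x" x 1] kp by (simp add: mult.commute)
    also have "\<dots> = b" unfolding k_def using ray_cube[of b "\<lambda>\<mu>. Bcr \<mu> 1" x] b h by simp
    finally show "Bcr (x * k x) (k x) = b" .
  qed
  have dom: "(\<mu> * k \<mu>, k \<mu>) \<in> Dop" using A[OF mu] A1 mu by (simp add: Dop_def)
  obtain k' where k': "(k has_real_derivative k') (at \<mu>)" "k' < 0"
    unfolding k_def
    by (rule ray_deriv[OF deriv_Acr1(2)[OF mu], of b]) (use b Acr_Bcr_pos(2)[OF mu] deriv_Acr1(4)[OF mu] in auto)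
  have d': "((\<lambda>\<mu>. \<mu> * k \<mu>) has_real_derivative 1 * k \<mu> + k' * \<mu>) (at \<mu>)"
    by (rule DERIV_mult[OF DERIV_ident k'(1)])
  define d'' where "d'' = 1 * k \<mu> + k' * \<mu>"
  have dk: "0 < \<mu> * k \<mu>" "\<mu> * k \<mu> < k \<mu>" using Dop_props[OF dom] by auto
  note cr = crit_order[OF dk]
  let ?g = "critp (\<mu> * k \<mu>) (k \<mu>)" and ?f = "critm (\<mu> * k \<mu>) (k \<mu>)"
  have ev: "\<forall>\<^sub>F x in nhds \<mu>. Bcr (x * k x) (k x) = b"
  proof -
    have "\<forall>\<^sub>F x in nhds \<mu>. x \<in> {0<..<1}" by (rule eventually_nhds_in_open) (use mu in auto)
    then show ?thesis by eventually_elim (use A(1) in auto)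
  qed
  have z: "d'' / (\<mu> * k \<mu> - ?f) + k' / (k \<mu> - ?f) = 0"
  proof -
    have "((\<lambda>x. Bcr (x * k x) (k x)) has_real_derivative 0) (at \<mu>)"
      using DERIV_cong_ev[OF refl ev refl, of 0] by simp
    from DERIV_unique[OF Acr_Bcr_deriv(2)[OF d' k'(1) dk] this]
    show ?thesis using A(1)[OF mu] b unfolding d''_def by simp
  qed
  \<comment> \<open>As \<open>k\<close> falls, constancy of \<open>B\<close> forces \<open>d\<close>
    to rise.\<close>
  have "k' / (k \<mu> - ?f) < 0" using k'(2) cr by (intro divide_neg_pos) auto
  then have "0 < d'' / (\<mu> * k \<mu> - ?f)" using z by linarith
  then have d''pos: "0 < d''" using cr by (simp add: zero_less_divide_iff)
  have neg: "k' / (k \<mu> - ?g) - d'' / (?g - \<mu> * k \<mu>) < 0"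
  proof -
    have "k' / (k \<mu> - ?g) < 0" using k'(2) cr by (intro divide_neg_pos) auto
    moreover have "0 < d'' / (?g - \<mu> * k \<mu>)" using d''pos cr by simp
    ultimately show ?thesis by linarith
  qed
  have T: "((\<lambda>\<mu>. Tf c (\<mu> * k \<mu>) (k \<mu>)) has_real_derivative
      Xw c (\<mu> * k \<mu>) (k \<mu>) * (k' / (k \<mu> - ?g) - d'' / (?g - \<mu> * k \<mu>))) (at \<mu>)" if "c = c2 \<or> c = c3" for c
    using Tf_path_deriv[OF d' k'(1) dom that] z unfolding d''_def by simp
  show "\<exists>D. ((\<lambda>\<mu>. Tf c2 (\<mu> * k \<mu>) (k \<mu>)) has_real_derivative D) (at \<mu>) \<and> D < 0"
    using T[of c2] mult_pos_neg[OF XY_signs(1)[OF dom] neg] by blast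
  show "\<exists>D. ((\<lambda>\<mu>. Tf c3 (\<mu> * k \<mu>) (k \<mu>)) has_real_derivative D) (at \<mu>) \<and> 0 < D"
    using T[of c3] mult_neg_neg[OF XY_signs(3)[OF dom] neg] by blast
qed

text \<open>\<open>A\<close> and \<open>B\<close> are \<open>k^3\<close> times a decreasing and an
  increasing function of \<open>d/k\<close>. If the ratio did not grow, the inequalities would
  squeeze \<open>k1^3 = k2^3\<close> and leave no room for the strict one.\<close>

lemma ratio_less_iff:
  assumes "(d1, k1) \<in> Dop" "(d2, k2) \<in> Dop" "Acr d2 k2 \<le> Acr d1 k1" "Bcr d1 k1 \<le> Bcr d2 k2"
    "Acr d2 k2 < Acr d1 k1 \<or> Bcr d1 k1 < Bcr d2 k2"
  shows "d1 / k1 < d2 / k2"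
proof (rule ccontr)
  assume n: "\<not> d1 / k1 < d2 / k2"
  note o1 = Dop_props[OF assms(1)] and o2 = Dop_props[OF assms(2)]
  define x y where "x = d2 / k2" and "y = d1 / k1"
  have xy: "0 < x" "x \<le> y" "y < 1" "0 < y" "x < 1" using n o1 o2 by (auto simp: x_def y_def)
  have AB: "Acr y 1 \<le> Acr x 1" "Bcr x 1 \<le> Bcr y 1"
    using Acr1_strict_decreasing[of x y] xy by (cases "x = y"; force)+
  have p: "0 < Acr y 1" "0 < Bcr x 1" using Acr_Bcr_pos[of y 1] Acr_Bcr_pos[of x 1] xy by auto
  have k: "0 < k1^3" "0 < k2^3" using o1 o2 by auto
  have 1: "k2^3 * Acr x 1 \<le> k1^3 * Acr y 1" "k1^3 * Bcr y 1 \<le> k2^3 * Bcr x 1"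
    "k2^3 * Acr x 1 < k1^3 * Acr y 1 \<or> k1^3 * Bcr y 1 < k2^3 * Bcr x 1"
    using assms(3-5) unfolding AB_ray[OF o1(1,2)] AB_ray[OF o2(1,2)] x_def y_def by auto
  have "k2^3 * Acr y 1 \<le> k2^3 * Acr x 1" "k1^3 * Bcr x 1 \<le> k1^3 * Bcr y 1" using AB k by auto
  then have 2: "k2^3 * Acr y 1 \<le> k1^3 * Acr y 1" "k1^3 * Bcr x 1 \<le> k2^3 * Bcr x 1"
    "k2^3 * Acr y 1 < k1^3 * Acr y 1 \<or> k1^3 * Bcr x 1 < k2^3 * Bcr x 1"
    using 1 by linarith+
  have "k2^3 \<le> k1^3" "k1^3 \<le> k2^3" using 2(1,2) p by auto
  then show False using 2(3) by auto
qed

lemma mono_B: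
  assumes "(d1, k1) \<in> Dop" "(d2, k2) \<in> Dop" "Acr d1 k1 = Acr d2 k2" "Bcr d1 k1 < Bcr d2 k2" "c = c2 \<or> c = c3"
  shows "Tf c d2 k2 < Tf c d1 k1"
proof -
  note o1 = Dop_props[OF assms(1)] and o2 = Dop_props[OF assms(2)]
  define a where "a = Acr d1 k1"
  define k where "k = ray (\<lambda>\<mu>. Acr \<mu> 1) a"
  have lt: "d1 / k1 < d2 / k2" by (rule ratio_less_iff[OF assms(1,2)]) (use assms(3,4) in auto)
  have b: "0 < d1 / k1" "d2 / k2 < 1" using o1 o2 by auto
  have "Tf c (d2/k2 * k (d2/k2)) (k (d2/k2)) < Tf c (d1/k1 * k (d1/k1)) (k (d1/k1))"
  proof (rule DERIV_neg_imp_decreasing[OF lt])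
    fix t assume "d1 / k1 \<le> t" "t \<le> d2 / k2"
    then have "0 < t" "t < 1" using b by linarith+
    from constant_A_path(3)[OF _ this assms(5), of a]
    show "\<exists>y. ((\<lambda>a. Tf c (a * k a) (k a)) has_real_derivative y) (at t) \<and> y < 0"
      unfolding k_def a_def using o1(3) by simp
  qed
  moreover have "k (d1/k1) = k1"
    unfolding k_def a_def AB_ray[OF o1(1,2)] by (rule ray_eq) (use o1 Acr_Bcr_pos(1)[of "d1/k1" 1] in auto)
  moreover have "k (d2/k2) = k2"
    unfolding k_def a_def assms(3) AB_ray[OF o2(1,2)] by (rule ray_eq) (use o2 Acr_Bcr_pos(1)[of "d2/k2" 1] in auto)
  ultimately show ?thesis using o1 o2 by simp
qed

lemma mono_A:
  assumes "(d1, k1) \<in> Dop" "(d2, k2) \<in> Dop" "Bcr d1 k1 = Bcr d2 k2" "Acr d2 k2 < Acr d1 k1"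
  shows "Tf c2 d2 k2 < Tf c2 d1 k1" "Tf c3 d1 k1 < Tf c3 d2 k2"
proof -
  note o1 = Dop_props[OF assms(1)] and o2 = Dop_props[OF assms(2)]
  define b where "b = Bcr d1 k1"
  have b0: "0 < b" unfolding b_def by (rule Acr_Bcr_pos(2)[OF o1(1,2)])
  define k where "k = ray (\<lambda>\<mu>. Bcr \<mu> 1) b"
  have lt: "d1 / k1 < d2 / k2" by (rule ratio_less_iff[OF assms(1,2)]) (use assms(3,4) in auto)
  have r: "0 < d1 / k1" "d2 / k2 < 1" "0 < d2 / k2" using o1 o2 by auto
  have k1: "k (d1/k1) = k1"
    unfolding k_def b_def AB_ray[OF o1(1,2)] by (rule ray_eq) (use o1 Acr_Bcr_pos(2)[of "d1/k1" 1] in auto)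
  have k2: "k (d2/k2) = k2"
    unfolding k_def b_def assms(3) AB_ray[OF o2(1,2)] by (rule ray_eq) (use o2 Acr_Bcr_pos(2)[of "d2/k2" 1] in auto)
  have kx: "0 < k x" "Acr (x * k x) (k x) = b * (Acr x 1 / Bcr x 1)" if "0 < x" "x < 1" for x
  proof -
    have h: "0 < Bcr x 1" using Acr_Bcr_pos(2)[OF that] .
    show kp: "0 < k x" unfolding k_def using b0 h by (intro ray_pos) auto
    have "Acr (x * k x) (k x) = k x ^ 3 * Acr x 1" using Acr_scale[of "k x" x 1] kp by (simp add: mult.commute)
    also have "k x ^ 3 = b / Bcr x 1" unfolding k_def using ray_cube[of b "\<lambda>\<mu>. Bcr \<mu> 1" x] b0 h by simp
    finally show "Acr (x * k x) (k x) = b * (Acr x 1 / Bcr x 1)" by simp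
  qed
  \<comment> \<open>On this level curve of \<open>B\<close>, \<open>A\<close> is \<open>b\<close>
    times a quotient that decreases with the ratio, so it stays at or above its final value
    \<open>Acr d2 k2\<close>, which exceeds 1.\<close>
  have A1: "1 < Acr (t * k t) (k t)" if t: "d1 / k1 \<le> t" "t \<le> d2 / k2" for t
  proof -
    have tb: "0 < t" "t < 1" using t r by linarith+
    let ?y = "d2 / k2"
    have "Acr ?y 1 \<le> Acr t 1" "Bcr t 1 \<le> Bcr ?y 1"
      using Acr1_strict_decreasing[of t ?y] t tb r by (cases "t = ?y"; force)+
    then have "Acr ?y 1 / Bcr ?y 1 \<le> Acr t 1 / Bcr t 1"
      using Acr_Bcr_pos[of t 1] Acr_Bcr_pos[of ?y 1] tb r by (intro frac_le) auto
    then have "b * (Acr ?y 1 / Bcr ?y 1) \<le> b * (Acr t 1 / Bcr t 1)" using b0 by (intro mult_left_mono) auto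
    then have "Acr (?y * k ?y) (k ?y) \<le> Acr (t * k t) (k t)" using kx(2)[OF tb] kx(2)[OF r(3,2)] by simp
    moreover have "?y * k ?y = d2" "k ?y = k2" using k2 o2 by auto
    ultimately show ?thesis using o2(3) by simp
  qed
  have "Tf c2 (d2/k2 * k (d2/k2)) (k (d2/k2)) < Tf c2 (d1/k1 * k (d1/k1)) (k (d1/k1))"
  proof (rule DERIV_neg_imp_decreasing[OF lt])
    fix t assume t: "d1 / k1 \<le> t" "t \<le> d2 / k2"
    then have tb: "0 < t" "t < 1" using r by linarith+
    show "\<exists>y. ((\<lambda>a. Tf c2 (a * k a) (k a)) has_real_derivative y) (at t) \<and> y < 0"
      using constant_B_path(1)[OF b0 tb] A1[OF t] unfolding k_def by blast
  qed
  then show "Tf c2 d2 k2 < Tf c2 d1 k1" using k1 k2 o1 o2 by simp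
  have "Tf c3 (d1/k1 * k (d1/k1)) (k (d1/k1)) < Tf c3 (d2/k2 * k (d2/k2)) (k (d2/k2))"
  proof (rule DERIV_pos_imp_increasing[OF lt])
    fix t assume t: "d1 / k1 \<le> t" "t \<le> d2 / k2"
    then have tb: "0 < t" "t < 1" using r by linarith+
    show "\<exists>y. ((\<lambda>a. Tf c3 (a * k a) (k a)) has_real_derivative y) (at t) \<and> 0 < y"
      using constant_B_path(2)[OF b0 tb] A1[OF t] unfolding k_def by blast
  qed
  then show "Tf c3 d1 k1 < Tf c3 d2 k2" using k1 k2 o1 o2 by simp
qed

text \<open>The ratio \<open>x = d/k\<close> must solve \<open>a * Bcr x 1 = b * Acr x 1\<close>. At
  \<open>x = 0\<close> the left side vanishes and at \<open>x = 1\<close> the right side does, so an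
  intermediate value exists; the scale \<open>k\<close> is then set by \<open>ray\<close>.\<close>

lemma ex_AB:
  assumes "1 < a" "0 < b"
  obtains d k where "(d, k) \<in> Dop" "Acr d k = a" "Bcr d k = b"
proof -
  define h where "h x = a * Bcr x 1 - b * Acr x 1" for x
  have v: "critp 0 1 = 2/3" "critm 0 1 = 0" "critp 1 1 = 1" "critm 1 1 = 1/3"
    by (simp_all add: critp_def critm_def)
  have h0: "h 0 < 0" unfolding h_def Acr_def Bcr_def Qc_def v using assms by simp
  have h1: "0 < h 1" unfolding h_def Acr_def Bcr_def Qc_def v using assms by simp
  have "continuous_on {0..1} h"
    unfolding h_def Acr_def Bcr_def Qc_def critp_def critm_def by (intro continuous_intros) auto
  with h0 h1 obtain x where x: "0 \<le> x" "x \<le> 1" "h x = 0"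
    using IVT'[of h 0 0 1] by auto
  then have x': "0 < x" "x < 1" using h0 h1 by (auto simp: less_le)
  define k where "k = ray (\<lambda>\<mu>. Acr \<mu> 1) a x"
  note P = Acr_Bcr_pos[OF x']
  have dom: "(x * k, k) \<in> Dop" "Acr (x * k) k = a"
    unfolding k_def by (rule constant_A_path(1)[OF assms(1) x', of c2], simp)
      (rule constant_A_path(2)[OF assms(1) x', of c2], simp)
  have k0: "0 < k" using Dop_props[OF dom(1)] by auto
  have "Bcr (x * k) k = k^3 * Bcr x 1" using Bcr_scale[of k x 1] k0 by (simp add: mult.commute)
  also have "k^3 = a / Acr x 1" unfolding k_def using ray_cube[of a "\<lambda>\<mu>. Acr \<mu> 1" x] assms P by simp
  also have "a / Acr x 1 * Bcr x 1 = b" using x(3) P by (simp add: h_def field_simps)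
  finally show ?thesis using that dom by blast
qed

lemma AB_determine_point:
  assumes p1: "(d1, k1) \<in> Dop" and p2: "(d2, k2) \<in> Dop"
    and A: "Acr d1 k1 = Acr d2 k2" and B: "Bcr d1 k1 = Bcr d2 k2"
  shows "d1 = d2 \<and> k1 = k2"
proof -
  note o1 = Dop_props[OF p1] and o2 = Dop_props[OF p2]
  have "\<not> d1 / k1 < d2 / k2" if l: "(d1, k1) \<in> Dop" "(d2, k2) \<in> Dop" "Acr d1 k1 = Acr d2 k2" "Bcr d1 k1 = Bcr d2 k2" for d1 k1 d2 k2
  proof
    assume l': "d1 / k1 < d2 / k2"
    note o1 = Dop_props[OF l(1)] and o2 = Dop_props[OF l(2)]
    have s: "Acr (d2/k2) 1 < Acr (d1/k1) 1" "Bcr (d1/k1) 1 < Bcr (d2/k2) 1"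
      using Acr1_strict_decreasing[of "d1/k1" "d2/k2"] l' o1 o2 by auto
    have e: "k1^3 * Acr (d1/k1) 1 = k2^3 * Acr (d2/k2) 1" "k1^3 * Bcr (d1/k1) 1 = k2^3 * Bcr (d2/k2) 1"
      using l(3,4) AB_ray[of d1 k1] AB_ray[of d2 k2] o1 o2 by auto
    have p: "0 < k1^3" "0 < k2^3" "0 < Acr (d2/k2) 1" "0 < Bcr (d1/k1) 1"
      using o1 o2 Acr_Bcr_pos[of "d1/k1" 1] Acr_Bcr_pos[of "d2/k2" 1] by auto
    have "k1^3 * Acr (d2/k2) 1 < k2^3 * Acr (d2/k2) 1"
      using mult_strict_left_mono[OF s(1) p(1)] e(1) by simp
    moreover have "k2^3 * Bcr (d1/k1) 1 < k1^3 * Bcr (d1/k1) 1"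
      using mult_strict_left_mono[OF s(2) p(2)] e(2) by simp
    ultimately show False using p by simp
  qed
  from this[OF p1 p2 A B] this[OF p2 p1 A[symmetric] B[symmetric]]
  have r: "d1 / k1 = d2 / k2" by linarith
  have "k1^3 * Acr (d2/k2) 1 = k2^3 * Acr (d2/k2) 1"
    using A AB_ray(1)[of d1 k1] AB_ray(1)[of d2 k2] o1 o2 r by auto
  then have k: "k1 = k2" using Acr_Bcr_pos(1)[of "d2/k2" 1] o1 o2 by (simp add: power_eq_iff_eq_base)
  then show ?thesis using r o2 by simp
qed

text \<open>The two points are joined through the corner with the \<open>A\<close> of one and the
  \<open>B\<close> of the other. Along constant \<open>B\<close> the periods move in opposite
  directions and along constant \<open>A\<close> in the same direction, so the two moves cannot
  restore both periods.\<close>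

lemma T_injective:
  assumes p1: "(d1, k1) \<in> Dop" and p2: "(d2, k2) \<in> Dop"
    and eq: "Tf c2 d1 k1 = Tf c2 d2 k2" "Tf c3 d1 k1 = Tf c3 d2 k2"
  shows "d1 = d2 \<and> k1 = k2"
proof -
  have False if p1: "(d1, k1) \<in> Dop" and p2: "(d2, k2) \<in> Dop"
    and eq: "Tf c2 d1 k1 = Tf c2 d2 k2" "Tf c3 d1 k1 = Tf c3 d2 k2" and lt: "Acr d1 k1 < Acr d2 k2"
    for d1 k1 d2 k2
  proof -
    note o1 = Dop_props[OF p1] and o2 = Dop_props[OF p2]
    obtain d k where p3: "(d, k) \<in> Dop" "Acr d k = Acr d2 k2" "Bcr d k = Bcr d1 k1"
      using ex_AB[OF o2(3) Acr_Bcr_pos(2)[OF o1(1,2)]] .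
    have m: "Tf c2 d1 k1 < Tf c2 d k" "Tf c3 d k < Tf c3 d1 k1"
      using mono_A[OF p3(1) p1] p3 lt by auto
    consider "Bcr d k < Bcr d2 k2" | "Bcr d k = Bcr d2 k2" | "Bcr d2 k2 < Bcr d k" by linarith
    then show False
    proof cases
      case 1
      from mono_B[OF p3(1) p2 p3(2) 1, of c3] m eq show False by simp
    next
      case 2
      from AB_determine_point[OF p3(1) p2 p3(2) 2] m eq show False by simp
    next
      case 3
      from mono_B[OF p2 p3(1) p3(2)[symmetric] 3, of c2] m eq show False by simp
    qed
  qed
  from this[OF p1 p2 eq] this[OF p2 p1 eq[symmetric]] have A: "Acr d1 k1 = Acr d2 k2"
    using less_linear[of "Acr d1 k1" "Acr d2 k2"] by blast
  have B: "Bcr d1 k1 = Bcr d2 k2"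
  proof (rule ccontr)
    assume "Bcr d1 k1 \<noteq> Bcr d2 k2"
    then consider "Bcr d1 k1 < Bcr d2 k2" | "Bcr d2 k2 < Bcr d1 k1" by linarith
    then show False
    proof cases
      case 1
      from mono_B[OF p1 p2 A this, of c2] eq show False by simp
    next
      case 2
      from mono_B[OF p2 p1 A[symmetric] this, of c2] eq show False by simp
    qed
  qed
  show ?thesis by (rule AB_determine_point[OF p1 p2 A B])
qed

section \<open>The sum of the two periods\<close>

lemma recip_lagrange:
  fixes n d :: real
  assumes n: "0 < n" and d: "0 \<le> d"
  shows "((\<lambda>\<theta>. 1 / (n + d * (sin \<theta>)^2)) has_integral pi / (2 * sqrt (n * (n + d)))) {0..pi/2}"
proof -
  define w where "w = sqrt (n * (n + d))"
  have w: "0 < w" "w * w = n * (n + d)" using assms by (auto simp: w_def)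
  define \<rho> where "\<rho> = w / n"
  have rho: "0 < \<rho>" "\<rho> * \<rho> = (n + d) / n" using w n by (auto simp: \<rho>_def field_simps)
  \<comment> \<open>A continuous form of \<open>arctan (\<rho> tan \<theta>) / w\<close>: the
    difference \<open>arctan (\<rho> tan \<theta>) - \<theta>\<close> is rewritten by the
    subtraction formula, which removes the pole of the tangent at \<open>pi/2\<close>.\<close>
  define F where "F \<theta> = (\<theta> + arctan ((\<rho> - 1) * (sin \<theta> * cos \<theta>) / ((cos \<theta>)^2 + \<rho> * (sin \<theta>)^2))) / w" for \<theta>
  have dF: "(F has_real_derivative 1 / (n + d * (sin \<theta>)^2)) (at \<theta>)" for \<theta>
  proof -
    define s c where "s = sin \<theta>" and "c = cos \<theta>"
    define N E where "N = (\<rho> - 1) * (s * c)" and "E = c^2 + \<rho> * s^2"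
    have sc: "c * c = 1 - s * s" using cos_squared_eq[of \<theta>] by (simp add: s_def c_def power2_eq_square)
    have E: "0 < E"
    proof (cases "s = 0")
      case True then show ?thesis using sc by (simp add: E_def power2_eq_square)
    next
      case False then show ?thesis unfolding E_def using rho by (intro add_nonneg_pos mult_pos_pos) auto
    qed
    have dN: "((\<lambda>\<theta>. (\<rho> - 1) * (sin \<theta> * cos \<theta>)) has_real_derivative (\<rho> - 1) * (c * c - s * s)) (at \<theta>)"
      unfolding s_def c_def by (auto intro!: derivative_eq_intros)
    have dE: "((\<lambda>\<theta>. (cos \<theta>)^2 + \<rho> * (sin \<theta>)^2) has_real_derivative 2 * (\<rho> - 1) * (s * c)) (at \<theta>)"
      unfolding s_def c_def by (auto intro!: derivative_eq_intros simp: algebra_simps)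
    have dq: "((\<lambda>\<theta>. (\<rho> - 1) * (sin \<theta> * cos \<theta>) / ((cos \<theta>)^2 + \<rho> * (sin \<theta>)^2)) has_real_derivative
        ((\<rho> - 1) * (c * c - s * s) * E - N * (2 * (\<rho> - 1) * (s * c))) / (E * E)) (at \<theta>)"
      using DERIV_divide[OF dN dE] E by (simp add: N_def E_def s_def c_def)
    have "((\<lambda>\<theta>. arctan ((\<rho> - 1) * (sin \<theta> * cos \<theta>) / ((cos \<theta>)^2 + \<rho> * (sin \<theta>)^2))) has_real_derivative
       inverse (1 + (N / E)^2) * (((\<rho> - 1) * (c * c - s * s) * E - N * (2 * (\<rho> - 1) * (s * c))) / (E * E))) (at \<theta>)"
      using DERIV_chain2[OF DERIV_arctan dq] by (simp add: N_def E_def s_def c_def)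
    from DERIV_cdivide[OF DERIV_add[OF DERIV_ident this], of w]
    have dF0: "(F has_real_derivative
       (1 + inverse (1 + (N / E)^2) * (((\<rho> - 1) * (c * c - s * s) * E - N * (2 * (\<rho> - 1) * (s * c))) / (E * E))) / w) (at \<theta>)"
      unfolding F_def .
    define C S where "C = c * c" and "S = s * s"
    have C: "C = 1 - S" using sc by (simp add: C_def S_def)
    have S0: "0 \<le> S" "0 \<le> C" by (simp_all add: C_def S_def)
    have EN: "E * E + N * N = C + \<rho> * \<rho> * S"
    proof -
      have "E * E + N * N = (C + \<rho> * S) * (C + \<rho> * S) + (\<rho> - 1) * (\<rho> - 1) * (S * C)"
        by (simp add: E_def N_def C_def S_def power2_eq_square algebra_simps)
      then show ?thesis unfolding C by (simp add: algebra_simps)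
    qed
    have num: "(\<rho> - 1) * (c * c - s * s) * E - N * (2 * (\<rho> - 1) * (s * c)) = (\<rho> - 1) * (C - \<rho> * S)"
    proof -
      have "(\<rho> - 1) * (c * c - s * s) * E - N * (2 * (\<rho> - 1) * (s * c))
          = (\<rho> - 1) * ((C - S) * (C + \<rho> * S) - 2 * (\<rho> - 1) * (S * C))"
        by (simp add: E_def N_def C_def S_def power2_eq_square algebra_simps)
      also have "(C - S) * (C + \<rho> * S) - 2 * (\<rho> - 1) * (S * C) = C - \<rho> * S" unfolding C by (simp add: algebra_simps)
      finally show ?thesis .
    qed
    have pos: "0 < C + \<rho> * \<rho> * S" unfolding EN[symmetric] using E by (intro add_pos_nonneg) auto
    have "1 + inverse (1 + (N / E)^2) * (((\<rho> - 1) * (C - \<rho> * S)) / (E * E))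
        = 1 + ((\<rho> - 1) * (C - \<rho> * S)) / (E * E + N * N)"
    proof -
      have "1 + (N / E)^2 = (E * E + N * N) / (E * E)" using E by (simp add: power2_eq_square add_divide_distrib)
      then show ?thesis using E by simp
    qed
    also have "\<dots> = (C + \<rho> * \<rho> * S + (\<rho> - 1) * (C - \<rho> * S)) / (C + \<rho> * \<rho> * S)"
      unfolding EN using pos by (simp add: add_divide_distrib)
    also have "C + \<rho> * \<rho> * S + (\<rho> - 1) * (C - \<rho> * S) = \<rho>" unfolding C by (simp add: algebra_simps)
    also have "C + \<rho> * \<rho> * S = (n + d * S) / n" unfolding rho(2) C using n by (simp add: field_simps)
    finally have "(1 + inverse (1 + (N / E)^2) * (((\<rho> - 1) * (C - \<rho> * S)) / (E * E))) / w = \<rho> / ((n + d * S) / n) / w" by simp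
    also have "\<dots> = 1 / (n + d * S)" unfolding \<rho>_def using w n by simp
    finally have "(1 + inverse (1 + (N / E)^2) * (((\<rho> - 1) * (C - \<rho> * S)) / (E * E))) / w = 1 / (n + d * S)" .
    then show ?thesis using dF0 unfolding num by (simp add: S_def s_def power2_eq_square)
  qed
  have "((\<lambda>\<theta>. 1 / (n + d * (sin \<theta>)^2)) has_integral F (pi/2) - F 0) {0..pi/2}"
    by (rule fundamental_theorem_of_calculus, simp)
      (rule has_vector_derivative_at_within[OF dF[unfolded has_real_derivative_iff_has_vector_derivative]])
  moreover have "F (pi/2) - F 0 = pi / (2 * w)" by (simp add: F_def)
  ultimately show ?thesis by (simp add: w_def)
qed

text \<open>By Vieta the third root is determined by the sum \<open>d + k\<close>. The difference of
  the two cubics is then linear and vanishes at \<open>c2\<close> and \<open>c3\<close>, so it is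
  zero. The product of the roots is \<open>-1\<close>, which makes the third root negative.\<close>

lemma third_root:
  assumes "(d, k) \<in> Dop"
  defines "c1 \<equiv> d + k - c2 d k - c3 d k"
  shows "Qc d k V + 1 = (V - c1) * (V - c2 d k) * (V - c3 d k)"
    "Qc' d k V = (V - c1) * (V - c2 d k) + (V - c1) * (V - c3 d k) + (V - c2 d k) * (V - c3 d k)"
    "c1 < 0"
proof -
  note o = Dop_props[OF assms(1)] and c = c_props[OF Dop_props(4,2,5)[OF assms(1)]]
  define x y where "x = c2 d k" and "y = c3 d k"
  have xy: "x \<noteq> y" "0 < x" "0 < y" using c(3,7,8) o by (auto simp: x_def y_def)
  have c1: "c1 = d + k - x - y" by (simp add: c1_def x_def y_def)
  define \<alpha> \<beta> where "\<alpha> = d * k - (c1 * x + c1 * y + x * y)" and "\<beta> = 1 + c1 * x * y"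
  have P: "Qc d k V + 1 - (V - c1) * (V - x) * (V - y) = \<alpha> * V + \<beta>" for V
    unfolding \<alpha>_def \<beta>_def c1 Qc_def by (simp add: algebra_simps)
  have "\<alpha> * x + \<beta> = 0" "\<alpha> * y + \<beta> = 0" using P[of x] P[of y] c(1,2) by (simp_all add: x_def y_def)
  moreover have "\<alpha> * (x - y) = (\<alpha> * x + \<beta>) - (\<alpha> * y + \<beta>)" by (simp add: algebra_simps)
  ultimately have "\<alpha> * (x - y) = 0" by simp
  then have \<alpha>: "\<alpha> = 0" using xy by simp
  then have \<beta>: "\<beta> = 0" using \<open>\<alpha> * x + \<beta> = 0\<close> by simp
  show "Qc d k V + 1 = (V - c1) * (V - c2 d k) * (V - c3 d k)"
    using P[of V] \<alpha> \<beta> by (simp add: x_def y_def)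
  have dk: "d * k = c1 * x + c1 * y + x * y" using \<alpha> by (simp add: \<alpha>_def)
  show "Qc' d k V = (V - c1) * (V - c2 d k) + (V - c1) * (V - c3 d k) + (V - c2 d k) * (V - c3 d k)"
    unfolding Qc'_def dk x_def[symmetric] y_def[symmetric] c1 by (simp add: power2_eq_square algebra_simps)
  have "c1 * (x * y) = -1" using \<beta> by (simp add: \<beta>_def algebra_simps)
  moreover have "0 < x * y" using xy by simp
  ultimately show "c1 < 0" using mult_nonneg_nonneg[of c1 "x * y"] by linarith
qed

text \<open>The integrand comes from the differential of \<open>arctan Y\<close>, and
  \<open>Y\<close> vanishes at both ends. As \<open>Q' / (1 + Q)\<close> is also the sum of the
  simple fractions at the three roots, their periods add up to zero.\<close>

lemma EI_arctan:
  assumes dk: "0 \<le> d" "d < k"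
  shows "EI d k (\<lambda>V. Qc' d k V / (1 + Qc d k V)) = 0"
proof -
  have dA: "((\<lambda>\<theta>. arctan (Yc d k \<theta>)) has_real_derivative
      (Qc' d k (d * (sin \<theta>)^2) / (1 + Qc d k (d * (sin \<theta>)^2))) / sqrt (k - d * (sin \<theta>)^2)) (at \<theta>)" for \<theta>
    by (rule DERIV_cong[OF DERIV_chain2[OF DERIV_arctan Yc_deriv[OF dk]]]) (simp add: Yc_sq[OF dk] divide_inverse)
  have "((\<lambda>\<theta>. (Qc' d k (d * (sin \<theta>)^2) / (1 + Qc d k (d * (sin \<theta>)^2))) / sqrt (k - d * (sin \<theta>)^2)) has_integral
     arctan (Yc d k (pi/2)) - arctan (Yc d k 0)) {0..pi/2}"
    by (rule fundamental_theorem_of_calculus, simp)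
      (rule has_vector_derivative_at_within[OF dA[unfolded has_real_derivative_iff_has_vector_derivative]])
  from integral_unique[OF this] show ?thesis unfolding EI_def Yc_ends by simp
qed

lemma recip_sum:
  fixes a b c :: real
  assumes "a \<noteq> 0" "b \<noteq> 0" "c \<noteq> 0"
  shows "1 / a + 1 / b + 1 / c = - ((a * b + a * c + b * c) / (- (a * b * c)))"
  using assms by (simp add: field_simps)

lemma EI_sum_zero:
  assumes "(d, k) \<in> Dop"
  defines "c1 \<equiv> d + k - c2 d k - c3 d k"
  shows "EI d k (\<lambda>V. 1 / (c1 - V)) + EI d k (\<lambda>V. 1 / (c2 d k - V)) + EI d k (\<lambda>V. 1 / (c3 d k - V)) = 0"
proof -
  note o = Dop_props[OF assms(1)] and c = c_props[OF Dop_props(4,2,5)[OF assms(1)]]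
  note t = third_root[OF assms(1), folded c1_def]
  have nz: "c1 - V \<noteq> 0" "c2 d k - V \<noteq> 0" "c3 d k - V \<noteq> 0" if "0 \<le> V" "V \<le> d" for V
    using that t(3) c(3,4,5) by auto
  have "EI d k (\<lambda>V. 1 / (c1 - V)) + EI d k (\<lambda>V. 1 / (c2 d k - V)) + EI d k (\<lambda>V. 1 / (c3 d k - V))
    = EI d k (\<lambda>V. 1 / (c1 - V) + 1 / (c2 d k - V) + 1 / (c3 d k - V))"
    by (subst EI_add[OF o(4,2)]; (subst EI_add[OF o(4,2)])?; (intro continuous_intros ballI)?; use nz in auto)
  also have "\<dots> = EI d k (\<lambda>V. - 1 * (Qc' d k V / (1 + Qc d k V)))"
  proof (rule EI_cong[OF o(4)])
    fix V assume V: "0 \<le> V" "V \<le> d"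
    have a: "1 + Qc d k V = - ((c1 - V) * (c2 d k - V) * (c3 d k - V))"
      using t(1)[of V] by (simp add: algebra_simps)
    have b: "Qc' d k V = (c1 - V) * (c2 d k - V) + (c1 - V) * (c3 d k - V) + (c2 d k - V) * (c3 d k - V)"
      using t(2)[of V] by (simp add: algebra_simps)
    show "1 / (c1 - V) + 1 / (c2 d k - V) + 1 / (c3 d k - V) = - 1 * (Qc' d k V / (1 + Qc d k V))"
      unfolding a b recip_sum[OF nz[OF V]] by (simp only: mult_minus1)
  qed
  also have "\<dots> = - 1 * EI d k (\<lambda>V. Qc' d k V / (1 + Qc d k V))" by (rule EI_cmult)
  also have "\<dots> = 0" unfolding EI_arctan[OF o(4,2)] by simp
  finally show ?thesis .
qed

lemma period_sum:
  assumes "(d, k) \<in> Dop"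
  obtains n where "0 < n" "n * (n + d) * (n + k) = 1" "Tf c2 d k + Tf c3 d k = EI d k (\<lambda>V. 1 / (n + V)) / pi"
    "n = c2 d k + c3 d k - d - k"
proof -
  note o = Dop_props[OF assms(1)] and c = c_props[OF Dop_props(4,2,5)[OF assms(1)]]
  note t = third_root[OF assms]
  define n where "n = c2 d k + c3 d k - d - k"
  have n: "0 < n" using t(3) by (simp add: n_def)
  have "n * (n + d) * (n + k) = 1" using t(1)[of "- n"] by (simp add: Qc_def n_def algebra_simps)
  moreover have "EI d k (\<lambda>V. 1 / (d + k - c2 d k - c3 d k - V)) = EI d k (\<lambda>V. - 1 * (1 / (n + V)))"
  proof (rule EI_cong[OF o(4)])
    fix V :: real
    have "d + k - c2 d k - c3 d k - V = - (n + V)" by (simp add: n_def)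
    then show "1 / (d + k - c2 d k - c3 d k - V) = - 1 * (1 / (n + V))" by (metis divide_minus_right mult_minus1)
  qed
  then have "EI d k (\<lambda>V. 1 / (n + V)) = EI d k (\<lambda>V. 1 / (c2 d k - V)) + EI d k (\<lambda>V. 1 / (c3 d k - V))"
    using EI_sum_zero[OF assms] unfolding EI_cmult by simp
  moreover have "Tf c2 d k = EI d k (\<lambda>V. 1 / (c2 d k - V)) / pi" "Tf c3 d k = EI d k (\<lambda>V. 1 / (c3 d k - V)) / pi"
    using Tf_EI[of d k c2] Tf_EI[of d k c3] o c(3,4,5) by auto
  ultimately show ?thesis using that[of n] n by (simp add: add_divide_distrib n_def)
qed

text \<open>Replacing \<open>sqrt (k - V)\<close> by \<open>sqrt k\<close> leaves an elementary
  integral, equal to \<open>pi / (2 sqrt (n (n + d) k))\<close>. Since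
  \<open>n (n + d) (n + k) = 1\<close>, this exceeds \<open>pi/2\<close>.\<close>

lemma period_sum_lower:
  assumes "(d, k) \<in> Dop" shows "1/2 < Tf c2 d k + Tf c3 d k"
proof -
  note o = Dop_props[OF assms(1)]
  obtain n where n: "0 < n" "n * (n + d) * (n + k) = 1" "Tf c2 d k + Tf c3 d k = EI d k (\<lambda>V. 1 / (n + V)) / pi"
    using period_sum[OF assms] by blast
  define w where "w = sqrt (n * (n + d))"
  have w: "0 < w" using n o by (simp add: w_def)
  have hi: "((\<lambda>\<theta>. 1 / (n + d * (sin \<theta>)^2) / sqrt k) has_integral pi / (2 * w) / sqrt k) {0..pi/2}"
    unfolding w_def by (rule has_integral_divide[OF recip_lagrange[OF n(1) o(4)]])
  have "pi / (2 * w) / sqrt k \<le> EI d k (\<lambda>V. 1 / (n + V))"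
  proof (rule has_integral_le[OF hi EI_has_integral[OF o(4,2)]])
    show "continuous_on {0..d} (\<lambda>V. 1 / (n + V))" by (intro continuous_intros ballI) (use n in auto)
    fix \<theta> :: real
    have V: "0 \<le> d * (sin \<theta>)^2" "d * (sin \<theta>)^2 \<le> d" using sin_sq_range[OF o(4), of \<theta>] by auto
    show "1 / (n + d * (sin \<theta>)^2) / sqrt k \<le> 1 / (n + d * (sin \<theta>)^2) / sqrt (k - d * (sin \<theta>)^2)"
    proof -
      have q: "0 < sqrt (k - d * (sin \<theta>)^2)" "sqrt (k - d * (sin \<theta>)^2) \<le> sqrt k" "0 < sqrt k"
        unfolding real_sqrt_gt_0_iff real_sqrt_le_iff using V o(1,2) by linarith+
      show ?thesis
        by (rule divide_left_mono[OF q(2) _ mult_pos_pos[OF q(3,1)]]) (use V n in simp)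
    qed
  qed
  moreover have "pi / 2 < pi / (2 * w) / sqrt k"
  proof -
    have "0 < n * (n * (n + d))" using n(1) o by (intro mult_pos_pos) auto
    moreover have "n * (n + d) * (n + k) = n * (n + d) * k + n * (n * (n + d))" by (simp add: algebra_simps)
    ultimately have "n * (n + d) * k < 1" using n(2) by linarith
    then have "w * sqrt k < 1" unfolding w_def real_sqrt_mult[symmetric] by simp
    moreover have "0 < w * sqrt k" using w o by simp
    ultimately have "1 < 1 / (w * sqrt k)" by (simp add: less_divide_eq)
    then have "pi / 2 * 1 < pi / 2 * (1 / (w * sqrt k))" by (intro mult_strict_left_mono) auto
    then show ?thesis by simp
  qed
  ultimately have "pi / 2 < EI d k (\<lambda>V. 1 / (n + V))" by linarith
  then show ?thesis unfolding n(3) by (simp add: less_divide_eq mult.commute)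
qed

lemma sqrt_gap:
  assumes "0 \<le> V" "V < k"
  shows "1 / sqrt (k - V) \<le> 1 / sqrt k + V / (k * sqrt (k - V))"
proof -
  define p q where "p = sqrt k" and "q = sqrt (k - V)"
  have pq: "0 < p" "0 < q" "q \<le> p" "p * p = k" "q * q = k - V" using assms by (auto simp: p_def q_def)
  have "q * q \<le> p * q" using pq by (intro mult_right_mono) auto
  then have "p * p - p * q \<le> V" using pq(4,5) by linarith
  then have "p * p \<le> p * q + V" by simp
  then have "(p * p) / (p * p * q) \<le> (p * q + V) / (p * p * q)" using pq by (intro divide_right_mono) auto
  then have "1 / q \<le> 1 / p + V / (p * p * q)" using pq(1,2) by (simp add: add_divide_distrib)
  then show ?thesis unfolding pq(4) by (simp add: p_def q_def)
qed

lemma sqrt_one_plus_le: "0 \<le> z \<Longrightarrow> sqrt (1 + z) \<le> 1 + z / 2" for z :: real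
  by (rule real_le_lsqrt) (simp_all add: power2_eq_square algebra_simps)

text \<open>Properness at the line \<open>x + y = 1/2\<close>: a sum of periods that stays away from
  \<open>1/2\<close> bounds \<open>k\<close>.\<close>

lemma period_sum_upper:
  assumes "(d, k) \<in> Dop" "1 \<le> k" shows "Tf c2 d k + Tf c3 d k \<le> 1/2 + 1 / sqrt k"
proof -
  note o = Dop_props[OF assms(1)] and c = c_props[OF Dop_props(4,2,5)[OF assms(1)]]
  obtain n where n: "0 < n" "n * (n + d) * (n + k) = 1" "Tf c2 d k + Tf c3 d k = EI d k (\<lambda>V. 1 / (n + V)) / pi"
    using period_sum[OF assms(1)] by blast
  define w where "w = sqrt (n * (n + d))"
  have w: "0 < w" using n o by (simp add: w_def)
  define B where "B = 1 / (k * sqrt (k - d))"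
  have hi: "((\<lambda>\<theta>. 1 / (n + d * (sin \<theta>)^2) / sqrt k + B) has_integral pi / (2 * w) / sqrt k + pi / 2 * B) {0..pi/2}"
    unfolding w_def
    using has_integral_add[OF has_integral_divide[OF recip_lagrange[OF n(1) o(4)], of "sqrt k"] has_integral_const_real[of B 0 "pi/2"]]
    by simp
  have le: "EI d k (\<lambda>V. 1 / (n + V)) \<le> pi / (2 * w) / sqrt k + pi / 2 * B"
  proof (rule has_integral_le[OF EI_has_integral[OF o(4,2)] hi])
    show "continuous_on {0..d} (\<lambda>V. 1 / (n + V))" by (intro continuous_intros ballI) (use n in auto)
    fix \<theta> :: real
    define V where "V = d * (sin \<theta>)^2"
    have V: "0 \<le> V" "V \<le> d" using sin_sq_range[OF o(4), of \<theta>] by (auto simp: V_def)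
    have Vk: "V < k" using V o by simp
    have "1 / (n + V) * (1 / sqrt (k - V)) \<le> 1 / (n + V) * (1 / sqrt k + V / (k * sqrt (k - V)))"
      using sqrt_gap[OF V(1) Vk] n V by (intro mult_left_mono) auto
    also have "\<dots> = 1 / (n + V) / sqrt k + V / (n + V) * (1 / (k * sqrt (k - V)))" by (simp add: distrib_left)
    also have "V / (n + V) * (1 / (k * sqrt (k - V))) \<le> 1 * (1 / (k * sqrt (k - d)))"
      using V n Vk o by (intro mult_mono divide_left_mono mult_left_mono) (auto simp: divide_le_eq)
    finally show "1 / (n + d * (sin \<theta>)^2) / sqrt (k - d * (sin \<theta>)^2) \<le> 1 / (n + d * (sin \<theta>)^2) / sqrt k + B"
      by (simp add: B_def V_def)
  qed
  have n1: "n \<le> 1"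
  proof (rule ccontr)
    assume "\<not> n \<le> 1"
    then have "1 < n" by simp
    then have "1 * 1 < n * (n + d)" using o(1) by (intro mult_strict_mono) auto
    then have "1 * 1 < n * (n + d) * (n + k)" using \<open>1 < n\<close> o(1,2) by (intro mult_strict_mono) auto
    then show False using n(2) by simp
  qed
  have s1: "1 / (w * sqrt k) \<le> 1 + 1 / (2 * k)"
  proof -
    have k: "0 < k" using o by simp
    have "w * sqrt k = sqrt (n * (n + d) * k)" by (simp add: w_def real_sqrt_mult)
    also have "n * (n + d) = 1 / (n + k)" using n o by (simp add: field_simps)
    also have "1 / (n + k) * k = 1 / (1 + n / k)" using n k by (simp add: field_simps)
    finally have "1 / (w * sqrt k) = sqrt (1 + n / k)" by (simp add: real_sqrt_divide)
    also have "\<dots> \<le> sqrt (1 + 1 / k)" using n1 k by (simp add: divide_right_mono)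
    also have "\<dots> \<le> 1 + (1 / k) / 2" by (rule sqrt_one_plus_le) (use k in simp)
    finally show ?thesis by simp
  qed
  \<comment> \<open>The root \<open>c2\<close> must fit between \<open>d\<close> and
    \<open>k\<close> with \<open>c2 (k - c2) (c2 - d) = 1\<close>. By the inequality of arithmetic
    and geometric means this keeps \<open>k - d\<close> from being small.\<close>
  have s2: "B \<le> 1 / sqrt k"
  proof -
    have k: "0 < k" "0 < k - d" using o by auto
    define y where "y = c2 d k"
    have y: "d < y" "y < k" "y * (k - y) * (y - d) = 1"
      using c(3,4,5,6) c_con(1)[OF o(4,2,5)] by (auto simp: y_def)
    have "4 * ((k - y) * (y - d)) \<le> (k - d) * (k - d)"
      using sum_squares_ge_zero[of "(k - y) - (y - d)" 0] by (simp add: algebra_simps)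
    moreover have "1 \<le> k * ((k - y) * (y - d))"
    proof -
      have "y * ((k - y) * (y - d)) \<le> k * ((k - y) * (y - d))" using y by (intro mult_right_mono) auto
      then show ?thesis using y(3) by (simp add: mult.assoc)
    qed
    ultimately have "4 \<le> k * ((k - d) * (k - d))"
      using mult_left_mono[of "4 * ((k - y) * (y - d))" "(k - d) * (k - d)" k] k(1)
      unfolding mult.left_commute[of k 4] by linarith
    moreover have "k * ((k - d) * (k - d)) \<le> (k * (k - d)) * (k * (k - d))"
      using mult_right_mono[OF assms(2), of "k * ((k - d) * (k - d))"] k by (simp add: mult_ac)
    ultimately have "1 * 1 \<le> (k * (k - d)) * (k * (k - d))" by simp
    moreover have "0 < k * (k - d)" using k by simp
    ultimately have "1 \<le> k * (k - d)"
      using mult_strict_mono[of "k * (k - d)" 1 "k * (k - d)" 1] by linarith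
    then have "k * 1 \<le> k * (k * (k - d))" using k by (intro mult_left_mono) auto
    then have "sqrt k \<le> sqrt (k * k * (k - d))" by (simp add: mult.assoc)
    also have "\<dots> = k * sqrt (k - d)" using k by (simp add: real_sqrt_mult)
    finally show ?thesis unfolding B_def using k by (intro divide_left_mono) auto
  qed
  have "EI d k (\<lambda>V. 1 / (n + V)) / pi \<le> (pi / (2 * w) / sqrt k + pi / 2 * B) / pi"
    using le by (intro divide_right_mono) auto
  also have "\<dots> = 1/2 * (1 / (w * sqrt k)) + 1/2 * B" by (simp add: add_divide_distrib)
  also have "\<dots> \<le> 1/2 * (1 + 1 / (2 * k)) + 1/2 * (1 / sqrt k)" using s1 s2 by (intro add_mono mult_left_mono) auto
  also have "\<dots> \<le> 1/2 + 1 / sqrt k"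
  proof -
    have "sqrt k \<le> k" using assms(2) by (simp add: real_le_lsqrt power2_eq_square)
    then have "1 / k \<le> 1 / sqrt k" using o by (intro divide_left_mono) auto
    moreover have "0 \<le> 1 / sqrt k" "1 / (2 * k) = (1 / k) / 2" using o by simp_all
    moreover have "1/2 * (1 + P / 2) + 1/2 * S \<le> 1/2 + S" if "P \<le> S" "0 \<le> S" for P S :: real
      using that by (simp add: field_simps)
    ultimately show ?thesis by (simp only:)
  qed
  finally show ?thesis unfolding n(3) .
qed

lemma T3_less_T2:
  assumes "(d, k) \<in> Dop" shows "0 < Tf c3 d k" "Tf c3 d k < Tf c2 d k"
proof -
  note o = Dop_props[OF assms(1)] and c = c_props[OF Dop_props(4,2,5)[OF assms(1)]]
  have T: "Tf c2 d k = EI d k (\<lambda>V. 1 / (c2 d k - V)) / pi" "Tf c3 d k = EI d k (\<lambda>V. 1 / (c3 d k - V)) / pi"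
    using Tf_EI[of d k c2] Tf_EI[of d k c3] o c(3,4,5) by auto
  have "0 < EI d k (\<lambda>V. 1 / (c3 d k - V))"
    by (rule EI_pos[OF o(4,2)]) (use c(3,4,5) o in \<open>auto intro!: continuous_intros\<close>)
  then show "0 < Tf c3 d k" unfolding T by simp
  have less: "1 / (c3 d k - V) < 1 / (c2 d k - V)" if "V \<le> d" for V
    using that c(3) c(7,8)[OF o(3)] by (intro divide_strict_left_mono mult_pos_pos) auto
  have "0 < EI d k (\<lambda>V. 1 * (1 / (c2 d k - V)) + - 1 * (1 / (c3 d k - V)))"
  proof (rule EI_pos[OF o(4,2)])
    show "continuous_on {0..d} (\<lambda>V. 1 * (1 / (c2 d k - V)) + - 1 * (1 / (c3 d k - V)))"
      by (intro continuous_intros ballI) (use c(3,4,5) in auto)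
    show "0 \<le> 1 * (1 / (c2 d k - V)) + - 1 * (1 / (c3 d k - V))" if "V \<le> d" for V
      using less[OF that] by linarith
    show "1 * (1 / (c2 d k - 0)) + - 1 * (1 / (c3 d k - 0)) \<noteq> 0"
      using less[of 0] o by linarith
  qed
  also have "EI d k (\<lambda>V. 1 * (1 / (c2 d k - V)) + - 1 * (1 / (c3 d k - V)))
     = 1 * EI d k (\<lambda>V. 1 / (c2 d k - V)) + - 1 * EI d k (\<lambda>V. 1 / (c3 d k - V))"
    by (rule EI_linear[OF o(4,2)]) (intro continuous_intros ballI; use c(3,4,5) in auto)+
  finally show "Tf c3 d k < Tf c2 d k" unfolding T by (simp add: divide_strict_right_mono)
qed

section \<open>The edges of the parameter domain\<close>

lemma continuous_c:
  "continuous_on Ecl (\<lambda>p. c2 (fst p) (snd p))" "continuous_on Ecl (\<lambda>p. c3 (fst p) (snd p))"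
proof -
  have r: "continuous_on Ecl (\<lambda>p. rr (fst p) (snd p))" unfolding rr_def by (intro continuous_intros) auto
  have q: "continuous_on Ecl (\<lambda>p. qq (fst p) (snd p))" unfolding qq_def by (intro continuous_intros) auto
  have nz: "2 * rr (fst p) (snd p) ^ 3 \<noteq> 0" if "p \<in> Ecl" for p
    using rr_pos[of "fst p" "snd p"] that by (auto simp: Ecl_def)
  have p: "continuous_on Ecl (\<lambda>p. pp (fst p) (snd p))"
    unfolding pp_def by (intro continuous_on_divide continuous_intros r q ballI nz)
  have a: "continuous_on Ecl (\<lambda>p. al (fst p) (snd p))"
    unfolding al_def
  proof (intro continuous_on_divide continuous_on_const continuous_on_arcsin p ballI)
    fix x assume "x \<in> Ecl"
    then have "0 \<le> fst x" "fst x < snd x" "1 \<le> Acr (fst x) (snd x)" by (auto simp: Ecl_def)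
    from pp_bounds(1,2)[OF this] show "- 1 \<le> pp (fst x) (snd x) \<and> pp (fst x) (snd x) \<le> 1" by simp
  qed simp
  show "continuous_on Ecl (\<lambda>p. c2 (fst p) (snd p))" unfolding c2_def by (intro continuous_intros r a) auto
  show "continuous_on Ecl (\<lambda>p. c3 (fst p) (snd p))" unfolding c3_def by (intro continuous_intros r a) auto
qed

lemma continuous_Tf:
  assumes c: "continuous_on Ecl (\<lambda>p. c (fst p) (snd p))" and gt: "\<And>d k. (d, k) \<in> Ecl \<Longrightarrow> d < c d k"
  shows "continuous_on Ecl (\<lambda>p. Tf c (fst p) (snd p))"
proof -
  have E: "0 \<le> fst p" "fst p < snd p" "fst p < c (fst p) (snd p)" if "p \<in> Ecl" for p
    using that gt[of "fst p" "snd p"] by (auto simp: Ecl_def)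
  have V: "0 \<le> fst p * (sin t)^2" "fst p * (sin t)^2 \<le> fst p" if "p \<in> Ecl" for p t
    using sin_sq_range[OF E(1)[OF that], of t] by auto
  have "continuous_on (Ecl \<times> cbox 0 (pi/2)) (\<lambda>(p, t). 1 / (c (fst p) (snd p) - fst p * (sin t)^2) / sqrt (snd p - fst p * (sin t)^2))"
    unfolding case_prod_beta
  proof (intro continuous_on_divide continuous_on_diff continuous_on_mult continuous_on_const continuous_on_power
      continuous_on_sin continuous_on_real_sqrt continuous_on_fst continuous_on_snd continuous_on_id ballI)
    show "continuous_on (Ecl \<times> cbox 0 (pi/2)) (\<lambda>x. c (fst (fst x)) (snd (fst x)))"
      by (rule continuous_on_compose2[OF c continuous_on_fst[OF continuous_on_id]]) auto
    fix x assume "x \<in> Ecl \<times> cbox 0 (pi/2)"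
    then have x: "fst x \<in> Ecl" by (simp add: mem_Times_iff)
    show "c (fst (fst x)) (snd (fst x)) - fst (fst x) * (sin (snd x))^2 \<noteq> 0"
      "sqrt (snd (fst x) - fst (fst x) * (sin (snd x))^2) \<noteq> 0"
      using E[OF x] V[OF x, of "snd x"] by auto
  qed
  from integral_continuous_on_param[OF this]
  have "continuous_on Ecl (\<lambda>p. EI (fst p) (snd p) (\<lambda>V. 1 / (c (fst p) (snd p) - V)) / pi)"
    unfolding EI_def by (intro continuous_on_divide continuous_on_const) auto
  then show ?thesis
    by (rule continuous_on_eq) (use E Tf_EI in auto)
qed

lemma Ecl_props: "(d, k) \<in> Ecl \<Longrightarrow> 0 \<le> d \<and> d < k \<and> 1 \<le> Acr d k"
  by (simp add: Ecl_def)

lemma continuous_T: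
  "continuous_on Ecl (\<lambda>p. Tf c2 (fst p) (snd p))" "continuous_on Ecl (\<lambda>p. Tf c3 (fst p) (snd p))"
proof -
  have gt: "d < c2 d k" "d < c3 d k" if "(d, k) \<in> Ecl" for d k
    using c_props(3,4,5)[of d k] Ecl_props[OF that] by auto
  show "continuous_on Ecl (\<lambda>p. Tf c2 (fst p) (snd p))" by (rule continuous_Tf[OF continuous_c(1) gt(1)])
  show "continuous_on Ecl (\<lambda>p. Tf c3 (fst p) (snd p))" by (rule continuous_Tf[OF continuous_c(2) gt(2)])
qed

lemma Tf_at_zero:
  assumes "0 < k" "0 < c 0 k" shows "Tf c 0 k = 1 / (2 * (c 0 k * sqrt k))"
proof -
  have "Tf c 0 k = EI 0 k (\<lambda>V. 1 / (c 0 k - V)) / pi" by (rule Tf_EI) (use assms in auto)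
  also have "EI 0 k (\<lambda>V. 1 / (c 0 k - V)) = pi / 2 * (1 / (c 0 k * sqrt k))" by (simp add: EI_def)
  finally show ?thesis by simp
qed

text \<open>At \<open>d = 0\<close> the periods are \<open>1 / (2 c sqrt k)\<close>, and the
  reciprocals of the two roots satisfy \<open>t^3 - k t + 1 = 0\<close>. Subtracting the two
  equations and dividing by the difference of the reciprocals gives
  \<open>x^2 + x y + y^2 = k\<close>.\<close>

lemma arc_value:
  assumes "0 < k" "1 < Acr 0 k"
  shows "(Tf c2 0 k)^2 + Tf c2 0 k * Tf c3 0 k + (Tf c3 0 k)^2 = 1/4"
proof -
  note c = c_props[OF order_refl assms(1) less_imp_le[OF assms(2)]] and con = c_con[OF order_refl assms(1) less_imp_le[OF assms(2)]]
  define x y where "x = 1 / c2 0 k" and "y = 1 / c3 0 k"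
  have pos: "0 < c2 0 k" "0 < c3 0 k" using c(3,4,5) by auto
  have ne: "x \<noteq> y" using c(7,8)[OF assms(2)] pos by (auto simp: x_def y_def)
  have root: "t^3 - k * t + 1 = 0" if "t = 1 / u" "0 < u" "u * (k - u) * (u - 0) = 1" for t u
  proof -
    have "t^3 - k * t + 1 = (1 - k * u * u + u * u * u) / (u * u * u)" using that(1,2) by (simp add: power3_eq_cube field_simps)
    also have "1 - k * u * u + u * u * u = 0" using that(3) by (simp add: algebra_simps)
    finally show ?thesis by simp
  qed
  have "x^3 - k * x + 1 = 0" "y^3 - k * y + 1 = 0" using root[OF x_def pos(1) con(1)] root[OF y_def pos(2) con(2)] by auto
  then have "(x - y) * (x^2 + x * y + y^2 - k) = 0" by (simp add: power2_eq_square power3_eq_cube algebra_simps)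
  then have k: "x^2 + x * y + y^2 = k" using ne by simp
  have T: "Tf c2 0 k = x / (2 * sqrt k)" "Tf c3 0 k = y / (2 * sqrt k)"
    using Tf_at_zero[of k c2] Tf_at_zero[of k c3] assms(1) pos by (simp_all add: x_def y_def)
  have "(Tf c2 0 k)^2 + Tf c2 0 k * Tf c3 0 k + (Tf c3 0 k)^2 = (x^2 + x * y + y^2) / (4 * k)"
    unfolding T using assms(1) by (simp add: power_divide power_mult_distrib add_divide_distrib)
  then show ?thesis unfolding k using assms(1) by simp
qed

text \<open>The curve of constant \<open>A\<close> is followed from \<open>d = 0\<close>, where the
  quadratic form equals \<open>1/4\<close>. Both periods are positive and decrease along it, so the
  form drops.\<close>

lemma arc_ineq:
  assumes p: "(d, k) \<in> Dop"
  shows "(Tf c2 d k)^2 + Tf c2 d k * Tf c3 d k + (Tf c3 d k)^2 < 1/4"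
proof -
  note o = Dop_props[OF p]
  define a where "a = Acr d k"
  have a: "1 < a" using o by (simp add: a_def)
  define K where "K = ray (\<lambda>\<mu>. Acr \<mu> 1) a"
  define F where "F \<mu> = (Tf c2 (\<mu> * K \<mu>) (K \<mu>))^2 + Tf c2 (\<mu> * K \<mu>) (K \<mu>) * Tf c3 (\<mu> * K \<mu>) (K \<mu>)
      + (Tf c3 (\<mu> * K \<mu>) (K \<mu>))^2" for \<mu>
  define m where "m = d / k"
  have m: "0 < m" "m < 1" using o by (auto simp: m_def)
  have A01: "Acr 0 1 = 4/27" by (simp add: Acr_def Qc_def critp_def)
  have hpos: "0 < Acr x 1" if "0 \<le> x" "x < 1" for x
    using that Acr_Bcr_pos(1)[of x 1] A01 by (cases "x = 0") auto
  have Kx: "0 < K x" "Acr (x * K x) (K x) = a" if "0 \<le> x" "x < 1" for x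
  proof -
    show kp: "0 < K x" unfolding K_def using a hpos[OF that] by (intro ray_pos) auto
    have "Acr (x * K x) (K x) = K x ^ 3 * Acr x 1" using Acr_scale[of "K x" x 1] kp by (simp add: mult.commute)
    also have "\<dots> = a" unfolding K_def using ray_cube[of a "\<lambda>\<mu>. Acr \<mu> 1" x] a hpos[OF that] by simp
    finally show "Acr (x * K x) (K x) = a" .
  qed
  have hc: "continuous_on {0..m} (\<lambda>\<mu>. Acr \<mu> 1)" unfolding Acr_def Qc_def critp_def by (intro continuous_intros) auto
  have hnz: "Acr x 1 \<noteq> 0" "a / Acr x 1 \<noteq> 0" if "x \<in> {0..m}" for x
  proof -
    have "0 < Acr x 1" using that m by (intro hpos) auto
    then show "Acr x 1 \<noteq> 0" "a / Acr x 1 \<noteq> 0" using a by auto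
  qed
  have Kc: "continuous_on {0..m} K"
    unfolding K_def ray_def
    by (intro continuous_on_powr continuous_on_divide continuous_on_const hc ballI hnz)
  have inE: "(x * K x, K x) \<in> Ecl" if "x \<in> {0..m}" for x
    using Kx[of x] that m a by (simp add: Ecl_def)
  have pc: "continuous_on {0..m} (\<lambda>x. (x * K x, K x))" by (intro continuous_intros Kc)
  have c2c: "continuous_on {0..m} (\<lambda>x. Tf c2 (x * K x) (K x))"
    by (rule continuous_on_compose2[OF continuous_T(1) pc, unfolded fst_conv snd_conv]) (use inE in blast)
  have c3c: "continuous_on {0..m} (\<lambda>x. Tf c3 (x * K x) (K x))"
    by (rule continuous_on_compose2[OF continuous_T(2) pc, unfolded fst_conv snd_conv]) (use inE in blast)
  have "F m < F 0"
  proof (rule DERIV_neg_imp_decreasing_open[OF m(1)])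
    show "continuous_on {0..m} F" unfolding F_def by (intro continuous_intros c2c c3c)
    fix x assume x: "0 < x" "x < m"
    then have x': "0 < x" "x < 1" using m by auto
    have dom: "(x * K x, K x) \<in> Dop" unfolding K_def by (rule constant_A_path(1)[OF a x', of c2]) simp
    obtain D2 where D2: "((\<lambda>\<mu>. Tf c2 (\<mu> * K \<mu>) (K \<mu>)) has_real_derivative D2) (at x)" "D2 < 0"
      using constant_A_path(3)[OF a x', of c2] unfolding K_def by auto
    obtain D3 where D3: "((\<lambda>\<mu>. Tf c3 (\<mu> * K \<mu>) (K \<mu>)) has_real_derivative D3) (at x)" "D3 < 0"
      using constant_A_path(3)[OF a x', of c3] unfolding K_def by auto
    define u v where "u = Tf c2 (x * K x) (K x)" and "v = Tf c3 (x * K x) (K x)"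
    have uv: "0 < u" "0 < v" using T3_less_T2[OF dom] by (auto simp: u_def v_def)
    have "(F has_real_derivative (2 * u * D2 + (D2 * v + D3 * u) + 2 * v * D3)) (at x)"
      unfolding F_def u_def v_def using D2(1) D3(1) by (auto intro!: derivative_eq_intros)
    moreover have "2 * u * D2 + (D2 * v + D3 * u) + 2 * v * D3 < 0"
    proof -
      have "u * D2 < 0" "D2 * v < 0" "D3 * u < 0" "v * D3 < 0"
        using uv D2(2) D3(2) by (auto simp: mult_pos_neg mult_neg_pos)
      then show ?thesis by linarith
    qed
    ultimately show "\<exists>y. (F has_real_derivative y) (at x) \<and> y < 0" by blast
  qed
  moreover have "F 0 = 1/4" unfolding F_def using arc_value[of "K 0"] Kx[of 0] a by simp
  moreover have "K m = k"
    unfolding K_def a_def m_def AB_ray[OF o(1,2)] by (rule ray_eq) (use o Acr_Bcr_pos(1)[of "d/k" 1] in auto)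
  ultimately show ?thesis unfolding F_def using o by (simp add: m_def)
qed

section \<open>The image of the period map\<close>

definition period_map :: "real \<times> real \<Rightarrow> real \<times> real" where
  "period_map p = (Tf c2 (fst p) (snd p), Tf c3 (fst p) (snd p))"

lemma period_map_in_domM: "p \<in> Dop \<Longrightarrow> period_map p \<in> domM"
  using arc_ineq[of "fst p" "snd p"] T3_less_T2[of "fst p" "snd p"] period_sum_lower[of "fst p" "snd p"]
  by (simp add: period_map_def domM_def)

lemma inj_period_map: "inj_on period_map Dop"
proof (rule inj_onI)
  fix p q assume "p \<in> Dop" "q \<in> Dop" "period_map p = period_map q"
  then show "p = q" using T_injective[of "fst p" "snd p" "fst q" "snd q"] by (simp add: period_map_def prod_eq_iff)
qed

text \<open>The total derivative exists by complexification; its two entries are found by moving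
  along the coordinate directions.\<close>

lemma T_has_derivative:
  assumes p: "(d, k) \<in> Dop" and c: "c = c2 \<or> c = c3"
  shows "((\<lambda>p. Tf c (fst p) (snd p)) has_derivative (\<lambda>h.
     (Xw c d k * (- 1 / (critp d k - d)) + Yw c d k * (1 / (d - critm d k))) * fst h
   + (Xw c d k * (1 / (k - critp d k)) + Yw c d k * (1 / (k - critm d k))) * snd h)) (at (d, k))"
proof -
  have "complexifiable (\<lambda>p. Tf c (fst p) (snd p)) (d, k)" using c complexifiable_T23[OF p] by auto
  then obtain A B where AB: "((\<lambda>p. Tf c (fst p) (snd p)) has_derivative (\<lambda>h. A * fst h + B * snd h)) (at (d, k))"
    using complexifiable_differentiable by blast
  have e1: "((\<lambda>s. Tf c s k) has_real_derivative A * 1 + B * 0) (at d)"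
    using deriv_along_path[of "\<lambda>p. Tf c (fst p) (snd p)" A B "\<lambda>x. x" d "\<lambda>_. k" 1 0, OF AB DERIV_ident DERIV_const]
    by (simp only: fst_conv snd_conv)
  have e2: "((\<lambda>s. Tf c s k) has_real_derivative
      Xw c d k * (- 1 / (critp d k - d)) + Yw c d k * (1 / (d - critm d k))) (at d)"
    using Tf_path_deriv[OF DERIV_ident DERIV_const p c] by simp
  from DERIV_unique[OF e1 e2] have A: "A = Xw c d k * (- 1 / (critp d k - d)) + Yw c d k * (1 / (d - critm d k))"
    by (simp only: mult_1_right mult_zero_right add_0_right)
  have e3: "((\<lambda>s. Tf c d s) has_real_derivative A * 0 + B * 1) (at k)"
    using deriv_along_path[of "\<lambda>p. Tf c (fst p) (snd p)" A B "\<lambda>_. d" k "\<lambda>x. x" 0 1, OF AB DERIV_const DERIV_ident]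
    by (simp only: fst_conv snd_conv)
  have e4: "((\<lambda>s. Tf c d s) has_real_derivative
      Xw c d k * (1 / (k - critp d k)) + Yw c d k * (1 / (k - critm d k))) (at k)"
    using Tf_path_deriv[OF DERIV_const DERIV_ident p c] by simp
  from DERIV_unique[OF e3 e4] have B: "B = Xw c d k * (1 / (k - critp d k)) + Yw c d k * (1 / (k - critm d k))"
    by (simp only: mult_1_right mult_zero_right add_0_left)
  show ?thesis using AB unfolding A B .
qed

lemma T_det_nonzero:
  assumes p: "(d, k) \<in> Dop"
  shows "(Xw c2 d k * (- 1 / (critp d k - d)) + Yw c2 d k * (1 / (d - critm d k))) *
         (Xw c3 d k * (1 / (k - critp d k)) + Yw c3 d k * (1 / (k - critm d k)))
       - (Xw c2 d k * (1 / (k - critp d k)) + Yw c2 d k * (1 / (k - critm d k))) *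
         (Xw c3 d k * (- 1 / (critp d k - d)) + Yw c3 d k * (1 / (d - critm d k))) \<noteq> 0"
proof -
  note o = Dop_props[OF p] and s = XY_signs[OF p]
  note cr = crit_order[OF o(1,2)]
  define u v x y where "u = 1 / (critp d k - d)" and "v = 1 / (d - critm d k)" and "x = 1 / (k - critp d k)" and "y = 1 / (k - critm d k)"
  have pos: "0 < u" "0 < v" "0 < x" "0 < y" using cr o by (auto simp: u_def v_def x_def y_def)
  \<comment> \<open>The Jacobian factors through \<open>(log A, log B)\<close>: one factor is the
    determinant formed by \<open>Xw\<close> and \<open>Yw\<close>, the other, up to sign, that of
    the logarithmic derivatives of \<open>A\<close> and \<open>B\<close>.\<close>
  have id: "(X2 * (- u) + Y2 * v) * (X3 * x + Y3 * y) - (X2 * x + Y2 * y) * (X3 * (- u) + Y3 * v)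
      = - (X2 * Y3 - Y2 * X3) * (u * y + v * x)" for X2 X3 Y2 Y3
    by (simp add: algebra_simps)
  have "Xw c2 d k * Yw c3 d k < 0" "0 < Yw c2 d k * Xw c3 d k" using s by (auto simp: mult_pos_neg mult_neg_neg)
  then have a: "Xw c2 d k * Yw c3 d k - Yw c2 d k * Xw c3 d k \<noteq> 0" by linarith
  have b: "u * y + v * x \<noteq> 0" using pos by (smt (verit) mult_pos_pos)
  have "- 1 / (critp d k - d) = - u" by (simp add: u_def)
  then show ?thesis unfolding v_def[symmetric] x_def[symmetric] y_def[symmetric]
    using id[of "Xw c2 d k" "Yw c2 d k" "Xw c3 d k" "Yw c3 d k"] a b by simp
qed

lemma complexifiable_cong:
  assumes "complexifiable f p" "\<forall>\<^sub>F q in nhds p. f q = g q"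
  shows "complexifiable g p"
proof -
  obtain F where F: "hol2_at F (cpt p)" "\<forall>\<^sub>F q in nhds p. F (cpt q) = of_real (f q)"
    using assms(1) by (auto simp: complexifiable_def)
  have "\<forall>\<^sub>F q in nhds p. F (cpt q) = of_real (g q)"
    using F(2) assms(2) by eventually_elim simp
  then show ?thesis unfolding complexifiable_def by (intro exI[of _ F] conjI F(1))
qed

lemma Dop_subset_Ecl: "Dop \<subseteq> Ecl" by (auto simp: Dop_def Ecl_def)

lemma continuous_period_map: "continuous_on Ecl period_map"
proof -
  have "period_map = (\<lambda>p. (Tf c2 (fst p) (snd p), Tf c3 (fst p) (snd p)))" by (rule ext) (simp add: period_map_def)
  from this show ?thesis by (rule ssubst) (rule continuous_on_Pair[OF continuous_T])
qed

lemma open_period_map: "open (period_map ` Dop)"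
  by (rule invariance_of_domain[OF continuous_on_subset[OF continuous_period_map Dop_subset_Ecl] open_Dop inj_period_map])

lemma convex_domM: "convex domM"
proof -
  \<comment> \<open>This linear map carries \<open>x^2 + x y + y^2\<close> to the squared Euclidean
    norm, so the elliptic region is the preimage of a ball.\<close>
  let ?f = "\<lambda>p::real\<times>real. (fst p + snd p / 2, sqrt 3 / 2 * snd p)"
  have l: "linear ?f" "linear (\<lambda>p::real\<times>real. fst p - snd p)" "linear (\<lambda>p::real\<times>real. fst p + snd p)"
    by (auto intro!: linearI simp: algebra_simps add_divide_distrib)
  have n: "norm (?f p) < 1/2 \<longleftrightarrow> (fst p)^2 + fst p * snd p + (snd p)^2 < 1/4" for p
  proof -
    have e: "(fst p + snd p / 2)^2 + (sqrt 3 / 2 * snd p)^2 = (fst p)^2 + fst p * snd p + (snd p)^2"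
      by (simp add: power_mult_distrib power_divide) (simp add: power2_eq_square field_simps)
    have "norm (?f p) < 1/2 \<longleftrightarrow> sqrt ((fst p)^2 + fst p * snd p + (snd p)^2) < sqrt ((1/2)^2)"
      unfolding norm_Pair real_norm_def power2_abs e by (simp only: real_sqrt_abs) simp
    then show ?thesis by (simp only: real_sqrt_less_iff) (simp add: power2_eq_square)
  qed
  have "domM = ?f -` ball 0 (1/2) \<inter> (\<lambda>p. fst p - snd p) -` {0<..} \<inter> (\<lambda>p. fst p + snd p) -` {1/2<..}"
    (is "_ = ?R")
  proof (rule set_eqI)
    fix p :: "real \<times> real"
    have "p \<in> domM \<longleftrightarrow> (fst p)^2 + fst p * snd p + (snd p)^2 < 1/4 \<and> fst p - snd p > 0 \<and> fst p + snd p > 1/2"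
      by (cases p) (simp add: domM_def)
    then show "p \<in> domM \<longleftrightarrow> p \<in> ?R" unfolding n[symmetric] by simp
  qed
  from this show ?thesis
    by (rule ssubst) (intro convex_Int convex_linear_vimage l convex_ball convex_real_interval)
qed

lemma open_domM: "open domM"
proof -
  have "domM = {p. (fst p)^2 + fst p * snd p + (snd p)^2 < 1/4} \<inter> {p. 0 < fst p - snd p} \<inter> {p. 1/2 < fst p + snd p}"
    by (auto simp: domM_def)
  from this show ?thesis by (rule ssubst) (intro open_Int open_Collect_less continuous_intros)
qed

lemma boundary_not_in_domM:
  assumes "p \<in> Ecl" "period_map p \<in> domM" shows "p \<in> Dop"
proof -
  obtain d k where p: "p = (d, k)" by (cases p)
  have e: "0 \<le> d" "d < k" "1 \<le> Acr d k" using assms(1) p by (auto simp: Ecl_def)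
  have M: "(Tf c2 d k)^2 + Tf c2 d k * Tf c3 d k + (Tf c3 d k)^2 < 1/4" "Tf c3 d k < Tf c2 d k"
    using assms(2) by (auto simp: p period_map_def domM_def)
  have A: "1 < Acr d k"
  proof (rule ccontr)
    assume "\<not> 1 < Acr d k"
    then have "c2 d k = c3 d k" using c_props(9)[OF e] e(3) by simp
    then have "Tf c2 d k = Tf c3 d k" by (simp add: Tf_def)
    then show False using M(2) by simp
  qed
  have "d \<noteq> 0"
  proof
    assume "d = 0"
    then show False using arc_value[of k] A e(2) M(1) by simp
  qed
  then show ?thesis using A e by (simp add: p Dop_def)
qed

lemma Acr_diag: "0 \<le> k \<Longrightarrow> Acr k k = 0"
  by (simp add: Acr_def Qc_def critp_def power2_eq_square)

text \<open>A point of \<open>domM\<close> has coordinate sum above \<open>1/2\<close>. Preimages of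
  nearby values have \<open>k\<close> bounded by \<open>period_sum_upper\<close>, hence lie in a
  compact part of \<open>Ecl\<close>; a preimage on an edge is then excluded by
  \<open>boundary_not_in_domM\<close>.\<close>

lemma period_map_closed_in_domM:
  assumes q: "q \<in> domM" "q \<in> closure (period_map ` Dop)" shows "q \<in> period_map ` Dop"
proof -
  define s where "s = (fst q + snd q + 1/2) / 2"
  have s: "1/2 < s" "s < fst q + snd q" using q(1) by (auto simp: domM_def s_def)
  define \<delta> where "\<delta> = s - 1/2"
  have \<delta>: "0 < \<delta>" using s by (simp add: \<delta>_def)
  \<comment> \<open>From \<open>\<delta> < 1 / sqrt k\<close> follows
    \<open>k < 1 / \<delta>^2\<close>; values \<open>k < 1\<close> are covered by the 1.\<close>
  define L where "L = max 1 (1 / \<delta>^2)"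
  \<comment> \<open>Only closed conditions appear, for compactness. The diagonal
    \<open>d = k\<close> is kept out by \<open>1 \<le> A\<close>, since \<open>A\<close> vanishes on
    it.\<close>
  define K where "K = ({0..L} \<times> {0..L}) \<inter> ({p. fst p \<le> snd p} \<inter> {p. 1 \<le> Acr (fst p) (snd p)})"
  define U where "U = {p::real\<times>real. s < fst p + snd p}"
  have "compact K" unfolding K_def
  proof (intro compact_Int_closed compact_Times compact_Icc closed_Int closed_Collect_le)
    show "continuous_on UNIV (\<lambda>p. Acr (fst p) (snd p))"
      unfolding Acr_def Qc_def critp_def by (intro continuous_intros) auto
  qed (intro continuous_intros)+
  have KE: "K \<subseteq> Ecl"
  proof
    fix p assume "p \<in> K"
    then have p: "0 \<le> fst p" "fst p \<le> snd p" "1 \<le> Acr (fst p) (snd p)" by (auto simp: K_def)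
    then have "fst p \<noteq> snd p" using Acr_diag[of "fst p"] by auto
    then show "p \<in> Ecl" using p by (auto simp: Ecl_def case_prod_beta)
  qed
  have "compact (period_map ` K)" by (rule compact_continuous_image[OF continuous_on_subset[OF continuous_period_map KE] \<open>compact K\<close>])
  then have cl: "closed (period_map ` K)" by (rule compact_imp_closed)
  have oU: "open U" unfolding U_def by (intro open_Collect_less continuous_intros)
  have sub: "U \<inter> period_map ` Dop \<subseteq> period_map ` K"
  proof
    fix x assume x: "x \<in> U \<inter> period_map ` Dop"
    then obtain d k where p: "(d, k) \<in> Dop" "x = period_map (d, k)" by (auto simp del: IntE)
    note o = Dop_props[OF p(1)]
    have s': "s < Tf c2 d k + Tf c3 d k" using x p(2) by (simp add: U_def period_map_def)
    have kL: "k \<le> L"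
    proof (cases "1 \<le> k")
      case True
      have "\<delta> < 1 / sqrt k" using period_sum_upper[OF p(1) True] s' by (simp add: \<delta>_def)
      then have "sqrt k < 1 / \<delta>" using \<delta> True by (simp add: field_simps)
      then have "(sqrt k)^2 \<le> (1 / \<delta>)^2" using True by (intro power_mono) auto
      then have "k \<le> 1 / \<delta>^2" using True by (simp add: power_divide)
      then show ?thesis by (simp add: L_def)
    qed (simp add: L_def)
    have "(d, k) \<in> K" using o kL by (simp add: K_def)
    then show "x \<in> period_map ` K" unfolding p(2) by (rule imageI)
  qed
  have "q \<in> U \<inter> closure (period_map ` Dop)" using q(2) s(2) by (simp add: U_def)
  then have "q \<in> closure (U \<inter> period_map ` Dop)" using open_Int_closure_subset[OF oU] by (rule subsetD[rotated])
  then have "q \<in> period_map ` K" using closure_minimal[OF sub cl] by (rule subsetD[rotated])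
  then obtain p where p: "p \<in> K" "q = period_map p" by (rule imageE) 
  have "p \<in> Dop" using boundary_not_in_domM[of p] p KE q(1) by auto
  then show ?thesis unfolding p(2) by (rule imageI)
qed

lemma period_map_image: "period_map ` Dop = domM"
proof -
  have sub: "period_map ` Dop \<subseteq> domM" using period_map_in_domM by auto
  \<comment> \<open>A point at which the square root in \<open>critp\<close> is rational:
    \<open>9 - 24 + 64 = 49\<close>, which gives \<open>A = 36\<close>. It makes the open and closed
    image nonempty.\<close>
  have "(3, 8) \<in> Dop"
  proof -
    have "sqrt (49::real) = 7" by (rule real_sqrt_unique) simp_all
    then have "critp 3 8 = 6" by (simp add: critp_def)
    then show ?thesis by (simp add: Dop_def Acr_def Qc_def)
  qed
  then have "period_map (3, 8) \<in> period_map ` Dop" by (rule imageI)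
  then have ne: "period_map ` Dop \<noteq> {}" by auto
  have op: "openin (top_of_set domM) (period_map ` Dop)" using open_period_map sub by (simp add: openin_open_eq[OF open_domM])
  have cl: "closedin (top_of_set domM) (period_map ` Dop)"
    unfolding closedin_closed
  proof (intro exI[of _ "closure (period_map ` Dop)"] conjI closed_closure equalityI subsetI)
    fix x assume "x \<in> period_map ` Dop" then show "x \<in> domM \<inter> closure (period_map ` Dop)" using sub closure_subset[of "period_map ` Dop"] by blast
  next
    fix x assume "x \<in> domM \<inter> closure (period_map ` Dop)" then show "x \<in> period_map ` Dop" using period_map_closed_in_domM[of x] by simp
  qed
  have "period_map ` Dop = {} \<or> period_map ` Dop = domM"
    using convex_connected[OF convex_domM] op cl unfolding connected_clopen by (elim allE[of _ "period_map ` Dop"]) simp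
  with ne show ?thesis by simp
qed

section \<open>Back to the characters (m, l)\<close>

definition to_char :: "real \<times> real \<Rightarrow> real \<times> real" where
  "to_char p = (fst p / snd p, sqrt (snd p))"

lemma Theta_to_char:
  assumes "p \<in> Dop" shows "to_char p \<in> domD" "Theta (to_char p) = period_map p"
proof -
  obtain d k where p: "p = (d, k)" by (cases p)
  note o = Dop_props[OF assms[unfolded p]]
  have k: "0 < k" using o by simp
  have e: "d / k * (sqrt k)^2 = d" "(sqrt k)^2 = k" using k by simp_all
  show "to_char p \<in> domD" unfolding p to_char_def fst_conv snd_conv domD_Dop e using assms p k by simp
  show "Theta (to_char p) = period_map p" unfolding p to_char_def fst_conv snd_conv
    using Theta_Tf[of "sqrt k" "d / k", unfolded e] k by (simp add: period_map_def)
qed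

lemma Theta_period_map:
  assumes "p \<in> domD" shows "(fst p * (snd p)^2, (snd p)^2) \<in> Dop" "Theta p = period_map (fst p * (snd p)^2, (snd p)^2)"
    "0 < snd p"
proof -
  obtain m l where p: "p = (m, l)" by (cases p)
  show "(fst p * (snd p)^2, (snd p)^2) \<in> Dop" "0 < snd p" using assms domD_Dop[of m l] by (auto simp: p)
  then show "Theta p = period_map (fst p * (snd p)^2, (snd p)^2)" using Theta_Tf[of l m] by (simp add: p period_map_def)
qed

lemma bij_Theta: "bij_betw Theta domD domM"
proof (rule bij_betw_imageI)
  show "inj_on Theta domD"
  proof (rule inj_onI)
    fix p q assume a: "p \<in> domD" "q \<in> domD" "Theta p = Theta q"
    note P = Theta_period_map[OF a(1)] and Q = Theta_period_map[OF a(2)]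
    have "(fst p * (snd p)^2, (snd p)^2) = (fst q * (snd q)^2, (snd q)^2)"
      by (rule inj_onD[OF inj_period_map _ P(1) Q(1)]) (use a(3) P(2) Q(2) in simp)
    then have e: "fst p * (snd p)^2 = fst q * (snd q)^2" "(snd p)^2 = (snd q)^2"
      unfolding prod.inject by (rule conjunct1, rule conjunct2)
    have "snd p = snd q" by (rule power2_eq_imp_eq[OF e(2)]) (use P(3) Q(3) in simp_all)
    moreover have "fst p = fst q" 
    proof -
      have "fst p * (snd q)^2 = fst q * (snd q)^2" using e(1) unfolding e(2) .
      then show ?thesis using Q(3) by simp
    qed
    ultimately show "p = q" by (rule prod_eqI[rotated])
  qed
  show "Theta ` domD = domM"
  proof (intro equalityI subsetI)
    fix x assume "x \<in> Theta ` domD"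
    then obtain p where p: "p \<in> domD" "x = Theta p" by (rule imageE) 
    then show "x \<in> domM" using Theta_period_map[OF p(1)] period_map_in_domM by simp
  next
    fix x assume "x \<in> domM"
    then obtain p where p: "p \<in> Dop" "x = period_map p" unfolding period_map_image[symmetric] by (rule imageE)
    then show "x \<in> Theta ` domD" using Theta_to_char[OF p(1)] by (intro image_eqI[of _ _ "to_char p"]) auto
  qed
qed

lemma analytic_Theta: "real_analytic_on2 Theta domD"
  unfolding real_analytic_on2_def
proof (intro ballI)
  fix p assume p: "p \<in> domD"
  note P = Theta_period_map[OF p]
  have ev: "\<forall>\<^sub>F q in nhds p. 0 < snd q"
    using eventually_nhds_in_open[of "{q. 0 < snd q}" p] P(3) open_Collect_less[of "\<lambda>_::real\<times>real. 0::real" snd]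
    by (simp add: continuous_on_snd)
  have Te: "Theta q = (Tf c2 (fst q * (snd q)^2) ((snd q)^2), Tf c3 (fst q * (snd q)^2) ((snd q)^2))" if "0 < snd q" for q
    using Theta_Tf[OF that, of "fst q"] by simp
  have c: "complexifiable (\<lambda>q. fst q * (snd q)^2) p" "complexifiable (\<lambda>q. (snd q)^2) p"
    by (intro complexifiable_mult complexifiable_power complexifiable_fst complexifiable_snd)+
  have "complexifiable (\<lambda>q. fst (Theta q)) p"
    by (rule complexifiable_cong[OF complexifiable_compose[OF complexifiable_T23(1)[OF P(1)] c]])
       (use ev in \<open>eventually_elim, simp add: Te\<close>)
  moreover have "complexifiable (\<lambda>q. snd (Theta q)) p"
    by (rule complexifiable_cong[OF complexifiable_compose[OF complexifiable_T23(2)[OF P(1)] c]])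
       (use ev in \<open>eventually_elim, simp add: Te\<close>)
  ultimately show "real_analytic_at2 (\<lambda>q. fst (Theta q)) p \<and> real_analytic_at2 (\<lambda>q. snd (Theta q)) p"
    by (intro conjI complexifiable_imp_real_analytic)
qed

lemma analytic_Theta_inverse: "real_analytic_on2 (inv_into domD Theta) domM"
  unfolding real_analytic_on2_def
proof (intro ballI)
  fix q assume q: "q \<in> domM"
  \<comment> \<open>Invariance of domain supplies a continuous inverse; its analyticity then follows
    from the nonzero Jacobian.\<close>
  obtain g where g: "homeomorphism Dop domM period_map g"
    using invariance_of_domain_homeomorphism[OF open_Dop continuous_on_subset[OF continuous_period_map Dop_subset_Ecl] _ inj_period_map]
    unfolding period_map_image by auto
  have g1: "g x \<in> Dop" "period_map (g x) = x" if "x \<in> domM" for x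
    using g that by (auto simp: homeomorphism_def)
  have gc: "isCont g q" using g q open_domM by (auto simp: homeomorphism_def continuous_on_eq_continuous_at)
  have ev: "\<forall>\<^sub>F x in nhds q. x \<in> domM" by (rule eventually_nhds_in_open[OF open_domM q])
  obtain d k where dk: "g q = (d, k)" by (cases "g q")
  have D: "(d, k) \<in> Dop" using g1(1)[OF q] dk by simp
  have qe: "q = (Tf c2 d k, Tf c3 d k)" using g1(2)[OF q] by (simp add: dk period_map_def)
  have cg: "complexifiable (\<lambda>x. fst (g x)) q" "complexifiable (\<lambda>x. snd (g x)) q"
  proof -
    have evq: "\<forall>\<^sub>F x in nhds q. (Tf c2 (fst (g x)) (snd (g x)), Tf c3 (fst (g x)) (snd (g x))) = x"
      using ev by eventually_elim (use g1(2) in \<open>simp add: period_map_def\<close>)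
    note I = complexifiable_inverse_map[OF complexifiable_T23[OF D] T_has_derivative[OF D disjI1[OF refl]]
       T_has_derivative[OF D disjI2[OF refl]] T_det_nonzero[OF D], of g,
       unfolded fst_conv snd_conv, folded qe, OF gc dk evq]
    show "complexifiable (\<lambda>x. fst (g x)) q" "complexifiable (\<lambda>x. snd (g x)) q" by (rule I)+
  qed
  have k: "0 < snd (g q)" using Dop_props[OF D] by (simp add: dk)
  have inv: "inv_into domD Theta x = (fst (g x) / snd (g x), sqrt (snd (g x)))" if "x \<in> domM" for x
    using inv_into_f_eq[OF bij_betw_imp_inj_on[OF bij_Theta] Theta_to_char[OF g1(1)[OF that], unfolded g1(2)[OF that]]]
    by (simp add: to_char_def)
  have "complexifiable (\<lambda>x. fst (inv_into domD Theta x)) q"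
    by (rule complexifiable_cong[OF complexifiable_divide[OF cg]])
       (use k in simp, use ev in \<open>eventually_elim, simp add: inv\<close>)
  moreover have "complexifiable (\<lambda>x. snd (inv_into domD Theta x)) q"
    by (rule complexifiable_cong[OF complexifiable_sqrt[OF cg(2) k]])
       (use ev in \<open>eventually_elim, simp add: inv\<close>)
  ultimately show "real_analytic_at2 (\<lambda>q. fst (inv_into domD Theta q)) q \<and> real_analytic_at2 (\<lambda>q. snd (inv_into domD Theta q)) q"
    by (intro conjI complexifiable_imp_real_analytic)
qed

section \<open>Jacobi's elliptic functions\<close>

lemma ellF_deriv:
  assumes m: "m < 1"
  shows "((\<lambda>\<phi>. ellF \<phi> m) has_real_derivative 1 / sqrt (1 - m * (sin \<phi>)^2)) (at \<phi>)"
proof -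
  define g where "g \<theta> = 1 / sqrt (1 - m * (sin \<theta>)^2)" for \<theta>
  have nz: "sqrt (1 - m * (sin \<theta>)^2) \<noteq> 0" for \<theta> using one_minus_sin_pos[OF m, of \<theta>] by simp
  have gc: "continuous_on S g" for S unfolding g_def by (intro continuous_intros ballI nz)
  have gi: "g integrable_on {a..b}" for a b by (rule integrable_continuous_interval[OF gc])
  \<comment> \<open>Moving the lower limit to \<open>-M\<close>, below both 0 and
    \<open>\<phi>\<close>, replaces the two cases of \<open>ellF\<close> by one integral up to a
    constant.\<close>
  define M where "M = \<bar>\<phi>\<bar> + 1"
  have M: "- M < \<phi>" "\<phi> < M" "0 < M" by (auto simp: M_def)
  have Fg: "ellF x m = (if 0 \<le> x then integral {0..x} g else - integral {x..0} g)" for x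
  proof -
    have "g = (\<lambda>\<theta>. 1 / sqrt (1 - m * (sin \<theta>)^2))" by (rule ext) (rule g_def)
    then show ?thesis by (simp only: ellF_def)
  qed
  have eq: "ellF x m = integral {-M..x} g - integral {-M..0} g" if "-M < x" for x
  proof (cases "0 \<le> x")
    case True
    have "integral {-M..0} g + integral {0..x} g = integral {-M..x} g"
      by (rule Henstock_Kurzweil_Integration.integral_combine[OF _ True gi]) (use M in simp)
    then show ?thesis unfolding Fg using True by simp
  next
    case False
    have "integral {-M..x} g + integral {x..0} g = integral {-M..0} g"
      by (rule Henstock_Kurzweil_Integration.integral_combine[OF _ _ gi]) (use that False in auto)
    then show ?thesis unfolding Fg using False by simp
  qed
  have "((\<lambda>x. integral {-M..x} g) has_real_derivative g \<phi>) (at \<phi> within {-M..M})"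
    by (rule integral_has_real_derivative[OF gc]) (use M in auto)
  then have "((\<lambda>x. integral {-M..x} g) has_real_derivative g \<phi>) (at \<phi>)"
    using at_within_Icc_at[of "-M" \<phi> M] M by simp
  from DERIV_diff[OF this DERIV_const[of "integral {-M..0} g"]]
  have "((\<lambda>x. integral {-M..x} g - integral {-M..0} g) has_real_derivative g \<phi>) (at \<phi>)" by simp
  moreover have "\<forall>\<^sub>F x in nhds \<phi>. ellF x m = integral {-M..x} g - integral {-M..0} g"
  proof -
    have "\<forall>\<^sub>F x in nhds \<phi>. x \<in> {-M<..}" by (rule eventually_nhds_in_open) (use M in auto)
    then show ?thesis by eventually_elim (use eq in simp)
  qed
  ultimately show ?thesis unfolding g_def[symmetric] by (rule DERIV_cong_ev[OF refl _ refl, THEN iffD2, rotated])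
qed

lemma ellF_integrand_ge_1:
  assumes "0 \<le> m" "m < 1" shows "1 \<le> 1 / sqrt (1 - m * (sin \<phi>)^2)"
proof -
  have "0 < 1 - m * (sin \<phi>)^2" by (rule one_minus_sin_pos[OF assms(2)])
  moreover have "1 - m * (sin \<phi>)^2 \<le> 1" using assms by simp
  ultimately have "0 < sqrt (1 - m * (sin \<phi>)^2)" "sqrt (1 - m * (sin \<phi>)^2) \<le> 1" by simp_all
  then show ?thesis by (simp add: le_divide_eq)
qed

lemma ellF_zero: "ellF 0 m = 0" by (simp add: ellF_def)

text \<open>The integrand is at least 1, so \<open>ellF\<close> stretches distances. It is therefore
  a bijection of the line, and its inverse \<open>jacobi_am\<close> is 1-Lipschitz.\<close>

lemma ellF_growth:
  assumes "0 \<le> m" "m < 1" "x \<le> y" shows "y - x \<le> ellF y m - ellF x m"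
proof -
  have "ellF x m - x \<le> ellF y m - y"
  proof (rule DERIV_nonneg_imp_nondecreasing[OF assms(3)])
    fix t
    have "((\<lambda>x. ellF x m - x) has_real_derivative 1 / sqrt (1 - m * (sin t)^2) - 1) (at t)"
      by (rule DERIV_diff[OF ellF_deriv[OF assms(2)] DERIV_ident])
    then show "\<exists>y. ((\<lambda>x. ellF x m - x) has_real_derivative y) (at t) \<and> 0 \<le> y"
      using ellF_integrand_ge_1[OF assms(1,2), of t] by (intro exI conjI) auto
  qed
  then show ?thesis by linarith
qed

lemma ellF_inj: assumes "0 \<le> m" "m < 1" "ellF x m = ellF y m" shows "x = y"
  using ellF_growth[OF assms(1,2), of x y] ellF_growth[OF assms(1,2), of y x] assms(3) by linarith

lemma ellF_surj:
  assumes "0 \<le> m" "m < 1" shows "\<exists>x. ellF x m = u"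
proof -
  have cont: "continuous_on {-\<bar>u\<bar>..\<bar>u\<bar>} (\<lambda>x. ellF x m)"
    by (intro continuous_at_imp_continuous_on ballI DERIV_isCont[OF ellF_deriv[OF assms(2)]])
  have "ellF (-\<bar>u\<bar>) m \<le> u" "u \<le> ellF \<bar>u\<bar> m"
    using ellF_growth[OF assms, of 0 "\<bar>u\<bar>"] ellF_growth[OF assms, of "-\<bar>u\<bar>" 0] by (auto simp: ellF_zero)
  from IVT'[OF this _ cont] show ?thesis by auto
qed

lemma ellF_am: assumes "0 \<le> m" "m < 1" shows "ellF (jacobi_am u m) m = u"
proof -
  obtain x where x: "ellF x m = u" using ellF_surj[OF assms] by blast
  have "jacobi_am u m = x" unfolding jacobi_am_def
    by (rule the_equality[of "\<lambda>\<phi>. ellF \<phi> m = u" x, OF x]) (use ellF_inj[OF assms] x in blast)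
  then show ?thesis using x by simp
qed

lemma am_ellF: assumes "0 \<le> m" "m < 1" shows "jacobi_am (ellF x m) m = x"
  by (rule ellF_inj[OF assms ellF_am[OF assms]])

lemma am_isCont: assumes "0 \<le> m" "m < 1" shows "isCont (\<lambda>u. jacobi_am u m) u"
proof -
  have L: "\<bar>jacobi_am x m - jacobi_am y m\<bar> \<le> \<bar>x - y\<bar>" for x y
    using ellF_growth[OF assms, of "jacobi_am x m" "jacobi_am y m"] ellF_growth[OF assms, of "jacobi_am y m" "jacobi_am x m"]
    unfolding ellF_am[OF assms] by linarith
  show ?thesis unfolding continuous_at_eps_delta
  proof (intro allI impI)
    fix e :: real assume "0 < e"
    moreover have "dist (jacobi_am x m) (jacobi_am u m) < e" if "dist x u < e" for x
      using L[of x u] that unfolding dist_real_def by linarith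
    ultimately show "\<exists>\<delta>>0. \<forall>x. dist x u < \<delta> \<longrightarrow> dist (jacobi_am x m) (jacobi_am u m) < e" by blast
  qed
qed

lemma am_deriv:
  assumes "0 \<le> m" "m < 1"
  shows "((\<lambda>u. jacobi_am u m) has_real_derivative sqrt (1 - m * (sin (jacobi_am u m))^2)) (at u)"
proof -
  have nz: "1 / sqrt (1 - m * (sin (jacobi_am u m))^2) \<noteq> 0"
    using ellF_integrand_ge_1[OF assms, of "jacobi_am u m"] by linarith
  have "((\<lambda>u. jacobi_am u m) has_real_derivative inverse (1 / sqrt (1 - m * (sin (jacobi_am u m))^2))) (at u)"
    by (rule DERIV_inverse_function[where f = "\<lambda>x. ellF x m" and a = "u - 1" and b = "u + 1"])
       (rule ellF_deriv[OF assms(2)], rule nz, simp, simp, rule ellF_am[OF assms], rule am_isCont[OF assms])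
  then show ?thesis by simp
qed

lemma ellF_add_pi:
  assumes "0 \<le> m" "m < 1" shows "ellF (x + pi) m = ellF x m + ellF pi m"
proof -
  have "((\<lambda>x. ellF (x + pi) m - ellF x m) has_real_derivative 0) (at t)" for t
  proof -
    have "((\<lambda>x. ellF (x + pi) m) has_real_derivative 1 / sqrt (1 - m * (sin (t + pi))^2)) (at t)"
      using ellF_deriv[OF assms(2), of "t + pi"] by (simp add: DERIV_shift)
    from DERIV_diff[OF this ellF_deriv[OF assms(2), of t]] show ?thesis by simp
  qed
  from DERIV_isconst_all[OF allI[OF this], of x 0] show ?thesis by (simp add: ellF_zero)
qed

lemma am_add_period:
  assumes "0 \<le> m" "m < 1" shows "jacobi_am (u + ellF pi m) m = jacobi_am u m + pi"
  by (rule ellF_inj[OF assms]) (simp add: ellF_am[OF assms] ellF_add_pi[OF assms])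

lemma ellF_pi_pos: assumes "0 \<le> m" "m < 1" shows "0 < ellF pi m"
  using ellF_growth[OF assms, of 0 pi] pi_gt_zero unfolding ellF_zero by linarith

lemma am_zero: assumes "0 \<le> m" "m < 1" shows "jacobi_am 0 m = 0"
  using am_ellF[OF assms, of 0] by (simp add: ellF_zero)

text \<open>A shifted Weierstrass function: \<open>W'\<^sup>2 = 4 W (W - d) (W - k)\<close>.\<close>

definition ang :: "real \<Rightarrow> real \<Rightarrow> real \<Rightarrow> real" where
  "ang d k u = jacobi_am (sqrt k * u) (d / k)"

definition Wf :: "real \<Rightarrow> real \<Rightarrow> real \<Rightarrow> real" where
  "Wf d k u = d * (sin (ang d k u))^2"

lemma ang_deriv:
  assumes "0 < d" "d < k"
  shows "(ang d k has_real_derivative sqrt (k - d * (sin (ang d k u))^2)) (at u)"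
proof -
  have m: "0 \<le> d / k" "d / k < 1" using assms by auto
  have "((\<lambda>u. sqrt k * u) has_real_derivative sqrt k) (at u)" by (auto intro!: derivative_eq_intros)
  from DERIV_chain2[OF am_deriv[OF m] this]
  have "(ang d k has_real_derivative sqrt (1 - d / k * (sin (ang d k u))^2) * sqrt k) (at u)"
    unfolding ang_def .
  moreover have "sqrt (1 - d / k * (sin (ang d k u))^2) * sqrt k = sqrt (k - d * (sin (ang d k u))^2)"
  proof -
    have "(1 - d / k * (sin (ang d k u))^2) * k = k - d * (sin (ang d k u))^2" using assms by (simp add: algebra_simps)
    then show ?thesis by (simp flip: real_sqrt_mult)
  qed
  ultimately show ?thesis by simp
qed

lemma Wf_deriv:
  assumes "0 < d" "d < k"
  shows "(Wf d k has_real_derivative 2 * Yc d k (ang d k u)) (at u)"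
    "((\<lambda>u. Yc d k (ang d k u)) has_real_derivative Qc' d k (Wf d k u)) (at u)"
    "(Yc d k (ang d k u))^2 = Qc d k (Wf d k u)"
proof -
  have dk: "0 \<le> d" "d < k" using assms by auto
  have pos: "0 < k - d * (sin (ang d k u))^2" using sin_sq_range[OF dk(1), of "ang d k u"] dk by auto
  show "(Wf d k has_real_derivative 2 * Yc d k (ang d k u)) (at u)"
    unfolding Wf_def using DERIV_chain2[OF sin_sq_deriv ang_deriv[OF assms]] by (simp add: Yc_def mult.assoc)
  show "((\<lambda>u. Yc d k (ang d k u)) has_real_derivative Qc' d k (Wf d k u)) (at u)"
    using DERIV_chain2[OF Yc_deriv[OF dk] ang_deriv[OF assms, of u]] pos by (simp add: Wf_def)
  show "(Yc d k (ang d k u))^2 = Qc d k (Wf d k u)" unfolding Wf_def by (rule Yc_sq[OF dk])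
qed

lemma Wf_range: assumes "0 < d" shows "0 \<le> Wf d k u" "Wf d k u \<le> d"
  using sin_sq_range[of d "ang d k u"] assms unfolding Wf_def by auto

text \<open>The period of \<open>Wf\<close> in \<open>u\<close>: over it the amplitude advances by
  \<open>pi\<close>.\<close>

definition per :: "real \<Rightarrow> real \<Rightarrow> real" where "per d k = ellF pi (d / k) / sqrt k"

lemma per_pos: assumes "0 < d" "d < k" shows "0 < per d k"
  unfolding per_def using ellF_pi_pos[of "d / k"] assms by simp

lemma ang_period: assumes "0 < d" "d < k" shows "ang d k (u + per d k) = ang d k u + pi"
proof -
  have "sqrt k * (u + per d k) = sqrt k * u + ellF pi (d / k)" using assms by (simp add: per_def distrib_left)
  then show ?thesis unfolding ang_def using am_add_period[of "d / k"] assms by simp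
qed

lemma Wf_period: assumes "0 < d" "d < k" shows "Wf d k (u + per d k) = Wf d k u"
  unfolding Wf_def ang_period[OF assms] by simp

lemma Wf_zero: assumes "0 < d" "d < k" shows "Wf d k 0 = 0" "Yc d k (ang d k 0) = 0"
  using am_zero[of "d / k"] assms by (simp_all add: Wf_def ang_def Yc_def)

lemma ang_surj: assumes "0 < d" "d < k" shows "\<exists>u. ang d k u = \<theta>"
proof -
  have m: "0 \<le> d / k" "d / k < 1" using assms by auto
  have "ang d k (ellF \<theta> (d / k) / sqrt k) = \<theta>" unfolding ang_def using assms am_ellF[OF m] by simp
  then show ?thesis by blast
qed

lemma sn_form:
  assumes "0 < m" "m < 1" "0 < l"
  shows "3/2 * l^2 * ((m + 1)/3 - m * (jacobi_sn (l * (u + u0)) m)^2)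
     = (m * l^2 + l^2) / 2 - 3/2 * Wf (m * l^2) (l^2) (u + u0)"
proof -
  have "ang (m * l^2) (l^2) (u + u0) = jacobi_am (l * (u + u0)) m" using assms by (simp add: ang_def)
  then show ?thesis unfolding Wf_def jacobi_sn_def by (simp add: field_simps)
qed

section \<open>Periodic solutions of the curvature equation\<close>

text \<open>A Gronwall argument for the squared distance in phase space. The common bound
  \<open>B\<close> makes the quadratic nonlinearity Lipschitz with constant
  \<open>12 B\<close>.\<close>

lemma ode2_unique:
  fixes v z v' z' :: "real \<Rightarrow> real"
  assumes v: "\<And>u. (v has_real_derivative v' u) (at u)" "\<And>u. (v' has_real_derivative 6 * (v u)^2 + q) (at u)"
    and z: "\<And>u. (z has_real_derivative z' u) (at u)" "\<And>u. (z' has_real_derivative 6 * (z u)^2 + q) (at u)"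
    and B: "\<And>u. \<bar>v u\<bar> \<le> B" "\<And>u. \<bar>z u\<bar> \<le> B"
    and init: "v u0 = z u0" "v' u0 = z' u0"
  shows "v u = z u"
proof -
  define E where "E u = (v u - z u)^2 + (v' u - z' u)^2" for u
  define E' where "E' u = 2 * (v u - z u) * (v' u - z' u) * (1 + 6 * (v u + z u))" for u
  define L where "L = 1 + 12 * B"
  have B0: "0 \<le> B" using B(1)[of 0] by linarith
  have dE: "(E has_real_derivative E' u) (at u)" for u
  proof -
    have "(E has_real_derivative 2 * (v u - z u) * (v' u - z' u) + 2 * (v' u - z' u) * ((6 * (v u)^2 + q) - (6 * (z u)^2 + q))) (at u)"
      unfolding E_def using v[of u] z[of u] by (auto intro!: derivative_eq_intros simp: algebra_simps)
    moreover have "2 * (v u - z u) * (v' u - z' u) + 2 * (v' u - z' u) * ((6 * (v u)^2 + q) - (6 * (z u)^2 + q)) = E' u"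
      unfolding E'_def by (simp add: power2_eq_square algebra_simps)
    ultimately show ?thesis by simp
  qed
  have bound: "\<bar>E' u\<bar> \<le> L * E u" for u
  proof -
    have "\<bar>1 + 6 * (v u + z u)\<bar> \<le> L"
    proof -
      have "v u \<le> B" "- B \<le> v u" "z u \<le> B" "- B \<le> z u" using B(1)[of u] B(2)[of u] by (simp_all add: abs_le_iff)
      then show ?thesis unfolding L_def by (intro abs_leI) (simp_all add: algebra_simps)
    qed
    moreover have "\<bar>2 * (v u - z u) * (v' u - z' u)\<bar> \<le> E u"
    proof -
      have "0 \<le> (\<bar>v u - z u\<bar> - \<bar>v' u - z' u\<bar>)^2" by simp
      then have "2 * (\<bar>v u - z u\<bar> * \<bar>v' u - z' u\<bar>) \<le> \<bar>v u - z u\<bar>^2 + \<bar>v' u - z' u\<bar>^2"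
        by (simp add: power2_diff)
      moreover have "\<bar>2 * (v u - z u) * (v' u - z' u)\<bar> = 2 * (\<bar>v u - z u\<bar> * \<bar>v' u - z' u\<bar>)"
        by (simp only: abs_mult abs_numeral mult.assoc)
      ultimately show ?thesis unfolding E_def power2_abs by linarith
    qed
    ultimately have "\<bar>2 * (v u - z u) * (v' u - z' u)\<bar> * \<bar>1 + 6 * (v u + z u)\<bar> \<le> E u * L"
      by (intro mult_mono) auto
    then show ?thesis by (simp add: E'_def abs_mult mult.commute)
  qed
  have E0: "E u0 = 0" using init by (simp add: E_def)
  have "E u \<le> 0"
  proof (cases "u0 \<le> u")
    case True
    have "E u * exp (- L * u) \<le> E u0 * exp (- L * u0)"
    proof (rule DERIV_nonpos_imp_nonincreasing[OF True])
      fix t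
      have "((\<lambda>u. E u * exp (- L * u)) has_real_derivative (E' t - L * E t) * exp (- L * t)) (at t)"
        using dE[of t] by (auto intro!: derivative_eq_intros simp: algebra_simps)
      moreover have "(E' t - L * E t) * exp (- L * t) \<le> 0"
        using bound[of t] by (intro mult_nonpos_nonneg) auto
      ultimately show "\<exists>y. ((\<lambda>u. E u * exp (- L * u)) has_real_derivative y) (at t) \<and> y \<le> 0" by blast
    qed
    then show ?thesis using E0 by (simp add: mult_le_0_iff)
  next
    case False
    then have le: "u \<le> u0" by simp
    have "E u * exp (L * u) \<le> E u0 * exp (L * u0)"
    proof (rule DERIV_nonneg_imp_nondecreasing[OF le])
      fix t
      have "((\<lambda>u. E u * exp (L * u)) has_real_derivative (E' t + L * E t) * exp (L * t)) (at t)"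
        using dE[of t] by (auto intro!: derivative_eq_intros simp: algebra_simps)
      moreover have "0 \<le> (E' t + L * E t) * exp (L * t)"
        using bound[of t] by (intro mult_nonneg_nonneg) auto
      ultimately show "\<exists>y. ((\<lambda>u. E u * exp (L * u)) has_real_derivative y) (at t) \<and> 0 \<le> y" by blast
    qed
    then show ?thesis using E0 by (simp add: mult_le_0_iff)
  qed
  then have "(v u - z u)^2 + (v' u - z' u)^2 \<le> 0" by (simp add: E_def)
  then show ?thesis by (simp only: sum_power2_le_zero_iff) simp
qed

lemma periodic_int_shift:
  fixes f :: "real \<Rightarrow> 'a"
  assumes "\<And>u. f (u + T) = f u"
  shows "f (u + of_nat n * T) = f u" "f (u - of_nat n * T) = f u"
proof -
  show 1: "f (u + of_nat n * T) = f u" for u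
  proof (induction n)
    case (Suc n)
    have "f (u + of_nat (Suc n) * T) = f ((u + of_nat n * T) + T)" by (simp add: algebra_simps)
    then show ?case using Suc assms by simp
  qed simp
  show "f (u - of_nat n * T) = f u" using 1[of "u - of_nat n * T"] by simp
qed

lemma periodic_reduce:
  fixes f :: "real \<Rightarrow> 'a"
  assumes "\<And>u. f (u + T) = f u" "0 < T"
  shows "\<exists>t. 0 \<le> t \<and> t \<le> T \<and> f t = f u"
proof -
  define n where "n = \<lfloor>u / T\<rfloor>"
  define t where "t = u - of_int n * T"
  have "0 \<le> t" "t \<le> T"
    using floor_divide_lower[OF assms(2), of u] floor_divide_upper[OF assms(2), of u]
    unfolding t_def n_def by (simp_all add: algebra_simps)
  moreover have "f t = f u"
  proof (cases "0 \<le> n")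
    case True
    then have "t = u - real (nat n) * T" by (simp add: t_def)
    then show ?thesis using periodic_int_shift(2)[of f T u "nat n", OF assms(1)] by (simp only:)
  next
    case False
    then have "t = u + real (nat (- n)) * T" by (simp add: t_def)
    then show ?thesis using periodic_int_shift(1)[of f T u "nat (- n)", OF assms(1)] by (simp only:)
  qed
  ultimately show ?thesis by blast
qed

text \<open>\<open>v = -2/3 \<kappa>\<close> satisfies the Weierstrass equation
  \<open>v'^2 = 4 (v^3 + p v + q)\<close>. Minimum and maximum of the periodic \<open>v\<close> are
  two roots \<open>e3 < e2\<close>, the third root \<open>e1\<close> lies above them, and
  \<open>v - e3\<close> is a translate of \<open>Wf (e2 - e3) (e1 - e3)\<close>.\<close>

lemma curvature_classification:
  fixes \<kappa> \<kappa>1 \<kappa>2 :: "real \<Rightarrow> real"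
  assumes d1: "\<And>u. (\<kappa> has_real_derivative \<kappa>1 u) (at u)"
    and d2: "\<And>u. (\<kappa>1 has_real_derivative \<kappa>2 u) (at u)"
    and d3: "\<And>u. (\<kappa>2 has_real_derivative - 8 * \<kappa> u * \<kappa>1 u) (at u)"
    and per: "0 < T" "\<And>u. \<kappa> (u + T) = \<kappa> u" and nc: "\<kappa> a \<noteq> \<kappa> b"
  obtains d k u0 where "0 < d" "d < k" "\<And>u. \<kappa> u = (d + k) / 2 - 3/2 * Wf d k (u + u0)"
proof -
  define v where "v u = - 2/3 * \<kappa> u" for u
  define v1 where "v1 u = - 2/3 * \<kappa>1 u" for u
  define p where "p = - 1/3 * \<kappa>2 0 - 3 * (v 0)^2"
  have dv: "(v has_real_derivative v1 u) (at u)" for u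
    unfolding v_def v1_def by (rule DERIV_cmult[OF d1])
  have c1: "- 2/3 * \<kappa>2 u - 6 * (v u)^2 = 2 * p" for u
  proof -
    have "((\<lambda>u. - 2/3 * \<kappa>2 u - 6 * (v u)^2) has_real_derivative 0) (at u)" for u
    proof -
      have "((\<lambda>u. - 2/3 * \<kappa>2 u - 6 * (v u)^2) has_real_derivative - 2/3 * (- 8 * \<kappa> u * \<kappa>1 u) - 6 * (2 * v u * v1 u)) (at u)"
        using d3[of u] dv[of u] by (auto intro!: derivative_eq_intros)
      then show ?thesis by (simp add: v_def v1_def)
    qed
    from DERIV_isconst_all[OF allI[OF this], of u 0] show ?thesis by (simp add: p_def)
  qed
  have dv1: "(v1 has_real_derivative 6 * (v u)^2 + 2 * p) (at u)" for u
    unfolding v1_def using DERIV_cmult[OF d2[of u], of "- 2/3"] c1[of u] by (simp add: algebra_simps)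
  define q where "q = ((v1 0)^2 - 4 * (v 0)^3 - 4 * p * v 0) / 4"
  have c2: "(v1 u)^2 = 4 * (v u)^3 + 4 * p * v u + 4 * q" for u
  proof -
    have "((\<lambda>u. (v1 u)^2 - 4 * (v u)^3 - 4 * p * v u) has_real_derivative 0) (at u)" for u
    proof -
      have "((\<lambda>u. (v1 u)^2 - 4 * (v u)^3 - 4 * p * v u) has_real_derivative
          2 * v1 u * (6 * (v u)^2 + 2 * p) - 4 * (3 * (v u)^2 * v1 u) - 4 * p * v1 u) (at u)"
        using dv1[of u] dv[of u] by (auto intro!: derivative_eq_intros)
      then show ?thesis by (simp add: algebra_simps)
    qed
    from DERIV_isconst_all[OF allI[OF this], of u 0]
    have "(v1 u)^2 - 4 * (v u)^3 - 4 * p * v u = (v1 0)^2 - 4 * (v 0)^3 - 4 * p * v 0" .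
    moreover have "4 * q = (v1 0)^2 - 4 * (v 0)^3 - 4 * p * v 0" by (simp add: q_def)
    ultimately show ?thesis by linarith
  qed
  have perv: "v (u + T) = v u" for u using per(2) by (simp add: v_def)
  have cv: "continuous_on S v" for S by (intro continuous_at_imp_continuous_on ballI DERIV_isCont[OF dv])
  have ne: "{0..T} \<noteq> {}" using per(1) by simp
  obtain u1 where u1: "\<And>t. t \<in> {0..T} \<Longrightarrow> v u1 \<le> v t"
    using continuous_attains_inf[OF compact_Icc ne cv] by blast
  obtain u2 where u2: "\<And>t. t \<in> {0..T} \<Longrightarrow> v t \<le> v u2"
    using continuous_attains_sup[OF compact_Icc ne cv] by blast
  have mn: "v u1 \<le> v u" and mx: "v u \<le> v u2" for u
  proof -
    obtain t where "0 \<le> t" "t \<le> T" "v t = v u" using periodic_reduce[of v T u, OF perv per(1)] by blast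
    then show "v u1 \<le> v u" "v u \<le> v u2" using u1[of t] u2[of t] by simp_all
  qed
  define e3 e2 where "e3 = v u1" and "e2 = v u2"
  have lt: "e3 < e2"
  proof (rule ccontr)
    assume "\<not> e3 < e2"
    then have "v u = e3" for u using mn[of u] mx[of u] by (simp add: e3_def e2_def)
    then have "v a = v b" by simp
    then show False using nc by (simp add: v_def)
  qed
  have z1: "v1 u1 = 0" by (rule DERIV_local_min[OF dv, of 1]) (use mn in auto)
  have z2: "v1 u2 = 0" by (rule DERIV_local_max[OF dv, of 1]) (use mx in auto)
  define e1 where "e1 = - e2 - e3"
  have r3: "e3^3 + p * e3 + q = 0" using c2[of u1] z1 by (simp add: e3_def)
  have r2: "e2^3 + p * e2 + q = 0" using c2[of u2] z2 by (simp add: e2_def)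
  have "(e2 - e3) * (e2^2 + e2 * e3 + e3^2 + p) = 0"
    using r2 r3 by (simp add: power2_eq_square power3_eq_cube algebra_simps)
  then have pp: "p = - (e2^2 + e2 * e3 + e3^2)" using lt by simp
  have qq: "q = e2 * e3 * (e2 + e3)" using r3 unfolding pp by (simp add: power2_eq_square power3_eq_cube algebra_simps)
  have fac: "x^3 + p * x + q = (x - e1) * (x - e2) * (x - e3)" for x
    unfolding pp qq e1_def by (simp add: power2_eq_square power3_eq_cube algebra_simps)
  have vb: "e3 \<le> v u" "v u \<le> e2" for u using mn mx by (auto simp: e3_def e2_def)
  \<comment> \<open>\<open>v\<close> takes every value \<open>x\<close> in \<open>(e3, e2)\<close>,
    and there \<open>v'^2 \<ge> 0\<close> forces \<open>x \<le> e1\<close>.\<close>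
  have below: "x \<le> e1" if "e3 < x" "x < e2" for x
  proof -
    have "connected (range v)" by (rule connected_continuous_image[OF cv connected_UNIV])
    then have "x \<in> range v"
      using that connectedD_interval[of "range v" e3 e2 x] by (auto simp: e3_def e2_def)
    then obtain u where u: "v u = x" by blast
    have "(v1 u)^2 = 4 * ((x - e1) * (x - e2) * (x - e3))" using c2[of u] unfolding fac[symmetric] u by simp
    then have "0 \<le> (x - e1) * (x - e2) * (x - e3)" using zero_le_power2[of "v1 u"] by linarith
    moreover have "0 < (e2 - x) * (x - e3)" using that by simp
    moreover have "(x - e1) * (x - e2) * (x - e3) = (e1 - x) * ((e2 - x) * (x - e3))" by (simp add: algebra_simps)
    ultimately show ?thesis by (simp add: zero_le_mult_iff)
  qed
  have le: "e2 \<le> e1" by (rule dense_le_bounded[OF lt below])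
  define B where "B = \<bar>e3\<bar> + \<bar>e2\<bar>"
  have vB: "\<bar>v u\<bar> \<le> B" for u using vb[of u] by (auto simp: B_def)
  \<comment> \<open>If \<open>e1 = e2\<close>, the maximum is a double root and the constant
    \<open>e2\<close> solves the same initial value problem, so \<open>v\<close> would be
    constant.\<close>
  have e12: "e2 < e1"
  proof (rule ccontr)
    assume "\<not> e2 < e1"
    then have e: "e1 = e2" using le by simp
    then have e3: "e3 = - 2 * e2" by (simp add: e1_def)
    have c0: "6 * e2^2 + 2 * p = 0" unfolding pp e3 by (simp add: power2_eq_square algebra_simps)
    have "v u1 = (\<lambda>_. e2) u1"
    proof (rule ode2_unique[of v v1 "2 * p" "\<lambda>_. e2" "\<lambda>_. 0" B u2])
      show "((\<lambda>_. 0) has_real_derivative 6 * e2^2 + 2 * p) (at u)" for u unfolding c0 by (rule DERIV_const)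
      show "((\<lambda>_. e2) has_real_derivative 0) (at u)" for u by (rule DERIV_const)
      show "\<bar>e2\<bar> \<le> B" by (simp add: B_def)
      show "v u2 = e2" by (simp add: e2_def)
    qed (rule dv dv1 vB z2)+
    then show False using lt by (simp add: e3_def)
  qed
  define d k where "d = e2 - e3" and "k = e1 - e3"
  have dk: "0 < d" "d < k" using lt e12 by (auto simp: d_def k_def)
  have s: "(d + k) / 3 = - e3" by (simp add: d_def k_def e1_def)
  define z where "z u = e3 + Wf d k (u - u1)" for u
  have shift: "((\<lambda>u. f (u - u1)) has_real_derivative D) (at u)" if "(f has_real_derivative D) (at (u - u1))" for f D u
    using DERIV_chain2[OF that DERIV_diff[OF DERIV_ident DERIV_const[of u1]]] by simp
  have "v u = z u" for u
  proof (rule ode2_unique[of v v1 "2 * p" z "\<lambda>u. 2 * Yc d k (ang d k (u - u1))" B u1])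
    show "(z has_real_derivative 2 * Yc d k (ang d k (u - u1))) (at u)" for u
      unfolding z_def using DERIV_add[OF DERIV_const[of e3] shift[OF Wf_deriv(1)[OF dk, of "u - u1"]]] by simp
    have "2 * Qc' d k (z u - e3) = 6 * (z u)^2 + 2 * p" for u
      unfolding Qc'_def pp d_def k_def e1_def by (simp add: power2_eq_square algebra_simps)
    then show "((\<lambda>u. 2 * Yc d k (ang d k (u - u1))) has_real_derivative 6 * (z u)^2 + 2 * p) (at u)" for u
      using DERIV_cmult[OF shift[OF Wf_deriv(2)[OF dk, of "u - u1"]], of 2] by (simp add: z_def)
    show "\<bar>z u\<bar> \<le> B" for u using Wf_range[OF dk(1), of k "u - u1"] by (auto simp: z_def B_def d_def)
    show "v u1 = z u1" using Wf_zero[OF dk] by (simp add: z_def e3_def)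
    show "v1 u1 = 2 * Yc d k (ang d k (u1 - u1))" using Wf_zero[OF dk] z1 by simp
  qed (rule vB dv dv1)+
  then have vz: "- 2/3 * \<kappa> u = e3 + Wf d k (u - u1)" for u by (simp only: v_def z_def)
  have "\<kappa> u = (d + k) / 2 - 3/2 * Wf d k (u + - u1)" for u
  proof -
    have "Wf d k (u + - u1) = Wf d k (u - u1)" by simp
    then show ?thesis using vz[of u] s by linarith
  qed
  then show ?thesis by (rule that[OF dk])
qed

no_notation fps_nth (infixl "$" 75)

declare One_nat_def [simp del] vd.simps(2) [simp del]

section \<open>Frenet equations of normalized Legendrian lifts\<close>

lemma herm_add_left: "herm (x + y) z = herm x z + herm y z"
  and herm_add_right: "herm z (x + y) = herm z x + herm z y"
  and herm_diff_right: "herm z (x - y) = herm z x - herm z y"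
  and herm_minus_right: "herm z (- x) = - herm z x"
  and herm_scale_left: "herm (c *s x) z = cnj c * herm x z"
  and herm_scale_right: "herm z (c *s x) = c * herm z x"
  by (simp_all add: herm_def algebra_simps)

lemma herm_cnj: "herm y x = cnj (herm x y)"
  by (simp add: herm_def algebra_simps)

lemma herm_self_Im: "Im (herm x x) = 0"
  by (simp add: herm_def)

lemma has_vector_derivative_nth:
  assumes "(f has_vector_derivative f') (at u within S)"
  shows "((\<lambda>u. f u $ i) has_vector_derivative f' $ i) (at u within S)"
  using bounded_linear.has_vector_derivative[OF bounded_linear_vec_nth assms] .

lemma has_vector_derivative_cnj':
  assumes "(f has_vector_derivative f') (at u within S)"
  shows "((\<lambda>u. cnj (f u)) has_vector_derivative cnj f') (at u within S)"
  using bounded_linear.has_vector_derivative[OF bounded_linear_cnj assms] .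

lemma herm_deriv:
  assumes f: "(f has_vector_derivative f') (at u)" and g: "(g has_vector_derivative g') (at u)"
  shows "((\<lambda>u. herm (f u) (g u)) has_vector_derivative herm f' (g u) + herm (f u) g') (at u)"
proof -
  have m: "((\<lambda>u. cnj (f u $ i) * g u $ j) has_vector_derivative
      cnj (f u $ i) * g' $ j + cnj (f' $ i) * g u $ j) (at u)" for i j
    by (rule has_vector_derivative_mult[OF has_vector_derivative_cnj'[OF has_vector_derivative_nth[OF f]] has_vector_derivative_nth[OF g]])
  have "((\<lambda>u. herm (f u) (g u)) has_vector_derivative
     \<i> * ((cnj (f u $ 1) * g' $ 3 + cnj (f' $ 1) * g u $ 3) - (cnj (f u $ 3) * g' $ 1 + cnj (f' $ 3) * g u $ 1))
      + (cnj (f u $ 2) * g' $ 2 + cnj (f' $ 2) * g u $ 2)) (at u)"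
    unfolding herm_def
    by (rule has_vector_derivative_add[OF has_vector_derivative_mult_right[OF has_vector_derivative_diff[OF m m]] m])
  then show ?thesis by (simp add: herm_def algebra_simps)
qed

definition Hmat :: "complex^3^3" where
  "Hmat = (\<chi> i j. if i = 1 \<and> j = 3 then \<i> else if i = 3 \<and> j = 1 then - \<i> else if i = 2 \<and> j = 2 then 1 else 0)"

lemma det_Hmat: "det Hmat = -1"
  by (simp add: det_3 Hmat_def)

definition rows3 :: "complex^3 \<Rightarrow> complex^3 \<Rightarrow> complex^3 \<Rightarrow> complex^3^3" where
  "rows3 x y z = (\<chi> i. if i = 1 then x else if i = 2 then y else z)"

lemma det3_rows3: "det3 x y z = det (rows3 x y z)"
  by (simp add: det3_def rows3_def)

lemma rows3_nth: "rows3 x y z $ 1 = x" "rows3 x y z $ 2 = y" "rows3 x y z $ 3 = z"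
  by (simp_all add: rows3_def)

lemma gram_factor:
  fixes R S :: "complex^3^3"
  shows "(\<chi> i j. herm (R $ i) (S $ j)) = (\<chi> i j. cnj (R $ i $ j)) ** Hmat ** transpose S"
  by (simp add: vec_eq_iff matrix_matrix_mult_def transpose_def herm_def Hmat_def sum_3 algebra_simps)

text \<open>Trades determinants of frames for Hermitian products and back; the sign is the
  determinant \<open>-1\<close> of the form itself.\<close>

lemma mixed_gram:
  fixes R S :: "complex^3^3"
  shows "det (\<chi> i j. herm (R $ i) (S $ j)) = - cnj (det R) * det S"
proof -
  have "det (\<chi> i j. cnj (R $ i $ j)) = cnj (det R)" by (simp add: det_3)
  then show ?thesis unfolding gram_factor det_mul det_transpose det_Hmat by simp
qed

text \<open>The form is nondegenerate, so identities between vectors can be proved by pairing with a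
  frame.\<close>

lemma herm_frame_zero:
  assumes d: "det3 x y z \<noteq> 0" and h: "herm x w = 0" "herm y w = 0" "herm z w = 0"
  shows "w = 0"
proof -
  let ?M = "(\<chi> i j. cnj (rows3 x y z $ i $ j)) ** Hmat"
  have "det (\<chi> i j. cnj (rows3 x y z $ i $ j)) = cnj (det (rows3 x y z))" by (simp add: det_3)
  then have "det ?M \<noteq> 0" using d unfolding det_mul det_Hmat det3_rows3 by simp
  then have "invertible ?M" by (simp add: invertible_det_nz)
  then obtain B where B: "B ** ?M = mat 1" unfolding invertible_def by blast
  have "(?M *v w) $ i = herm (rows3 x y z $ i) w" for i
    by (simp add: matrix_vector_mult_def matrix_matrix_mult_def herm_def Hmat_def sum_3 algebra_simps)
  moreover have "herm (rows3 x y z $ i) w = 0" for i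
    using exhaust_3[of i] h by (auto simp: rows3_nth)
  ultimately have "?M *v w = 0" by (simp add: vec_eq_iff)
  then have "B *v (?M *v w) = 0" by simp
  then show "w = 0" unfolding matrix_vector_mul_assoc B by simp
qed

lemma det3_deriv:
  assumes "(f has_vector_derivative f') (at u)" "(g has_vector_derivative g') (at u)" "(h has_vector_derivative h') (at u)"
  shows "((\<lambda>u. det3 (f u) (g u) (h u)) has_vector_derivative
     det3 f' (g u) (h u) + det3 (f u) g' (h u) + det3 (f u) (g u) h') (at u)"
proof -
  have m: "((\<lambda>u. f u $ i * g u $ j * h u $ k) has_vector_derivative
     (f u $ i * g u $ j) * h' $ k + (f u $ i * g' $ j + f' $ i * g u $ j) * h u $ k) (at u)" for i j k
    by (rule has_vector_derivative_mult[OF has_vector_derivative_mult[OF has_vector_derivative_nth[OF assms(1)]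
          has_vector_derivative_nth[OF assms(2)]] has_vector_derivative_nth[OF assms(3)]])
  have e: "det3 x y z = x $ 1 * y $ 2 * z $ 3 + x $ 2 * y $ 3 * z $ 1 + x $ 3 * y $ 1 * z $ 2
     - x $ 1 * y $ 3 * z $ 2 - x $ 2 * y $ 1 * z $ 3 - x $ 3 * y $ 2 * z $ 1" for x y z
    unfolding det3_rows3 det_3 rows3_nth by (simp add: algebra_simps)
  show ?thesis unfolding e
    by (rule has_vector_derivative_eq_rhs[OF has_vector_derivative_diff[OF has_vector_derivative_diff[OF has_vector_derivative_diff[OF
          has_vector_derivative_add[OF has_vector_derivative_add[OF m m] m] m] m] m]])
       (simp add: algebra_simps)
qed

lemma det3_repeat: "det3 x x z = 0" "det3 x y y = 0" "det3 x y x = 0"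
  unfolding det3_rows3 det_3 rows3_nth by (simp_all add: algebra_simps)

lemma smooth_deriv: "smooth_fun f \<Longrightarrow> (vd f k has_vector_derivative vd f (Suc k) u) (at u)"
  unfolding smooth_fun_def by blast

lemma const_deriv_zero:
  fixes f :: "real \<Rightarrow> 'a::real_normed_vector"
  assumes "\<And>u. f u = c" "(f has_vector_derivative f') (at u)"
  shows "f' = 0"
proof -
  have "f = (\<lambda>_. c)" using assms(1) by (rule ext)
  then have "(f has_vector_derivative 0) (at u)" by simp
  then show ?thesis using assms(2) vector_derivative_unique_at by blast
qed

text \<open>The derivative of \<open>cr_curv G\<close>, because \<open>cr_curv\<close> is half of
  the product of \<open>G''\<close> with itself.\<close>

definition kap' :: "(real \<Rightarrow> complex^3) \<Rightarrow> real \<Rightarrow> real" where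
  "kap' G u = Re (herm (vd G 2 u) (vd G 3 u))"

lemma real_cube_eq_1:
  fixes Y :: real assumes "Y^3 = 1" shows "Y = 1"
proof -
  have "(Y - 1) * ((Y + 1/2)^2 + 3/4) = Y^3 - 1" by (simp add: power2_eq_square power3_eq_cube field_simps)
  then have "(Y - 1) * ((Y + 1/2)^2 + 3/4) = 0" using assms by simp
  moreover have "(Y + 1/2)^2 + 3/4 \<noteq> 0" using zero_le_power2[of "Y + 1/2"] by linarith
  ultimately show ?thesis by simp
qed

text \<open>The products come from successive differentiation, except two. That of \<open>G'\<close>
  with itself is real, and the Gram determinant shows that its cube is 1. That of \<open>G\<close>
  with \<open>G'''\<close> vanishes by the mixed Gram determinant, because \<open>det = \<i>\<close>
  is constant. Testing \<open>G'''\<close> against the frame then gives the Frenet equation.\<close>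

lemma frenet:
  assumes "normalized_legendrian_lift G"
  shows "herm (G u) (G u) = 0" "herm (G u) (vd G 1 u) = 0" "herm (vd G 1 u) (G u) = 0"
    "herm (vd G 1 u) (vd G 1 u) = 1" "herm (G u) (vd G 2 u) = -1" "herm (vd G 2 u) (G u) = -1"
    "herm (vd G 1 u) (vd G 2 u) = 0" "herm (vd G 2 u) (vd G 1 u) = 0"
    "herm (vd G 2 u) (vd G 2 u) = of_real (2 * cr_curv G u)"
    "herm (G u) (vd G 3 u) = 0" "herm (vd G 1 u) (vd G 3 u) = - of_real (2 * cr_curv G u)"
    "det3 (G u) (vd G 1 u) (vd G 2 u) = \<i>"
    "(cr_curv G has_real_derivative kap' G u) (at u)"
    "herm (vd G 2 u) (vd G 3 u) = of_real (kap' G u) - \<i> * of_real (inv_a G u)"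
    "vd G 3 u = (\<i> * of_real (inv_a G u) - of_real (kap' G u)) *s G u + (- 2 * of_real (cr_curv G u)) *s vd G 1 u"
proof -
  have sm: "smooth_fun G" and h00: "\<And>u. herm (G u) (G u) = 0" and h01: "\<And>u. herm (G u) (vd G 1 u) = 0"
    and dt: "\<And>u. det3 (G u) (vd G 1 u) (vd G 2 u) = \<i>"
    using assms by (auto simp: normalized_legendrian_lift_def)
  have D0: "(G has_vector_derivative vd G 1 u) (at u)" for u using smooth_deriv[OF sm, of 0] by (simp add: One_nat_def)
  have D1: "(vd G 1 has_vector_derivative vd G 2 u) (at u)" for u using smooth_deriv[OF sm, of 1] by (simp add: Suc_1)
  have D2: "(vd G 2 has_vector_derivative vd G 3 u) (at u)" for u using smooth_deriv[OF sm, of 2] by simp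
  have h10: "herm (vd G 1 u) (G u) = 0" for u using h01[of u] herm_cnj[of "vd G 1 u" "G u"] by simp
  have s1: "herm (G u) (vd G 2 u) = - herm (vd G 1 u) (vd G 1 u)" for u
    using const_deriv_zero[OF h01 herm_deriv[OF D0 D1], of u] by (simp add: eq_neg_iff_add_eq_0 add.commute)
  have h11: "herm (vd G 1 u) (vd G 1 u) = 1" for u
  proof -
    define Y where "Y = Re (herm (vd G 1 u) (vd G 1 u))"
    have Y: "herm (vd G 1 u) (vd G 1 u) = of_real Y" using herm_self_Im by (simp add: complex_eq_iff Y_def)
    have x: "herm (G u) (vd G 2 u) = - of_real Y" "herm (vd G 2 u) (G u) = - of_real Y"
      using s1[of u] Y herm_cnj[of "vd G 2 u" "G u"] by simp_all
    have "det (\<chi> i j. herm (rows3 (G u) (vd G 1 u) (vd G 2 u) $ i) (rows3 (G u) (vd G 1 u) (vd G 2 u) $ j)) = - (of_real Y * of_real Y * of_real Y)"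
      by (simp add: det_3 rows3_nth h00 h01 h10 x Y)
    then have "- (of_real Y * of_real Y * of_real Y) = - cnj \<i> * \<i>" unfolding mixed_gram det3_rows3[symmetric] dt by simp
    then have "complex_of_real (Y^3) = of_real 1" by (simp add: power3_eq_cube)
    then have "Y^3 = 1" by (simp only: of_real_eq_iff)
    then have "Y = 1" by (rule real_cube_eq_1)
    then show ?thesis using Y by simp
  qed
  have h02: "herm (G u) (vd G 2 u) = -1" and h20: "herm (vd G 2 u) (G u) = -1" for u
    using s1[of u] h11[of u] herm_cnj[of "vd G 2 u" "G u"] by simp_all
  have dt3: "det3 (G u) (vd G 1 u) (vd G 3 u) = 0" for u
    using const_deriv_zero[OF dt det3_deriv[OF D0 D1 D2], of u] by (simp add: det3_repeat)
  have h03: "herm (G u) (vd G 3 u) = 0" for u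
  proof -
    have "det (\<chi> i j. herm (rows3 (G u) (vd G 1 u) (vd G 2 u) $ i) (rows3 (G u) (vd G 1 u) (vd G 3 u) $ j)) = herm (G u) (vd G 3 u)"
      by (simp add: det_3 rows3_nth h00 h01 h10 h11 h20)
    then show ?thesis unfolding mixed_gram det3_rows3[symmetric] dt3 by simp
  qed
  have h12: "herm (vd G 1 u) (vd G 2 u) = 0" and h21: "herm (vd G 2 u) (vd G 1 u) = 0" for u
  proof -
    show "herm (vd G 1 u) (vd G 2 u) = 0"
      using const_deriv_zero[OF h02 herm_deriv[OF D0 D2], of u] h03 by simp
    then show "herm (vd G 2 u) (vd G 1 u) = 0" using herm_cnj[of "vd G 2 u" "vd G 1 u"] by simp
  qed
  have h22: "herm (vd G 2 u) (vd G 2 u) = of_real (2 * cr_curv G u)" for u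
    using herm_self_Im[of "vd G 2 u"] by (simp add: complex_eq_iff cr_curv_def)
  have h13: "herm (vd G 1 u) (vd G 3 u) = - of_real (2 * cr_curv G u)" for u
    using const_deriv_zero[OF h12 herm_deriv[OF D1 D2], of u] h22[of u] by (simp add: eq_neg_iff_add_eq_0 add.commute)
  have h32: "herm (vd G 3 u) (vd G 2 u) = cnj (herm (vd G 2 u) (vd G 3 u))" for u by (rule herm_cnj)
  have dk: "(cr_curv G has_real_derivative kap' G u) (at u)" for u
  proof -
    have "((\<lambda>u. Re (herm (vd G 2 u) (vd G 2 u)) / 2) has_vector_derivative
        Re (herm (vd G 3 u) (vd G 2 u) + herm (vd G 2 u) (vd G 3 u)) / 2) (at u)"
      by (intro has_vector_derivative_divide bounded_linear.has_vector_derivative[OF bounded_linear_Re] herm_deriv D2)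
    then show ?thesis unfolding has_real_derivative_iff_has_vector_derivative cr_curv_def[abs_def] kap'_def h32 by simp
  qed
  have h23: "herm (vd G 2 u) (vd G 3 u) = of_real (kap' G u) - \<i> * of_real (inv_a G u)" for u
    using h32[of u] by (simp add: complex_eq_iff kap'_def inv_a_def)
  have G3: "vd G 3 u = (\<i> * of_real (inv_a G u) - of_real (kap' G u)) *s G u + (- 2 * of_real (cr_curv G u)) *s vd G 1 u" for u
  proof -
    let ?w = "vd G 3 u - ((\<i> * of_real (inv_a G u) - of_real (kap' G u)) *s G u + (- 2 * of_real (cr_curv G u)) *s vd G 1 u)"
    have "?w = 0"
      by (rule herm_frame_zero[of "G u" "vd G 1 u" "vd G 2 u"])
         (simp_all only: dt herm_diff_right herm_add_right herm_scale_right h00 h01 h10 h11 h20 h21 h03 h13 h23, simp_all)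
    then show ?thesis by simp
  qed
  show "herm (G u) (G u) = 0" "herm (G u) (vd G 1 u) = 0" "herm (vd G 1 u) (G u) = 0"
    "herm (vd G 1 u) (vd G 1 u) = 1" "herm (G u) (vd G 2 u) = -1" "herm (vd G 2 u) (G u) = -1"
    "herm (vd G 1 u) (vd G 2 u) = 0" "herm (vd G 2 u) (vd G 1 u) = 0"
    "herm (vd G 2 u) (vd G 2 u) = of_real (2 * cr_curv G u)"
    "herm (G u) (vd G 3 u) = 0" "herm (vd G 1 u) (vd G 3 u) = - of_real (2 * cr_curv G u)"
    "det3 (G u) (vd G 1 u) (vd G 2 u) = \<i>"
    "(cr_curv G has_real_derivative kap' G u) (at u)"
    "herm (vd G 2 u) (vd G 3 u) = of_real (kap' G u) - \<i> * of_real (inv_a G u)"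
    "vd G 3 u = (\<i> * of_real (inv_a G u) - of_real (kap' G u)) *s G u + (- 2 * of_real (cr_curv G u)) *s vd G 1 u"
    by (rule h00 h01 h10 h11 h02 h20 h12 h21 h22 h03 h13 dt dk h23 G3)+
qed

section \<open>Smoothness of the curvature\<close>

text \<open>\<open>vd\<close> iterates \<open>vector_derivative\<close>, so membership in a class
  closed under differentiation passes to every order. Smoothness is thus obtained without a formula
  for higher derivatives.\<close>

lemma smooth_funI:
  assumes closed: "\<And>f. f \<in> \<F> \<Longrightarrow> \<exists>g\<in>\<F>. \<forall>u. (f has_vector_derivative g u) (at u)" and f: "f \<in> \<F>"
  shows "smooth_fun f"
proof -
  have in_F: "vd f k \<in> \<F> \<and> (\<forall>u. (vd f k has_vector_derivative vd f (Suc k) u) (at u))" for k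
  proof -
    have step: "(\<forall>u. (g has_vector_derivative vector_derivative g (at u)) (at u)) \<and> (\<lambda>u. vector_derivative g (at u)) \<in> \<F>"
      if gF: "g \<in> \<F>" for g
    proof -
      obtain h where h: "h \<in> \<F>" "\<And>u. (g has_vector_derivative h u) (at u)" using closed[OF gF] by blast
      then have "(\<lambda>u. vector_derivative g (at u)) = h" using vector_derivative_at by blast
      then show ?thesis using h by (metis vector_derivative_at)
    qed
    have "vd f k \<in> \<F>" by (induction k) (use f step in \<open>auto simp: vd.simps\<close>)
    then show ?thesis using step by (simp add: vd.simps)
  qed
  then show ?thesis unfolding smooth_fun_def by blast
qed

text \<open>Closed under differentiation by the product rule, and it contains the curvature.\<close>

inductive_set hermspan :: "(real \<Rightarrow> complex^3) \<Rightarrow> (real \<Rightarrow> real) set" for G where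
  base: "(\<lambda>u. c * Re (herm (vd G i u) (vd G j u))) \<in> hermspan G"
| sum: "f \<in> hermspan G \<Longrightarrow> g \<in> hermspan G \<Longrightarrow> (\<lambda>u. f u + g u) \<in> hermspan G"

lemma smooth_cr_curv:
  assumes "smooth_fun G" shows "smooth_fun (cr_curv G)"
proof (rule smooth_funI)
  fix f assume "f \<in> hermspan G"
  then show "\<exists>g\<in>hermspan G. \<forall>u. (f has_vector_derivative g u) (at u)"
  proof induction
    case (base c i j)
    have "((\<lambda>u. c * Re (herm (vd G i u) (vd G j u))) has_vector_derivative
        c * Re (herm (vd G (Suc i) u) (vd G j u)) + c * Re (herm (vd G i u) (vd G (Suc j) u))) (at u)" for u
    proof -
      have "((\<lambda>u. c * Re (herm (vd G i u) (vd G j u))) has_vector_derivative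
         c * Re (herm (vd G (Suc i) u) (vd G j u) + herm (vd G i u) (vd G (Suc j) u))) (at u)"
        by (intro has_vector_derivative_mult_right bounded_linear.has_vector_derivative[OF bounded_linear_Re]
            herm_deriv smooth_deriv[OF assms])
      then show ?thesis by (simp add: distrib_left)
    qed
    then show ?case
      by (intro bexI[OF _ hermspan.sum[OF hermspan.base hermspan.base]] allI)
  next
    case (sum f g)
    then obtain f' g' where "f' \<in> hermspan G" "\<forall>u. (f has_vector_derivative f' u) (at u)"
      "g' \<in> hermspan G" "\<forall>u. (g has_vector_derivative g' u) (at u)" by blast
    then show ?case
      by (intro bexI[OF _ hermspan.sum[of f' G g']] allI has_vector_derivative_add) auto
  qed
next
  have "cr_curv G = (\<lambda>u. (1/2) * Re (herm (vd G 2 u) (vd G 2 u)))" by (simp add: fun_eq_iff cr_curv_def)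
  then show "cr_curv G \<in> hermspan G" using hermspan.base[of "1/2" G 2 2] by simp
qed

lemma bounded_bilinear_smult: "bounded_bilinear ((*s) :: complex \<Rightarrow> complex^3 \<Rightarrow> complex^3)"
proof -
  have "bilinear ((*s) :: complex \<Rightarrow> complex^3 \<Rightarrow> complex^3)"
    unfolding bilinear_def
    by (intro conjI allI linearI) (simp_all add: vec_eq_iff algebra_simps)
  then show ?thesis by (simp only: bilinear_conv_bounded_bilinear)
qed

lemma smult_deriv:
  assumes "(c has_vector_derivative c') (at u)" "(f has_vector_derivative f') (at u)"
  shows "((\<lambda>u. c u *s f u) has_vector_derivative c u *s f' + c' *s (f u :: complex^3)) (at u)"
  using bounded_bilinear.has_vector_derivative[OF bounded_bilinear_smult assms] .

lemma bounded_linear_matrix: "bounded_linear (\<lambda>x::complex^3. (A::complex^3^3) *v x)"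
proof -
  have "linear (\<lambda>x::complex^3. A *v x)"
    by (rule linearI) (simp_all add: vec_eq_iff matrix_vector_mult_def sum_3 algebra_simps)
  then show ?thesis by (simp only: linear_conv_bounded_linear)
qed

section \<open>Congruence of lifts with equal curvature\<close>

text \<open>The row vector of the linear functional \<open>herm x\<close>; it serves to write
  \<open>frame_map\<close> as a matrix.\<close>

definition hcov :: "complex^3 \<Rightarrow> complex^3" where
  "hcov x = (\<chi> j. if j = 1 then - \<i> * cnj (x $ 3) else if j = 2 then cnj (x $ 2) else \<i> * cnj (x $ 1))"

lemma hcov_herm: "hcov x $ 1 * z $ 1 + hcov x $ 2 * z $ 2 + hcov x $ 3 * z $ 3 = herm x z"
  by (simp add: hcov_def herm_def algebra_simps)

text \<open>The coefficients are those of \<open>z\<close> in the frame \<open>G1, G1', G1''\<close>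
  at \<open>u\<close>, so for a normalized lift \<open>G1\<close> this is the linear map taking its
  frame to that of \<open>G2\<close>.\<close>

definition frame_map :: "(real \<Rightarrow> complex^3) \<Rightarrow> (real \<Rightarrow> complex^3) \<Rightarrow> real \<Rightarrow> complex^3 \<Rightarrow> complex^3" where
  "frame_map G1 G2 u z = (- (herm (vd G1 2 u) z + 2 * of_real (cr_curv G1 u) * herm (G1 u) z)) *s G2 u
     + herm (vd G1 1 u) z *s vd G2 1 u + (- herm (G1 u) z) *s vd G2 2 u"

lemma frame_map_matrix: "\<exists>A. \<forall>z. A *v z = frame_map G1 G2 u z"
proof -
  define A :: "complex^3^3" where "A = (\<chi> i j. (- (hcov (vd G1 2 u) $ j + 2 * of_real (cr_curv G1 u) * hcov (G1 u) $ j)) * G2 u $ i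
     + hcov (vd G1 1 u) $ j * vd G2 1 u $ i + (- hcov (G1 u) $ j) * vd G2 2 u $ i)"
  have "A *v z = frame_map G1 G2 u z" for z
    unfolding frame_map_def hcov_herm[symmetric] A_def
    by (simp add: vec_eq_iff matrix_vector_mult_def sum_3 algebra_simps)
  then show ?thesis by blast
qed

lemma frame_map_frame:
  assumes "normalized_legendrian_lift G1"
  shows "frame_map G1 G2 u (G1 u) = G2 u" "frame_map G1 G2 u (vd G1 1 u) = vd G2 1 u" "frame_map G1 G2 u (vd G1 2 u) = vd G2 2 u"
  unfolding frame_map_def by (simp_all add: frenet[OF assms])

lemma frame_expand:
  assumes "normalized_legendrian_lift G"
  shows "frame_map G G u z = z"
proof -
  have "z - frame_map G G u z = 0"
    by (rule herm_frame_zero[of "G u" "vd G 1 u" "vd G 2 u"])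
       (simp_all add: frame_map_def herm_diff_right herm_add_right herm_minus_right herm_scale_right frenet[OF assms])
  then show ?thesis by simp
qed

text \<open>With equal curvature the two frames have the same Gram matrix. The comparison runs
  through \<open>frame_map G1 G1\<close>, which is the identity.\<close>

lemma frame_map_herm:
  assumes 1: "normalized_legendrian_lift G1" and 2: "normalized_legendrian_lift G2"
    and k: "cr_curv G1 u = cr_curv G2 u"
  shows "herm (frame_map G1 G2 u z) (frame_map G1 G2 u w) = herm z w"
proof -
  have "herm (frame_map G1 G2 u z) (frame_map G1 G2 u w) = herm (frame_map G1 G1 u z) (frame_map G1 G1 u w)"
    unfolding frame_map_def herm_add_left herm_add_right herm_scale_left herm_scale_right
    by (simp only: frenet[OF 1] frenet[OF 2] k)
  then show ?thesis by (simp only: frame_expand[OF 1])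
qed

lemma smooth_lift_derivs:
  assumes "normalized_legendrian_lift G"
  shows "(G has_vector_derivative vd G 1 u) (at u)" "(vd G 1 has_vector_derivative vd G 2 u) (at u)"
    "(vd G 2 has_vector_derivative vd G 3 u) (at u)"
proof -
  have sm: "smooth_fun G" using assms by (simp add: normalized_legendrian_lift_def)
  show "(G has_vector_derivative vd G 1 u) (at u)" using smooth_deriv[OF sm, of 0] by (simp add: One_nat_def)
  show "(vd G 1 has_vector_derivative vd G 2 u) (at u)" using smooth_deriv[OF sm, of 1] by (simp add: Suc_1)
  show "(vd G 2 has_vector_derivative vd G 3 u) (at u)" using smooth_deriv[OF sm, of 2] by simp
qed

lemma herm_const_deriv:
  assumes "(f has_vector_derivative f') (at u)"
  shows "((\<lambda>u. herm (f u) z) has_vector_derivative herm f' z) (at u)"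
  using herm_deriv[OF assms has_vector_derivative_const[of z]] by (simp add: herm_def)

text \<open>Both frames obey the same linear Frenet system, so the map carrying one to the other
  does not depend on \<open>u\<close>.\<close>

lemma frame_map_deriv:
  assumes 1: "normalized_legendrian_lift G1" and 2: "normalized_legendrian_lift G2"
    and a: "inv_a G1 u = 1" "inv_a G2 u = 1" and k: "\<And>u. cr_curv G1 u = cr_curv G2 u"
  shows "((\<lambda>u. frame_map G1 G2 u z) has_vector_derivative 0) (at u)"
proof -
  have kk: "kap' G1 u = kap' G2 u"
    using DERIV_unique[OF frenet(13)[OF 1, of u], of "kap' G2 u"] frenet(13)[OF 2, of u] k
    by (metis ext)
  note D1 = smooth_lift_derivs[OF 1, of u] and D2 = smooth_lift_derivs[OF 2, of u]
  define x0 x1 x2 where "x0 = herm (G1 u) z" and "x1 = herm (vd G1 1 u) z" and "x2 = herm (vd G1 2 u) z"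
  define \<kappa> where "\<kappa> = complex_of_real (cr_curv G1 u)"
  define \<kappa>' where "\<kappa>' = complex_of_real (kap' G1 u)"
  have x3: "herm (vd G1 3 u) z = (- \<i> - \<kappa>') * x0 - 2 * \<kappa> * x1"
    unfolding frenet(15)[OF 1, of u] herm_add_left herm_scale_left a x0_def x1_def \<kappa>_def \<kappa>'_def by simp
  have g3: "vd G2 3 u = (\<i> - \<kappa>') *s G2 u + (- 2 * \<kappa>) *s vd G2 1 u"
    unfolding frenet(15)[OF 2, of u] a kk[symmetric] k[symmetric] \<kappa>_def \<kappa>'_def by simp
  have dk: "((\<lambda>u. complex_of_real (cr_curv G1 u)) has_vector_derivative \<kappa>') (at u)"
    unfolding \<kappa>'_def using frenet(13)[OF 1, of u]
    by (intro has_vector_derivative_of_real) (simp add: has_real_derivative_iff_has_vector_derivative)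
  have e0: "((\<lambda>u. - (herm (vd G1 2 u) z + 2 * of_real (cr_curv G1 u) * herm (G1 u) z)) has_vector_derivative
      - (herm (vd G1 3 u) z + (2 * of_real (cr_curv G1 u) * herm (vd G1 1 u) z + 2 * \<kappa>' * herm (G1 u) z))) (at u)"
    by (intro has_vector_derivative_minus has_vector_derivative_add has_vector_derivative_mult has_vector_derivative_mult_right
        herm_const_deriv D1 dk)
  have e2: "((\<lambda>u. - herm (G1 u) z) has_vector_derivative - herm (vd G1 1 u) z) (at u)"
    by (intro has_vector_derivative_minus herm_const_deriv D1)
  have "((\<lambda>u. frame_map G1 G2 u z) has_vector_derivative
     ((- (x2 + 2 * \<kappa> * x0)) *s vd G2 1 u + (- (herm (vd G1 3 u) z + (2 * \<kappa> * x1 + 2 * \<kappa>' * x0))) *s G2 u)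
     + (x1 *s vd G2 2 u + x2 *s vd G2 1 u) + ((- x0) *s vd G2 3 u + (- x1) *s vd G2 2 u)) (at u)"
    unfolding frame_map_def x0_def x1_def x2_def \<kappa>_def
    by (intro has_vector_derivative_add smult_deriv e0 e2 herm_const_deriv D1 D2)
  moreover have "((- (x2 + 2 * \<kappa> * x0)) *s vd G2 1 u + (- (herm (vd G1 3 u) z + (2 * \<kappa> * x1 + 2 * \<kappa>' * x0))) *s G2 u)
     + (x1 *s vd G2 2 u + x2 *s vd G2 1 u) + ((- x0) *s vd G2 3 u + (- x1) *s vd G2 2 u) = 0"
    unfolding x3 g3 by (simp add: vec_eq_iff algebra_simps)
  ultimately show ?thesis by simp
qed

lemma congruent_lifts:
  assumes 1: "normalized_legendrian_lift G1" and 2: "normalized_legendrian_lift G2"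
    and a: "\<And>u. inv_a G1 u = 1" "\<And>u. inv_a G2 u = 1" and k: "\<And>u. cr_curv G1 u = cr_curv G2 u"
  obtains A where "A \<in> SU21" "\<And>u. G2 u = A *v G1 u"
proof -
  obtain A where A: "\<And>z. A *v z = frame_map G1 G2 0 z" using frame_map_matrix[of G1 G2 0] by blast
  have const: "frame_map G1 G2 u z = frame_map G1 G2 0 z" for u z
  proof -
    have d: "((\<lambda>u. frame_map G1 G2 u z) has_derivative (\<lambda>h. 0)) (at u within UNIV)" for u
      using frame_map_deriv[OF 1 2 a k, where u = u and z = z] by (simp add: has_vector_derivative_def)
    obtain c where "\<And>u. u \<in> UNIV \<Longrightarrow> frame_map G1 G2 u z = c"
      using has_derivative_zero_constant[OF convex_UNIV d] by blast
    then show ?thesis by simp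
  qed
  have H: "herm (A *v z) (A *v w) = herm z w" for z w unfolding A by (rule frame_map_herm[OF 1 2 k])
  have "A ** transpose (rows3 (G1 0) (vd G1 1 0) (vd G1 2 0)) = transpose (rows3 (G2 0) (vd G2 1 0) (vd G2 2 0))"
  proof -
    have "(A ** transpose R) $ i $ j = (A *v (R $ j)) $ i" for R :: "complex^3^3" and i j
      by (simp add: matrix_matrix_mult_def matrix_vector_mult_def transpose_def)
    moreover have "A *v (rows3 (G1 0) (vd G1 1 0) (vd G1 2 0) $ j) = rows3 (G2 0) (vd G2 1 0) (vd G2 2 0) $ j" for j
      unfolding A using exhaust_3[of j] by (auto simp: rows3_nth frame_map_frame[OF 1])
    ultimately show ?thesis by (simp add: vec_eq_iff transpose_def)
  qed
  then have "det A * det (rows3 (G1 0) (vd G1 1 0) (vd G1 2 0)) = det (rows3 (G2 0) (vd G2 1 0) (vd G2 2 0))"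
    by (metis det_mul det_transpose)
  then have "det A = 1" using frenet(12)[OF 1, of 0] frenet(12)[OF 2, of 0] by (simp add: det3_rows3)
  with H have "A \<in> SU21" by (simp add: SU21_def)
  moreover have "G2 u = A *v G1 u" for u
    unfolding A using const[of u "G1 u"] frame_map_frame(1)[OF 1, of G2 u] by simp
  ultimately show ?thesis by (rule that)
qed

section \<open>Changes of parameter and projective equivalence\<close>

lemma vd_shift:
  assumes "smooth_fun f" shows "vd (\<lambda>u. f (u + s)) k = (\<lambda>u. vd f k (u + s))"
proof (induction k)
  case (Suc k)
  have "(((vd f k) \<circ> (\<lambda>u. u + s)) has_vector_derivative 1 *\<^sub>R vd f (Suc k) (u + s)) (at u)" for u
    by (rule vector_diff_chain_at[OF _ smooth_deriv[OF assms]]) (auto intro!: derivative_eq_intros simp: has_vector_derivative_def)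
  then have "((\<lambda>u. vd f k (u + s)) has_vector_derivative vd f (Suc k) (u + s)) (at u)" for u by (simp add: o_def)
  then show ?case unfolding vd.simps(2) Suc
    using vector_derivative_at vd.simps(2)[of f k] by (metis (no_types, lifting))
qed simp

lemma smooth_shift: "smooth_fun f \<Longrightarrow> smooth_fun (\<lambda>u. f (u + s))"
proof -
  assume sm: "smooth_fun f"
  have "(((vd f k) \<circ> (\<lambda>u. u + s)) has_vector_derivative 1 *\<^sub>R vd f (Suc k) (u + s)) (at u)" for u k
    by (rule vector_diff_chain_at[OF _ smooth_deriv[OF sm]]) (auto intro!: derivative_eq_intros simp: has_vector_derivative_def)
  then show ?thesis unfolding smooth_fun_def vd_shift[OF sm] by (simp add: o_def)
qed

lemma shift_lift:
  assumes "normalized_legendrian_lift G"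
  shows "normalized_legendrian_lift (\<lambda>u. G (u + s))" "inv_a (\<lambda>u. G (u + s)) u = inv_a G (u + s)"
    "cr_curv (\<lambda>u. G (u + s)) u = cr_curv G (u + s)"
proof -
  have sm: "smooth_fun G" using assms by (simp add: normalized_legendrian_lift_def)
  show "normalized_legendrian_lift (\<lambda>u. G (u + s))"
    using assms unfolding normalized_legendrian_lift_def vd_shift[OF sm] by (simp add: smooth_shift)
  show "inv_a (\<lambda>u. G (u + s)) u = inv_a G (u + s)" "cr_curv (\<lambda>u. G (u + s)) u = cr_curv G (u + s)"
    unfolding inv_a_def cr_curv_def vd_shift[OF sm] by simp_all
qed

lemma change_of_param_shift: "change_of_param (\<lambda>u. u + s)"
proof -
  have v: "vd (\<lambda>u. u + s) k = (if k = 0 then (\<lambda>u. u + s) else if k = 1 then (\<lambda>_. 1) else (\<lambda>_. 0))" for k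
  proof (induction k)
    case (Suc k)
    have "((\<lambda>u. u + s) has_vector_derivative 1) (at u)" for u
      by (auto intro!: derivative_eq_intros simp: has_vector_derivative_def)
    then have 1: "vector_derivative (\<lambda>u. u + s) (at u) = 1" for u by (rule vector_derivative_at)
    show ?case unfolding vd.simps(2) Suc by (auto simp: 1 One_nat_def)
  qed simp
  have "(vd (\<lambda>u. u + s) k has_vector_derivative vd (\<lambda>u. u + s) (Suc k) u) (at u)" for k u
    unfolding v by (auto intro!: derivative_eq_intros simp: has_vector_derivative_def One_nat_def)
  then have "smooth_fun (\<lambda>u. u + s)" by (simp add: smooth_fun_def)
  moreover have "bij (\<lambda>u::real. u + s)" by (rule bij_betw_byWitness[where f' = "\<lambda>u. u - s"]) auto
  ultimately show ?thesis unfolding change_of_param_def v by (simp add: One_nat_def)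
qed

lemma cr_equiv_of_same_curvature:
  assumes 1: "normalized_legendrian_lift G1" and 2: "normalized_legendrian_lift G2"
    and a: "\<And>u. inv_a G1 u = 1" "\<And>u. inv_a G2 u = 1" and k: "\<And>u. cr_curv G1 u = cr_curv G2 (u + s)"
  shows "cr_equiv G1 G2"
proof -
  obtain A where A: "A \<in> SU21" "\<And>u. G2 (u + s) = A *v G1 u"
    by (rule congruent_lifts[OF 1 shift_lift(1)[OF 2, of s]]) (use a k in \<open>auto simp: shift_lift[OF 2]\<close>)
  have "G2 u = 1 *s (A *v G1 (u + (- s)))" for u using A(2)[of "u + (- s)"] by (simp add: vec_eq_iff)
  then show ?thesis unfolding cr_equiv_def using A(1) change_of_param_shift[of "- s"]
    by (intro bexI[OF _ A(1)] exI[of _ "\<lambda>u. u + (- s)"] conjI allI exI[of _ 1]) auto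
qed

lemma det3_triangular:
  "det3 (a *s X) (b *s X + d *s Y) (e *s X + f *s Y + g *s Z) = a * d * g * det3 X Y Z"
  unfolding det3_rows3 det_3 rows3_nth by (simp add: algebra_simps)

lemma det3_matrix: "det3 (A *v x) (A *v y) (A *v z) = det A * det3 x y z"
proof -
  have "rows3 (A *v x) (A *v y) (A *v z) = rows3 x y z ** transpose A"
    unfolding vec_eq_iff forall_3
    by (simp add: rows3_nth matrix_matrix_mult_def matrix_vector_mult_def transpose_def mult.commute)
  then show ?thesis unfolding det3_rows3 by (simp add: det_mul mult.commute)
qed

text \<open>A projective equivalence of lifts is a congruence up to a translation of the parameter:
  the determinant normalises \<open>c h'\<close> to a constant, and then \<open>a \<equiv> 1\<close> forces \<open>h'\<^sup>3 = 1\<close>.\<close>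

lemma cr_equiv_param:
  assumes 1: "normalized_legendrian_lift G1" and 2: "normalized_legendrian_lift G2"
    and a: "\<And>u. inv_a G1 u = 1" "\<And>u. inv_a G2 u = 1"
    and A: "A \<in> SU21" and h: "smooth_fun h" "\<And>u. vd h 1 u \<noteq> 0"
    and eq: "\<And>u. G2 u = c u *s (A *v G1 (h u))"
  shows "vd h 1 u = 1" "(c u)^3 = 1" "c u = c 0" "cr_curv G2 u = cr_curv G1 (h u)"
proof -
  \<comment> \<open>The frame of \<open>G1\<close> transported by \<open>A\<close> and
    \<open>h\<close>. Its Gram matrix is still the one of \<open>frenet\<close>, since
    \<open>A\<close> preserves the form.\<close>
  define X where "X k u = A *v vd G1 k (h u)" for k u
  define h1 where "h1 = vd h 1"
  define h2 where "h2 = vd h 2"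
  have dh: "(h has_vector_derivative h1 u) (at u)" "(h1 has_vector_derivative h2 u) (at u)" for u
    using smooth_deriv[OF h(1), of 0 u] smooth_deriv[OF h(1), of 1 u] by (simp_all add: h1_def h2_def One_nat_def Suc_1[unfolded One_nat_def])
  have sm1: "smooth_fun G1" using 1 by (simp add: normalized_legendrian_lift_def)
  have dX: "(X k has_vector_derivative of_real (h1 u) *s X (Suc k) u) (at u)" for k u
  proof -
    have "((vd G1 k \<circ> h) has_vector_derivative h1 u *\<^sub>R vd G1 (Suc k) (h u)) (at u)"
      by (rule vector_diff_chain_at[OF dh(1) smooth_deriv[OF sm1]])
    from bounded_linear.has_vector_derivative[OF bounded_linear_matrix[of A] this]
    have "((\<lambda>u. A *v vd G1 k (h u)) has_vector_derivative A *v (h1 u *\<^sub>R vd G1 (Suc k) (h u))) (at u)" by (simp add: o_def)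
    moreover have "A *v (h1 u *\<^sub>R vd G1 (Suc k) (h u)) = of_real (h1 u) *s X (Suc k) u"
      by (simp add: X_def vec_eq_iff matrix_vector_mult_def sum_3 scaleR_conv_of_real[symmetric] algebra_simps)
    ultimately show ?thesis by (simp add: X_def[abs_def])
  qed
  have herm_X: "herm (X i u) (X j u) = herm (vd G1 i (h u)) (vd G1 j (h u))" for i j u
    using A by (simp add: X_def SU21_def)
  have X0: "X 0 u = A *v G1 (h u)" for u by (simp add: X_def)
  have vd0: "vd G1 0 = G1" by simp
  note F = frenet[OF 1]
  have hX: "herm (X 2 u) (X 0 u) = -1" "herm (X 2 u) (X 1 u) = 0" "herm (X 2 u) (X 2 u) = of_real (2 * cr_curv G1 (h u))"
    "herm (X 1 u) (X 0 u) = 0" "herm (X 1 u) (X 1 u) = 1" "herm (X 1 u) (X 2 u) = 0" "herm (X 0 u) (X 0 u) = 0"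
    "herm (X 0 u) (X 1 u) = 0" "herm (X 0 u) (X 2 u) = -1" for u
    unfolding herm_X vd0 by (simp_all only: F)
  have X3: "X 3 u = (\<i> - of_real (kap' G1 (h u))) *s X 0 u + (- 2 * of_real (cr_curv G1 (h u))) *s X 1 u" for u
    unfolding X_def F(15)[of "h u"] a(1) vd0
    by (simp add: vec_eq_iff matrix_vector_mult_def sum_3 algebra_simps)
  have S1: "Suc 0 = 1" "Suc 1 = 2" "Suc 2 = 3" by simp_all
  have dX': "(X 0 has_vector_derivative of_real (h1 u) *s X 1 u) (at u)" "(X 1 has_vector_derivative of_real (h1 u) *s X 2 u) (at u)"
    "(X 2 has_vector_derivative of_real (h1 u) *s X 3 u) (at u)" for u
    using dX[of 0 u] dX[of 1 u] dX[of 2 u] unfolding S1 by simp_all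
  note D2 = smooth_lift_derivs[OF 2]
  have eqc: "G2 u = c u *s X 0 u" for u unfolding X0 by (rule eq)
  \<comment> \<open>The factor \<open>c\<close> is given only pointwise. Pairing with
    \<open>X 2\<close> expresses it by differentiable quantities.\<close>
  have c_eq: "c u = - herm (X 2 u) (G2 u)" for u unfolding eqc herm_scale_right hX by simp
  define c1 where "c1 u = - (herm (of_real (h1 u) *s X 3 u) (G2 u) + herm (X 2 u) (vd G2 1 u))" for u
  have dc: "(c has_vector_derivative c1 u) (at u)" for u
  proof -
    have "((\<lambda>u. - herm (X 2 u) (G2 u)) has_vector_derivative c1 u) (at u)"
      unfolding c1_def by (intro has_vector_derivative_minus herm_deriv dX' D2)
    moreover have "(\<lambda>u. - herm (X 2 u) (G2 u)) = c" using c_eq by (simp add: fun_eq_iff)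
    ultimately show ?thesis by simp
  qed
  have g1: "vd G2 1 u = c1 u *s X 0 u + (c u * of_real (h1 u)) *s X 1 u" for u
  proof -
    have "((\<lambda>u. c u *s X 0 u) has_vector_derivative c u *s (of_real (h1 u) *s X 1 u) + c1 u *s X 0 u) (at u)"
      by (rule smult_deriv[OF dc dX'(1)])
    moreover have "(\<lambda>u. c u *s X 0 u) = G2" using eqc by (simp add: fun_eq_iff)
    ultimately have "(G2 has_vector_derivative c u *s (of_real (h1 u) *s X 1 u) + c1 u *s X 0 u) (at u)" by simp
    from vector_derivative_unique_at[OF D2(1) this] show ?thesis by (simp add: vec_eq_iff algebra_simps)
  qed
  have c1_eq: "c1 u = - herm (X 2 u) (vd G2 1 u)" for u unfolding g1 herm_add_right herm_scale_right hX by simp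
  define c2 where "c2 u = - (herm (of_real (h1 u) *s X 3 u) (vd G2 1 u) + herm (X 2 u) (vd G2 2 u))" for u
  have dc1: "(c1 has_vector_derivative c2 u) (at u)" for u
  proof -
    have "((\<lambda>u. - herm (X 2 u) (vd G2 1 u)) has_vector_derivative c2 u) (at u)"
      unfolding c2_def by (intro has_vector_derivative_minus herm_deriv dX' D2)
    moreover have "(\<lambda>u. - herm (X 2 u) (vd G2 1 u)) = c1" using c1_eq by (simp add: fun_eq_iff)
    ultimately show ?thesis by simp
  qed
  define e where "e u = c u * of_real (h1 u)" for u
  define e' where "e' u = c u * of_real (h2 u) + c1 u * of_real (h1 u)" for u
  have de: "(e has_vector_derivative e' u) (at u)" for u
    unfolding e_def e'_def by (intro has_vector_derivative_mult dc has_vector_derivative_of_real dh(2)[folded has_real_derivative_iff_has_vector_derivative])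
  have g2: "vd G2 2 u = c2 u *s X 0 u + (c1 u * of_real (h1 u) + e' u) *s X 1 u + (e u * of_real (h1 u)) *s X 2 u" for u
  proof -
    have "((\<lambda>u. c1 u *s X 0 u + e u *s X 1 u) has_vector_derivative
       (c1 u *s (of_real (h1 u) *s X 1 u) + c2 u *s X 0 u) + (e u *s (of_real (h1 u) *s X 2 u) + e' u *s X 1 u)) (at u)"
      by (intro has_vector_derivative_add smult_deriv dc1 de dX')
    moreover have "(\<lambda>u. c1 u *s X 0 u + e u *s X 1 u) = vd G2 1" using g1 by (simp add: fun_eq_iff e_def)
    ultimately have "(vd G2 1 has_vector_derivative
       (c1 u *s (of_real (h1 u) *s X 1 u) + c2 u *s X 0 u) + (e u *s (of_real (h1 u) *s X 2 u) + e' u *s X 1 u)) (at u)" by simp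
    from vector_derivative_unique_at[OF D2(2) this] show ?thesis by (simp add: vec_eq_iff algebra_simps)
  qed
  have detX: "det3 (X 0 u) (X 1 u) (X 2 u) = \<i>" for u
    unfolding X_def det3_matrix vd0 F(12) using A by (simp add: SU21_def)
  \<comment> \<open>In the basis \<open>X 0, X 1, X 2\<close> the frame of \<open>G2\<close> is
    triangular, so the two determinant conditions leave \<open>e^3 = 1\<close>; differentiating this
    shows that \<open>e\<close> is constant.\<close>
  have e3: "e u * e u * e u = 1" for u
  proof -
    have "\<i> = c u * e u * (e u * of_real (h1 u)) * \<i>"
      using frenet(12)[OF 2, of u] unfolding g2 g1 eqc[of u] e_def[symmetric] det3_triangular detX by simp
    then have "c u * e u * (e u * of_real (h1 u)) = 1" by simp
    then show ?thesis by (simp add: e_def algebra_simps)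
  qed
  have enz: "e u \<noteq> 0" for u using e3[of u] by auto
  have e'0: "e' u = 0" for u
  proof -
    have "((\<lambda>u. e u * e u * e u) has_vector_derivative (e u * e u) * e' u + (e u * e' u + e' u * e u) * e u) (at u)"
      by (intro has_vector_derivative_mult de)
    from const_deriv_zero[OF e3 this] have "3 * (e u * e u * e' u) = 0" by (simp add: algebra_simps)
    then show ?thesis using enz by simp
  qed
  obtain w where w: "\<And>u. e u = w"
  proof -
    have "(e has_derivative (\<lambda>h. 0)) (at u within UNIV)" for u
      using de[of u] unfolding e'0 by (simp add: has_vector_derivative_def)
    from has_derivative_zero_constant[OF convex_UNIV this] that show ?thesis by blast
  qed
  have wnz: "w \<noteq> 0" using enz w by simp
  have nh: "h1 u \<noteq> 0" for u using h(2) by (simp add: h1_def)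
  \<comment> \<open>As \<open>e = c h'\<close> is the constant \<open>w\<close>, the quotient
    \<open>c / w = 1 / h'\<close> is real, and so are its derivatives.\<close>
  have C0: "Im (c u / w) = 0" for u
  proof -
    have "c u / w = 1 / of_real (h1 u)" using w[of u] wnz nh[of u] by (simp add: e_def field_simps)
    then have "c u / w = of_real (1 / h1 u)" by simp
    then show ?thesis by (simp only: Im_complex_of_real)
  qed
  have C1: "Im (c1 u / w) = 0" for u
    using const_deriv_zero[OF C0 bounded_linear.has_vector_derivative[OF bounded_linear_Im has_vector_derivative_divide[OF dc]]] .
  have C2: "Im (c2 u / w) = 0" for u
    using const_deriv_zero[OF C1 bounded_linear.has_vector_derivative[OF bounded_linear_Im has_vector_derivative_divide[OF dc1]]] .
  \<comment> \<open>The condition \<open>a = 1\<close> enters only with third derivatives.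
    \<open>q\<close> is real, and the imaginary part of its derivative is
    \<open>h'^2 - 1/h'\<close>.\<close>
  define q where "q u = herm (X 2 u) (vd G2 2 u) / w" for u
  have qv: "q u = - (c2 u / w) + of_real (h1 u * (2 * cr_curv G1 (h u)))" for u
    unfolding q_def g2 herm_add_right herm_scale_right hX e'0 using wnz w[of u] by (simp add: field_simps)
  have q0: "Im (q u) = 0" for u unfolding qv using C2[of u] by simp
  have dq: "(q has_vector_derivative (herm (of_real (h1 u) *s X 3 u) (vd G2 2 u) + herm (X 2 u) (vd G2 3 u)) / w) (at u)" for u
    unfolding q_def by (intro has_vector_derivative_divide herm_deriv dX' D2)
  have q'0: "Im ((herm (of_real (h1 u) *s X 3 u) (vd G2 2 u) + herm (X 2 u) (vd G2 3 u)) / w) = 0" for u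
    using const_deriv_zero[OF q0 bounded_linear.has_vector_derivative[OF bounded_linear_Im dq]] .
  have hh: "h1 u = 1" for u
  proof -
    define k1 k1' k2 k2' where "k1 = cr_curv G1 (h u)" and "k1' = kap' G1 (h u)" and "k2 = cr_curv G2 u" and "k2' = kap' G2 u"
    have 1: "herm (of_real (h1 u) *s X 3 u) (vd G2 2 u)
       = of_real (h1 u) * ((- \<i> - of_real k1') * (- (w * of_real (h1 u))) + (- 2 * of_real k1) * (c1 u * of_real (h1 u)))"
      unfolding herm_scale_left X3 herm_add_left g2 herm_add_right herm_scale_right hX e'0 w k1_def k1'_def by (simp add: algebra_simps)
    have 2: "herm (X 2 u) (vd G2 3 u) = - ((\<i> - of_real k2') * c u) + 2 * of_real k2 * c1 u"
      unfolding frenet(15)[OF 2, of u] a(2) herm_add_right herm_scale_right c1_eq c_eq k2_def k2'_def by (simp add: algebra_simps)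
    have cw: "c u / w = of_real (1 / h1 u)" using w[of u] wnz nh[of u] by (simp add: e_def field_simps)
    define r where "r = Re (c1 u / w)"
    have c1w: "c1 u / w = of_real r" using C1[of u] by (simp add: complex_eq_iff r_def)
    have cc: "c u = w * of_real (1 / h1 u)" "c1 u = w * of_real r" using cw c1w wnz by (simp_all add: field_simps)
    have "(herm (of_real (h1 u) *s X 3 u) (vd G2 2 u) + herm (X 2 u) (vd G2 3 u)) / w
      = of_real (h1 u) * ((\<i> + of_real k1') * of_real (h1 u) - 2 * of_real k1 * (of_real r * of_real (h1 u)))
        - (\<i> - of_real k2') * of_real (1 / h1 u) + 2 * of_real k2 * of_real r"
    proof -
      have "herm (of_real (h1 u) *s X 3 u) (vd G2 2 u) + herm (X 2 u) (vd G2 3 u)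
       = w * (of_real (h1 u) * ((\<i> + of_real k1') * of_real (h1 u) - 2 * of_real k1 * (of_real r * of_real (h1 u)))
        - (\<i> - of_real k2') * of_real (1 / h1 u) + 2 * of_real k2 * of_real r)"
        unfolding 1 2 cc by (simp add: algebra_simps)
      then show ?thesis using wnz by simp
    qed
    then have "h1 u * h1 u - 1 / h1 u = 0" using q'0[of u] by simp
    then have "(h1 u)^3 = 1" using nh[of u] by (simp add: power3_eq_cube field_simps)
    then show "h1 u = 1" by (rule real_cube_eq_1)
  qed
  have cw: "c u = w" for u using w[of u] hh by (simp add: e_def)
  show "vd h 1 u = 1" using hh by (simp add: h1_def)
  show "(c u)^3 = 1" using e3[of u] w[of u] unfolding cw power3_eq_cube by simp
  show "c u = c 0" unfolding cw ..
  have c10: "c1 u = 0" for u by (rule const_deriv_zero[OF cw dc])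
  have c20: "c2 u = 0" for u by (rule const_deriv_zero[OF c10 dc1])
  have "vd G2 2 u = w *s X 2 u" unfolding g2 c20 c10 e'0 w hh by (simp add: vec_eq_iff)
  then have "herm (vd G2 2 u) (vd G2 2 u) = cnj w * w * of_real (2 * cr_curv G1 (h u))"
    by (simp only: herm_scale_left herm_scale_right hX ac_simps)
  moreover have "cnj w * w = 1"
  proof -
    have "(norm w)^3 = 1" 
    proof -
      have "norm (w * w * w) = 1" using e3[of u] unfolding w by simp
      then show ?thesis by (simp only: norm_mult power3_eq_cube)
    qed
    then have "norm w = 1" by (rule real_cube_eq_1)
    then show ?thesis by (simp add: complex_norm_square[symmetric] mult.commute)
  qed
  ultimately show "cr_curv G2 u = cr_curv G1 (h u)"
    using frenet(9)[OF 2, of u] by (simp only: mult_1 of_real_eq_iff)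
qed

lemma param_translation:
  assumes "smooth_fun h" "\<And>u. vd h 1 u = (1::real)"
  obtains s where "\<And>u. h u = u + s"
proof -
  have "((\<lambda>u. h u - u) has_real_derivative 0) (at u)" for u
  proof -
    have "(h has_vector_derivative vd h (Suc 0) u) (at u)" using smooth_deriv[OF assms(1), of 0 u] by simp
    then have "(h has_real_derivative 1) (at u)"
      using assms(2)[of u] by (simp add: has_real_derivative_iff_has_vector_derivative One_nat_def)
    from DERIV_diff[OF this DERIV_ident] show ?thesis by simp
  qed
  then have z: "\<forall>u. ((\<lambda>u. h u - u) has_real_derivative 0) (at u)" by (intro allI)
  have e: "h u - u = h 0 - 0" for u by (rule DERIV_isconst_all[OF z])
  have "h u = u + h 0" for u using e[of u] by linarith
  then show ?thesis by (rule that)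
qed

lemma cr_equiv_imp_curvature_shift:
  assumes 1: "normalized_legendrian_lift G1" and 2: "normalized_legendrian_lift G2"
    and a: "\<And>u. inv_a G1 u = 1" "\<And>u. inv_a G2 u = 1" and eq: "cr_equiv G1 G2"
  obtains s where "\<And>u. cr_curv G2 u = cr_curv G1 (u + s)"
proof -
  obtain A h where A: "A \<in> SU21" "change_of_param h" "\<forall>u. \<exists>c. c \<noteq> 0 \<and> G2 u = c *s (A *v G1 (h u))"
    using eq unfolding cr_equiv_def by (elim bexE exE conjE)
  obtain c where "\<forall>u. c u \<noteq> 0 \<and> G2 u = c u *s (A *v G1 (h u))" using choice[OF A(3)] by (rule exE)
  then have c: "\<And>u. G2 u = c u *s (A *v G1 (h u))" by simp
  have h: "smooth_fun h" "\<And>u. vd h 1 u \<noteq> 0" using A(2) unfolding change_of_param_def by simp_all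
  note P = cr_equiv_param[OF 1 2 a A(1) h c]
  show ?thesis
  proof (rule param_translation[OF h(1) P(1)])
    fix s assume s: "\<And>u. h u = u + s"
    show ?thesis by (rule that[of s]) (use P(4) s in simp)
  qed
qed

lemma mat_one_SU21: "mat 1 \<in> SU21"
  by (simp add: SU21_def)

text \<open>Compared with its own translate under the identity change of parameter, the lift picks
  up by \<open>cr_equiv_param\<close> a constant cube root of unity, which three periods
  cancel.\<close>

lemma projective_period:
  assumes 1: "normalized_legendrian_lift G" and a: "\<And>u. inv_a G u = 1"
    and T: "\<And>u. \<exists>c. c \<noteq> 0 \<and> G (u + T) = c *s G u"
  shows "G (u + 3 * T) = G u" "cr_curv G (u + T) = cr_curv G u"
proof -
  obtain c where "\<forall>u. c u \<noteq> 0 \<and> G (u + T) = c u *s G u" using choice[OF allI[OF T]] by (rule exE)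
  then have c: "\<And>u. G (u + T) = c u *s G u" by simp
  have cc: "G (u + T) = c u *s (mat 1 *v G (u + 0))" for u using c by simp
  have h: "smooth_fun (\<lambda>u::real. u + 0)" "vd (\<lambda>u::real. u + 0) 1 u \<noteq> 0" for u
    using change_of_param_shift[of 0] unfolding change_of_param_def by simp_all
  have a2: "inv_a (\<lambda>u. G (u + T)) u = 1" for u using shift_lift(2)[OF 1, of T u] a by simp
  note P = cr_equiv_param[OF 1 shift_lift(1)[OF 1, of T] a a2 mat_one_SU21 h cc]
  have "G (u + 3 * T) = G (((u + T) + T) + T)" by (simp add: algebra_simps)
  also have "\<dots> = (c 0 * c 0 * c 0) *s G u" 
    unfolding c[of "u + T + T"] c[of "u + T"] c[of u] P(3)[of "u + T + T"] P(3)[of "u + T"] P(3)[of u] vector_smult_assoc mult.assoc ..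
  also have "c 0 * c 0 * c 0 = 1" using P(2)[of 0] by (simp add: power3_eq_cube)
  finally show "G (u + 3 * T) = G u" by simp
  show "cr_curv G (u + T) = cr_curv G u" using P(4)[of u] shift_lift(3)[OF 1, of T u] by simp
qed

section \<open>The linear system with elliptic coefficients\<close>

lemma vderiv_inverse:
  fixes s :: "real \<Rightarrow> complex"
  assumes "(s has_vector_derivative s') (at u)" "s u \<noteq> 0"
  shows "((\<lambda>u. inverse (s u)) has_vector_derivative - s' * (inverse (s u) * inverse (s u))) (at u)"
  using field_vector_diff_chain_at[OF assms(1) DERIV_inverse[OF assms(2)]]
  by (simp add: o_def power2_eq_square numeral_2_eq_2[symmetric])

lemma vderiv_exp:
  fixes p :: "real \<Rightarrow> complex"
  assumes "(p has_vector_derivative p') (at u)"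
  shows "((\<lambda>u. exp (p u)) has_vector_derivative p' * exp (p u)) (at u)"
  using field_vector_diff_chain_at[OF assms DERIV_exp] by (simp add: o_def)

lemma vderiv_of_real:
  assumes "(f has_real_derivative f') (at u)"
  shows "((\<lambda>u. complex_of_real (f u)) has_vector_derivative of_real f') (at u)"
  using has_vector_derivative_of_real[OF assms] .

lemma vderiv_zero_const:
  fixes f :: "real \<Rightarrow> complex"
  assumes "\<And>u. (f has_vector_derivative 0) (at u)" shows "f u = f v"
proof -
  have "(f has_derivative (\<lambda>h. 0)) (at u within UNIV)" for u
    using assms[of u] by (simp add: has_vector_derivative_def)
  from has_derivative_zero_constant[OF convex_UNIV this] obtain c where "\<And>x. x \<in> UNIV \<Longrightarrow> f x = c" by (rule exE) blast
  then show ?thesis by simp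
qed

lemma antiderivative_real:
  fixes f :: "real \<Rightarrow> real"
  assumes "\<And>x. isCont f x" shows "\<exists>F. \<forall>x. (F has_real_derivative f x) (at x)"
  using einterval_antiderivative[of "-\<infinity>" "\<infinity>" f] assms
  by (simp add: has_real_derivative_iff_has_vector_derivative)

lemma phase_angle:
  assumes dk: "0 < d" "d < k" and c: "c \<notin> {0..d}"
  shows "\<exists>\<Phi>. (\<forall>\<theta>. (\<Phi> has_real_derivative 1 / (c - d * (sin \<theta>)^2) / sqrt (k - d * (sin \<theta>)^2)) (at \<theta>)) \<and>
     (\<forall>\<theta>. \<Phi> (\<theta> + pi) = \<Phi> \<theta> + 2 * EI d k (\<lambda>V. 1 / (c - V)))"
proof -
  define f where "f \<theta> = 1 / (c - d * (sin \<theta>)^2) / sqrt (k - d * (sin \<theta>)^2)" for \<theta>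
  have V: "0 \<le> d * (sin \<theta>)^2" "d * (sin \<theta>)^2 \<le> d" for \<theta> using sin_sq_range[of d \<theta>] dk by auto
  have nz: "c - d * (sin \<theta>)^2 \<noteq> 0" "sqrt (k - d * (sin \<theta>)^2) \<noteq> 0" for \<theta>
    using c V[of \<theta>] dk by auto
  have "isCont f \<theta>" for \<theta> unfolding f_def by (intro continuous_intros nz)
  from antiderivative_real[OF this] obtain \<Phi> where P: "\<And>\<theta>. (\<Phi> has_real_derivative f \<theta>) (at \<theta>)" by (rule exE) blast
  have sh: "((\<lambda>x. \<Phi> (x + pi)) has_real_derivative f \<theta>) (at \<theta>)" for \<theta>
    using P[of "\<theta> + pi"] by (simp add: DERIV_shift f_def)
  have z: "\<forall>\<theta>. ((\<lambda>x. \<Phi> (x + pi) - \<Phi> x) has_real_derivative 0) (at \<theta>)"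
    using DERIV_diff[OF sh P] by simp
  have c1: "\<Phi> (\<theta> + pi) - \<Phi> \<theta> = \<Phi> (0 + pi) - \<Phi> 0" for \<theta> by (rule DERIV_isconst_all[OF z])
  \<comment> \<open>The integrand is symmetric under
    \<open>\<theta> \<mapsto> pi - \<theta>\<close>, so the integral over \<open>[0, pi]\<close> is
    twice the one over \<open>[0, pi/2]\<close>.\<close>
  have refl: "((\<lambda>x. \<Phi> (pi - x)) has_real_derivative f \<theta> * (0 - 1)) (at \<theta>)" for \<theta>
  proof -
    have "(\<Phi> has_real_derivative f \<theta>) (at (pi - \<theta>))" using P[of "pi - \<theta>"] by (simp add: f_def)
    from DERIV_chain2[OF this DERIV_diff[OF DERIV_const DERIV_ident]] show ?thesis .
  qed
  have z2: "\<forall>\<theta>. ((\<lambda>x. \<Phi> x + \<Phi> (pi - x)) has_real_derivative 0) (at \<theta>)"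
    using DERIV_add[OF P refl] by simp
  have c2: "\<Phi> 0 + \<Phi> (pi - 0) = \<Phi> (pi/2) + \<Phi> (pi - pi/2)" by (rule DERIV_isconst_all[OF z2])
  have "(f has_integral \<Phi> (pi/2) - \<Phi> 0) {0..pi/2}"
    by (rule fundamental_theorem_of_calculus)
       (use P in \<open>auto simp: has_real_derivative_iff_has_vector_derivative[symmetric] intro: has_field_derivative_at_within\<close>)
  then have "EI d k (\<lambda>V. 1 / (c - V)) = \<Phi> (pi/2) - \<Phi> 0" unfolding EI_def f_def by (rule integral_unique)
  then have "\<Phi> (\<theta> + pi) = \<Phi> \<theta> + 2 * EI d k (\<lambda>V. 1 / (c - V))" for \<theta>
    using c1[of \<theta>] c2 by simp
  then show ?thesis using P unfolding f_def by (intro exI[of _ \<Phi>] conjI allI)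
qed

text \<open>\<open>P\<close> is the phase of the solution \<open>sqrt (c - W) exp (\<i> P)\<close>.
  It is a function of the amplitude alone, so its increment is known wherever the amplitude is a
  multiple of \<open>pi\<close>.\<close>

lemma phase_function:
  assumes dk: "0 < d" "d < k" and c: "c \<notin> {0..d}"
  obtains P where "\<And>u. (P has_real_derivative 1 / (c - Wf d k u)) (at u)"
    "\<And>u n. P (u + of_nat n * per d k) = P u + of_nat n * (2 * EI d k (\<lambda>V. 1 / (c - V)))"
    "\<And>u n. ang d k u = of_nat n * pi \<Longrightarrow> P u = P 0 + of_nat n * (2 * EI d k (\<lambda>V. 1 / (c - V)))"
proof -
  define A where "A = 2 * EI d k (\<lambda>V. 1 / (c - V))"
  obtain \<Phi> where P: "\<And>\<theta>. (\<Phi> has_real_derivative 1 / (c - d * (sin \<theta>)^2) / sqrt (k - d * (sin \<theta>)^2)) (at \<theta>)"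
    "\<And>\<theta>. \<Phi> (\<theta> + pi) = \<Phi> \<theta> + A"
    using phase_angle[OF dk c] unfolding A_def by (elim exE conjE) blast
  have N: "\<Phi> (\<theta> + of_nat n * pi) = \<Phi> \<theta> + of_nat n * A" for \<theta> n
  proof (induction n)
    case (Suc n)
    have "\<theta> + of_nat (Suc n) * pi = (\<theta> + of_nat n * pi) + pi" by (simp add: algebra_simps)
    then show ?case unfolding P(2) using Suc P(2)[of "\<theta> + of_nat n * pi"] by (simp only:) (simp add: algebra_simps)
  qed simp
  have a: "ang d k (u + of_nat n * per d k) = ang d k u + of_nat n * pi" for u n
  proof (induction n)
    case (Suc n)
    have "u + of_nat (Suc n) * per d k = (u + of_nat n * per d k) + per d k" by (simp add: algebra_simps)
    then show ?case using Suc ang_period[OF dk, of "u + of_nat n * per d k"] by (simp only:) (simp add: algebra_simps)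
  qed simp
  have D: "((\<lambda>u. \<Phi> (ang d k u)) has_real_derivative 1 / (c - Wf d k u)) (at u)" for u
  proof -
    have "0 < k - d * (sin (ang d k u))^2" using Wf_range(2)[OF dk(1), of k u] dk unfolding Wf_def by linarith
    then have "sqrt (k - d * (sin (ang d k u))^2) \<noteq> 0" by simp
    then show ?thesis using DERIV_chain2[OF P(1) ang_deriv[OF dk], of u] by (simp add: Wf_def)
  qed
  have a0: "ang d k 0 = 0" using am_zero[of "d / k"] dk by (simp add: ang_def)
  show ?thesis
  proof (rule that[of "\<lambda>u. \<Phi> (ang d k u)"])
    show "((\<lambda>u. \<Phi> (ang d k u)) has_real_derivative 1 / (c - Wf d k u)) (at u)" for u by (rule D)
    show "\<Phi> (ang d k (u + of_nat n * per d k)) = \<Phi> (ang d k u) + of_nat n * (2 * EI d k (\<lambda>V. 1 / (c - V)))" for u n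
      unfolding a N A_def ..
    show "\<Phi> (ang d k u) = \<Phi> (ang d k 0) + of_nat n * (2 * EI d k (\<lambda>V. 1 / (c - V)))" if "ang d k u = of_nat n * pi" for u n
      unfolding that a0 using N[of 0 n] by (simp add: A_def)
  qed
qed

text \<open>The components of a lift with curvature \<open>(d + k)/2 - 3/2 W\<close> satisfy a third-order equation. For each
  root \<open>c\<close> of \<open>Q(c) = -1\<close> it has the first-order factor \<open>(c - W) h' = (\<i> - Y) h\<close>, obtained with \<open>h = hh c\<close>;
  \<open>kk\<close> is the derivative of \<open>hh\<close> in \<open>c\<close> and takes over when the root is double.\<close>

locale lame =
  fixes d k :: real and g g1 g2 :: "real \<Rightarrow> complex"
  assumes dk: "0 < d" "d < k"
    and dg: "\<And>u. (g has_vector_derivative g1 u) (at u)"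
    and dg1: "\<And>u. (g1 has_vector_derivative g2 u) (at u)"
    and dg2: "\<And>u. (g2 has_vector_derivative (\<i> + 3 * of_real (Yc d k (ang d k u))) * g u
        + of_real (3 * Wf d k u - (d + k)) * g1 u) (at u)"
begin

abbreviation "W u \<equiv> complex_of_real (Wf d k u)"
abbreviation "Y u \<equiv> complex_of_real (Yc d k (ang d k u))"

definition hh :: "complex \<Rightarrow> real \<Rightarrow> complex" where
  "hh c u = (c - W u) * g2 u + (Y u + \<i>) * g1 u + (c - W u) * (c - W u) * g u"

definition kk :: "complex \<Rightarrow> real \<Rightarrow> complex" where
  "kk c u = g2 u + 2 * ((c - W u) * g u)"

lemma dW: "((\<lambda>u. c - W u) has_vector_derivative - (2 * Y u)) (at u)"
  using has_vector_derivative_diff[OF has_vector_derivative_const vderiv_of_real[OF Wf_deriv(1)[OF dk]], of c u] by simp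

lemma dY: "((\<lambda>u. Y u + \<i>) has_vector_derivative of_real (Qc' d k (Wf d k u))) (at u)"
proof -
  have "((\<lambda>u. Y u + \<i>) has_vector_derivative of_real (Qc' d k (Wf d k u)) + 0) (at u)"
    by (intro has_vector_derivative_add vderiv_of_real Wf_deriv(2)[OF dk] has_vector_derivative_const)
  then show ?thesis by simp
qed

lemma Y_sq: "Y u * Y u = W u * (W u - of_real d) * (W u - of_real k)"
proof -
  have "Y u * Y u = of_real ((Yc d k (ang d k u))^2)" by (simp add: power2_eq_square)
  then show ?thesis unfolding Wf_deriv(3)[OF dk] Qc_def by simp
qed

lemma hh_algebra:
  fixes c w y j G0 G1 G2 D K :: complex
  assumes y: "y * y = w * (w - D) * (w - K)" and j: "j * j = -1"
  shows "(c - w) * ((c - w) * ((j + 3 * y) * G0 + (3 * w - (D + K)) * G1) + - (2 * y) * G2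
      + ((y + j) * G2 + (3 * (w * w) - 2 * (D + K) * w + D * K) * G1)
      + ((c - w) * (c - w) * G1 + ((c - w) * - (2 * y) + - (2 * y) * (c - w)) * G0))
     = (j - y) * ((c - w) * G2 + (y + j) * G1 + (c - w) * (c - w) * G0) + (c * (c - D) * (c - K) + 1) * G1"
proof -
  have "?thesis \<longleftrightarrow> (y * y - j * j - (w * (w - D) * (w - K) + 1)) * G1 = 0"
    by (simp add: algebra_simps)
  then show ?thesis by (simp add: y j)
qed

text \<open>The first-order equation holds for every \<open>c\<close> up to the error
  \<open>(Q(c) + 1) g1\<close>, which is why the roots of \<open>Q = -1\<close> are singled
  out.\<close>

lemma hh_deriv0:
  obtains h' where "(hh c has_vector_derivative h') (at u)"
    "(c - W u) * h' = (\<i> - Y u) * hh c u + (c * (c - of_real d) * (c - of_real k) + 1) * g1 u"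
proof -
  have Q: "of_real (Qc' d k (Wf d k u)) = 3 * (W u * W u) - 2 * (of_real d + of_real k) * W u + of_real d * of_real k"
    by (simp add: Qc'_def power2_eq_square)
  have w: "of_real (3 * Wf d k u - (d + k)) = 3 * W u - (of_real d + of_real k)" by simp
  have "(hh c has_vector_derivative (c - W u) * ((\<i> + 3 * Y u) * g u + (3 * W u - (of_real d + of_real k)) * g1 u) + - (2 * Y u) * g2 u
      + ((Y u + \<i>) * g2 u + (3 * (W u * W u) - 2 * (of_real d + of_real k) * W u + of_real d * of_real k) * g1 u)
      + ((c - W u) * (c - W u) * g1 u + ((c - W u) * - (2 * Y u) + - (2 * Y u) * (c - W u)) * g u)) (at u)"
    unfolding hh_def[abs_def]
    by (intro has_vector_derivative_add has_vector_derivative_mult dW dY[of u, unfolded Q] dg dg1 dg2[of u, unfolded w])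
  then show ?thesis
    by (rule that) (unfold hh_def, rule hh_algebra[OF Y_sq], simp)
qed

lemma hh_deriv:
  assumes c: "c * (c - of_real d) * (c - of_real k) = -1" "c \<noteq> W u"
  shows "(hh c has_vector_derivative (\<i> - Y u) * inverse (c - W u) * hh c u) (at u)"
proof -
  obtain h' where h: "(hh c has_vector_derivative h') (at u)"
    "(c - W u) * h' = (\<i> - Y u) * hh c u + (c * (c - of_real d) * (c - of_real k) + 1) * g1 u" by (rule hh_deriv0)
  have "(c - W u) * h' = (\<i> - Y u) * hh c u" using h(2) unfolding c(1) by simp
  moreover have "h' = inverse (c - W u) * ((c - W u) * h')" using c(2) by simp
  ultimately have "h' = (\<i> - Y u) * inverse (c - W u) * hh c u" by (simp only: ac_simps)
  with h(1) show ?thesis by simp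
qed

text \<open>Squaring \<open>hh\<close> and dividing by \<open>c - W\<close> removes \<open>Y\<close>
  from the logarithmic derivative and leaves \<open>2 \<i> / (c - W)\<close>, which is purely
  imaginary for real \<open>c\<close>.\<close>

definition zz :: "complex \<Rightarrow> real \<Rightarrow> complex" where
  "zz c u = hh c u * hh c u * inverse (c - W u)"

lemma zz_deriv:
  assumes c: "c * (c - of_real d) * (c - of_real k) = -1" "c \<noteq> W u"
  shows "(zz c has_vector_derivative 2 * \<i> * inverse (c - W u) * zz c u) (at u)"
proof -
  have nz: "c - W u \<noteq> 0" using c by simp
  define s h y where "s = inverse (c - W u)" and "h = hh c u" and "y = Y u"
  have "(zz c has_vector_derivative (hh c u * hh c u) * (- (- (2 * Y u)) * (inverse (c - W u) * inverse (c - W u)))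
     + (hh c u * ((\<i> - Y u) * inverse (c - W u) * hh c u) + (\<i> - Y u) * inverse (c - W u) * hh c u * hh c u) * inverse (c - W u)) (at u)"
    unfolding zz_def[abs_def] by (intro has_vector_derivative_mult vderiv_inverse hh_deriv[OF c] dW nz)
  moreover have "(h * h) * (- (- (2 * y)) * (s * s)) + (h * ((\<i> - y) * s * h) + (\<i> - y) * s * h * h) * s = 2 * \<i> * s * (h * h * s)"
    by (simp add: algebra_simps)
  ultimately show ?thesis unfolding zz_def s_def h_def y_def by simp
qed

lemma zz_phase:
  fixes c :: real
  assumes c: "Qc d k c = -1" "c \<notin> {0..d}"
    and P: "\<And>u. (P has_real_derivative 1 / (c - Wf d k u)) (at u)"
  shows "zz (of_real c) u * exp (- 2 * \<i> * of_real (P u)) = zz (of_real c) 0 * exp (- 2 * \<i> * of_real (P 0))"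
proof (rule vderiv_zero_const)
  fix u
  have c': "of_real c * (of_real c - of_real d) * (of_real c - of_real k) = (-1::complex)"
    using arg_cong[OF c(1), of complex_of_real] by (simp add: Qc_def)
  have ne: "of_real c \<noteq> W u" using c(2) Wf_range[OF dk(1), of k u] by auto
  have i: "complex_of_real (1 / (c - Wf d k u)) = inverse (of_real c - W u)" by (simp add: divide_inverse)
  have "((\<lambda>u. - 2 * \<i> * of_real (P u)) has_vector_derivative - 2 * \<i> * inverse (of_real c - W u)) (at u)"
    using has_vector_derivative_mult_right[OF vderiv_of_real[OF P], of "- 2 * \<i>" u] unfolding i .
  note D = has_vector_derivative_mult[OF zz_deriv[OF c' ne] vderiv_exp[OF this]]
  have z: "z * (- 2 * \<i> * s * E) + 2 * \<i> * s * z * E = 0" for z s E :: complex by (simp add: algebra_simps)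
  show "((\<lambda>u. zz (of_real c) u * exp (- 2 * \<i> * of_real (P u))) has_vector_derivative 0) (at u)"
    using D unfolding z .
qed

lemma kk_deriv:
  assumes c: "c * (c - of_real d) * (c - of_real k) = -1" "c \<noteq> W u"
    and dbl: "3 * (c * c) - 2 * (of_real d + of_real k) * c + of_real d * of_real k = 0" and nz: "hh c u \<noteq> 0"
  shows "((\<lambda>u. kk c u * inverse (hh c u)) has_vector_derivative
     - ((\<i> - Y u) * (inverse (c - W u) * inverse (c - W u)))) (at u)"
proof -
  have w: "of_real (3 * Wf d k u - (d + k)) = 3 * W u - (of_real d + of_real k)" by simp
  define k' where "k' = ((\<i> + 3 * Y u) * g u + (3 * W u - (of_real d + of_real k)) * g1 u)
      + 2 * ((c - W u) * g1 u + - (2 * Y u) * g u)"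
  have dkk: "(kk c has_vector_derivative k') (at u)"
    unfolding kk_def[abs_def] k'_def
    by (intro has_vector_derivative_add has_vector_derivative_mult_right has_vector_derivative_mult dW dg dg1 dg2[of u, unfolded w])
  define s h y K where "s = inverse (c - W u)" and "h = hh c u" and "y = Y u" and "K = kk c u"
  have sc: "s * (c - W u) = 1" using c(2) by (simp add: s_def)
  have hi: "h * inverse h = 1" using nz by (simp add: h_def)
  have e: "(c - W u) * k' = (\<i> - y) * K - (\<i> - y) * s * h"
  proof -
    have "(c - W u) * ((c - W u) * k') = (c - W u) * ((\<i> - y) * K) - (\<i> - y) * h"
    proof -
      define w D L where "w = W u" and "D = complex_of_real d" and "L = complex_of_real k"
      have yy: "y * y = w * (w - D) * (w - L)" unfolding y_def w_def D_def L_def by (rule Y_sq)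
      have q1: "c * (c - D) * (c - L) = -1" using c(1) by (simp add: D_def L_def)
      have q2: "3 * (c * c) - 2 * (D + L) * c + D * L = 0" using dbl by (simp add: D_def L_def)
      \<comment> \<open>The identity \<open>I\<close> holds up to a combination of three quantities
        that vanish: \<open>Q'(c)\<close>, \<open>Q(c) + 1\<close> and
        \<open>y^2 - Q(w)\<close>.\<close>
      have X: "(c - w) * (3 * (c * c) - 2 * (D + L) * c + D * L) - (c * (c - D) * (c - L) + 1)
             - (y * y - w * (w - D) * (w - L)) = 0" unfolding q1 q2 yy by simp
      have I: "((c - w) * ((c - w) * (((\<i> + 3 * y) * G0 + (3 * w - (D + L)) * G1) + 2 * ((c - w) * G1 + - (2 * y) * G0)))
         = (c - w) * ((\<i> - y) * (G2 + 2 * ((c - w) * G0))) - (\<i> - y) * ((c - w) * G2 + (y + \<i>) * G1 + (c - w) * (c - w) * G0))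
        \<longleftrightarrow> ((c - w) * (3 * (c * c) - 2 * (D + L) * c + D * L) - (c * (c - D) * (c - L) + 1)
             - (y * y - w * (w - D) * (w - L))) * G1 = 0" for G0 G1 G2
        by (simp add: algebra_simps)
      show ?thesis unfolding k'_def h_def hh_def K_def kk_def w_def[symmetric] D_def[symmetric] L_def[symmetric] y_def[symmetric]
        by (rule I[THEN iffD2]) (simp only: X mult_zero_left)
    qed
    then have 1: "s * ((c - W u) * ((c - W u) * k')) = s * ((c - W u) * ((\<i> - y) * K)) - s * ((\<i> - y) * h)"
      by (simp only: right_diff_distrib[of s, symmetric])
    have "s * ((c - W u) * X) = X" for X using sc by (simp add: mult.assoc[symmetric])
    then have "(c - W u) * k' = (\<i> - y) * K - s * ((\<i> - y) * h)" using 1 by (simp only:)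
    also have "s * ((\<i> - y) * h) = (\<i> - y) * s * h" by (simp only: ac_simps)
    finally show ?thesis .
  qed
  have "((\<lambda>u. kk c u * inverse (hh c u)) has_vector_derivative
     K * (- ((\<i> - y) * s * h) * (inverse h * inverse h)) + k' * inverse h) (at u)"
    unfolding s_def h_def y_def K_def
    by (intro has_vector_derivative_mult vderiv_inverse hh_deriv[OF c] dkk nz)
  moreover have "K * (- ((\<i> - y) * s * h) * (inverse h * inverse h)) + k' * inverse h = - ((\<i> - y) * (s * s))"
  proof -
    have k: "k' = s * ((\<i> - y) * K - (\<i> - y) * s * h)" using e sc by (simp add: mult.assoc[symmetric] e[symmetric])
    have "K * (- ((\<i> - y) * s * h) * (inverse h * inverse h)) = - (K * (\<i> - y) * s * inverse h) * (h * inverse h)"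
      by (simp add: algebra_simps)
    moreover have "k' * inverse h = K * (\<i> - y) * s * inverse h - (\<i> - y) * (s * s) * (h * inverse h)"
      unfolding k by (simp add: algebra_simps)
    ultimately show ?thesis unfolding hi by simp
  qed
  ultimately show ?thesis unfolding s_def y_def by simp
qed

end

context lame
begin

lemma Y_zero: assumes "Wf d k u = 0" shows "Yc d k (ang d k u) = 0"
  using Wf_deriv(3)[OF dk, of u] assms by (simp add: Qc_def)

lemma periodic_values:
  assumes "g T = g 0" "g1 T = g1 0" "g2 T = g2 0" "Wf d k T = 0"
  shows "hh c T = hh c 0" "kk c T = kk c 0" "zz c T = zz c 0"
proof -
  note W = assms(4) Wf_zero(1)[OF dk] Y_zero[OF assms(4)] Wf_zero(2)[OF dk]
  show h: "hh c T = hh c 0" unfolding hh_def by (simp only: assms W)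
  show "kk c T = kk c 0" unfolding kk_def by (simp only: assms W)
  show "zz c T = zz c 0" unfolding zz_def h by (simp only: assms W)
qed

text \<open>The squared modulus of \<open>zz\<close> grows strictly, because
  \<open>2 \<i> / (c - W)\<close> has the positive real part
  \<open>2 Im c / |c - W|^2\<close>.\<close>

lemma periodic_no_nonreal_root:
  assumes T: "0 < T" "g T = g 0" "g1 T = g1 0" "g2 T = g2 0" "Wf d k T = 0"
    and c: "c * (c - of_real d) * (c - of_real k) = -1" "0 < Im c" "hh c 0 \<noteq> 0"
  shows False
proof -
  have ne: "c \<noteq> W u" for u using c(2) by (auto simp: complex_eq_iff)
  define N where "N u = (Re (zz c u))^2 + (Im (zz c u))^2" for u
  define a where "a u = 2 * \<i> * inverse (c - W u)" for u
  have ra: "0 < Re (a u)" for u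
  proof -
    have "Re (a u) = 2 * (Im c / ((Re c - Wf d k u)^2 + (Im c)^2))" by (simp add: a_def)
    moreover have "0 < (Re c - Wf d k u)^2 + (Im c)^2" using c(2) by (intro add_nonneg_pos) auto
    ultimately show ?thesis using c(2) by simp
  qed
  have dz: "(zz c has_vector_derivative a u * zz c u) (at u)" for u unfolding a_def by (rule zz_deriv[OF c(1) ne])
  have dN: "(N has_real_derivative 2 * Re (a u) * N u) (at u)" for u
  proof -
    have R: "((\<lambda>u. Re (zz c u)) has_real_derivative Re (a u * zz c u)) (at u)"
      "((\<lambda>u. Im (zz c u)) has_real_derivative Im (a u * zz c u)) (at u)"
      unfolding has_real_derivative_iff_has_vector_derivative
      by (rule bounded_linear.has_vector_derivative[OF bounded_linear_Re dz],
          rule bounded_linear.has_vector_derivative[OF bounded_linear_Im dz])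
    have "(N has_real_derivative 2 * (Re (zz c u) * Re (a u * zz c u)) + 2 * (Im (zz c u) * Im (a u * zz c u))) (at u)"
      unfolding N_def[abs_def] by (rule derivative_eq_intros R refl)+ (simp add: power2_eq_square)
    moreover have "2 * (x * (p * x - q * y)) + 2 * (y * (p * y + q * x)) = 2 * p * (x^2 + y^2)" for x y p q :: real
      by (simp add: power2_eq_square algebra_simps)
    ultimately show ?thesis unfolding N_def by (simp only: times_complex.simps)
  qed
  have N0: "0 \<le> N u" for u by (simp add: N_def)
  have mono: "N 0 \<le> N u" if "0 \<le> u" for u
    by (rule DERIV_nonneg_imp_nondecreasing[OF that]) (use dN ra N0 in \<open>blast intro: mult_nonneg_nonneg less_imp_le zero_le_numeral\<close>)
  have "zz c 0 \<noteq> 0" using c(3) ne[of 0] by (simp add: zz_def)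
  then have "0 < N 0" by (auto simp: N_def complex_eq_iff sum_power2_gt_zero_iff)
  have "N 0 < N T"
  proof (rule DERIV_pos_imp_increasing[OF T(1)])
    fix u :: real assume "0 \<le> u" "u \<le> T"
    then have "0 < N u" using mono[of u] \<open>0 < N 0\<close> by linarith
    then have "0 < 2 * Re (a u) * N u" using ra[of u] by simp
    then show "\<exists>y. (N has_real_derivative y) (at u) \<and> 0 < y" using dN[of u] by (intro exI conjI)
  qed
  then show False unfolding N_def periodic_values(3)[OF T(2-5)] by simp
qed

lemma zz_nonzero:
  fixes c :: real
  assumes c: "Qc d k c = -1" "c \<notin> {0..d}" and h: "hh c 0 \<noteq> 0" shows "hh c u \<noteq> 0"
proof -
  obtain P where P: "\<And>u. (P has_real_derivative 1 / (c - Wf d k u)) (at u)"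
    "\<And>u n. P (u + of_nat n * per d k) = P u + of_nat n * (2 * EI d k (\<lambda>V. 1 / (c - V)))"
    "\<And>u n. ang d k u = of_nat n * pi \<Longrightarrow> P u = P 0 + of_nat n * (2 * EI d k (\<lambda>V. 1 / (c - V)))"
    by (rule phase_function[OF dk c(2)]) (rule that)
  have ne: "of_real c \<noteq> W u" for u using c(2) Wf_range[OF dk(1), of k u] by auto
  have "zz (of_real c) 0 \<noteq> 0" using h ne[of 0] by (simp add: zz_def)
  then have "zz (of_real c) u * exp (- 2 * \<i> * of_real (P u)) \<noteq> 0" unfolding zz_phase[OF c P(1), of u] by simp
  then show ?thesis by (simp add: zz_def)
qed

text \<open>The quotient \<open>kk / hh\<close> has derivative
  \<open>- (\<i> - Y) / (c - W)^2\<close>. For real \<open>c\<close> its imaginary part decreases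
  strictly and cannot return.\<close>

lemma periodic_no_double_root:
  fixes c :: real
  assumes T: "0 < T" "g T = g 0" "g1 T = g1 0" "g2 T = g2 0" "Wf d k T = 0"
    and c: "Qc d k c = -1" "Qc' d k c = 0" "c \<notin> {0..d}" and h: "hh c 0 \<noteq> 0"
  shows False
proof -
  have c': "of_real c * (of_real c - of_real d) * (of_real c - of_real k) = (-1::complex)"
    using arg_cong[OF c(1), of complex_of_real] by (simp add: Qc_def)
  have c'': "3 * (of_real c * of_real c) - 2 * (of_real d + of_real k) * of_real c + of_real d * of_real k = (0::complex)"
    using arg_cong[OF c(2), of complex_of_real] by (simp add: Qc'_def power2_eq_square)
  have ne: "of_real c \<noteq> W u" for u using c(3) Wf_range[OF dk(1), of k u] by auto
  define F where "F u = Im (kk (of_real c) u * inverse (hh (of_real c) u))" for u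
  have D: "(F has_real_derivative - ((1 / (c - Wf d k u))^2)) (at u)" for u
  proof -
    define s where "s = 1 / (c - Wf d k u)"
    have s: "inverse (of_real c - W u) = of_real s" by (simp add: s_def divide_inverse)
    have "(F has_real_derivative Im (- ((\<i> - Y u) * (inverse (of_real c - W u) * inverse (of_real c - W u))))) (at u)"
      unfolding has_real_derivative_iff_has_vector_derivative F_def[abs_def]
      by (rule bounded_linear.has_vector_derivative[OF bounded_linear_Im kk_deriv[OF c' ne c'' zz_nonzero[OF c(1,3) h]]])
    moreover have "Im (- ((\<i> - Y u) * (inverse (of_real c - W u) * inverse (of_real c - W u)))) = - (s^2)"
      unfolding s by (simp add: power2_eq_square)
    ultimately show ?thesis by (simp only: s_def)
  qed
  have "F T < F 0"
  proof (rule DERIV_neg_imp_decreasing[OF T(1)])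
    fix u :: real
    have "c - Wf d k u \<noteq> 0" using ne[of u] by simp
    then have "- ((1 / (c - Wf d k u))^2) < 0" by simp
    then show "\<exists>y. (F has_real_derivative y) (at u) \<and> y < 0" using D[of u] by (intro exI conjI)
  qed
  then show False unfolding F_def periodic_values(1,2)[OF T(2-5)] by simp
qed

lemma ang_pos: assumes "0 < T" shows "0 < ang d k T"
proof -
  have "ang d k 0 < ang d k T"
  proof (rule DERIV_pos_imp_increasing[OF assms])
    fix u :: real
    have "0 < k - d * (sin (ang d k u))^2" using Wf_range(2)[OF dk(1), of k u] dk unfolding Wf_def by linarith
    then have "0 < sqrt (k - d * (sin (ang d k u))^2)" by simp
    then show "\<exists>y. (ang d k has_real_derivative y) (at u) \<and> 0 < y" using ang_deriv[OF dk, of u] by (intro exI conjI)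
  qed
  then show ?thesis using am_zero[of "d / k"] dk by (simp add: ang_def)
qed

text \<open>\<open>W(T) = 0\<close> makes the amplitude at \<open>T\<close> equal to
  \<open>n pi\<close>, with \<open>n > 0\<close> because the amplitude increases. Since
  \<open>zz\<close> returns to its value, its phase \<open>2 P\<close> has turned by a multiple of
  \<open>2 pi\<close>, so \<open>2 n EI\<close> is an integer multiple of \<open>pi\<close>.\<close>

lemma periodic_rational:
  fixes c :: real
  assumes T: "0 < T" "g T = g 0" "g1 T = g1 0" "g2 T = g2 0" "Wf d k T = 0"
    and c: "Qc d k c = -1" "c \<notin> {0..d}" and h: "hh c 0 \<noteq> 0"
  shows "EI d k (\<lambda>V. 1 / (c - V)) / pi \<in> \<rat>"
proof -
  define E where "E = EI d k (\<lambda>V. 1 / (c - V))"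
  obtain P where P: "\<And>u. (P has_real_derivative 1 / (c - Wf d k u)) (at u)"
    "\<And>u n. P (u + of_nat n * per d k) = P u + of_nat n * (2 * E)"
    "\<And>u n. ang d k u = of_nat n * pi \<Longrightarrow> P u = P 0 + of_nat n * (2 * E)" by (rule phase_function[OF dk c(2), folded E_def]) (rule that)
  have "sin (ang d k T) = 0" using T(5) dk by (simp add: Wf_def)
  then obtain i :: int where i: "ang d k T = of_int i * pi" using sin_zero_iff_int2 by blast
  have "0 < i" using ang_pos[OF T(1)] i by (simp add: zero_less_mult_iff)
  then obtain n where n: "ang d k T = of_nat n * pi" "0 < n" using i by (intro that[of "nat i"]) auto
  have ne: "of_real c \<noteq> W 0" using c(2) Wf_range[OF dk(1), of k 0] by auto
  have z0: "zz (of_real c) 0 \<noteq> 0" using h ne by (simp add: zz_def)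
  have "zz (of_real c) T * exp (- 2 * \<i> * of_real (P T)) = zz (of_real c) 0 * exp (- 2 * \<i> * of_real (P 0))"
    by (rule zz_phase[OF c P(1)])
  then have "exp (- 2 * \<i> * of_real (P T)) = exp (- 2 * \<i> * of_real (P 0))"
    unfolding periodic_values(3)[OF T(2-5)] using z0 by simp
  then obtain j :: int where j: "- 2 * \<i> * of_real (P T) = - 2 * \<i> * of_real (P 0) + (of_int (2 * j) * of_real pi) * \<i>"
    unfolding exp_eq by auto
  have "- 2 * P T = - 2 * P 0 + of_int (2 * j) * pi" using arg_cong[OF j, of Im] by simp
  then have "of_nat n * (2 * E) = - (of_int j * pi)"
    using P(3)[OF n(1)] mult.assoc[of 2 "real_of_int j" pi] unfolding of_int_mult of_int_numeral by linarith
  then have "E / pi = - of_int j / (2 * of_nat n)" using n(2) by (simp add: field_simps)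
  then show ?thesis unfolding E_def by simp
qed

end

section \<open>Roots of Q = -1 below the critical level\<close>

lemma critp_deriv_zero: "Qc' d k (critp d k) = 0"
  by (simp add: Qc'_factor)

text \<open>The expansion at \<open>critp\<close> has a double zero with cofactor
  \<open>V + 2 critp - (d + k)\<close>, which is nonnegative because
  \<open>d + k \<le> 2 sqrt (d^2 - d k + k^2)\<close>.\<close>

lemma Qc_lower:
  assumes "0 < d" "d < k" "0 \<le> V" shows "- Acr d k \<le> Qc d k V"
proof -
  define p where "p = critp d k"
  have id: "Qc d k V - Qc d k p = (V - p)^2 * (V + (2 * p - (d + k))) + Qc' d k p * (V - p)"
    by (simp add: Qc_def Qc'_def power2_eq_square algebra_simps)
  have "(d + k)^2 \<le> 4 * (d^2 - d * k + k^2)"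
  proof -
    have "4 * (d^2 - d * k + k^2) - (d + k)^2 = 3 * (d - k)^2" by (simp add: power2_eq_square algebra_simps)
    then show ?thesis using zero_le_power2[of "d - k"] by linarith
  qed
  then have s: "sqrt ((d + k)^2) \<le> sqrt (4 * (d^2 - d * k + k^2))" by (rule real_sqrt_le_mono)
  have r: "sqrt (4 * X) = 2 * sqrt X" for X :: real by (simp add: real_sqrt_mult)
  have "d + k \<le> 2 * sqrt (d^2 - d * k + k^2)" using s assms unfolding r by simp
  then have "0 \<le> 2 * p - (d + k)" unfolding p_def critp_def by simp
  then have "0 \<le> (V - p)^2 * (V + (2 * p - (d + k)))" using assms by simp
  then show ?thesis using id critp_deriv_zero[of d k] unfolding Acr_def p_def by simp
qed

text \<open>After splitting off the real root \<open>r \<le> 0\<close>, a real zero of the quadratic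
  cofactor would produce a positive \<open>v\<close> with \<open>Q(v) = -1\<close>, against the
  lower bound \<open>-A > -1\<close>.\<close>

lemma nonreal_root:
  assumes "0 < d" "d < k" "Acr d k < 1"
  shows "\<exists>c::complex. c * (c - of_real d) * (c - of_real k) = -1 \<and> 0 < Im c"
proof -
  have "Qc d k (-1) \<le> -1"
  proof -
    have "Qc d k (-1) = - (1 + d + k + d * k)" by (simp add: Qc_def algebra_simps)
    then show ?thesis using assms(1,2) mult_pos_pos[of d k] by linarith
  qed
  moreover have "-1 \<le> Qc d k 0" by (simp add: Qc_def)
  moreover have "continuous_on {-1..0} (Qc d k)" unfolding Qc_def[abs_def] by (intro continuous_intros)
  ultimately obtain r where r: "-1 \<le> r" "r \<le> 0" "Qc d k r = -1" using IVT'[of "Qc d k" "-1" "-1" 0] by auto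
  define p q where "p = r - (d + k)" and "q = r * r - (d + k) * r + d * k"
  have rq: "r * q = -1" using r(3) by (simp add: q_def Qc_def algebra_simps)
  have neg: "p^2 - 4 * q < 0"
  proof (rule ccontr)
    assume a: "\<not> p^2 - 4 * q < 0"
    define s where "s = sqrt (p^2 - 4 * q)"
    have s: "s * s = p * p - 4 * q" "0 \<le> s" using a by (auto simp: s_def power2_eq_square)
    define v where "v = (s - p) / 2"
    have v: "0 < v" using s r(2) assms by (simp add: v_def p_def)
    have "v * v + p * v + q = 0" using s(1) by (simp add: v_def field_simps)
    moreover have "Qc d k v + 1 = (v - r) * (v * v + p * v + q) + (1 + r * q)"
      by (simp add: Qc_def p_def q_def algebra_simps)
    ultimately have "Qc d k v = -1" using rq by simp
    then show False using Qc_lower[OF assms(1,2), of v] v assms(3) by simp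
  qed
  define t where "t = sqrt (4 * q - p^2)"
  have t: "t * t = 4 * q - p * p" "0 < t" using neg by (auto simp: t_def power2_eq_square)
  define c where "c = Complex (- p / 2) (t / 2)"
  have c0: "c * c + of_real p * c + of_real q = 0"
    using t(1) by (simp add: c_def complex_eq_iff field_simps)
  have id: "z * (z - D) * (z - K) + 1 = (z - R) * (z * z + (R - (D + K)) * z + (R * R - (D + K) * R + D * K))
     + (1 + R * (R * R - (D + K) * R + D * K))" for z D K R :: complex
    by (simp add: algebra_simps)
  have "of_real r * of_real q = (-1::complex)" using arg_cong[OF rq, of complex_of_real] by simp
  then have "c * (c - of_real d) * (c - of_real k) + 1 = 0"
    unfolding id[of c _ _ "of_real r"] using c0 by (simp add: p_def q_def)
  then have "c * (c - of_real d) * (c - of_real k) = -1" by (simp add: eq_neg_iff_add_eq_0)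
  then show ?thesis using t(2) by (intro exI[of _ c] conjI) (simp_all add: c_def)
qed

section \<open>Closed strings have rational periods\<close>

lemma lift_lame:
  assumes dk: "0 < d" "d < k" and G: "normalized_legendrian_lift G" "\<And>u. inv_a G u = 1"
    and \<kappa>: "\<And>u. cr_curv G u = (d + k) / 2 - 3/2 * Wf d k u"
  shows "lame d k (\<lambda>u. G u $ i) (\<lambda>u. vd G 1 u $ i) (\<lambda>u. vd G 2 u $ i)"
proof (unfold_locales)
  note D = smooth_lift_derivs[OF G(1)]
  show "0 < d" "d < k" by (fact dk)+
  show "((\<lambda>u. G u $ i) has_vector_derivative vd G 1 u $ i) (at u)" for u by (rule has_vector_derivative_nth[OF D(1)])
  show "((\<lambda>u. vd G 1 u $ i) has_vector_derivative vd G 2 u $ i) (at u)" for u by (rule has_vector_derivative_nth[OF D(2)])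
  fix u
  have "(cr_curv G has_real_derivative - 3 * Yc d k (ang d k u)) (at u)"
  proof -
    have e: "cr_curv G = (\<lambda>u. (d + k) / 2 - 3/2 * Wf d k u)" using \<kappa> by (rule ext)
    have "((\<lambda>u. (d + k) / 2 - 3/2 * Wf d k u) has_real_derivative 0 - 3/2 * (2 * Yc d k (ang d k u))) (at u)"
      by (intro DERIV_diff DERIV_const DERIV_cmult Wf_deriv(1)[OF dk])
    then show ?thesis unfolding e by simp
  qed
  from DERIV_unique[OF frenet(13)[OF G(1)] this] have kp: "kap' G u = - 3 * Yc d k (ang d k u)" .
  have "vd G 3 u = (\<i> + 3 * of_real (Yc d k (ang d k u))) *s G u + of_real (3 * Wf d k u - (d + k)) *s vd G 1 u"
  proof -
    have "- 2 * ((d + k) / 2 - 3/2 * w) = 3 * w - (d + k)" for w :: real by (simp add: field_simps)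
    then have 1: "- 2 * complex_of_real ((d + k) / 2 - 3/2 * w) = of_real (3 * w - (d + k))" for w
      by (metis of_real_mult of_real_minus of_real_numeral)
    have 2: "\<i> * complex_of_real 1 - complex_of_real (- 3 * y) = \<i> + 3 * of_real y" for y by simp
    show ?thesis unfolding frenet(15)[OF G(1), of u] G(2) kp \<kappa> 1 2 ..
  qed
  then have "vd G 3 u $ i = (\<i> + 3 * of_real (Yc d k (ang d k u))) * G u $ i + of_real (3 * Wf d k u - (d + k)) * vd G 1 u $ i"
    by (simp only: vector_add_component vector_smult_component)
  then show "((\<lambda>u. vd G 2 u $ i) has_vector_derivative (\<i> + 3 * of_real (Yc d k (ang d k u))) * G u $ i
     + of_real (3 * Wf d k u - (d + k)) * vd G 1 u $ i) (at u)"
    using has_vector_derivative_nth[OF D(3), of i u] by simp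
qed

text \<open>If all components vanished, pairing the vector combination with \<open>G'\<close> would
  isolate the coefficient \<open>Y + \<i>\<close>, which has imaginary part 1.\<close>

lemma some_component_nonzero:
  assumes dk: "0 < d" "d < k" and G: "normalized_legendrian_lift G" "\<And>u. inv_a G u = 1"
    and \<kappa>: "\<And>u. cr_curv G u = (d + k) / 2 - 3/2 * Wf d k u"
  shows "\<exists>i. lame.hh d k (\<lambda>u. G u $ i) (\<lambda>u. vd G 1 u $ i) (\<lambda>u. vd G 2 u $ i) c 0 \<noteq> 0"
proof (rule ccontr)
  define y w where "y = complex_of_real (Yc d k (ang d k 0))" and "w = c - complex_of_real (Wf d k 0)"
  assume "\<not> ?thesis"
  then have z: "lame.hh d k (\<lambda>u. G u $ i) (\<lambda>u. vd G 1 u $ i) (\<lambda>u. vd G 2 u $ i) c 0 = 0" for i by simp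
  have "w *s vd G 2 0 + (y + \<i>) *s vd G 1 0 + (w * w) *s G 0 = 0" (is "?H = 0")
  proof (rule vec_eq_iff[THEN iffD2], rule allI)
    fix i show "?H $ i = 0 $ i" using z[of i] unfolding lame.hh_def[OF lift_lame[OF assms]]
      by (simp only: vector_add_component vector_smult_component zero_index y_def w_def)
  qed
  then have "herm (vd G 1 0) ?H = 0" by (simp add: herm_def)
  then have "y + \<i> = 0" unfolding herm_add_right herm_scale_right using frenet(3,4,7)[OF G(1), of 0] by simp
  then have "Im (y + \<i>) = 0" by simp
  then show False by (simp add: y_def)
qed

lemma periodic_lift_rational:
  assumes dk: "0 < d" "d < k" and G: "normalized_legendrian_lift G" "\<And>u. inv_a G u = 1"
    and \<kappa>: "\<And>u. cr_curv G u = (d + k) / 2 - 3/2 * Wf d k u"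
    and T: "0 < T" "\<And>u. G (u + T) = G u"
  shows "(d, k) \<in> Dop" "Tf c2 d k \<in> \<rat>" "Tf c3 d k \<in> \<rat>"
proof -
  note L = lift_lame[OF dk G \<kappa>] and nz = some_component_nonzero[OF dk G \<kappa>]
  have sm: "smooth_fun G" using G(1) by (simp add: normalized_legendrian_lift_def)
  have "(\<lambda>u. G (u + T)) = G" using T(2) by (rule ext)
  then have vp: "vd G j (u + T) = vd G j u" for j u using fun_cong[OF vd_shift[OF sm, of T j], of u] by simp
  have v0: "vd G j T = vd G j 0" for j using vp[of j 0] by simp
  have "cr_curv G T = cr_curv G 0" unfolding cr_curv_def v0 ..
  \<comment> \<open>\<open>u = 0\<close> is a zero of \<open>W\<close>, so periodicity of the
    curvature places \<open>T\<close> at a zero as well.\<close>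
  then have WT: "Wf d k T = 0" unfolding \<kappa> Wf_zero(1)[OF dk] by linarith
  have P: "G T $ i = G 0 $ i" "vd G 1 T $ i = vd G 1 0 $ i" "vd G 2 T $ i = vd G 2 0 $ i" for i
    unfolding v0 using T(2)[of 0] by simp_all
  have A1: "1 < Acr d k"
  proof (rule ccontr)
    assume "\<not> 1 < Acr d k"
    then consider "Acr d k < 1" | "Acr d k = 1" by linarith
    then show False
    proof cases
      case 1
      obtain c where c: "c * (c - of_real d) * (c - of_real k) = -1" "0 < Im c"
        using nonreal_root[OF dk 1] by (elim exE conjE)
      obtain i where i: "lame.hh d k (\<lambda>u. G u $ i) (\<lambda>u. vd G 1 u $ i) (\<lambda>u. vd G 2 u $ i) c 0 \<noteq> 0"
        using nz[of c] by (rule exE)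
      show False by (rule lame.periodic_no_nonreal_root[OF L T(1) P WT c i])
    next
      case 2
      define c where "c = critp d k"
      have c: "Qc d k c = -1" "Qc' d k c = 0" "c \<notin> {0..d}"
        using 2 critp_deriv_zero crit_order(3)[OF dk] by (auto simp: c_def Acr_def)
      obtain i where i: "lame.hh d k (\<lambda>u. G u $ i) (\<lambda>u. vd G 1 u $ i) (\<lambda>u. vd G 2 u $ i) (of_real c) 0 \<noteq> 0"
        using nz[of "of_real c"] by (rule exE)
      show False by (rule lame.periodic_no_double_root[OF L T(1) P WT c i])
    qed
  qed
  show D: "(d, k) \<in> Dop" using dk A1 by (simp add: Dop_def)
  note cp = c_props[OF Dop_props(4,2,5)[OF D]]
  have rat: "EI d k (\<lambda>V. 1 / (c - V)) / pi \<in> \<rat>" if c: "Qc d k c = -1" "c \<notin> {0..d}" for c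
  proof -
    obtain i where i: "lame.hh d k (\<lambda>u. G u $ i) (\<lambda>u. vd G 1 u $ i) (\<lambda>u. vd G 2 u $ i) (of_real c) 0 \<noteq> 0"
      using nz[of "of_real c"] by (rule exE)
    show ?thesis by (rule lame.periodic_rational[OF L T(1) P WT c i])
  qed
  have n: "c2 d k \<notin> {0..d}" "c3 d k \<notin> {0..d}" using cp(3,4,5) by auto
  show "Tf c2 d k \<in> \<rat>" using Tf_EI[of d k c2] dk cp(3) rat[OF cp(1) n(1)] by simp
  show "Tf c3 d k \<in> \<rat>" using Tf_EI[of d k c3] dk cp(3,4,5) rat[OF cp(2) n(2)] by simp
qed

section \<open>Characters\<close>

text \<open>The extreme values of the curvature determine the parameters: \<open>W\<close> attains 0
  and \<open>d\<close>, so the maximum gives \<open>d + k\<close> and the minimum then gives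
  \<open>d\<close>.\<close>

lemma Wf_form_unique:
  assumes dk: "0 < d" "d < k" "0 < d'" "d' < k'"
    and eq: "\<And>u. (d + k) / 2 - 3/2 * Wf d k (u + s) = (d' + k') / 2 - 3/2 * Wf d' k' (u + s')"
  shows "d = d'" "k = k'"
proof -
  have vals: "\<exists>u. Wf a b (u + t) = 0" "\<exists>u. Wf a b (u + t) = a" if ab: "0 < a" "a < b" for a b t :: real
  proof -
    obtain x where x: "ang a b x = 0" using ang_surj[OF ab] by (rule exE)
    show "\<exists>u. Wf a b (u + t) = 0" by (rule exI[of _ "x - t"]) (unfold Wf_def diff_add_cancel x, simp)
    obtain y where y: "ang a b y = pi / 2" using ang_surj[OF ab] by (rule exE)
    show "\<exists>u. Wf a b (u + t) = a" by (rule exI[of _ "y - t"]) (unfold Wf_def diff_add_cancel y, simp)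
  qed
  obtain u1 where u1: "Wf d k (u1 + s) = 0" using vals(1)[OF dk(1,2)] by (rule exE)
  obtain u2 where u2: "Wf d k (u2 + s) = d" using vals(2)[OF dk(1,2)] by (rule exE)
  obtain u3 where u3: "Wf d' k' (u3 + s') = 0" using vals(1)[OF dk(3,4)] by (rule exE)
  obtain u4 where u4: "Wf d' k' (u4 + s') = d'" using vals(2)[OF dk(3,4)] by (rule exE)
  have clear: "a / 2 - 3/2 * x = b / 2 - 3/2 * y \<Longrightarrow> a - 3 * x = b - 3 * y" for a b x y :: real by (simp add: field_simps)
  note eq = clear[OF eq]
  note r = Wf_range[OF dk(1), of k] and r' = Wf_range[OF dk(3), of k']
  have sum: "d + k = d' + k'"
    using eq[of u1, unfolded u1] eq[of u3, unfolded u3] r(1)[of "u3 + s"] r'(1)[of "u1 + s'"] by (intro antisym) linarith+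
  show "d = d'" using eq[of u2, unfolded u2] eq[of u4, unfolded u4] r(2)[of "u4 + s"] r'(2)[of "u2 + s'"] sum
    by (intro antisym) linarith+
  then show "k = k'" using sum by simp
qed

lemma characters_eq:
  assumes dk: "0 < d" "d < k" and \<kappa>: "\<And>u. cr_curv G u = (d + k) / 2 - 3/2 * Wf d k (u + u0)"
  shows "characters G = to_char (d, k)"
  unfolding characters_def to_char_def fst_conv snd_conv
proof (rule the_equality)
  have e: "d / k * (sqrt k)^2 = d" "(sqrt k)^2 = k" "d / k * k = d" using dk by simp_all
  have p: "0 < d / k" "d / k < 1" "0 < sqrt k" using dk by simp_all
  show "case (d / k, sqrt k) of (m, l) \<Rightarrow> 0 < m \<and> m < 1 \<and> 0 < l \<and>
     (\<exists>u0. \<forall>u. cr_curv G u = 3/2 * l^2 * ((m + 1)/3 - m * (jacobi_sn (l * (u + u0)) m)^2))"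
    unfolding prod.case sn_form[OF p] unfolding e using p \<kappa> by (intro conjI exI[of _ u0] allI)
next
  fix x :: "real \<times> real"
  obtain m l where x: "x = (m, l)" by (cases x)
  assume "case x of (m, l) \<Rightarrow> 0 < m \<and> m < 1 \<and> 0 < l \<and>
     (\<exists>u0. \<forall>u. cr_curv G u = 3/2 * l^2 * ((m + 1)/3 - m * (jacobi_sn (l * (u + u0)) m)^2))"
  then obtain u1 where a: "0 < m" "m < 1" "0 < l"
    and b: "\<forall>u. cr_curv G u = 3/2 * l^2 * ((m + 1)/3 - m * (jacobi_sn (l * (u + u1)) m)^2)"
    unfolding x prod.case by (elim conjE exE)
  have ml: "0 < m * l^2" "m * l^2 < l^2" using a by simp_all
  have "(d + k) / 2 - 3/2 * Wf d k (u + u0) = (m * l^2 + l^2) / 2 - 3/2 * Wf (m * l^2) (l^2) (u + u1)" for u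
    using b[rule_format, of u] unfolding sn_form[OF a] \<kappa> .
  note u = Wf_form_unique[OF dk ml this]
  have "sqrt k = l" "d / k = m" using u a by simp_all
  then show "x = (d / k, sqrt k)" unfolding x by simp
qed

lemma string_curvature:
  assumes "is_string G"
  obtains d k u0 where "0 < d" "d < k" "\<And>u. cr_curv G u = (d + k) / 2 - 3/2 * Wf d k (u + u0)"
proof -
  have S1: "Suc 0 = 1" "Suc 1 = 2" "Suc 2 = 3" by simp_all
  have G: "normalized_legendrian_lift G" "\<exists>u v. cr_curv G u \<noteq> cr_curv G v"
     "\<exists>T>0. \<forall>u. cr_curv G (u + T) = cr_curv G u"
     "\<forall>u. vd (cr_curv G) 3 u + 8 * cr_curv G u * vd (cr_curv G) 1 u = 0"
    using assms unfolding is_string_def by auto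
  have sm: "smooth_fun (cr_curv G)" using G(1) by (intro smooth_cr_curv) (simp add: normalized_legendrian_lift_def)
  have d1: "(cr_curv G has_real_derivative vd (cr_curv G) 1 u) (at u)" for u
    using smooth_deriv[OF sm, of 0 u] unfolding S1 by (simp add: has_real_derivative_iff_has_vector_derivative)
  have d2: "(vd (cr_curv G) 1 has_real_derivative vd (cr_curv G) 2 u) (at u)" for u
    using smooth_deriv[OF sm, of 1 u] unfolding S1 by (simp add: has_real_derivative_iff_has_vector_derivative)
  have d3: "(vd (cr_curv G) 2 has_real_derivative - 8 * cr_curv G u * vd (cr_curv G) 1 u) (at u)" for u
  proof -
    have "vd (cr_curv G) 3 u = - 8 * cr_curv G u * vd (cr_curv G) 1 u" using G(4)[rule_format, of u] by linarith
    then show ?thesis using smooth_deriv[OF sm, of 2 u] unfolding S1 by (simp add: has_real_derivative_iff_has_vector_derivative)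
  qed
  obtain a b where nc: "cr_curv G a \<noteq> cr_curv G b" using G(2) by (elim exE)
  obtain T where T: "0 < T" "\<forall>u. cr_curv G (u + T) = cr_curv G u" using G(3) by (elim exE conjE)
  show ?thesis by (rule curvature_classification[OF d1 d2 d3 T(1) T(2)[rule_format] nc]) (rule that)
qed

lemma closed_string_characters:
  assumes "closed_string G"
  obtains d k u0 where "(d, k) \<in> Dop" "\<And>u. cr_curv G u = (d + k) / 2 - 3/2 * Wf d k (u + u0)"
    "characters G = to_char (d, k)" "Tf c2 d k \<in> \<rat>" "Tf c3 d k \<in> \<rat>"
proof -
  have st: "is_string G" and cl: "\<exists>T>0. \<forall>u. \<exists>c. c \<noteq> 0 \<and> G (u + T) = c *s G u"
    using assms unfolding closed_string_def by simp_all
  have G: "normalized_legendrian_lift G" "\<And>u. inv_a G u = 1" using st unfolding is_string_def by simp_all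
  obtain T where T: "0 < T" "\<forall>u. \<exists>c. c \<noteq> 0 \<and> G (u + T) = c *s G u" using cl by (elim exE conjE)
  have per: "G (u + 3 * T) = G u" for u by (rule projective_period(1)[OF G T(2)[rule_format]])
  show ?thesis
  proof (rule string_curvature[OF st])
    fix d k u0 assume dk: "0 < d" "d < k" and \<kappa>: "\<And>u. cr_curv G u = (d + k) / 2 - 3/2 * Wf d k (u + u0)"
    \<comment> \<open>A translation of the parameter brings \<open>u0\<close> to 0, the normal form
      expected by \<open>periodic_lift_rational\<close>.\<close>
    define G0 where "G0 = (\<lambda>u. G (u + (- u0)))"
    have L: "normalized_legendrian_lift G0" unfolding G0_def by (rule shift_lift(1)[OF G(1)])
    have a: "inv_a G0 u = 1" for u unfolding G0_def shift_lift(2)[OF G(1)] by (rule G(2))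
    have k0: "cr_curv G0 u = (d + k) / 2 - 3/2 * Wf d k u" for u unfolding G0_def shift_lift(3)[OF G(1)] \<kappa> by simp
    have p: "G0 (u + 3 * T) = G0 u" for u using per[of "u - u0"] by (simp add: G0_def algebra_simps)
    have T3: "0 < 3 * T" using T(1) by simp
    note R = periodic_lift_rational[OF dk L a k0 T3 p]
    show ?thesis by (rule that[OF R(1) \<kappa> characters_eq[OF dk \<kappa>] R(2,3)])
  qed
qed

lemma closed_string_Theta:
  assumes "closed_string G"
  shows "characters G \<in> domD" "Theta (characters G) \<in> domM \<inter> (\<rat> \<times> \<rat>)"
proof -
  obtain d k u0 where D: "(d, k) \<in> Dop" and "\<And>u. cr_curv G u = (d + k) / 2 - 3/2 * Wf d k (u + u0)" and c: "characters G = to_char (d, k)" and q: "Tf c2 d k \<in> \<rat>" "Tf c3 d k \<in> \<rat>"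
    by (rule closed_string_characters[OF assms]) (rule that)
  show "characters G \<in> domD" unfolding c by (rule Theta_to_char(1)[OF D])
  show "Theta (characters G) \<in> domM \<inter> (\<rat> \<times> \<rat>)"
    unfolding c Theta_to_char(2)[OF D] using period_map_in_domM[OF D] q by (simp add: period_map_def)
qed

text \<open>The curvature up to translation is a complete invariant: an equivalence translates it,
  and lifts with equal curvature are congruent. \<open>Theta\<close> enters through the injectivity
  of \<open>period_map\<close>.\<close>

lemma closed_string_cr_equiv:
  assumes 1: "closed_string G1" and 2: "closed_string G2"
  shows "cr_equiv G1 G2 \<longleftrightarrow> Theta (characters G1) = Theta (characters G2)"
proof -
  have G: "normalized_legendrian_lift G" "\<And>u. inv_a G u = 1" if "closed_string G" for G
    using that unfolding closed_string_def is_string_def by simp_all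
  obtain d k u0 where D: "(d, k) \<in> Dop" and k1: "\<And>u. cr_curv G1 u = (d + k) / 2 - 3/2 * Wf d k (u + u0)"
    and c1: "characters G1 = to_char (d, k)" and "Tf c2 d k \<in> \<rat>" "Tf c3 d k \<in> \<rat>" by (rule closed_string_characters[OF 1]) (rule that)
  obtain d' k' u1 where D': "(d', k') \<in> Dop" and k2: "\<And>u. cr_curv G2 u = (d' + k') / 2 - 3/2 * Wf d' k' (u + u1)"
    and c2: "characters G2 = to_char (d', k')" and "Tf c2 d' k' \<in> \<rat>" "Tf c3 d' k' \<in> \<rat>" by (rule closed_string_characters[OF 2]) (rule that)
  show ?thesis
  proof
    assume eq: "cr_equiv G1 G2"
    show "Theta (characters G1) = Theta (characters G2)"
    proof (rule cr_equiv_imp_curvature_shift[OF G(1)[OF 1] G(1)[OF 2] G(2)[OF 1] G(2)[OF 2] eq])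
      fix s assume "\<And>u. cr_curv G2 u = cr_curv G1 (u + s)"
      then have "cr_curv G2 u = (d + k) / 2 - 3/2 * Wf d k (u + (s + u0))" for u unfolding k1 by (simp add: add.assoc)
      from characters_eq[OF Dop_props(1,2)[OF D] this] show ?thesis unfolding c1 by simp
    qed
  next
    assume "Theta (characters G1) = Theta (characters G2)"
    then have "period_map (d, k) = period_map (d', k')" unfolding c1 c2 Theta_to_char(2)[OF D] Theta_to_char(2)[OF D'] .
    from inj_onD[OF inj_period_map this D D'] have e: "d' = d" "k' = k" by simp_all
    have "cr_curv G1 u = cr_curv G2 (u + (u0 - u1))" for u unfolding k1 k2 e by simp
    then show "cr_equiv G1 G2" by (rule cr_equiv_of_same_curvature[OF G(1)[OF 1] G(1)[OF 2] G(2)[OF 1] G(2)[OF 2]])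
  qed
qed

section \<open>Construction of closed strings\<close>

text \<open>The logarithmic derivative of the solution attached to \<open>c\<close>, and its second derivative over itself.\<close>

definition aa :: "real \<Rightarrow> real \<Rightarrow> real \<Rightarrow> real \<Rightarrow> complex" where
  "aa d k c u = (\<i> - of_real (Yc d k (ang d k u))) * inverse (of_real c - of_real (Wf d k u))"

definition bb :: "real \<Rightarrow> real \<Rightarrow> real \<Rightarrow> real \<Rightarrow> real" where
  "bb d k c u = 2 * Wf d k u - (d + k) + c"

text \<open>The Riccati equation \<open>a' + a^2 = b\<close> for the logarithmic derivative
  \<open>a\<close>. As \<open>Q(c) = -1\<close>, the quantity \<open>1 + y^2 = Q(w) - Q(c)\<close>
  is divisible by \<open>c - w\<close>, which cancels the double pole.\<close>

lemma aa_algebra: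
  fixes j y w c D K s t :: complex
  assumes j: "j * j = -1" and y: "y * y = w * (w - D) * (w - K)" and c: "c * (c - D) * (c - K) = -1"
    and t: "(c - w) * t = 1"
  shows "((j - y) * t) * ((j - y) * t) + ((j - y) * (2 * y * (t * t)) + (0 - (3 * (w * w) - 2 * (D + K) * w + D * K)) * t)
    = 2 * w - (D + K) + c"
proof -
  define q where "q = 3 * (w * w) - 2 * (D + K) * w + D * K"
  define s where "s = c - w"
  have st: "s * t = 1" using t by (simp add: s_def)
  have "c * (c - D) * (c - K) - w * (w - D) * (w - K) = s * (q + s * (3 * w - (D + K)) + s * s)"
    unfolding s_def q_def by (simp add: algebra_simps)
  then have e: "1 + y * y = - (s * (q + s * (3 * w - (D + K)) + s * s))" unfolding c y by (simp add: algebra_simps)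
  have "((j - y) * t) * ((j - y) * t) + ((j - y) * (2 * y * (t * t)) + (0 - q) * t) = (j * j - y * y) * (t * t) - q * t"
    by (simp add: algebra_simps)
  also have "j * j - y * y = s * (q + s * (3 * w - (D + K)) + s * s)" using e by (simp add: j) (simp add: algebra_simps)
  also have "s * (q + s * (3 * w - (D + K)) + s * s) * (t * t) - q * t
     = (s * t) * t * q + (s * t) * (s * t) * (3 * w - (D + K)) + (s * t) * (s * t) * s - q * t" by (simp add: algebra_simps)
  also have "\<dots> = 2 * w - (D + K) + c" unfolding st by (simp add: s_def algebra_simps)
  finally show ?thesis unfolding q_def .
qed

text \<open>The solution is \<open>sqrt (m (c - W)) exp (\<i> P)\<close>. The weight
  \<open>m\<close> makes the radicand positive for either sign of \<open>c - W\<close> and later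
  normalises the Hermitian products. Over \<open>N\<close> periods of \<open>W\<close> the phase
  grows by \<open>2 pi N \<theta>\<close>, a multiple of \<open>2 pi\<close>.\<close>

lemma exponential_solution:
  assumes dk: "0 < d" "d < k" and c: "Qc d k c = -1" "c \<notin> {0..d}"
    and m: "\<And>u. 0 < m * (c - Wf d k u)"
    and E: "EI d k (\<lambda>V. 1 / (c - V)) = pi * \<theta>" and N: "of_nat N * \<theta> \<in> \<int>"
  obtains z where
    "\<And>u. (z has_vector_derivative aa d k c u * z u) (at u)"
    "\<And>u. ((\<lambda>u. aa d k c u * z u) has_vector_derivative of_real (bb d k c u) * z u) (at u)"
    "\<And>u. ((\<lambda>u. of_real (bb d k c u) * z u) has_vector_derivative
        (\<i> + 3 * of_real (Yc d k (ang d k u))) * z u + of_real (3 * Wf d k u - (d + k)) * (aa d k c u * z u)) (at u)"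
    "\<And>u. cnj (z u) * z u = of_real (m * (c - Wf d k u))"
    "\<And>u. z (u + of_nat N * per d k) = z u"
proof -
  define A where "A = 2 * EI d k (\<lambda>V. 1 / (c - V))"
  obtain P where P: "\<And>u. (P has_real_derivative 1 / (c - Wf d k u)) (at u)"
    "\<And>u n. P (u + of_nat n * per d k) = P u + of_nat n * A"
    "\<And>u n. ang d k u = of_nat n * pi \<Longrightarrow> P u = P 0 + of_nat n * A"
    by (rule phase_function[OF dk c(2), folded A_def]) (rule that)
  define r where "r u = sqrt (m * (c - Wf d k u))" for u
  define z where "z u = of_real (r u) * exp (\<i> * of_real (P u))" for u
  define y w where "y u = Yc d k (ang d k u)" and "w u = Wf d k u" for u
  have snz: "c - Wf d k u \<noteq> 0" and mnz: "m \<noteq> 0" for u using m[of u] by auto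
  have csnz: "complex_of_real c - of_real (w u) \<noteq> 0" for u using snz[of u] by (simp add: w_def)
  have dr: "(r has_real_derivative - y u / (c - w u) * r u) (at u)" for u
  proof -
    have "((\<lambda>u. m * (c - Wf d k u)) has_real_derivative m * (0 - 2 * y u)) (at u)"
      unfolding y_def by (intro DERIV_cmult DERIV_diff DERIV_const Wf_deriv(1)[OF dk])
    from DERIV_chain2[OF DERIV_real_sqrt[OF m] this]
    have "(r has_real_derivative inverse (r u) / 2 * (m * (0 - 2 * y u))) (at u)" unfolding r_def .
    moreover have "inverse (r u) / 2 * (m * (0 - 2 * y u)) = - y u / (c - w u) * r u"
    proof -
      have rr: "r u * r u = m * (c - w u)" using m[of u] by (simp add: r_def w_def)
      have "0 < r u" unfolding r_def using m[of u] by (rule real_sqrt_gt_zero)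
      then have "inverse (r u) / 2 * (m * (0 - 2 * y u)) = - y u * m * r u / (r u * r u)" by (simp add: field_simps)
      also have "\<dots> = - y u / (c - w u) * r u" unfolding rr using mnz snz[of u] by (simp add: w_def)
      finally show ?thesis .
    qed
    ultimately show ?thesis by simp
  qed
  have D1: "(z has_vector_derivative aa d k c u * z u) (at u)" for u
  proof -
    have "(z has_vector_derivative of_real (r u) * (\<i> * of_real (1 / (c - Wf d k u)) * exp (\<i> * of_real (P u)))
        + of_real (- y u / (c - w u) * r u) * exp (\<i> * of_real (P u))) (at u)"
      unfolding z_def[abs_def]
      by (intro has_vector_derivative_mult vderiv_of_real[OF dr] vderiv_exp has_vector_derivative_mult_right vderiv_of_real[OF P(1)])
    moreover have "R * (\<i> * t * e) + - y * t * R * e = ((\<i> - y) * t) * (R * e)" for R t e y :: complex by (simp add: algebra_simps)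
    ultimately show ?thesis unfolding aa_def z_def y_def w_def by (simp add: divide_inverse)
  qed
  have Yd: "((\<lambda>u. \<i> - of_real (y u)) has_vector_derivative 0 - of_real (Qc' d k (w u))) (at u)" for u
    unfolding y_def w_def by (intro has_vector_derivative_diff has_vector_derivative_const vderiv_of_real Wf_deriv(2)[OF dk])
  have Wd: "((\<lambda>u. complex_of_real c - of_real (w u)) has_vector_derivative 0 - of_real (2 * y u)) (at u)" for u
    unfolding y_def w_def by (intro has_vector_derivative_diff has_vector_derivative_const vderiv_of_real Wf_deriv(1)[OF dk])
  have c': "of_real c * (of_real c - of_real d) * (of_real c - of_real k) = (-1::complex)"
    using arg_cong[OF c(1), of complex_of_real] by (simp add: Qc_def)
  have y2: "complex_of_real (y u) * of_real (y u) = of_real (w u) * (of_real (w u) - of_real d) * (of_real (w u) - of_real k)" for u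
    using arg_cong[OF Wf_deriv(3)[OF dk, of u], of complex_of_real] by (simp add: Qc_def y_def w_def power2_eq_square)
  have ii: "\<i> * \<i> = -1" by simp
  have D2: "((\<lambda>u. aa d k c u * z u) has_vector_derivative of_real (bb d k c u) * z u) (at u)" for u
  proof -
    define t where "t = inverse (of_real c - complex_of_real (w u))"
    have t: "(of_real c - of_real (w u)) * t = 1" unfolding t_def using csnz[of u] by simp
    have "((\<lambda>u. ((\<i> - of_real (y u)) * inverse (of_real c - of_real (w u))) * z u) has_vector_derivative
        ((\<i> - of_real (y u)) * t) * (((\<i> - of_real (y u)) * t) * z u)
        + ((\<i> - of_real (y u)) * (- (0 - of_real (2 * y u)) * (t * t)) + (0 - of_real (Qc' d k (w u))) * t) * z u) (at u)"
      unfolding t_def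
      by (intro has_vector_derivative_mult vderiv_inverse Yd Wd csnz D1[unfolded aa_def, folded y_def w_def])
    moreover have "((\<i> - of_real (y u)) * t) * (((\<i> - of_real (y u)) * t) * z u)
        + ((\<i> - of_real (y u)) * (- (0 - of_real (2 * y u)) * (t * t)) + (0 - of_real (Qc' d k (w u))) * t) * z u
       = of_real (bb d k c u) * z u"
    proof -
      have "complex_of_real (Qc' d k (w u)) = 3 * (of_real (w u) * of_real (w u)) - 2 * (of_real d + of_real k) * of_real (w u) + of_real d * of_real k"
        by (simp add: Qc'_def power2_eq_square)
      moreover have "- (0 - complex_of_real (2 * y u)) = 2 * of_real (y u)" by simp
      moreover have "complex_of_real (bb d k c u) = 2 * of_real (w u) - (of_real d + of_real k) + of_real c" by (simp add: bb_def w_def)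
      ultimately show ?thesis
        unfolding aa_algebra[OF ii y2 c' t, symmetric] by (simp only: distrib_right mult.assoc)
    qed
    ultimately show ?thesis unfolding aa_def y_def w_def by (simp only:)
  qed
  have D3: "((\<lambda>u. of_real (bb d k c u) * z u) has_vector_derivative
        (\<i> + 3 * of_real (Yc d k (ang d k u))) * z u + of_real (3 * Wf d k u - (d + k)) * (aa d k c u * z u)) (at u)" for u
  proof -
    have "(bb d k c has_real_derivative 2 * (2 * y u)) (at u)"
    proof -
      have "(bb d k c has_real_derivative 2 * (2 * y u) - 0 + 0) (at u)"
        unfolding bb_def[abs_def] y_def by (intro DERIV_add DERIV_diff DERIV_const DERIV_cmult Wf_deriv(1)[OF dk])
      then show ?thesis by simp
    qed
    note X = has_vector_derivative_mult[OF vderiv_of_real[OF this] D1]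
    have ac: "(of_real c - of_real (w u)) * aa d k c u = \<i> - of_real (y u)"
      unfolding aa_def w_def[symmetric] y_def[symmetric] using csnz[of u] by simp
    have "of_real (bb d k c u) = (of_real c - of_real (w u)) + complex_of_real (3 * Wf d k u - (d + k))" by (simp add: bb_def w_def)
    then have "of_real (bb d k c u) * (aa d k c u * z u)
      = ((of_real c - of_real (w u)) * aa d k c u) * z u + of_real (3 * Wf d k u - (d + k)) * (aa d k c u * z u)"
      by (simp only: distrib_right mult.assoc)
    then have "of_real (bb d k c u) * (aa d k c u * z u) + of_real (2 * (2 * y u)) * z u
      = (\<i> + 3 * of_real (y u)) * z u + of_real (3 * Wf d k u - (d + k)) * (aa d k c u * z u)"
      unfolding ac by (simp add: algebra_simps)
    then show ?thesis using X unfolding y_def by (simp only:)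
  qed
  have n: "cnj (z u) * z u = of_real (m * (c - Wf d k u))" for u
  proof -
    have e: "exp (- (\<i> * of_real (P u))) * exp (\<i> * of_real (P u)) = 1" by (simp add: exp_add[symmetric])
    have "cnj (z u) * z u = of_real (r u * r u) * (exp (- (\<i> * of_real (P u))) * exp (\<i> * of_real (P u)))"
      by (simp add: z_def exp_cnj ac_simps)
    then show ?thesis unfolding e using m[of u] by (simp add: r_def)
  qed
  have p: "z (u + of_nat N * per d k) = z u" for u
  proof -
    obtain i :: int where i: "of_nat N * \<theta> = of_int i" using N by (elim Ints_cases)
    have "of_nat N * A = 2 * pi * (of_nat N * \<theta>)" unfolding A_def E by simp
    then have PN: "P (u + of_nat N * per d k) = P u + 2 * pi * of_int i" unfolding P(2) i by simp
    have dW: "Wf d k (u + of_nat N * per d k) = Wf d k u" by (rule periodic_int_shift(1)[of "Wf d k" "per d k", OF Wf_period[OF dk]])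
    have "exp (\<i> * of_real (P u + 2 * pi * of_int i)) = exp (\<i> * of_real (P u))"
      unfolding exp_eq by (intro exI[of _ i]) (simp add: algebra_simps)
    then show ?thesis unfolding z_def r_def PN dW by simp
  qed
  show ?thesis by (rule that[OF D1 D2 D3 n p])
qed

text \<open>Complex polynomials in \<open>W\<close> and \<open>Y\<close>. The derivatives
  \<open>W' = 2 Y\<close> and \<open>Y' = Q'(W)\<close> stay in this algebra, so combinations of
  \<open>G, G1, G2\<close> with such coefficients are closed under differentiation, which makes
  \<open>G\<close> smooth.\<close>

inductive_set wy_alg :: "real \<Rightarrow> real \<Rightarrow> (real \<Rightarrow> complex) set" for d k where
  const: "(\<lambda>u. c) \<in> wy_alg d k"
| W: "(\<lambda>u. of_real (Wf d k u)) \<in> wy_alg d k"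
| Y: "(\<lambda>u. of_real (Yc d k (ang d k u))) \<in> wy_alg d k"
| add: "f \<in> wy_alg d k \<Longrightarrow> g \<in> wy_alg d k \<Longrightarrow> (\<lambda>u. f u + g u) \<in> wy_alg d k"
| mult: "f \<in> wy_alg d k \<Longrightarrow> g \<in> wy_alg d k \<Longrightarrow> (\<lambda>u. f u * g u) \<in> wy_alg d k"

lemma wy_alg_deriv:
  assumes dk: "0 < d" "d < k" and f: "f \<in> wy_alg d k"
  shows "\<exists>g\<in>wy_alg d k. \<forall>u. (f has_vector_derivative g u) (at u)"
  using f
proof induction
  case (const c)
  show ?case by (rule bexI[OF _ wy_alg.const[of 0]]) (intro allI has_vector_derivative_const)
next
  case W
  have "(\<lambda>u. 2 * of_real (Yc d k (ang d k u))) \<in> wy_alg d k" by (intro wy_alg.intros)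
  then show ?case
    by (rule bexI[rotated]) (use vderiv_of_real[OF Wf_deriv(1)[OF dk]] in simp)
next
  case Y
  have "(\<lambda>u. 3 * (of_real (Wf d k u) * of_real (Wf d k u)) + (- 2 * (of_real d + of_real k) * of_real (Wf d k u) + of_real d * of_real k)) \<in> wy_alg d k"
    by (intro wy_alg.intros)
  moreover have "3 * (of_real (Wf d k u) * of_real (Wf d k u)) + (- 2 * (of_real d + of_real k) * of_real (Wf d k u) + of_real d * of_real k)
     = complex_of_real (Qc' d k (Wf d k u))" for u by (simp add: Qc'_def power2_eq_square algebra_simps)
  ultimately have "(\<lambda>u. complex_of_real (Qc' d k (Wf d k u))) \<in> wy_alg d k" by simp
  then show ?case
    by (rule bexI[rotated]) (use vderiv_of_real[OF Wf_deriv(2)[OF dk]] in simp)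
next
  case (add f g)
  obtain f' where f': "f' \<in> wy_alg d k" "\<forall>u. (f has_vector_derivative f' u) (at u)" using add.IH(1) by (elim bexE)
  obtain g' where g': "g' \<in> wy_alg d k" "\<forall>u. (g has_vector_derivative g' u) (at u)" using add.IH(2) by (elim bexE)
  show ?case by (rule bexI[OF _ wy_alg.add[OF f'(1) g'(1)]]) (use f'(2) g'(2) in \<open>intro allI has_vector_derivative_add, auto\<close>)
next
  case (mult f g)
  obtain f' where f': "f' \<in> wy_alg d k" "\<forall>u. (f has_vector_derivative f' u) (at u)" using mult.IH(1) by (elim bexE)
  obtain g' where g': "g' \<in> wy_alg d k" "\<forall>u. (g has_vector_derivative g' u) (at u)" using mult.IH(2) by (elim bexE)
  show ?case by (rule bexI[OF _ wy_alg.add[OF wy_alg.mult[OF mult.hyps(1) g'(1)] wy_alg.mult[OF f'(1) mult.hyps(2)]]])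
      (use f'(2) g'(2) in \<open>intro allI has_vector_derivative_mult, auto\<close>)
qed

lemma lame_smooth:
  fixes G G1 G2 :: "real \<Rightarrow> complex^3"
  assumes dk: "0 < d" "d < k"
    and D: "\<And>u. (G has_vector_derivative G1 u) (at u)" "\<And>u. (G1 has_vector_derivative G2 u) (at u)"
    "\<And>u. (G2 has_vector_derivative (\<i> + 3 * of_real (Yc d k (ang d k u))) *s G u + of_real (3 * Wf d k u - (d + k)) *s G1 u) (at u)"
  shows "smooth_fun G"
proof (rule smooth_funI[where \<F> = "{\<lambda>u. p u *s G u + q u *s G1 u + r u *s G2 u | p q r. p \<in> wy_alg d k \<and> q \<in> wy_alg d k \<and> r \<in> wy_alg d k}"])
  show "G \<in> {\<lambda>u. p u *s G u + q u *s G1 u + r u *s G2 u | p q r. p \<in> wy_alg d k \<and> q \<in> wy_alg d k \<and> r \<in> wy_alg d k}"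
    by (rule CollectI, rule exI[of _ "\<lambda>u. 1"], rule exI[of _ "\<lambda>u. 0"], rule exI[of _ "\<lambda>u. 0"])
       (simp add: wy_alg.const)
next
  fix f assume "f \<in> {\<lambda>u. p u *s G u + q u *s G1 u + r u *s G2 u | p q r. p \<in> wy_alg d k \<and> q \<in> wy_alg d k \<and> r \<in> wy_alg d k}"
  then obtain p q r where f: "f = (\<lambda>u. p u *s G u + q u *s G1 u + r u *s G2 u)"
    and w: "p \<in> wy_alg d k" "q \<in> wy_alg d k" "r \<in> wy_alg d k" by (elim CollectE exE conjE)
  obtain p' where p': "p' \<in> wy_alg d k" "\<forall>u. (p has_vector_derivative p' u) (at u)" using wy_alg_deriv[OF dk w(1)] by (elim bexE)
  obtain q' where q': "q' \<in> wy_alg d k" "\<forall>u. (q has_vector_derivative q' u) (at u)" using wy_alg_deriv[OF dk w(2)] by (elim bexE)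
  obtain r' where r': "r' \<in> wy_alg d k" "\<forall>u. (r has_vector_derivative r' u) (at u)" using wy_alg_deriv[OF dk w(3)] by (elim bexE)
  define a where "a u = \<i> + 3 * complex_of_real (Yc d k (ang d k u))" for u
  define b where "b u = 3 * complex_of_real (Wf d k u) + - (of_real d + of_real k)" for u
  have ab: "a \<in> wy_alg d k" "b \<in> wy_alg d k" unfolding a_def[abs_def] b_def[abs_def] by (intro wy_alg.intros)+
  have D3: "(G2 has_vector_derivative a u *s G u + b u *s G1 u) (at u)" for u
  proof -
    have "of_real (3 * Wf d k u - (d + k)) = b u" by (simp add: b_def)
    then show ?thesis using D(3)[of u] unfolding a_def by simp
  qed
  have "(f has_vector_derivative (p' u + r u * a u) *s G u + ((p u + q' u) + r u * b u) *s G1 u + (q u + r' u) *s G2 u) (at u)" for u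
  proof -
    have "(f has_vector_derivative (p u *s G1 u + p' u *s G u) + (q u *s G2 u + q' u *s G1 u)
        + (r u *s (a u *s G u + b u *s G1 u) + r' u *s G2 u)) (at u)"
      unfolding f by (intro has_vector_derivative_add smult_deriv D(1,2) D3 p'(2)[rule_format] q'(2)[rule_format] r'(2)[rule_format])
    moreover have "(p u *s G1 u + p' u *s G u) + (q u *s G2 u + q' u *s G1 u)
        + (r u *s (a u *s G u + b u *s G1 u) + r' u *s G2 u)
       = (p' u + r u * a u) *s G u + ((p u + q' u) + r u * b u) *s G1 u + (q u + r' u) *s G2 u"
      by (simp add: vec_eq_iff algebra_simps)
    ultimately show ?thesis by (simp only:)
  qed
  then show "\<exists>g\<in>{\<lambda>u. p u *s G u + q u *s G1 u + r u *s G2 u | p q r. p \<in> wy_alg d k \<and> q \<in> wy_alg d k \<and> r \<in> wy_alg d k}.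
     \<forall>u. (f has_vector_derivative g u) (at u)"
  proof (intro bexI[of _ "\<lambda>u. (p' u + r u * a u) *s G u + ((p u + q' u) + r u * b u) *s G1 u + (q u + r' u) *s G2 u"] allI CollectI)
    show "\<exists>p0 q0 r0. (\<lambda>u. (p' u + r u * a u) *s G u + ((p u + q' u) + r u * b u) *s G1 u + (q u + r' u) *s G2 u)
       = (\<lambda>u. p0 u *s G u + q0 u *s G1 u + r0 u *s G2 u) \<and> p0 \<in> wy_alg d k \<and> q0 \<in> wy_alg d k \<and> r0 \<in> wy_alg d k"
      by (rule exI[of _ "\<lambda>u. p' u + r u * a u"], rule exI[of _ "\<lambda>u. (p u + q' u) + r u * b u"], rule exI[of _ "\<lambda>u. q u + r' u"])
         (intro conjI refl wy_alg.add wy_alg.mult w p' q' r' ab)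
  qed
qed

lemma vd_unfold:
  assumes "\<And>u. (f has_vector_derivative f1 u) (at u)" "\<And>u. (f1 has_vector_derivative f2 u) (at u)" "\<And>u. (f2 has_vector_derivative f3 u) (at u)"
  shows "vd f 1 = f1" "vd f 2 = f2" "vd f 3 = f3"
proof -
  have S1: "1 = Suc 0" "2 = Suc 1" "3 = Suc 2" by simp_all
  show 1: "vd f 1 = f1" by (rule ext) (simp only: S1(1) vd.simps, rule vector_derivative_at[OF assms(1)])
  show 2: "vd f 2 = f2" by (rule ext) (simp only: S1(2) vd.simps(2) 1, rule vector_derivative_at[OF assms(2)])
  show "vd f 3 = f3" by (rule ext) (simp only: S1(3) vd.simps(2) 2, rule vector_derivative_at[OF assms(3)])
qed

lemma det3_dependent: "det3 X Y (a *s X + b *s Y) = 0"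
  unfolding det3_rows3 det_3 rows3_nth by (simp add: algebra_simps)

lemma det3_scale: "det3 (c *s X) (c *s Y) (c *s Z) = c^3 * det3 X Y Z"
  unfolding det3_rows3 det_3 rows3_nth by (simp add: algebra_simps power3_eq_cube)

lemma smult_const_deriv:
  assumes "(f has_vector_derivative f') (at u)"
  shows "((\<lambda>u. c *s (f u :: complex^3)) has_vector_derivative c *s f') (at u)"
  using smult_deriv[OF has_vector_derivative_const[of c] assms] by simp

text \<open>The Gram relations fix the determinant of the frame up to a factor of modulus 1, and the
  differential equation keeps it constant. Multiplication by a suitable unit constant turns it into
  \<open>\<i>\<close> and leaves all Hermitian products unchanged.\<close>

lemma closed_string_of_gram:
  fixes F F1 F2 :: "real \<Rightarrow> complex^3"
  assumes dk: "0 < d" "d < k"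
    and D: "\<And>u. (F has_vector_derivative F1 u) (at u)" "\<And>u. (F1 has_vector_derivative F2 u) (at u)"
    "\<And>u. (F2 has_vector_derivative (\<i> + 3 * of_real (Yc d k (ang d k u))) *s F u + of_real (3 * Wf d k u - (d + k)) *s F1 u) (at u)"
    and h: "\<And>u. herm (F u) (F u) = 0" "\<And>u. herm (F u) (F1 u) = 0" "\<And>u. herm (F u) (F2 u) = -1"
      "\<And>u. herm (F1 u) (F1 u) = 1" "\<And>u. herm (F1 u) (F2 u) = 0" "\<And>u. herm (F2 u) (F2 u) = of_real (d + k - 3 * Wf d k u)"
    and T: "0 < T" "\<And>u. F (u + T) = F u"
  shows "\<exists>G. closed_string G \<and> (\<forall>u. cr_curv G u = (d + k) / 2 - 3/2 * Wf d k u)"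
proof -
  define \<delta> where "\<delta> = det3 (F 0) (F1 0) (F2 0)"
  have dc: "det3 (F u) (F1 u) (F2 u) = \<delta>" for u
    unfolding \<delta>_def
  proof (rule vderiv_zero_const[of "\<lambda>u. det3 (F u) (F1 u) (F2 u)"])
    fix u
    show "((\<lambda>u. det3 (F u) (F1 u) (F2 u)) has_vector_derivative 0) (at u)"
      using det3_deriv[OF D(1) D(2) D(3), of u] unfolding det3_dependent det3_repeat by simp
  qed
  have h': "herm (F1 u) (F u) = 0" "herm (F2 u) (F u) = -1" "herm (F2 u) (F1 u) = 0" for u
    using herm_cnj[of "F1 u" "F u"] herm_cnj[of "F2 u" "F u"] herm_cnj[of "F2 u" "F1 u"] h by simp_all
  have "- cnj \<delta> * \<delta> = -1"
    using mixed_gram[of "rows3 (F 0) (F1 0) (F2 0)" "rows3 (F 0) (F1 0) (F2 0)"]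
    unfolding det3_rows3[symmetric] \<delta>_def[symmetric] det_3[of "\<chi> i j. _ i j"] by (simp add: rows3_nth h h')
  then have "cnj \<delta> * \<delta> = 1" by simp
  then have "complex_of_real ((norm \<delta>)^2) = of_real 1" unfolding complex_norm_square by (simp add: mult.commute)
  then have "(norm \<delta>)^2 = 1" unfolding of_real_eq_iff .
  then have \<delta>n: "norm \<delta> = 1" using norm_ge_zero[of \<delta>] by (auto simp: power2_eq_1_iff)
  then have "\<delta> \<noteq> 0" by auto
  note \<delta>1 = \<delta>n this
  define \<beta> where "\<beta> = \<i> / \<delta>"
  have \<beta>: "norm \<beta> = 1" "\<beta> \<noteq> 0" using \<delta>1 by (simp_all add: \<beta>_def norm_divide)
  \<comment> \<open>A cube root of \<open>\<beta> = \<i> / \<delta>\<close>: scaling the frame by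
    \<open>\<omega>\<close> multiplies its determinant by \<open>\<omega>^3\<close>.\<close>
  define \<omega> where "\<omega> = cis (Arg \<beta> / 3)"
  have \<omega>3: "\<omega>^3 = \<beta>"
  proof -
    have "\<omega>^3 = cis (Arg \<beta>)" unfolding \<omega>_def Complex.DeMoivre by simp
    then show ?thesis using cis_Arg[OF \<beta>(2)] \<beta>(1) by (simp add: sgn_div_norm)
  qed
  have \<omega>1: "cnj \<omega> * (\<omega> * X) = X" for X
  proof -
    have "cnj \<omega> * \<omega> = 1" unfolding \<omega>_def cis_cnj by (simp add: cis_mult)
    then show ?thesis by (simp add: mult.assoc[symmetric])
  qed
  have hs: "herm (\<omega> *s x) (\<omega> *s y) = herm x y" for x y
  proof -
    have "\<omega> * (cnj \<omega> * X) = X" for X unfolding mult.left_commute[of \<omega>] by (rule \<omega>1)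
    then show ?thesis by (simp only: herm_scale_left herm_scale_right \<omega>1)
  qed
  define G where "G u = \<omega> *s F u" for u
  define G1 where "G1 u = \<omega> *s F1 u" for u
  define G2 where "G2 u = \<omega> *s F2 u" for u
  define \<alpha> where "\<alpha> u = \<i> + 3 * complex_of_real (Yc d k (ang d k u))" for u
  define \<gamma> where "\<gamma> u = complex_of_real (3 * Wf d k u - (d + k))" for u
  have DG: "(G has_vector_derivative G1 u) (at u)" "(G1 has_vector_derivative G2 u) (at u)"
    "(G2 has_vector_derivative \<alpha> u *s G u + \<gamma> u *s G1 u) (at u)" for u
  proof -
    show "(G has_vector_derivative G1 u) (at u)" unfolding G_def[abs_def] G1_def by (rule smult_const_deriv[OF D(1)])
    show "(G1 has_vector_derivative G2 u) (at u)" unfolding G1_def[abs_def] G2_def by (rule smult_const_deriv[OF D(2)])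
    have "(G2 has_vector_derivative \<omega> *s (\<alpha> u *s F u + \<gamma> u *s F1 u)) (at u)"
      unfolding G2_def[abs_def] \<alpha>_def \<gamma>_def by (rule smult_const_deriv[OF D(3)])
    moreover have "\<omega> *s (\<alpha> u *s F u + \<gamma> u *s F1 u) = \<alpha> u *s G u + \<gamma> u *s G1 u"
      unfolding G_def G1_def by (simp add: vec_eq_iff algebra_simps)
    ultimately show "(G2 has_vector_derivative \<alpha> u *s G u + \<gamma> u *s G1 u) (at u)" by (simp only:)
  qed
  note v = vd_unfold[OF DG]
  have sm: "smooth_fun G" by (rule lame_smooth[OF dk DG(1,2) DG(3)[unfolded \<alpha>_def \<gamma>_def]])
  have gh: "herm (G u) (G u) = 0" "herm (G u) (G1 u) = 0" "herm (G u) (G2 u) = -1" "herm (G1 u) (G2 u) = 0"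
    "herm (G2 u) (G2 u) = of_real (d + k - 3 * Wf d k u)" for u
    unfolding G_def G1_def G2_def hs h by (rule refl)+
  have nz: "G u \<noteq> 0" for u
  proof
    assume "G u = 0"
    then have "herm (G u) (G2 u) = 0" by (simp add: herm_def)
    then show False unfolding gh by simp
  qed
  have dt: "det3 (G u) (G1 u) (G2 u) = \<i>" for u
    unfolding G_def G1_def G2_def det3_scale dc \<omega>3 \<beta>_def using \<delta>1 by simp
  have lift: "normalized_legendrian_lift G"
    unfolding normalized_legendrian_lift_def v using sm nz gh dt by (intro conjI allI) 
  have ia: "inv_a G u = 1" for u
  proof -
    have "herm (vd G 3 u) (vd G 2 u) = - cnj (\<alpha> u)"
      unfolding v herm_add_left herm_scale_left gh by simp
    then show ?thesis by (simp add: inv_a_def \<alpha>_def)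
  qed
  have \<kappa>: "cr_curv G u = (d + k) / 2 - 3/2 * Wf d k u" for u
    unfolding cr_curv_def v gh by (simp add: diff_divide_distrib)
  have nc: "\<exists>u v. cr_curv G u \<noteq> cr_curv G v"
  proof -
    obtain x where x: "ang d k x = 0" using ang_surj[OF dk] by (rule exE)
    obtain y where y: "ang d k y = pi / 2" using ang_surj[OF dk] by (rule exE)
    have "Wf d k x = 0" "Wf d k y = d" unfolding Wf_def x y by simp_all
    then have "cr_curv G x \<noteq> cr_curv G y" unfolding \<kappa> using dk by simp
    then show ?thesis by (intro exI)
  qed
  have per: "\<exists>T>0. \<forall>u. cr_curv G (u + T) = cr_curv G u"
    by (rule exI[of _ "per d k"]) (simp only: \<kappa> Wf_period[OF dk] per_pos[OF dk] simp_thms)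
  have ode: "vd (cr_curv G) 3 u + 8 * cr_curv G u * vd (cr_curv G) 1 u = 0" for u
  proof -
    define y where "y u = Yc d k (ang d k u)" for u
    have e: "cr_curv G = (\<lambda>u. (d + k) / 2 - 3/2 * Wf d k u)" using \<kappa> by (rule ext)
    have 1: "(cr_curv G has_vector_derivative 0 - 3/2 * (2 * y u)) (at u)" for u
      unfolding e has_real_derivative_iff_has_vector_derivative[symmetric] y_def
      by (intro DERIV_diff DERIV_const DERIV_cmult Wf_deriv(1)[OF dk])
    have 2: "((\<lambda>u. 0 - 3/2 * (2 * y u)) has_vector_derivative 0 - 3/2 * (2 * Qc' d k (Wf d k u))) (at u)" for u
      unfolding has_real_derivative_iff_has_vector_derivative[symmetric] y_def
      by (intro DERIV_diff DERIV_const DERIV_cmult Wf_deriv(2)[OF dk])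
    have 3: "((\<lambda>u. 0 - 3/2 * (2 * Qc' d k (Wf d k u))) has_vector_derivative 0 - 3/2 * (2 * ((6 * Wf d k u - 2 * (d + k)) * (2 * y u)))) (at u)" for u
    proof -
      have "(Qc' d k has_real_derivative 6 * V - 2 * (d + k)) (at V)" for V
        unfolding Qc'_def[abs_def] by (rule derivative_eq_intros refl)+ (simp add: algebra_simps)
      from DERIV_chain2[OF this Wf_deriv(1)[OF dk]]
      show ?thesis unfolding has_real_derivative_iff_has_vector_derivative[symmetric] y_def
        by (intro DERIV_diff DERIV_const DERIV_cmult)
    qed
    note w = vd_unfold[OF 1 2 3]
    show ?thesis unfolding w \<kappa> by (simp add: field_simps)
  qed
  have "closed_string G"
    unfolding closed_string_def is_string_def
  proof (intro conjI allI lift ia nc per ode)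
    show "\<exists>T>0. \<forall>u. \<exists>c. c \<noteq> 0 \<and> G (u + T) = c *s G u"
      by (rule exI[of _ T], rule conjI[OF T(1)], rule allI, rule exI[of _ 1]) (simp add: G_def T(2))
  qed
  then show ?thesis using \<kappa> by (intro exI[of _ G] conjI allI)
qed

text \<open>The weights are \<open>-1/P'(a)\<close>, \<open>-1/P'(b)\<close>, \<open>-1/P'(c)\<close> for \<open>P(V) = (V - a) (V - b) (V - c)\<close>.\<close>

lemma lagrange_weights:
  fixes a b c w :: real
  assumes "a \<noteq> b" "b \<noteq> c" "a \<noteq> c"
  defines "\<Delta> \<equiv> (a - b) * (b - c) * (a - c)"
  defines "m1 \<equiv> - (b - c) / \<Delta>" and "m2 \<equiv> (a - c) / \<Delta>" and "m3 \<equiv> - (a - b) / \<Delta>" and "e \<equiv> a + b + c"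
  shows "m1 + m2 + m3 = 0"
    "m1 * (a - w) + m2 * (b - w) + m3 * (c - w) = 0"
    "m1 * (2 * w - e + a) + m2 * (2 * w - e + b) + m3 * (2 * w - e + c) = 0"
    "m1 * ((a - w) * (2 * w - e + a)) + m2 * ((b - w) * (2 * w - e + b)) + m3 * ((c - w) * (2 * w - e + c)) = -1"
    "m1 * ((a - w) * ((2 * w - e + a) * (2 * w - e + a))) + m2 * ((b - w) * ((2 * w - e + b) * (2 * w - e + b)))
       + m3 * ((c - w) * ((2 * w - e + c) * (2 * w - e + c))) = e - 3 * w"
    "m1 * ((b - w) * (c - w)) + m2 * ((a - w) * (c - w)) + m3 * ((a - w) * (b - w)) = -1"
proof -
  have nz: "\<Delta> \<noteq> 0" using assms(1-3) by (simp add: \<Delta>_def)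
  have K: "m1 * A + m2 * B + m3 * C = r" if "- (b - c) * A + (a - c) * B - (a - b) * C = r * \<Delta>" for A B C r
  proof -
    have "m1 * A + m2 * B + m3 * C = (- (b - c) * A + (a - c) * B - (a - b) * C) / \<Delta>"
      unfolding m1_def m2_def m3_def using nz by (simp add: field_simps)
    then show ?thesis unfolding that using nz by simp
  qed
  show "m1 + m2 + m3 = 0" using K[of 1 1 1 0] by simp
  show "m1 * (a - w) + m2 * (b - w) + m3 * (c - w) = 0" by (rule K) (simp add: algebra_simps)
  show "m1 * (2 * w - e + a) + m2 * (2 * w - e + b) + m3 * (2 * w - e + c) = 0" by (rule K) (simp add: algebra_simps)
  show "m1 * ((a - w) * (2 * w - e + a)) + m2 * ((b - w) * (2 * w - e + b)) + m3 * ((c - w) * (2 * w - e + c)) = -1"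
    by (rule K) (simp add: \<Delta>_def algebra_simps)
  show "m1 * ((a - w) * ((2 * w - e + a) * (2 * w - e + a))) + m2 * ((b - w) * ((2 * w - e + b) * (2 * w - e + b)))
       + m3 * ((c - w) * ((2 * w - e + c) * (2 * w - e + c))) = e - 3 * w"
    by (rule K) (simp add: \<Delta>_def e_def algebra_simps)
  show "m1 * ((b - w) * (c - w)) + m2 * ((a - w) * (c - w)) + m3 * ((a - w) * (b - w)) = -1"
    by (rule K) (simp add: \<Delta>_def algebra_simps)
qed

text \<open>\<open>ev1, ev2, ev3\<close> form a basis in which the Hermitian form is diagonal with
  entries 1, 1, -1.\<close>

definition ev1 :: "complex^3" where "ev1 = (\<chi> i. if i = 1 then 1 else if i = 2 then 0 else - \<i> / 2)"
definition ev2 :: "complex^3" where "ev2 = (\<chi> i. if i = 1 then 0 else if i = 2 then 1 else 0)"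
definition ev3 :: "complex^3" where "ev3 = (\<chi> i. if i = 1 then 1 else if i = 2 then 0 else \<i> / 2)"

definition diag_vec :: "complex \<Rightarrow> complex \<Rightarrow> complex \<Rightarrow> complex^3" where
  "diag_vec a b c = a *s ev1 + b *s ev2 + c *s ev3"

lemma herm_diag_vec: "herm (diag_vec a b c) (diag_vec a' b' c') = cnj a * a' + cnj b * b' - cnj c * c'"
proof -
  have "herm ev1 ev1 = 1" "herm ev2 ev2 = 1" "herm ev3 ev3 = -1"
    "herm ev1 ev2 = 0" "herm ev2 ev1 = 0" "herm ev1 ev3 = 0" "herm ev3 ev1 = 0" "herm ev2 ev3 = 0" "herm ev3 ev2 = 0"
    by (simp_all add: herm_def ev1_def ev2_def ev3_def)
  then show ?thesis unfolding diag_vec_def herm_add_left herm_add_right herm_scale_left herm_scale_right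
    by (simp add: algebra_simps)
qed

lemma diag_vec_deriv:
  assumes "(a has_vector_derivative a') (at u)" "(b has_vector_derivative b') (at u)" "(c has_vector_derivative c') (at u)"
  shows "((\<lambda>u. diag_vec (a u) (b u) (c u)) has_vector_derivative diag_vec a' b' c') (at u)"
proof -
  have s: "((\<lambda>u. f u *s (X :: complex^3)) has_vector_derivative f' *s X) (at u)" if "(f has_vector_derivative f') (at u)" for f f' X
    using smult_deriv[OF that has_vector_derivative_const[of X]] by simp
  show ?thesis unfolding diag_vec_def by (intro has_vector_derivative_add s assms)
qed

lemma Rats_clear_denominator:
  fixes x :: real
  assumes "x \<in> \<rat>" obtains n :: nat where "0 < n" "of_nat n * x \<in> \<int>"
proof -
  obtain a b where ab: "0 < b" "x = of_int a / of_int b" using assms by (elim Rats_cases')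
  show ?thesis by (rule that[of "nat b"]) (use ab in auto)
qed

text \<open>Each root contributes one exponential solution, and the weights make the three combine
  to the Gram matrix of a normalized lift. Rationality of two of the periods, hence of the third,
  gives a common period.\<close>

lemma closed_string_exists:
  assumes q: "q \<in> domM" "fst q \<in> \<rat>" "snd q \<in> \<rat>"
  shows "\<exists>G. closed_string G \<and> Theta (characters G) = q"
proof -
  obtain d k where D: "(d, k) \<in> Dop" and qe: "q = period_map (d, k)"
    using q(1) unfolding period_map_image[symmetric] by (auto elim!: imageE)
  note o = Dop_props[OF D] and cp = c_props[OF Dop_props(4,2,5)[OF D]]
  define c where "c = c2 d k"
  define c' where "c' = c3 d k"
  define b where "b = d + k - c - c'"
  have ord: "b < 0" "d < c" "c < c'" using third_root(3)[OF D] cp(3,7,8) o(3) by (auto simp: b_def c_def c'_def)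
  have fac: "Qc d k V + 1 = (V - b) * (V - c) * (V - c')" for V
    unfolding b_def c_def c'_def by (rule third_root(1)[OF D])
  have rt: "Qc d k b = -1" "Qc d k c = -1" "Qc d k c' = -1" using fac[of b] fac[of c] fac[of c'] by simp_all
  have nin: "b \<notin> {0..d}" "c \<notin> {0..d}" "c' \<notin> {0..d}" using ord o(1) by auto
  have ne: "b \<noteq> c" "c \<noteq> c'" "b \<noteq> c'" using ord o(1) by auto
  define \<Delta> where "\<Delta> = (b - c) * (c - c') * (b - c')"
  define m1 m2 m3 where "m1 = - (c - c') / \<Delta>" and "m2 = (b - c') / \<Delta>" and "m3 = - (b - c) / \<Delta>"
  have e: "b + c + c' = d + k" by (simp add: b_def)
  note L = lagrange_weights[OF ne, folded \<Delta>_def, folded m1_def m2_def m3_def, unfolded e]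
  have \<Delta>: "\<Delta> < 0" unfolding \<Delta>_def using ord o(1) by (intro mult_pos_neg mult_neg_neg) auto
  \<comment> \<open>With these signs \<open>m1 (b - W)\<close>, \<open>m2 (c - W)\<close> and
    \<open>- m3 (c' - W)\<close> are positive. The root \<open>c'\<close> goes to the negative
    direction \<open>ev3\<close> of the form, which restores the weight \<open>m3\<close>.\<close>
  have ms: "m1 < 0" "0 < m2" "m3 < 0" unfolding m1_def m2_def m3_def using \<Delta> ord o(1)
    by (auto intro!: divide_pos_neg divide_neg_neg)
  have Wr: "0 \<le> Wf d k u" "Wf d k u \<le> d" for u using Wf_range[OF o(1)] by auto
  have pos: "0 < m1 * (b - Wf d k u)" "0 < m2 * (c - Wf d k u)" "0 < (- m3) * (c' - Wf d k u)" for u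
  proof -
    have s: "b - Wf d k u < 0" "0 < c - Wf d k u" "0 < c' - Wf d k u" using Wr[of u] ord by linarith+
    show "0 < m1 * (b - Wf d k u)" by (rule mult_neg_neg[OF ms(1) s(1)])
    show "0 < m2 * (c - Wf d k u)" by (rule mult_pos_pos[OF ms(2) s(2)])
    show "0 < (- m3) * (c' - Wf d k u)" by (rule mult_pos_pos[OF _ s(3)]) (use ms(3) in simp)
  qed
  define x y where "x = Tf c2 d k" and "y = Tf c3 d k"
  have xy: "x \<in> \<rat>" "y \<in> \<rat>" using q(2,3) by (simp_all add: qe period_map_def x_def y_def)
  have E2: "EI d k (\<lambda>V. 1 / (c - V)) = pi * x" using Tf_EI[of d k c2] o cp(3) by (simp add: x_def c_def)
  have E3: "EI d k (\<lambda>V. 1 / (c' - V)) = pi * y" using Tf_EI[of d k c3] o cp(3,4,5) by (simp add: y_def c'_def)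
  have E1: "EI d k (\<lambda>V. 1 / (b - V)) = pi * (- (x + y))"
  proof (rule period_sum[OF D])
    fix n assume n: "Tf c2 d k + Tf c3 d k = EI d k (\<lambda>V. 1 / (n + V)) / pi" "n = c2 d k + c3 d k - d - k"
    have "b = - n" using n(2) by (simp add: b_def c_def c'_def)
    moreover have "1 / (- n - V) = - (1 / (n + V))" for V :: real
      by (metis minus_add_distrib diff_conv_add_uminus minus_divide_right)
    ultimately have "EI d k (\<lambda>V. 1 / (b - V)) = EI d k (\<lambda>V. - (1 / (n + V)))" by simp
    also have "\<dots> = - EI d k (\<lambda>V. 1 / (n + V))"
      unfolding EI_def by (simp add: minus_divide_left[symmetric] del: minus_divide_left)
    also have "EI d k (\<lambda>V. 1 / (n + V)) = pi * (x + y)" using n(1) by (simp add: x_def y_def)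
    finally show ?thesis by (simp only: mult_minus_right)
  qed
  obtain n1 where n1: "0 < n1" "of_nat n1 * x \<in> \<int>" by (rule Rats_clear_denominator[OF xy(1)])
  obtain n2 where n2: "0 < n2" "of_nat n2 * y \<in> \<int>" by (rule Rats_clear_denominator[OF xy(2)])
  \<comment> \<open>A common denominator: the phases of all three solutions close up after
    \<open>N\<close> periods of \<open>W\<close>.\<close>
  define N where "N = n1 * n2"
  have N: "0 < N" using n1 n2 by (simp add: N_def)
  have Nx: "of_nat N * x \<in> \<int>" 
  proof -
    have "of_nat N * x = of_nat n2 * (of_nat n1 * x)" by (simp add: N_def)
    from this show ?thesis by (rule ssubst) (intro Ints_mult Ints_of_nat n1(2))
  qed
  have Ny: "of_nat N * y \<in> \<int>"
  proof -
    have "of_nat N * y = of_nat n1 * (of_nat n2 * y)" by (simp add: N_def)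
    from this show ?thesis by (rule ssubst) (intro Ints_mult Ints_of_nat n2(2))
  qed
  have Nxy: "of_nat N * (- (x + y)) \<in> \<int>"
  proof -
    have "of_nat N * (- (x + y)) = - (of_nat N * x) - of_nat N * y" by (simp add: algebra_simps)
    from this show ?thesis by (rule ssubst) (intro Ints_diff Ints_minus Nx Ny)
  qed
  define P where "P = of_nat N * per d k"
  define Y where "Y u = Yc d k (ang d k u)" for u
  define w where "w u = Wf d k u" for u
  obtain z1 where z1:
    "\<And>u. (z1 has_vector_derivative aa d k b u * z1 u) (at u)"
    "\<And>u. ((\<lambda>u. aa d k b u * z1 u) has_vector_derivative of_real (bb d k b u) * z1 u) (at u)"
    "\<And>u. ((\<lambda>u. of_real (bb d k b u) * z1 u) has_vector_derivative
        (\<i> + 3 * of_real (Yc d k (ang d k u))) * z1 u + of_real (3 * Wf d k u - (d + k)) * (aa d k b u * z1 u)) (at u)"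
    "\<And>u. cnj (z1 u) * z1 u = of_real (m1 * (b - Wf d k u))" "\<And>u. z1 (u + of_nat N * per d k) = z1 u"
    by (rule exponential_solution[OF o(1,2) rt(1) nin(1) pos(1) E1 Nxy]) (rule that)
  obtain z2 where z2:
    "\<And>u. (z2 has_vector_derivative aa d k c u * z2 u) (at u)"
    "\<And>u. ((\<lambda>u. aa d k c u * z2 u) has_vector_derivative of_real (bb d k c u) * z2 u) (at u)"
    "\<And>u. ((\<lambda>u. of_real (bb d k c u) * z2 u) has_vector_derivative
        (\<i> + 3 * of_real (Yc d k (ang d k u))) * z2 u + of_real (3 * Wf d k u - (d + k)) * (aa d k c u * z2 u)) (at u)"
    "\<And>u. cnj (z2 u) * z2 u = of_real (m2 * (c - Wf d k u))" "\<And>u. z2 (u + of_nat N * per d k) = z2 u"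
    by (rule exponential_solution[OF o(1,2) rt(2) nin(2) pos(2) E2 Nx]) (rule that)
  obtain z3 where z3:
    "\<And>u. (z3 has_vector_derivative aa d k c' u * z3 u) (at u)"
    "\<And>u. ((\<lambda>u. aa d k c' u * z3 u) has_vector_derivative of_real (bb d k c' u) * z3 u) (at u)"
    "\<And>u. ((\<lambda>u. of_real (bb d k c' u) * z3 u) has_vector_derivative
        (\<i> + 3 * of_real (Yc d k (ang d k u))) * z3 u + of_real (3 * Wf d k u - (d + k)) * (aa d k c' u * z3 u)) (at u)"
    "\<And>u. cnj (z3 u) * z3 u = of_real ((- m3) * (c' - Wf d k u))" "\<And>u. z3 (u + of_nat N * per d k) = z3 u"
    by (rule exponential_solution[OF o(1,2) rt(3) nin(3) pos(3) E3 Ny]) (rule that)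
  define F where "F u = diag_vec (z1 u) (z2 u) (z3 u)" for u
  define F1 where "F1 u = diag_vec (aa d k b u * z1 u) (aa d k c u * z2 u) (aa d k c' u * z3 u)" for u
  define F2 where "F2 u = diag_vec (of_real (bb d k b u) * z1 u) (of_real (bb d k c u) * z2 u) (of_real (bb d k c' u) * z3 u)" for u
  have DF: "(F has_vector_derivative F1 u) (at u)" "(F1 has_vector_derivative F2 u) (at u)" for u
    unfolding F_def[abs_def] F1_def[abs_def] F2_def[abs_def] by (rule diag_vec_deriv z1 z2 z3)+
  have DF3: "(F2 has_vector_derivative (\<i> + 3 * of_real (Yc d k (ang d k u))) *s F u + of_real (3 * Wf d k u - (d + k)) *s F1 u) (at u)" for u
  proof -
    have lin: "diag_vec (p * x + q * x') (p * y + q * y') (p * z + q * z') = p *s diag_vec x y z + q *s diag_vec x' y' z'" for p q x y z x' y' z'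
      unfolding diag_vec_def by (simp add: vec_eq_iff algebra_simps)
    show ?thesis unfolding F_def F1_def lin[symmetric] unfolding F2_def[abs_def] by (rule diag_vec_deriv z1 z2 z3)+
  qed
  have mv: "cnj (p * z) * (r * z) = cnj p * r * (cnj z * z)" "cnj z * (r * z) = r * (cnj z * z)" for p r z :: complex
    by (simp_all add: ac_simps)
  have snz: "b - w u \<noteq> 0" "c - w u \<noteq> 0" "c' - w u \<noteq> 0" for u
    using Wr[of u] ord unfolding w_def by auto
  have a1: "aa d k v u * of_real (M * (v - w u)) = (\<i> - of_real (Y u)) * of_real M"
    "cnj (aa d k v u) * of_real (M * (v - w u)) = (- \<i> - of_real (Y u)) * of_real M"
    "cnj (aa d k v u) * aa d k v u * of_real (M * (v - w u)) = of_real ((1 + Y u * Y u) * (M / (v - w u)))"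
    if vn: "v - w u \<noteq> 0" for v u M
  proof -
    define s where "s = v - w u"
    have i: "inverse (complex_of_real v - of_real (w u)) = of_real (inverse s)" by (simp add: s_def)
    have si: "complex_of_real (inverse s) * of_real (M * s) = of_real M" using vn by (simp add: s_def)
    have A: "aa d k v u = (\<i> - of_real (Y u)) * of_real (inverse s)" unfolding aa_def i[symmetric] w_def Y_def ..
    have cA: "cnj (aa d k v u) = (- \<i> - of_real (Y u)) * of_real (inverse s)" unfolding A by simp
    show "aa d k v u * of_real (M * (v - w u)) = (\<i> - of_real (Y u)) * of_real M"
      unfolding A s_def[symmetric] mult.assoc si ..
    show "cnj (aa d k v u) * of_real (M * (v - w u)) = (- \<i> - of_real (Y u)) * of_real M"
      unfolding cA s_def[symmetric] mult.assoc si ..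
    have "cnj (aa d k v u) * aa d k v u * of_real (M * (v - w u))
       = ((- \<i> - of_real (Y u)) * (\<i> - of_real (Y u))) * (of_real (inverse s) * (of_real (inverse s) * of_real (M * s)))"
      unfolding cA unfolding A s_def by (simp only: ac_simps)
    also have "(- \<i> - of_real (Y u)) * (\<i> - of_real (Y u)) = of_real (1 + Y u * Y u)" by (simp add: algebra_simps)
    also have "of_real (inverse s) * (of_real (inverse s) * of_real (M * s)) = complex_of_real (M / s)"
      unfolding si by (simp add: divide_inverse)
    finally show "cnj (aa d k v u) * aa d k v u * of_real (M * (v - w u)) = of_real ((1 + Y u * Y u) * (M / (v - w u)))"
      unfolding s_def by simp
  qed
  note n = z1(4)[folded w_def] z2(4)[folded w_def] z3(4)[folded w_def]
  have bbv: "bb d k v u = 2 * w u - (d + k) + v" for v u by (simp add: bb_def w_def)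
  have h00: "herm (F u) (F u) = 0" for u
  proof -
    have "herm (F u) (F u) = of_real (m1 * (b - w u) + m2 * (c - w u) + m3 * (c' - w u))"
      unfolding F_def herm_diag_vec n by simp
    then show ?thesis unfolding L(2) by simp
  qed
  have h01: "herm (F u) (F1 u) = 0" for u
  proof -
    have "herm (F u) (F1 u) = (\<i> - of_real (Y u)) * of_real (m1 + m2 + m3)"
      unfolding F_def F1_def herm_diag_vec mv n a1(1)[OF snz(1)] a1(1)[OF snz(2)] a1(1)[OF snz(3)] by (simp add: algebra_simps)
    then show ?thesis unfolding L(1) by simp
  qed
  have h02: "herm (F u) (F2 u) = -1" for u
  proof -
    have "herm (F u) (F2 u) = of_real (m1 * ((b - w u) * bb d k b u) + m2 * ((c - w u) * bb d k c u) + m3 * ((c' - w u) * bb d k c' u))"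
      unfolding F_def F2_def herm_diag_vec mv n by (simp add: algebra_simps)
    then show ?thesis unfolding bbv L(4) by simp
  qed
  have h12: "herm (F1 u) (F2 u) = 0" for u
  proof -
    have mv2: "cnj p * r * X = r * (cnj p * X)" for p r X :: complex by (simp add: ac_simps)
    have "herm (F1 u) (F2 u) = (- \<i> - of_real (Y u)) * of_real (m1 * bb d k b u + m2 * bb d k c u + m3 * bb d k c' u)"
      unfolding F1_def F2_def herm_diag_vec mv(1) n mv2 a1(2)[OF snz(1)] a1(2)[OF snz(2)] a1(2)[OF snz(3)] by (simp add: algebra_simps)
    then show ?thesis unfolding bbv L(3) by simp
  qed
  have h22: "herm (F2 u) (F2 u) = of_real (d + k - 3 * Wf d k u)" for u
  proof -
    have "herm (F2 u) (F2 u) = of_real (m1 * ((b - w u) * (bb d k b u * bb d k b u)) + m2 * ((c - w u) * (bb d k c u * bb d k c u))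
        + m3 * ((c' - w u) * (bb d k c' u * bb d k c' u)))"
      unfolding F2_def herm_diag_vec mv(1) n by (simp add: algebra_simps)
    then show ?thesis unfolding bbv L(5) w_def .
  qed
  have h11: "herm (F1 u) (F1 u) = 1" for u
  proof -
    define s t r where "s = b - w u" and "t = c - w u" and "r = c' - w u"
    have nz: "s \<noteq> 0" "t \<noteq> 0" "r \<noteq> 0" using snz[of u] by (simp_all add: s_def t_def r_def)
    \<comment> \<open>\<open>1 + Y^2 = 1 + Q(W)\<close> is the product over the three roots, so it
      cancels the poles of \<open>m1 / s + m2 / t + m3 / r\<close>.\<close>
    have YY: "1 + Y u * Y u = - (s * t * r)"
      using Wf_deriv(3)[OF o(1,2), of u] fac[of "w u"] unfolding Y_def w_def s_def t_def r_def
      by (simp add: power2_eq_square algebra_simps)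
    have "herm (F1 u) (F1 u) = of_real ((1 + Y u * Y u) * (m1 / s + m2 / t + m3 / r))"
      unfolding F1_def herm_diag_vec mv(1) n a1(3)[OF snz(1)] a1(3)[OF snz(2)] a1(3)[OF snz(3)]
      unfolding s_def[symmetric] t_def[symmetric] r_def[symmetric]
      by (simp add: distrib_left)
    also have "(1 + Y u * Y u) * (m1 / s + m2 / t + m3 / r) = - (m1 * (t * r) + m2 * (s * r) + m3 * (s * t))"
      unfolding YY using nz by (simp add: field_simps)
    also have "\<dots> = 1" using L(6)[of "w u"] unfolding s_def t_def r_def by simp
    finally show ?thesis by simp
  qed
  have Ppos: "0 < P" using N per_pos[OF o(1,2)] by (simp add: P_def)
  have Fp: "F (u + P) = F u" for u unfolding F_def P_def z1(5) z2(5) z3(5) ..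
  obtain G where G: "closed_string G" "\<forall>u. cr_curv G u = (d + k) / 2 - 3/2 * Wf d k u"
    using closed_string_of_gram[OF o(1,2) DF DF3 h00 h01 h02 h11 h12 h22 Ppos Fp] by (elim exE conjE)
  have "characters G = to_char (d, k)"
    by (rule characters_eq[OF o(1,2), of G 0]) (use G(2) in simp)
  then have "Theta (characters G) = q" unfolding qe using Theta_to_char(2)[OF D] by simp
  then show ?thesis using G(1) by (intro exI conjI)
qed

theorem theoremB:
  shows "bij_betw Theta domD domM \<and> real_analytic_on2 Theta domD \<and>
         real_analytic_on2 (inv_into domD Theta) domM \<and>
         (\<forall>G. closed_string G \<longrightarrow> Theta (characters G) \<in> domM \<inter> (\<rat> \<times> \<rat>)) \<and>
         (\<forall>G1 G2. closed_string G1 \<longrightarrow> closed_string G2 \<longrightarrow>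
             (cr_equiv G1 G2 \<longleftrightarrow> Theta (characters G1) = Theta (characters G2))) \<and>
         (\<forall>q \<in> domM \<inter> (\<rat> \<times> \<rat>). \<exists>G. closed_string G \<and> Theta (characters G) = q)"
proof (intro conjI allI impI ballI)
  show "bij_betw Theta domD domM" by (rule bij_Theta)
  show "real_analytic_on2 Theta domD" by (rule analytic_Theta)
  show "real_analytic_on2 (inv_into domD Theta) domM" by (rule analytic_Theta_inverse)
  show "Theta (characters G) \<in> domM \<inter> (\<rat> \<times> \<rat>)" if "closed_string G" for G by (rule closed_string_Theta(2)[OF that])
  show "cr_equiv G1 G2 \<longleftrightarrow> Theta (characters G1) = Theta (characters G2)" if "closed_string G1" "closed_string G2" for G1 G2
    by (rule closed_string_cr_equiv[OF that])
  show "\<exists>G. closed_string G \<and> Theta (characters G) = q" if "q \<in> domM \<inter> (\<rat> \<times> \<rat>)" for q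
    by (rule closed_string_exists) (use that in auto)
qed

end
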